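(* Let $T>0$, $w\in L^\infty([0,T])$, $z\in C([0,T];\mathbb{R}^d)$ and $u_0\in\mathbb{R}^d$. Suppose that $b\in\mathcal{F}L_{q'}^\delta(\mathbb{R}^d)$ ($\mathbb{R}^d$-valued, componentwise) and that the two-parameter measure $$G_{t_1,t_2}(C)=\int_0^{t_2}\int_0^{t_1}w_{r_1}w_{r_2}\mathbf{1}_C(z_{r_2}-z_{r_1})\,\mathrm{d}r_1\,\mathrm{d}r_2$$ satisfies $G\in C^\gamma([0,T]^2;\mathcal{F}L_q^\kappa(\mathbb{R}^d))$, where $\gamma\in(1/2,1)$, $\delta,\kappa\in\mathbb{R}$ and $q,q'\in[1,\infty]$ satisfy $$\frac1q+\frac1{q'}=1\quad\text{and}\quad\delta+\kappa>1+\frac1\gamma .$$ Then the equation $$u(t)=u_0+\int_0^t\int_0^tw_sw_r\,b(u(s)-u(r))\,\mathrm{d}r\,\mathrm{d}s+z_t,\qquad t\in[0,T],$$ has a unique solution $u$ (in the nonlinear Young sense defined in the context). This solution depends continuously on the drift $b$ and the initial datum $u_0$. Namely, let $(b_n)_{n\ge1}\subset\mathcal{F}L_{q'}^\delta(\mathbb{R}^d)$ be a sequence of Lipschitz continuous vector fields with $b_n\to b$ in $\mathcal{F}L_{q'}^\delta(\mathbb{R}^d)$ and let $(u_0^{(n)})_{n\ge1}\subset\mathbb{R}^d$ with $u_0^{(n)}\to u_0$. Denote by $u_n$ the unique solution of $$u_n(t)=u_0^{(n)}+\int_0^t\int_0^tw_sw_r\,b_n(u_n(s)-u_n(r))\,\mathrm{d}r\,\mathrm{d}s+z_t,\qquad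 t\in[0,T].$$ Then there exists a constant $C>0$ (independent of $n$) such that $$\|u_n-u\|_{C^\gamma([0,T])}\le C\big(\|b_n-b\|_{\mathcal{F}L_{q'}^\delta}+|u_0^{(n)}-u_0|\big).$$
   Context: Function spaces. For $p\in[1,\infty]$, $s\in\mathbb{R}$, the Fourier–Lebesgue space $\mathcal{F}L_p^s(\mathbb{R}^d)$ consists of all tempered distributions $f$ with $\widehat f\in L^p_{\mathrm{loc}}(\mathbb{R}^d)$ and $\|f\|_{\mathcal{F}L_p^s}=\|\langle\cdot\rangle^s\widehat f\|_{L^p(\mathbb{R}^d)}<\infty$, where $\langle\xi\rangle=(1+|\xi|^2)^{1/2}$. $\mathcal{C}^s(\mathbb{R}^d)=B^s_{\infty,\infty}(\mathbb{R}^d)$ is the Hölder–Zygmund space. $C^\gamma([0,T])$ is the usual Hölder space with norm $\|f\|_\infty+\sup_{s\ne t}|f_t-f_s|/|t-s|^\gamma$. For a Banach space $E$ and $f:[0,T]^2\to E$ put $\Box_{s,t}f=f_{t_1,t_2}-f_{t_1,s_2}-f_{s_1,t_2}+f_{s_1,s_2}$ for $s=(s_1,s_2)$, $t=(t_1,t_2)$. $C^\gamma([0,T]^2;E)$ is the space of $f$ with finite norm $\|f\|_\infty+\sup\frac{\|f_{t_1,s_2}-f_{s_1,s_2}\|_E}{|t_1-s_1|^\gamma}+\sup\frac{\|f_{s_1,t_2}-f_{s_1,s_2}\|_E}{|t_2-s_2|^\gamma}+\sup\frac{\|\Box_{s,t}f\|_E}{|t_1-s_1|^\gamma|t_2-s_2|^\gamma}$.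 Averaged field. With $\overline G_{t_1,t_2}(C)=G_{t_1,t_2}(-C)$ set $A^b(t_1,t_2,x)=(b*\overline G_{t_1,t_2})(x)$, $x\in\mathbb{R}^d$ (componentwise). For bounded measurable $b$ this equals $\int_0^{t_2}\int_0^{t_1}w_{r_1}w_{r_2}b(x+z_{r_2}-z_{r_1})\,\mathrm{d}r_1\,\mathrm{d}r_2$. Nonlinear Young integral. If $A\in C^{\gamma}([0,T]^2;\mathcal{C}^{1+\kappa'}(\mathbb{R}^d))$ with $\gamma\in(1/2,1]$, $\kappa'\in(0,1]$, and $\theta\in C^\beta([0,T];\mathbb{R}^d)$ with $\beta\in(0,1)$, $\gamma+\kappa'\beta>1$, then $$\int_0^{t_2}\int_0^{t_1}A(\mathrm{d}r,\theta_{r_2}-\theta_{r_1})=\lim_{|\mathcal{P}|\to0}\sum_{[u,v]\in\mathcal{P}}\Box_{u,v}A(\cdot,\theta_{u_2}-\theta_{u_1}),$$ the limit being over (grid-like) partitions $\mathcal{P}$ of $[0,t_1]\times[0,t_2]$ into rectangles $[u,v]=[u_1,v_1]\times[u_2,v_2]$ with mesh tending to $0$; this limit exists. Solution. When $A^b\in C^\gamma([0,T]^2;\mathcal{C}^{1+\kappa'}(\mathbb{R}^d))$ with $\gamma\in(1/2,1]$, $\kappa'\in(0,1]$ and $\gamma(1+\kappa')>1$, a solution of the equation with drift $b$, initial value $u_0$ and perturbation $z$ is a function $u=\theta+z$ with $\theta\in C^\gamma([0,T];\mathbb{R}^d)$ such that $$\theta_t=u_0+\int_0^t\int_0^tA^b(\mathrm{d}r,\theta_{r_2}-\theta_{r_1}),\qquad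 t\in[0,T].$$ *)

theory Defs
  imports "HOL-Probability.Probability" "HOL-Library.Function_Algebras"
begin

section \<open>Schwartz functions and tempered distributions\<close>

definition pderiv_at :: "'n::finite \<Rightarrow> (real^'n \<Rightarrow> 'b::real_normed_vector) \<Rightarrow> real^'n \<Rightarrow> 'b" where
  "pderiv_at i f x = frechet_derivative f (at x) (axis i 1)"

text \<open>Iterated partial derivatives; the list plays the role of a multi-index.\<close>
definition pderivs :: "'n::finite list \<Rightarrow> (real^'n \<Rightarrow> 'b::real_normed_vector) \<Rightarrow> real^'n \<Rightarrow> 'b" where
  "pderivs is f = foldr pderiv_at is f"

definition smooth :: "(real^'n::finite \<Rightarrow> 'b::real_normed_vector) \<Rightarrow> bool" where
  "smooth f \<longleftrightarrow> (\<forall>is x. pderivs is f differentiable (at x))"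

definition schwartz :: "(real^'n::finite \<Rightarrow> complex) set" where
  "schwartz = {\<phi>. smooth \<phi> \<and>
     (\<forall>k is. bounded (range (\<lambda>x. (1 + norm x) ^ k *\<^sub>R pderivs is \<phi> x)))}"

definition schwartz_seminorm :: "nat \<Rightarrow> nat \<Rightarrow> (real^'n::finite \<Rightarrow> complex) \<Rightarrow> real" where
  "schwartz_seminorm k m \<phi> =
     (SUP (is, x)\<in>{is. length is \<le> m} \<times> UNIV. (1 + norm x) ^ k * norm (pderivs is \<phi> x))"

text \<open>A distribution is a functional on all complex functions of which only the values on
  Schwartz functions matter.\<close>
type_synonym 'n distribution = "(real^'n \<Rightarrow> complex) \<Rightarrow> complex"

definition tempered :: "'n::finite distribution \<Rightarrow> bool" where
  "tempered u \<longleftrightarrow>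
     (\<forall>\<phi>\<in>schwartz. \<forall>\<psi>\<in>schwartz. u (\<lambda>x. \<phi> x + \<psi> x) = u \<phi> + u \<psi>) \<and>
     (\<forall>\<phi>\<in>schwartz. \<forall>c. u (\<lambda>x. c * \<phi> x) = c * u \<phi>) \<and>
     (\<exists>C k m. \<forall>\<phi>\<in>schwartz. norm (u \<phi>) \<le> C * schwartz_seminorm k m \<phi>)"

definition real_valued_distr :: "'n::finite distribution \<Rightarrow> bool" where
  "real_valued_distr u \<longleftrightarrow> (\<forall>\<phi>\<in>schwartz. u (\<lambda>x. cnj (\<phi> x)) = cnj (u \<phi>))"

definition fun_distr :: "(real^'n::finite \<Rightarrow> complex) \<Rightarrow> 'n distribution" where
  "fun_distr g \<phi> = (LINT x|lborel. g x * \<phi> x)"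

text \<open>\<open>g\<close> is asked to be integrable against every Schwartz function. This is automatic when
  \<open>\<langle>\<cdot>\<rangle>\<^sup>s g\<close> is in \<open>L\<^sup>p\<close> for some \<open>s\<close> and \<open>p\<close>, so the spaces below are the usual ones.\<close>
definition represents :: "(real^'n::finite \<Rightarrow> complex) \<Rightarrow> 'n distribution \<Rightarrow> bool" where
  "represents g u \<longleftrightarrow> g \<in> borel_measurable borel \<and>
     (\<forall>\<phi>\<in>schwartz. integrable lborel (\<lambda>x. g x * \<phi> x) \<and> u \<phi> = fun_distr g \<phi>)"

text \<open>A representing function is unique up to null sets.\<close>
definition density_of :: "'n::finite distribution \<Rightarrow> real^'n \<Rightarrow> complex" where
  "density_of u = (SOME g. represents g u)"

definition fourier :: "(real^'n::finite \<Rightarrow> complex) \<Rightarrow> real^'n \<Rightarrow> complex" where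
  "fourier \<phi> \<xi> = (LINT x|lborel. exp (- \<i> * complex_of_real (x \<bullet> \<xi>)) * \<phi> x)"

definition inv_fourier :: "(real^'n::finite \<Rightarrow> complex) \<Rightarrow> real^'n \<Rightarrow> complex" where
  "inv_fourier \<phi> x = (LINT \<xi>|lborel. exp (\<i> * complex_of_real (x \<bullet> \<xi>)) * \<phi> \<xi>)
     / complex_of_real ((2 * pi) ^ CARD('n))"

definition fourier_distr :: "'n::finite distribution \<Rightarrow> 'n distribution" where
  "fourier_distr u \<phi> = u (fourier \<phi>)"

definition inv_fourier_distr :: "'n::finite distribution \<Rightarrow> 'n distribution" where
  "inv_fourier_distr u \<phi> = u (inv_fourier \<phi>)"

definition mult_distr :: "(real^'n::finite \<Rightarrow> real) \<Rightarrow> 'n distribution \<Rightarrow> 'n distribution" where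
  "mult_distr m u \<phi> = u (\<lambda>x. complex_of_real (m x) * \<phi> x)"


section \<open>Function spaces\<close>

text \<open>All norms take values in the extended nonnegative reals and are infinite outside
  the space in question, so that a space is the set where its norm is finite.\<close>

definition Lp_norm :: "ennreal \<Rightarrow> 'a measure \<Rightarrow> ('a \<Rightarrow> 'b::real_normed_vector) \<Rightarrow> ennreal" where
  "Lp_norm p M f =
     (if p = \<infinity> then esssup M (\<lambda>x. ennreal (norm (f x)))
      else (let I = (\<integral>\<^sup>+ x. ennreal (norm (f x) powr enn2real p) \<partial>M)
            in if I = \<infinity> then \<infinity> else ennreal (enn2real I powr (1 / enn2real p))))"

definition Linfty_on :: "real set \<Rightarrow> (real \<Rightarrow> real) set" where
  "Linfty_on S = {w. w \<in> borel_measurable (restrict_space lborel S) \<and>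
     Lp_norm \<infinity> (restrict_space lborel S) w < \<infinity>}"

definition Lp_loc :: "ennreal \<Rightarrow> (real^'n::finite \<Rightarrow> complex) set" where
  "Lp_loc p = {g. g \<in> borel_measurable borel \<and>
     (\<forall>K. compact K \<longrightarrow> Lp_norm p (restrict_space lborel K) g < \<infinity>)}"

definition japanese_bracket :: "real^'n::finite \<Rightarrow> real" where
  "japanese_bracket \<xi> = sqrt (1 + (norm \<xi>)\<^sup>2)"

definition FL_norm :: "ennreal \<Rightarrow> real \<Rightarrow> 'n::finite distribution \<Rightarrow> ennreal" where
  "FL_norm p s u =
     (if tempered u \<and> (\<exists>g\<in>Lp_loc p. represents g (fourier_distr u))
      then Lp_norm p lborel (\<lambda>\<xi>. japanese_bracket \<xi> powr s *\<^sub>R density_of (fourier_distr u) \<xi>)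
      else \<infinity>)"

definition FL_vec_norm :: "ennreal \<Rightarrow> real \<Rightarrow> ('n::finite \<Rightarrow> 'n distribution) \<Rightarrow> ennreal" where
  "FL_vec_norm p s b = (\<Sum>i\<in>UNIV. FL_norm p s (b i))"

definition dyadic_partition :: "(real^'n::finite \<Rightarrow> real) \<Rightarrow> (real^'n \<Rightarrow> real) \<Rightarrow> bool" where
  "dyadic_partition \<psi> \<rho> \<longleftrightarrow>
     smooth \<psi> \<and> smooth \<rho> \<and>
     (\<forall>\<xi> \<eta>. norm \<xi> = norm \<eta> \<longrightarrow> \<psi> \<xi> = \<psi> \<eta> \<and> \<rho> \<xi> = \<rho> \<eta>) \<and>
     range \<psi> \<subseteq> {0..1} \<and> range \<rho> \<subseteq> {0..1} \<and>
     (\<forall>\<xi>. \<psi> \<xi> \<noteq> 0 \<longrightarrow> norm \<xi> \<le> 4/3) \<and>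
     (\<forall>\<xi>. \<rho> \<xi> \<noteq> 0 \<longrightarrow> 3/4 \<le> norm \<xi> \<and> norm \<xi> \<le> 8/3) \<and>
     (\<forall>\<xi>. (\<lambda>j::nat. \<rho> ((1 / 2 ^ j) *\<^sub>R \<xi>)) sums (1 - \<psi> \<xi>))"

text \<open>A dyadic partition of unity, fixed once and for all; existence is
  \<open>dyadic_partition_exists\<close> below.\<close>
definition the_dyadic_partition :: "(real^'n::finite \<Rightarrow> real) \<times> (real^'n \<Rightarrow> real)" where
  "the_dyadic_partition = (SOME (\<psi>, \<rho>). dyadic_partition \<psi> \<rho>)"

definition littlewood_paley_symbol :: "int \<Rightarrow> real^'n::finite \<Rightarrow> real" where
  "littlewood_paley_symbol j \<xi> =
     (if j = -1 then fst the_dyadic_partition \<xi>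
      else snd the_dyadic_partition ((2 powr - real_of_int j) *\<^sub>R \<xi>))"

definition littlewood_paley :: "int \<Rightarrow> 'n::finite distribution \<Rightarrow> 'n distribution" where
  "littlewood_paley j u =
     inv_fourier_distr (mult_distr (littlewood_paley_symbol j) (fourier_distr u))"

definition Linfty_distr_norm :: "'n::finite distribution \<Rightarrow> ennreal" where
  "Linfty_distr_norm u =
     (if \<exists>g. represents g u then Lp_norm \<infinity> lborel (density_of u) else \<infinity>)"

definition zygmund_norm :: "real \<Rightarrow> 'n::finite distribution \<Rightarrow> ennreal" where
  "zygmund_norm s u =
     (if tempered u
      then (SUP j\<in>{-1..}. ennreal (2 powr (real_of_int j * s)) * Linfty_distr_norm (littlewood_paley j u))
      else \<infinity>)"

definition holder_norm :: "real \<Rightarrow> real \<Rightarrow> (real \<Rightarrow> 'b::real_normed_vector) \<Rightarrow> ennreal" where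
  "holder_norm T \<gamma> f =
     (SUP t\<in>{0..T}. ennreal (norm (f t))) +
     (SUP (s, t)\<in>{(s, t). s \<in> {0..T} \<and> t \<in> {0..T} \<and> s \<noteq> t}.
        ennreal (norm (f t - f s) / \<bar>t - s\<bar> powr \<gamma>))"

definition box ::
    "real \<times> real \<Rightarrow> real \<times> real \<Rightarrow> (real \<Rightarrow> real \<Rightarrow> 'v::{plus, minus}) \<Rightarrow> 'v" where
  "box s t f = f (fst t) (snd t) - f (fst t) (snd s) - f (fst s) (snd t) + f (fst s) (snd s)"

text \<open>The norm of \<open>C\<^sup>\<gamma>([0,T]\<^sup>2; E)\<close>, where \<open>N\<close> is the norm of \<open>E\<close>.\<close>
definition holder2_norm ::
    "real \<Rightarrow> real \<Rightarrow> ('v::{plus, minus} \<Rightarrow> ennreal) \<Rightarrow> (real \<Rightarrow> real \<Rightarrow> 'v) \<Rightarrow> ennreal" where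
  "holder2_norm T \<gamma> N f =
     (SUP (t1, t2)\<in>{0..T} \<times> {0..T}. N (f t1 t2)) +
     (SUP (s1, t1, s2)\<in>{(s1, t1, s2). {s1, t1, s2} \<subseteq> {0..T} \<and> s1 \<noteq> t1}.
        N (f t1 s2 - f s1 s2) / ennreal (\<bar>t1 - s1\<bar> powr \<gamma>)) +
     (SUP (s1, s2, t2)\<in>{(s1, s2, t2). {s1, s2, t2} \<subseteq> {0..T} \<and> s2 \<noteq> t2}.
        N (f s1 t2 - f s1 s2) / ennreal (\<bar>t2 - s2\<bar> powr \<gamma>)) +
     (SUP (s1, s2, t1, t2)\<in>{(s1, s2, t1, t2). {s1, s2, t1, t2} \<subseteq> {0..T} \<and> s1 \<noteq> t1 \<and> s2 \<noteq> t2}.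
        N (box (s1, s2) (t1, t2) f) / ennreal (\<bar>t1 - s1\<bar> powr \<gamma> * \<bar>t2 - s2\<bar> powr \<gamma>))"


section \<open>Signed measures and the averaged field\<close>

text \<open>A finite signed Borel measure is given by its set function; integration uses the Jordan
  decomposition, where \<open>\<nu>\<^sup>+(C) = sup {\<nu>(B) | B \<subseteq> C Borel}\<close> and \<open>\<nu>\<^sup>- = (-\<nu>)\<^sup>+\<close>.\<close>

definition positive_variation :: "('a::topological_space set \<Rightarrow> real) \<Rightarrow> 'a measure" where
  "positive_variation \<nu> =
     measure_of UNIV (sets borel) (\<lambda>C. SUP B\<in>{B \<in> sets borel. B \<subseteq> C}. ennreal (\<nu> B))"

definition signed_integral ::
    "('a::topological_space set \<Rightarrow> real) \<Rightarrow> ('a \<Rightarrow> complex) \<Rightarrow> complex" where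
  "signed_integral \<nu> f =
     integral\<^sup>L (positive_variation \<nu>) f - integral\<^sup>L (positive_variation (\<lambda>C. - \<nu> C)) f"

text \<open>Since \<open>signed_integral \<nu>\<close> maps a test function to its \<open>\<nu>\<close>-integral, it is at the same
  time the distribution induced by \<open>\<nu>\<close>.\<close>

definition reflect :: "((real^'n::finite) set \<Rightarrow> real) \<Rightarrow> (real^'n) set \<Rightarrow> real" where
  "reflect \<nu> C = \<nu> (uminus ` C)"

text \<open>\<open>u * \<nu>\<close> for a compactly supported signed measure \<open>\<nu>\<close>:
  \<open>(u * \<nu>)(\<phi>) = u(x \<mapsto> \<integral> \<phi>(x + y) \<nu>(dy))\<close>.\<close>
definition conv_distr ::
    "'n::finite distribution \<Rightarrow> ((real^'n) set \<Rightarrow> real) \<Rightarrow> 'n distribution" where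
  "conv_distr u \<nu> \<phi> = u (\<lambda>x. signed_integral \<nu> (\<lambda>y. \<phi> (x + y)))"

definition two_param_measure ::
    "(real \<Rightarrow> real) \<Rightarrow> (real \<Rightarrow> real^'n::finite) \<Rightarrow> real \<Rightarrow> real \<Rightarrow> (real^'n) set \<Rightarrow> real" where
  "two_param_measure w z t1 t2 C =
     (LINT r2:{0..t2}|lborel. (LINT r1:{0..t1}|lborel.
        w r1 * w r2 * indicator C (z r2 - z r1)))"

definition averaged_distr ::
    "('n::finite \<Rightarrow> 'n distribution) \<Rightarrow> (real \<Rightarrow> real) \<Rightarrow> (real \<Rightarrow> real^'n)
     \<Rightarrow> 'n \<Rightarrow> real \<Rightarrow> real \<Rightarrow> 'n distribution" where
  "averaged_distr b w z i t1 t2 = conv_distr (b i) (reflect (two_param_measure w z t1 t2))"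

text \<open>Elements of the Zygmund space of positive order are identified with the bounded continuous
  function representing them.\<close>
definition continuous_version :: "'n::finite distribution \<Rightarrow> real^'n \<Rightarrow> complex" where
  "continuous_version u = (THE f. continuous_on UNIV f \<and> bounded (range f) \<and> represents f u)"

text \<open>For a real distribution \<open>b\<close> the continuous version is real-valued, so that \<open>Re\<close> is merely a
  change of type.\<close>
definition averaged_field ::
    "('n::finite \<Rightarrow> 'n distribution) \<Rightarrow> (real \<Rightarrow> real) \<Rightarrow> (real \<Rightarrow> real^'n)
     \<Rightarrow> real \<Rightarrow> real \<Rightarrow> real^'n \<Rightarrow> real^'n" where
  "averaged_field b w z t1 t2 x = (\<chi> i. Re (continuous_version (averaged_distr b w z i t1 t2) x))"


section \<open>Nonlinear Young integral and solutions\<close>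

definition is_partition :: "real \<Rightarrow> nat \<Rightarrow> (nat \<Rightarrow> real) \<Rightarrow> bool" where
  "is_partition t m p \<longleftrightarrow> p 0 = 0 \<and> p m = t \<and> (\<forall>i<m. p i < p (Suc i))"

definition young_sum ::
    "(real \<Rightarrow> real \<Rightarrow> real^'n::finite \<Rightarrow> real^'n) \<Rightarrow> (real \<Rightarrow> real^'n)
     \<Rightarrow> nat \<Rightarrow> (nat \<Rightarrow> real) \<Rightarrow> nat \<Rightarrow> (nat \<Rightarrow> real) \<Rightarrow> real^'n" where
  "young_sum A \<theta> m p n q =
     (\<Sum>i<m. \<Sum>j<n. box (p i, q j) (p (Suc i), q (Suc j)) (\<lambda>t1 t2. A t1 t2 (\<theta> (q j) - \<theta> (p i))))"

definition has_young_integral ::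
    "(real \<Rightarrow> real \<Rightarrow> real^'n::finite \<Rightarrow> real^'n) \<Rightarrow> (real \<Rightarrow> real^'n)
     \<Rightarrow> real \<Rightarrow> real \<Rightarrow> real^'n \<Rightarrow> bool" where
  "has_young_integral A \<theta> t1 t2 I \<longleftrightarrow>
     (\<forall>\<epsilon>>0. \<exists>\<delta>>0. \<forall>m p n q.
        is_partition t1 m p \<and> is_partition t2 n q \<and>
        (\<forall>i<m. p (Suc i) - p i < \<delta>) \<and> (\<forall>j<n. q (Suc j) - q j < \<delta>)
        \<longrightarrow> norm (young_sum A \<theta> m p n q - I) < \<epsilon>)"

definition young_solution ::
    "real \<Rightarrow> real \<Rightarrow> (real \<Rightarrow> real) \<Rightarrow> (real \<Rightarrow> real^'n::finite)
     \<Rightarrow> ('n \<Rightarrow> 'n distribution) \<Rightarrow> real^'n \<Rightarrow> (real \<Rightarrow> real^'n) \<Rightarrow> bool" where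
  "young_solution T \<gamma> w z b u0 u \<longleftrightarrow>
     1/2 < \<gamma> \<and> \<gamma> \<le> 1 \<and>
     (\<exists>\<kappa>'. 0 < \<kappa>' \<and> \<kappa>' \<le> 1 \<and> \<gamma> * (1 + \<kappa>') > 1 \<and>
        (\<forall>i. holder2_norm T \<gamma> (zygmund_norm (1 + \<kappa>')) (averaged_distr b w z i) < \<infinity>)) \<and>
     (\<exists>\<theta>. holder_norm T \<gamma> \<theta> < \<infinity> \<and>
        (\<forall>t\<in>{0..T}. u t = \<theta> t + z t \<and>
           (\<exists>I. has_young_integral (averaged_field b w z) \<theta> t t I \<and> \<theta> t = u0 + I)))"

text \<open>The equation understood literally, for a drift that is a continuous function.\<close>
definition classical_solution ::
    "real \<Rightarrow> (real \<Rightarrow> real) \<Rightarrow> (real \<Rightarrow> real^'n::finite)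
     \<Rightarrow> (real^'n \<Rightarrow> real^'n) \<Rightarrow> real^'n \<Rightarrow> (real \<Rightarrow> real^'n) \<Rightarrow> bool" where
  "classical_solution T w z b u0 u \<longleftrightarrow> continuous_on {0..T} u \<and>
     (\<forall>t\<in>{0..T}. u t = u0 +
        (LINT s:{0..t}|lborel. (LINT r:{0..t}|lborel. (w s * w r) *\<^sub>R b (u s - u r))) + z t)"

text \<open>\<open>u\<close> is the only solution of \<open>P\<close>, where functions are considered on \<open>S\<close> only.\<close>
definition unique_on :: "real set \<Rightarrow> ((real \<Rightarrow> 'b) \<Rightarrow> bool) \<Rightarrow> (real \<Rightarrow> 'b) \<Rightarrow> bool" where
  "unique_on S P u \<longleftrightarrow> P u \<and> (\<forall>v. P v \<longrightarrow> (\<forall>t\<in>S. v t = u t))"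

definition vec_fun_distr :: "(real^'n::finite \<Rightarrow> real^'n) \<Rightarrow> 'n \<Rightarrow> 'n distribution" where
  "vec_fun_distr b i = fun_distr (\<lambda>x. complex_of_real (b x $ i))"


section \<open>Existence of a dyadic partition of unity\<close>

definition flat_exp :: "real poly \<Rightarrow> real \<Rightarrow> real" where
  "flat_exp p t = (if t > 0 then poly p (1 / t) * exp (- (1 / t)) else 0)"

definition flat_exp_step :: "real poly \<Rightarrow> real poly" where
  "flat_exp_step p = monom 1 2 * (p - pderiv p)"

lemma poly_exp_tendsto_0: "((\<lambda>y::real. poly p y * exp (- y)) \<longlongrightarrow> 0) at_top"
proof -
  have "((\<lambda>y. \<Sum>i\<le>degree p. coeff p i * (y ^ i / exp y)) \<longlongrightarrow> (\<Sum>i\<le>degree p. coeff p i * 0)) at_top"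
    by (intro tendsto_intros tendsto_power_div_exp_0)
  then show ?thesis
    by (simp add: poly_altdef sum_distrib_right exp_minus divide_inverse sum_distrib_left algebra_simps)
qed

lemma flat_exp_tendsto_0: "(flat_exp p \<longlongrightarrow> 0) (at 0)"
proof -
  have "((\<lambda>t. poly p (1 / t) * exp (- (1 / t))) \<longlongrightarrow> 0) (at_right (0::real))"
    using filterlim_compose[OF poly_exp_tendsto_0[of p] filterlim_inverse_at_top_right]
    by (simp add: inverse_eq_divide)
  then have "(flat_exp p \<longlongrightarrow> 0) (at_right 0)"
    by (rule Lim_transform_eventually) (auto simp: flat_exp_def eventually_at_filter)
  moreover have "(flat_exp p \<longlongrightarrow> 0) (at_left 0)"
    by (rule Lim_transform_eventually[OF tendsto_const])
       (auto simp: flat_exp_def eventually_at_filter)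
  ultimately show ?thesis by (simp add: filterlim_at_split)
qed

lemma flat_exp_deriv: "(flat_exp p has_real_derivative flat_exp (flat_exp_step p) t) (at t)"
proof (cases t "0::real" rule: linorder_cases)
  case less
  have "((\<lambda>_. 0) has_real_derivative 0) (at t)" by simp
  then have "(flat_exp p has_real_derivative 0) (at t)"
    by (rule has_field_derivative_transform_within_open[where S = "{..<0}"])
       (use less in \<open>auto simp: flat_exp_def\<close>)
  then show ?thesis using less by (simp add: flat_exp_def)
next
  case equal
  have "((\<lambda>s. flat_exp (monom 1 1 * p) s) \<longlongrightarrow> 0) (at 0)"
    by (rule flat_exp_tendsto_0)
  then have "((\<lambda>s. (flat_exp p (0 + s) - flat_exp p 0) / s) \<longlongrightarrow> 0) (at 0)"
    by (rule Lim_transform_eventually)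
       (auto simp: flat_exp_def eventually_at_filter poly_monom)
  then show ?thesis using equal
    by (simp add: DERIV_def flat_exp_def)
next
  case greater
  have "((\<lambda>t. poly p (1 / t) * exp (- (1 / t))) has_real_derivative flat_exp (flat_exp_step p) t) (at t)"
    using greater
    by (auto intro!: derivative_eq_intros simp: flat_exp_def flat_exp_step_def poly_monom
         field_simps power2_eq_square)
  then show ?thesis
    by (rule has_field_derivative_transform_within_open[where S = "{0<..}"])
       (use greater in \<open>auto simp: flat_exp_def\<close>)
qed

text \<open>A class of functions containing the cut-off and closed under partial derivatives.\<close>
inductive elementary :: "(real^'n::finite \<Rightarrow> real) \<Rightarrow> bool" where
  const: "elementary (\<lambda>_. c)"
| coord: "elementary (\<lambda>x. x $ i)"
| add: "elementary f \<Longrightarrow> elementary g \<Longrightarrow> elementary (\<lambda>x. f x + g x)"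
| mult: "elementary f \<Longrightarrow> elementary g \<Longrightarrow> elementary (\<lambda>x. f x * g x)"
| inverse: "elementary f \<Longrightarrow> (\<And>x. f x \<noteq> 0) \<Longrightarrow> elementary (\<lambda>x. inverse (f x))"
| flat: "elementary f \<Longrightarrow> elementary (\<lambda>x. flat_exp p (f x))"

lemma elementary_deriv:
  assumes "elementary (f :: real^'n::finite \<Rightarrow> real)"
  shows "\<exists>D. (\<forall>x. (f has_derivative D x) (at x)) \<and> (\<forall>i. elementary (\<lambda>x. D x (axis i 1)))"
  using assms
proof induction
  case (const c)
  show ?case by (rule exI[of _ "\<lambda>_ _. 0"]) (auto intro: elementary.const)
next
  case (coord i)
  have "((\<lambda>x::real^'n. x $ i) has_derivative (\<lambda>h. h $ i)) (at x)" for x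
    by (rule bounded_linear_imp_has_derivative[OF bounded_linear_vec_nth])
  then show ?case by (intro exI[of _ "\<lambda>_ h. h $ i"]) (auto intro: elementary.const)
next
  case (add f g)
  then obtain D E where "\<And>x. (f has_derivative D x) (at x)" "\<And>x. (g has_derivative E x) (at x)"
    "\<And>i. elementary (\<lambda>x. D x (axis i 1))" "\<And>i. elementary (\<lambda>x. E x (axis i 1))" by metis
  then show ?case
    by (intro exI[of _ "\<lambda>x h. D x h + E x h"]) (auto intro!: derivative_intros elementary.intros)
next
  case (mult f g)
  then obtain D E where "\<And>x. (f has_derivative D x) (at x)" "\<And>x. (g has_derivative E x) (at x)"
    "\<And>i. elementary (\<lambda>x. D x (axis i 1))" "\<And>i. elementary (\<lambda>x. E x (axis i 1))" by metis
  then show ?case using mult.hyps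
    by (intro exI[of _ "\<lambda>x h. f x * E x h + D x h * g x"])
       (auto intro!: derivative_intros elementary.intros)
next
  case (inverse f)
  then obtain D where D: "\<And>x. (f has_derivative D x) (at x)"
    "\<And>i. elementary (\<lambda>x. D x (axis i 1))" by metis
  have "elementary (\<lambda>x. (-1) * (inverse (f x) * D x (axis i 1) * inverse (f x)))" for i
    by (intro elementary.intros inverse.hyps D)
  then show ?case using D(1) inverse.hyps
    by (intro exI[of _ "\<lambda>x h. - (inverse (f x) * D x h * inverse (f x))"])
       (auto intro!: has_derivative_inverse)
next
  case (flat f p)
  then obtain D where D: "\<And>x. (f has_derivative D x) (at x)"
    "\<And>i. elementary (\<lambda>x. D x (axis i 1))" by metis
  have "((\<lambda>x. flat_exp p (f x)) has_derivative (\<lambda>h. flat_exp (flat_exp_step p) (f x) * D x h)) (at x)" for x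
    using has_derivative_compose[OF D(1)[of x], of "flat_exp p"] flat_exp_deriv[of p "f x"]
    by (simp add: has_field_derivative_def)
  then show ?case using flat.hyps D(2)
    by (intro exI[of _ "\<lambda>x h. flat_exp (flat_exp_step p) (f x) * D x h"])
       (auto intro!: elementary.intros)
qed

lemma elementary_pderiv_at:
  assumes "elementary f" shows "elementary (pderiv_at i f)"
proof -
  obtain D where D: "\<And>x. (f has_derivative D x) (at x)"
    "\<And>i. elementary (\<lambda>x. D x (axis i 1))" using elementary_deriv[OF assms] by metis
  have "pderiv_at i f = (\<lambda>x. D x (axis i 1))"
    using frechet_derivative_at[OF D(1)] by (auto simp: pderiv_at_def fun_eq_iff)
  then show ?thesis using D(2) by simp
qed

lemma elementary_smooth:
  assumes "elementary f" shows "smooth f"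
proof -
  have "elementary (pderivs is f)" for "is"
    using assms by (induction "is") (auto simp: pderivs_def intro: elementary_pderiv_at)
  then show ?thesis
    unfolding smooth_def differentiable_def using elementary_deriv by metis
qed

lemma elementary_sum:
  "finite I \<Longrightarrow> (\<And>i. i \<in> I \<Longrightarrow> elementary (f i)) \<Longrightarrow> elementary (\<lambda>x. \<Sum>i\<in>I. f i x)"
  by (induction I rule: finite_induct) (auto intro: elementary.intros)

definition cutoff :: "real \<Rightarrow> real" where
  "cutoff r = flat_exp 1 (16/9 - r) / (flat_exp 1 (16/9 - r) + flat_exp 1 (r - 9/16))"

lemma flat_exp_nonneg: "0 \<le> flat_exp 1 t" by (simp add: flat_exp_def)

lemma flat_exp_pos_iff: "0 < flat_exp 1 t \<longleftrightarrow> 0 < t" by (simp add: flat_exp_def)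

lemma flat_exp_mono: "s \<le> t \<Longrightarrow> flat_exp 1 s \<le> flat_exp 1 t"
  by (auto simp: flat_exp_def field_simps)

lemma cutoff_denom_pos: "0 < flat_exp 1 (16/9 - r) + flat_exp 1 (r - 9/16)"
  using flat_exp_nonneg[of "16/9 - r"] flat_exp_nonneg[of "r - 9/16"]
    flat_exp_pos_iff[of "16/9 - r"] flat_exp_pos_iff[of "r - 9/16"]
  by (cases "r < 16/9") (auto intro: add_pos_nonneg add_nonneg_pos)

lemma cutoff_bounds: "0 \<le> cutoff r" "cutoff r \<le> 1"
  using flat_exp_nonneg cutoff_denom_pos[of r] by (auto simp: cutoff_def divide_simps)

lemma cutoff_antimono:
  assumes "r \<le> s" shows "cutoff s \<le> cutoff r"
proof -
  define a b where "a = flat_exp 1 (16/9 - r)" and "b = flat_exp 1 (r - 9/16)"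
  define a' b' where "a' = flat_exp 1 (16/9 - s)" and "b' = flat_exp 1 (s - 9/16)"
  have "a' \<le> a" "b \<le> b'" "0 \<le> a'" "0 \<le> b"
    unfolding a_def b_def a'_def b'_def using assms by (auto intro: flat_exp_mono flat_exp_nonneg)
  then have "a' * b \<le> a * b'" by (intro mult_mono) auto
  moreover have "0 < a + b" "0 < a' + b'"
    unfolding a_def b_def a'_def b'_def by (rule cutoff_denom_pos)+
  ultimately have "a' / (a' + b') \<le> a / (a + b)" by (simp add: divide_simps algebra_simps)
  then show ?thesis by (simp add: cutoff_def a_def b_def a'_def b'_def)
qed

lemma cutoff_eq_1: "r \<le> 9/16 \<Longrightarrow> cutoff r = 1"
  using cutoff_denom_pos[of r] by (auto simp: cutoff_def flat_exp_def)

lemma cutoff_eq_0: "16/9 \<le> r \<Longrightarrow> cutoff r = 0"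
  by (auto simp: cutoff_def flat_exp_def)

lemma elementary_cutoff: "elementary (\<lambda>x::real^'n::finite. cutoff (c * (x \<bullet> x)))"
proof -
  have sq: "elementary (\<lambda>x::real^'n. x \<bullet> x)"
    unfolding inner_vec_def by (auto intro!: elementary_sum elementary.intros)
  have "elementary (\<lambda>x::real^'n. flat_exp 1 (16/9 + (- c) * (x \<bullet> x)))"
       "elementary (\<lambda>x::real^'n. flat_exp 1 (- (9/16) + c * (x \<bullet> x)))"
    by (intro elementary.intros sq)+
  then have A: "elementary (\<lambda>x::real^'n. flat_exp 1 (16/9 - c * (x \<bullet> x)))"
       "elementary (\<lambda>x::real^'n. flat_exp 1 (c * (x \<bullet> x) - 9/16))"
    by (simp_all add: algebra_simps)
  have "elementary (\<lambda>x::real^'n. flat_exp 1 (16/9 - c * (x \<bullet> x)) *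
      inverse (flat_exp 1 (16/9 - c * (x \<bullet> x)) + flat_exp 1 (c * (x \<bullet> x) - 9/16)))"
    by (rule elementary.mult[OF A(1) elementary.inverse[OF elementary.add[OF A]]])
       (metis cutoff_denom_pos less_irrefl)
  then show ?thesis unfolding cutoff_def divide_inverse[symmetric] .
qed

lemma dyadic_partition_exists: "\<exists>\<psi> \<rho> :: real^'n::finite \<Rightarrow> real. dyadic_partition \<psi> \<rho>"
proof -
  define \<psi> :: "real^'n \<Rightarrow> real" where "\<psi> x = cutoff (1 * (x \<bullet> x))" for x
  define \<rho> :: "real^'n \<Rightarrow> real" where "\<rho> x = cutoff (1/4 * (x \<bullet> x)) + (-1) * cutoff (1 * (x \<bullet> x))" for x
  have "smooth \<psi>" "smooth \<rho>"
    unfolding \<psi>_def \<rho>_def by (intro elementary_smooth elementary.intros elementary_cutoff)+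
  have rho: "\<rho> \<xi> = \<psi> ((1/2) *\<^sub>R \<xi>) - \<psi> \<xi>" for \<xi> by (simp add: \<rho>_def \<psi>_def)
  have norm: "\<psi> \<xi> = cutoff ((norm \<xi>)\<^sup>2)" for \<xi> by (simp add: \<psi>_def power2_norm_eq_inner)
  have mono: "\<psi> \<xi> \<le> \<psi> ((1/2) *\<^sub>R \<xi>)" for \<xi>
    by (auto simp: norm power_divide intro!: cutoff_antimono)
  have one: "\<psi> \<xi> = 1" if "norm \<xi> \<le> 3/4" for \<xi>
    using power_mono[OF that, of 2] by (auto simp: norm power_divide intro!: cutoff_eq_1)
  have zero: "\<psi> \<xi> = 0" if "norm \<xi> \<ge> 4/3" for \<xi>
    using power_mono[OF that, of 2] by (auto simp: norm power_divide intro!: cutoff_eq_0)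
  have bd: "0 \<le> \<psi> \<xi>" "\<psi> \<xi> \<le> 1" for \<xi> by (simp_all add: norm cutoff_bounds)
  have sums: "(\<lambda>j::nat. \<rho> ((1 / 2 ^ j) *\<^sub>R \<xi>)) sums (1 - \<psi> \<xi>)" for \<xi>
  proof -
    have "(\<lambda>j::nat. (1 / 2 ^ j) *\<^sub>R \<xi>) \<longlonglongrightarrow> 0 *\<^sub>R \<xi>"
      by (intro tendsto_intros LIMSEQ_divide_realpow_zero) auto
    then have "eventually (\<lambda>j::nat. norm ((1 / 2 ^ j) *\<^sub>R \<xi>) < 3/4) sequentially"
      using tendsto_norm_zero order_tendstoD(2)[of _ "0::real" _ "3/4"] by fastforce
    then have "eventually (\<lambda>j::nat. 1 = \<psi> ((1 / 2 ^ j) *\<^sub>R \<xi>)) sequentially"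
      by (rule eventually_mono) (simp add: one del: norm_scaleR)
    then have "(\<lambda>j::nat. \<psi> ((1 / 2 ^ j) *\<^sub>R \<xi>)) \<longlonglongrightarrow> 1"
      by (rule Lim_transform_eventually[OF tendsto_const])
    from telescope_sums[OF this] show ?thesis by (simp add: rho)
  qed
  have "dyadic_partition \<psi> \<rho>"
    unfolding dyadic_partition_def
  proof (intro conjI allI impI)
    show "smooth \<psi>" "smooth \<rho>" by fact+
    show "range \<psi> \<subseteq> {0..1}" using bd by auto
    show "range \<rho> \<subseteq> {0..1}" using bd mono by (auto simp: rho) (smt (verit) bd)
    fix \<xi> \<eta> :: "real^'n"
    show "\<psi> \<xi> = \<psi> \<eta>" "\<rho> \<xi> = \<rho> \<eta>" if "norm \<xi> = norm \<eta>" using that by (auto simp: rho norm)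
    show "norm \<xi> \<le> 4/3" if "\<psi> \<xi> \<noteq> 0" using that zero[of \<xi>] by linarith
    show "3/4 \<le> norm \<xi>" if "\<rho> \<xi> \<noteq> 0"
    proof (rule ccontr)
      assume "\<not> 3/4 \<le> norm \<xi>"
      then have "\<psi> \<xi> = 1" "\<psi> ((1/2) *\<^sub>R \<xi>) = 1" by (auto intro!: one)
      with that show False by (simp add: rho)
    qed
    show "norm \<xi> \<le> 8/3" if "\<rho> \<xi> \<noteq> 0"
    proof (rule ccontr)
      assume "\<not> norm \<xi> \<le> 8/3"
      then have "\<psi> \<xi> = 0" "\<psi> ((1/2) *\<^sub>R \<xi>) = 0" by (auto intro!: zero)
      with that show False by (simp add: rho)
    qed
    show "(\<lambda>j::nat. \<rho> ((1 / 2 ^ j) *\<^sub>R \<xi>)) sums (1 - \<psi> \<xi>)" by (rule sums)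
  qed
  then show ?thesis by blast
qed

end

theory Submission
 imports Defs
begin

text \<open>
The Fourier transform of the rectangular increment of \<open>A\<^sup>b\<close> over \<open>R = I \<times> J\<close> is the
product of those of \<open>b\<close> and of the increment of the reflected \<open>G\<close>. By Hoelder's inequality,
\<open>\<bar>\<Sum> c\<^sub>k A\<^sup>b(R, x\<^sub>k)\<bar> \<le> M \<bar>I\<bar>\<^sup>\<gamma> \<bar>J\<bar>\<^sup>\<gamma> S\<close> for all finite families of points and weights, where
\<open>S\<close> is the supremum of \<open>\<bar>\<Sum> c\<^sub>k exp (i x\<^sub>k \<bullet> \<xi>)\<bar> / \<langle>\<xi>\<rangle>\<close> with the bracket raised to the power \<open>1 + 1/\<gamma>\<close>.
This estimate (\<open>regular_field\<close>) is all that is needed of the field. It reduces the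
increments of a germ to those of the functions \<open>exp (i (\<theta> t - \<theta> s) \<bullet> \<xi>)\<close>, which are products of
a function of \<open>s\<close> and a function of \<open>t\<close>: interpolation gives
\<open>\<bar>exp (i \<theta> t \<bullet> \<xi>) - exp (i \<theta> s \<bullet> \<xi>)\<bar> \<le> C \<langle>\<xi>\<rangle> \<^bsup>1/(2\<gamma>)\<^esup> \<bar>t - s\<bar>\<^bsup>1/2\<^esup>\<close> for \<open>\<gamma>\<close>-Hoelder \<open>\<theta>\<close>, so that
germs have defects of order \<open>\<gamma> + 1/2 > 1\<close> in both variables and can be sewn, one variable after
the other. For two paths one further factor \<open>\<langle>\<xi>\<rangle>\<close> pays for a Lipschitz dependence on
\<open>\<theta> - \<eta>\<close>. Since \<open>\<gamma> > 1/2\<close> the resulting equation is of Volterra type with a contraction on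
short time intervals, which gives existence, uniqueness and stability.
For Lipschitz \<open>b\<close> the continuous version of \<open>A\<^sup>b\<close> is the double integral
itself and the Young sums are Riemann sums.
\<close>

text \<open>The exponent \<open>1 + 1 / \<gamma>\<close> is a budget:
  \<open>1 / (2 * \<gamma>)\<close> for an increment in each of the two time variables, and
  \<open>1\<close> for exchanging one path for another. The equation does not localise in time. The
  increment over \<open>[s, t]\<close> of the integral over \<open>[0, t]^2\<close> is an integral
  over two strips reaching back to 0, so solutions on short intervals cannot simply be concatenated.
  All estimates therefore live on \<open>[0, T]\<close>, and smallness has two other sources. For
  invariance, paths are normalised by the Hoelder constant \<open>\<tau> powr (- \<gamma>)\<close>
  at scale \<open>\<tau>\<close>; the integral along such a path has a constant of order
  \<open>1 / sqrt \<tau>\<close>, which is beaten by \<open>\<tau> powr (- \<gamma>)\<close> for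
  small \<open>\<tau>\<close>. For contraction, differences are measured in the 1/2-Hoelder
  seminorm, and passing from \<open>\<gamma>\<close> to \<open>1/2\<close> on a step of length
  \<open>h\<close> gains \<open>h powr (\<gamma> - 1/2)\<close>; weights growing from step to step
  absorb the memory of the strips. The measure \<open>G\<close> enters through a Jordan
  decomposition, which does not commute with taking images; conditional densities repair this once,
  and afterwards only integrals over the time square occur.\<close>

lemmas LINT_cong = Bochner_Integration.integral_cong
lemmas int_bound = Bochner_Integration.integrable_bound
lemmas LINT_diff = Bochner_Integration.integral_diff
lemmas LINT_add = Bochner_Integration.integral_add
lemmas int_diff = Bochner_Integration.integrable_diff
lemmas int_add = Bochner_Integration.integrable_add

abbreviation jb :: "real^'n::finite => real" where
 "jb \<equiv> japanese_bracket"

section \<open>Sewing in two parameters\<close>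

lemma norm_pmm: "norm (a + b - c - d) <= norm a + norm b + norm c + norm (d :: 'a::real_normed_vector)"
 using norm_triangle_ineq[of a b] norm_triangle_ineq4[of "a + b" c] norm_triangle_ineq4[of "a + b - c" d]
 by linarith

lemma norm_path2: "norm (a - c) <= norm (a - b) + norm (b - c :: 'a::real_normed_vector)"
 using dist_triangle[of a c b] by (simp add: dist_norm)

lemma norm_path4: "norm (a - e) <= norm (b - a) + norm (b - c) + norm (c - d) + norm (d - e :: 'a::real_normed_vector)"
 using norm_path2[of a e b] norm_path2[of b e c] norm_path2[of c e d] by (simp add: norm_minus_commute)

section \<open>Partitions as ordered lists of points\<close>

text \<open>Lists rather than indexed points, because the proofs below cut a partition at a point,
  glue two partitions and merge two into a common refinement.\<close>

fun psum :: "(real => real => 'a::real_normed_vector) => real list => 'a" where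
 "psum X (x # y # l) = X x y + psum X (y # l)"
| "psum X _ = 0"

text \<open>The end points are only required to be members, which makes the condition easy to check
  for unions of point sets; that they come first and last is a consequence. The interval
  \<open>[a, a]\<close> has exactly one chain, the singleton list.\<close>

definition chain :: "real => real => real list => bool" where
 "chain a b P \<longleftrightarrow> sorted_wrt (<) P \<and> a \<in> set P \<and> b \<in> set P \<and> set P \<subseteq> {a..b}"

definition mesh :: "real => real list => bool" where
 "mesh h P \<longleftrightarrow> successively (%x y. y < x + h) P"

lemma psum_append:
 "us \<noteq> [] ==> vs \<noteq> [] ==> psum X (us @ vs) = psum X us + X (last us) (hd vs) + psum X vs"
proof (induction us)
 case (Cons u us)
 show ?case
 proof (cases us)
  case Nil
  then show ?thesis using Cons.prems by (cases vs) auto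
 next
  case (Cons v us')
  then show ?thesis using Cons.IH Cons.prems by (auto simp: algebra_simps)
 qed
qed simp

text \<open>In contrast to \<open>psum_append\<close> the two parts share the point
  \<open>y\<close>, so no bridging term appears.\<close>

lemma psum_join: "psum X (us @ y # vs) = psum X (us @ [y]) + psum X (y # vs)"
proof (induction us)
 case (Cons u us)
 then show ?case by (cases us) (auto simp: algebra_simps)
qed simp

lemma psum_diff: "psum (%s t. X s t - Y s t) P = psum X P - psum Y P"
 by (induction X P rule: psum.induct) (auto simp: algebra_simps)

lemma psum_add: "psum (%s t. X s t + Y s t) P = psum X P + psum Y P"
 by (induction X P rule: psum.induct) (auto simp: algebra_simps)

lemma psum_zero: "psum (%s t. 0) P = 0"
 by (induction "%(s::real) (t::real). 0 :: 'a" P rule: psum.induct) auto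

lemma psum_swap:
 "psum (%s1 t1. psum (%s2 t2. X s1 t1 s2 t2) Q) P = psum (%s2 t2. psum (%s1 t1. X s1 t1 s2 t2) P) Q"
proof (induction P rule: induct_list012)
 case (3 x y l)
 then show ?case by (simp add: psum_add)
qed (simp_all add: psum_zero)

lemma chain_le: "chain a b P ==> a <= b"
 by (auto simp: chain_def)

lemma chain_nonempty: "chain a b P ==> P \<noteq> []"
 by (auto simp: chain_def)

lemma chain_hd: "chain a b P ==> hd P = a"
proof (cases P)
 case (Cons x l)
 assume "chain a b P"
 then have "a = x \<or> a \<in> set l" "\<forall>y\<in>set l. x < y" "a <= x" by (auto simp: Cons chain_def)
 then have "a = x" by force
 then show ?thesis by (simp add: Cons)
qed (simp add: chain_def)

lemma chain_last: "chain a b P ==> last P = b"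
proof (cases P rule: rev_cases)
 case (snoc l x)
 assume "chain a b P"
 then have "b = x \<or> b \<in> set l" "\<forall>y\<in>set l. y < x" "x <= b" by (auto simp: snoc chain_def sorted_wrt_append)
 then have "b = x" by force
 then show ?thesis by (simp add: snoc)
qed (simp add: chain_def)

lemma chain_refl_iff: "chain a a P \<longleftrightarrow> P = [a]"
proof
 assume P: "chain a a P"
 show "P = [a]"
 proof (cases P)
  case (Cons x l)
  with P have "x = a" "\<forall>y\<in>set l. x < y \<and> y = a" by (auto simp: chain_def)
  then have no: "y \<notin> set l" for y by fastforce
  have "l = []" using no[of "hd l"] by (cases l) auto
  then show ?thesis using Cons \<open>x = a\<close> by simp
 qed (use P in \<open>simp add: chain_def\<close>)
qed (simp add: chain_def)

lemma chain_append:
 assumes "chain a b (us @ vs)" "us \<noteq> []" "vs \<noteq> []"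
 shows "chain a (last us) us" "chain (hd vs) b vs" "last us < hd vs" "a <= last us" "hd vs <= b"
proof -
 have hd: "hd us = a" using chain_hd[OF assms(1)] assms(2) by simp
 have la: "last vs = b" using chain_last[OF assms(1)] assms(3) by simp
 have s: "sorted_wrt (<) us" "sorted_wrt (<) vs" "\<forall>x\<in>set us. \<forall>y\<in>set vs. x < y"
  using assms(1) by (auto simp: chain_def sorted_wrt_append)
 have le: "x <= last us" if "x \<in> set us" for x
  using that s(1) assms(2)
  by (cases us rule: rev_cases) (auto simp: sorted_wrt_append)
 have ge: "hd vs <= x" if "x \<in> set vs" for x
  using that s(2) assms(3) by (cases vs) auto
 show 1: "chain a (last us) us"
  using assms hd le s hd_in_set[OF assms(2)] by (auto simp: chain_def)
 show 2: "chain (hd vs) b vs"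
  using assms la ge s last_in_set[OF assms(3)] by (auto simp: chain_def)
 show "last us < hd vs" using s(3) assms by simp
 show "a <= last us" "hd vs <= b" using chain_le[OF 1] chain_le[OF 2] .
qed

section \<open>Sewing in one variable\<close>

text \<open>The solution of \<open>C = 2 + 2 * C / 2 powr \<beta>\<close>, the recursion produced by
  bisection in \<open>sewing\<close>: two defects plus the errors of two halves. It is positive
  because \<open>\<beta> > 1\<close>.\<close>

definition sewC :: "real => real" where "sewC \<beta> = 2 / (1 - 2 powr (1 - \<beta>))"

lemma sewC_pos: "1 < \<beta> ==> 0 < sewC \<beta>"
 unfolding sewC_def using powr_less_mono[of "1 - \<beta>" 0 2] by auto

lemma sewC_eq: "1 < \<beta> ==> 2 + 2 * sewC \<beta> / 2 powr \<beta> = sewC \<beta>"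
proof -
 assume "1 < \<beta>"
 then have "2 powr (1 - \<beta>) < 1" using powr_less_mono[of "1 - \<beta>" 0 "2::real"] by auto
 moreover have *: "2 powr (1 - \<beta>) = 2 / 2 powr \<beta>" by (simp add: powr_diff)
 ultimately have "2 < 2 powr \<beta>" by (simp add: divide_simps)
 then show ?thesis unfolding sewC_def * by (simp add: field_simps)
qed

text \<open>Bisection: let \<open>u\<close> be the last partition point up to the midpoint and
  \<open>v\<close> the first one after it. Both \<open>[a, u]\<close> and \<open>[v, b]\<close> have
  at most half the length and fewer points, while inserting \<open>u\<close> and \<open>v\<close>
  into \<open>X a b\<close> costs two defects. Since \<open>\<beta> > 1\<close>, the errors of the
  halves add up to a fixed fraction, so the constant does not depend on the partition.\<close>

lemma sewing:
 fixes X :: "real => real => 'a::real_normed_vector"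
 assumes \<beta>: "1 < \<beta>" and K: "0 <= K"
  and X: "\<And>s m t. a0 <= s ==> s <= m ==> m <= t ==> t <= b0 ==>
   norm (X s t - X s m - X m t) <= K * (t - s) powr \<beta>"
  and "chain a b P" "a0 <= a" "b <= b0"
 shows "norm (psum X P - X a b) <= sewC \<beta> * K * (b - a) powr \<beta>"
 using assms(4-)
proof (induction "length P" arbitrary: P a b rule: less_induct)
 case less
 note ch = less.prems(1) and rng = less.prems(2,3)
 have ab: "a <= b" using chain_le[OF ch] .
 \<comment> \<open>For \<open>s = m = t\<close> the defect is \<open>- X s s\<close> and its bound
   is \<open>0 powr \<beta> = 0\<close>.\<close>
 have Xaa: "X s s = 0" if "a0 <= s" "s <= b0" for s
  using X[of s s s] that by simp
 show ?case
 proof (cases "a = b")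
  case True
  then show ?thesis using ch Xaa[of a] rng by (simp add: chain_refl_iff)
 next
  case False
  define c where "c = (a + b) / 2"
  define us where "us = takeWhile (%x. x <= c) P"
  define vs where "vs = dropWhile (%x. x <= c) P"
  have P: "P = us @ vs" by (simp add: us_def vs_def)
  have ac: "a <= c" "c < b" using ab False by (auto simp: c_def)
  have us: "us \<noteq> []"
   using chain_hd[OF ch] chain_nonempty[OF ch] ac by (cases P) (auto simp: us_def)
  have vs: "vs \<noteq> []"
   using ch ac unfolding vs_def dropWhile_eq_Nil_conv chain_def by (metis not_le)
  have hv: "c < hd vs" using hd_dropWhile[of "%x. x <= c" P] vs by (auto simp: vs_def)
  have lu: "last us <= c"
   using last_in_set[OF us] by (auto simp: us_def dest: set_takeWhileD)
  note sp = chain_append[OF ch[unfolded P] us vs]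
  define u v where "u = last us" and "v = hd vs"
  have len: "length us < length P" "length vs < length P" using us vs by (auto simp: P)
  have i1: "norm (psum X us - X a u) <= sewC \<beta> * K * (u - a) powr \<beta>"
   using less.hyps[OF len(1) sp(1)] rng sp by (simp add: u_def)
  have i2: "norm (psum X vs - X v b) <= sewC \<beta> * K * (b - v) powr \<beta>"
   using less.hyps[OF len(2) sp(2)] rng sp by (simp add: v_def)
  have CK: "0 <= sewC \<beta> * K" using sewC_pos[OF \<beta>] K by simp
  have half: "((b - a) / 2) powr \<beta> = (b - a) powr \<beta> / 2 powr \<beta>"
   using ab by (simp add: powr_divide)
  have "(u - a) powr \<beta> <= ((b - a) / 2) powr \<beta>" "(b - v) powr \<beta> <= ((b - a) / 2) powr \<beta>"
   using lu hv sp \<beta> by (auto intro!: powr_mono2 simp: u_def v_def c_def field_simps)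
  then have i3: "sewC \<beta> * K * (u - a) powr \<beta> <= sewC \<beta> * K * ((b - a) powr \<beta> / 2 powr \<beta>)"
    "sewC \<beta> * K * (b - v) powr \<beta> <= sewC \<beta> * K * ((b - a) powr \<beta> / 2 powr \<beta>)"
   unfolding half using CK by (intro mult_left_mono; simp)+
  have e1: "norm (X a b - X a u - X u b) <= K * (b - a) powr \<beta>"
   using X[of a u b] sp rng by (simp add: u_def)
  have "norm (X u b - X u v - X v b) <= K * (b - u) powr \<beta>"
   using X[of u v b] sp rng by (simp add: u_def v_def)
  also have "\<dots> <= K * (b - a) powr \<beta>"
   using sp K \<beta> by (intro mult_left_mono powr_mono2) (auto simp: u_def)
  finally have e2: "norm (X u b - X u v - X v b) <= K * (b - a) powr \<beta>" .
  have "psum X P - X a b = (psum X us - X a u) + (psum X vs - X v b)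
    - (X a b - X a u - X u b) - (X u b - X u v - X v b)"
   unfolding P psum_append[OF us vs] u_def v_def by simp
  then have "norm (psum X P - X a b) <= norm (psum X us - X a u) + norm (psum X vs - X v b)
    + norm (X a b - X a u - X u b) + norm (X u b - X u v - X v b)"
   by (simp only: norm_pmm)
  also have "\<dots> <= 2 * (K * (b - a) powr \<beta>) + 2 * (sewC \<beta> * K * ((b - a) powr \<beta> / 2 powr \<beta>))"
   by (rule order_trans[OF add_mono[OF add_mono[OF add_mono[OF
      order_trans[OF i1 i3(1)] order_trans[OF i2 i3(2)]] e1] e2]]) (simp add: mult_ac)
  also have "\<dots> = (2 + 2 * sewC \<beta> / 2 powr \<beta>) * (K * (b - a) powr \<beta>)"
   by (simp add: distrib_right)
  also have "\<dots> = sewC \<beta> * K * (b - a) powr \<beta>"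
   unfolding sewC_eq[OF \<beta>] by simp
  finally show ?thesis .
 qed
qed

text \<open>\<open>sewing\<close> is applied inside each interval \<open>[x, y]\<close> of the
  coarser partition, where \<open>(y - x) powr \<beta> <= h powr (\<beta> - 1) * (y - x)\<close>;
  the lengths then sum to \<open>b - a\<close>. The surplus \<open>\<beta> - 1\<close> becomes the
  rate of convergence in the mesh.\<close>

lemma sewing_refine:
 fixes X :: "real => real => 'a::real_normed_vector"
 assumes \<beta>: "1 < \<beta>" and K: "0 <= K"
  and X: "\<And>s m t. a0 <= s ==> s <= m ==> m <= t ==> t <= b0 ==>
   norm (X s t - X s m - X m t) <= K * (t - s) powr \<beta>"
  and h: "0 < h"
  and "chain a b P" "chain a b Q" "set P \<subseteq> set Q" "mesh h P" "a0 <= a" "b <= b0"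
 shows "norm (psum X Q - psum X P) <= sewC \<beta> * K * h powr (\<beta> - 1) * (b - a)"
 using assms(5-)
proof (induction P arbitrary: a Q rule: induct_list012)
 case 1
 then show ?case by (simp add: chain_def)
next
 case (2 x)
 then have "a = b" by (auto simp: chain_def)
 with 2 show ?case by (simp add: chain_refl_iff)
next
 case (3 x y l)
 have ax: "a = x" using chain_hd[OF 3(3)] by simp
 have xy: "x < y" "y < x + h" using 3 by (auto simp: chain_def mesh_def)
 obtain Q1 Q2 where Q: "Q = Q1 @ y # Q2" using 3 by (auto dest: split_list)
 have c1: "chain y b (y # l)" using chain_append(2)[of a b "[x]" "y # l"] 3(3) by simp
 have ne: "Q1 \<noteq> []" using chain_hd[OF 3(4)] xy ax by (auto simp: Q)
 have c2: "chain y b (y # Q2)" using chain_append(2)[OF 3(4)[unfolded Q] ne] by simp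
 have c3: "chain a y (Q1 @ [y])"
 proof (cases Q2)
  case Nil then show ?thesis using 3(4) chain_last[OF 3(4)] by (simp add: Q)
 next
  case (Cons w ws)
  then show ?thesis using chain_append(1)[of a b "Q1 @ [y]" Q2] 3(4) by (simp add: Q)
 qed
 have sub: "set (y # l) \<subseteq> set (y # Q2)"
 proof
  fix p assume p: "p \<in> set (y # l)"
  then have "y <= p" using c1 by (auto simp: chain_def)
  moreover have "p \<in> set Q" using p 3(5) by auto
  moreover have "\<forall>q\<in>set Q1. q < y" using 3(4) by (auto simp: Q chain_def sorted_wrt_append)
  ultimately show "p \<in> set (y # Q2)" by (auto simp: Q)
 qed
 have rng: "a0 <= y" "y <= b0" "a0 <= a" "b <= b0" using 3 chain_le[OF c1] xy ax by auto
 have i1: "norm (psum X (y # Q2) - psum X (y # l)) <= sewC \<beta> * K * h powr (\<beta> - 1) * (b - y)"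
  using 3(2)[OF c1 c2 sub] 3 rng by (simp add: mesh_def)
 have "norm (psum X (Q1 @ [y]) - X a y) <= sewC \<beta> * K * (y - a) powr \<beta>"
  by (rule sewing[OF \<beta> K X c3]) (use rng in auto)
 also have "(y - a) powr \<beta> = (y - a) powr (\<beta> - 1) * (y - a)"
  using xy ax by (simp add: powr_diff)
 also have "sewC \<beta> * K * ((y - a) powr (\<beta> - 1) * (y - a)) <= sewC \<beta> * K * (h powr (\<beta> - 1) * (y - a))"
  using xy ax \<beta> K sewC_pos[OF \<beta>] by (intro mult_left_mono mult_right_mono powr_mono2) auto
 finally have i2: "norm (psum X (Q1 @ [y]) - X a y) <= sewC \<beta> * K * h powr (\<beta> - 1) * (y - a)"
  by (simp add: mult.assoc)
 have "psum X Q - psum X (x # y # l) = (psum X (Q1 @ [y]) - X a y) + (psum X (y # Q2) - psum X (y # l))"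
  unfolding Q psum_join[of X Q1 y Q2] ax by simp
 then have "norm (psum X Q - psum X (x # y # l)) <= norm (psum X (Q1 @ [y]) - X a y) +
  norm (psum X (y # Q2) - psum X (y # l))" by (simp only: norm_triangle_ineq)
 also have "\<dots> <= sewC \<beta> * K * h powr (\<beta> - 1) * (b - a)" using i1 i2 by (simp add: algebra_simps)
 finally show ?case .
qed

section \<open>Sewing in two variables\<close>

definition psum2 :: "(real => real => real => real => 'a::real_normed_vector) => real list => real list => 'a" where
 "psum2 X P Q = psum (%s t. psum (X s t) Q) P"

text \<open>Four bounds: size, defect in the first variable, defect in the second, and defect of the
  defect. Every defect gains half a power of time and costs a factor \<open>r\<close>. This
  \<open>r\<close> is kept apart from \<open>N\<close> because existence depends on how the
  constants grow with the roughness of the path.\<close>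

definition germ2 :: "real => real => real => real => (real => real => real => real => 'a::real_normed_vector) => bool" where
 "germ2 T \<gamma> N r X \<longleftrightarrow>
  (\<forall>s1 t1 s2 t2. 0 <= s1 --> s1 <= t1 --> t1 <= T --> 0 <= s2 --> s2 <= t2 --> t2 <= T -->
   norm (X s1 t1 s2 t2) <= N * (t1 - s1) powr \<gamma> * (t2 - s2) powr \<gamma>) \<and>
  (\<forall>s1 m1 t1 s2 t2. 0 <= s1 --> s1 <= m1 --> m1 <= t1 --> t1 <= T --> 0 <= s2 --> s2 <= t2 --> t2 <= T -->
   norm (X s1 t1 s2 t2 - X s1 m1 s2 t2 - X m1 t1 s2 t2)
    <= N * r * (t1 - s1) powr (\<gamma> + 1/2) * (t2 - s2) powr \<gamma>) \<and>
  (\<forall>s1 t1 s2 m2 t2. 0 <= s1 --> s1 <= t1 --> t1 <= T --> 0 <= s2 --> s2 <= m2 --> m2 <= t2 --> t2 <= T -->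
   norm (X s1 t1 s2 t2 - X s1 t1 s2 m2 - X s1 t1 m2 t2)
    <= N * r * (t1 - s1) powr \<gamma> * (t2 - s2) powr (\<gamma> + 1/2)) \<and>
  (\<forall>s1 m1 t1 s2 m2 t2. 0 <= s1 --> s1 <= m1 --> m1 <= t1 --> t1 <= T -->
    0 <= s2 --> s2 <= m2 --> m2 <= t2 --> t2 <= T -->
   norm ((X s1 t1 s2 t2 - X s1 m1 s2 t2 - X m1 t1 s2 t2)
     - (X s1 t1 s2 m2 - X s1 m1 s2 m2 - X m1 t1 s2 m2)
     - (X s1 t1 m2 t2 - X s1 m1 m2 t2 - X m1 t1 m2 t2))
    <= N * r * r * (t1 - s1) powr (\<gamma> + 1/2) * (t2 - s2) powr (\<gamma> + 1/2))"

lemma germ2D: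
 assumes "germ2 T \<gamma> N r X"
 shows "0 <= s1 ==> s1 <= t1 ==> t1 <= T ==> 0 <= s2 ==> s2 <= t2 ==> t2 <= T ==>
   norm (X s1 t1 s2 t2) <= N * (t1 - s1) powr \<gamma> * (t2 - s2) powr \<gamma>"
  and "0 <= s1 ==> s1 <= m1 ==> m1 <= t1 ==> t1 <= T ==> 0 <= s2 ==> s2 <= t2 ==> t2 <= T ==>
   norm (X s1 t1 s2 t2 - X s1 m1 s2 t2 - X m1 t1 s2 t2)
    <= N * r * (t1 - s1) powr (\<gamma> + 1/2) * (t2 - s2) powr \<gamma>"
  and "0 <= s1 ==> s1 <= t1 ==> t1 <= T ==> 0 <= s2 ==> s2 <= m2 ==> m2 <= t2 ==> t2 <= T ==>
   norm (X s1 t1 s2 t2 - X s1 t1 s2 m2 - X s1 t1 m2 t2)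
    <= N * r * (t1 - s1) powr \<gamma> * (t2 - s2) powr (\<gamma> + 1/2)"
  and "0 <= s1 ==> s1 <= m1 ==> m1 <= t1 ==> t1 <= T ==>
    0 <= s2 ==> s2 <= m2 ==> m2 <= t2 ==> t2 <= T ==>
   norm ((X s1 t1 s2 t2 - X s1 m1 s2 t2 - X m1 t1 s2 t2)
     - (X s1 t1 s2 m2 - X s1 m1 s2 m2 - X m1 t1 s2 m2)
     - (X s1 t1 m2 t2 - X s1 m1 m2 t2 - X m1 t1 m2 t2))
    <= N * r * r * (t1 - s1) powr (\<gamma> + 1/2) * (t2 - s2) powr (\<gamma> + 1/2)"
   apply (fact assms[unfolded germ2_def, THEN conjunct1, rule_format])
  apply (fact assms[unfolded germ2_def, THEN conjunct2, THEN conjunct1, rule_format])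
  apply (fact assms[unfolded germ2_def, THEN conjunct2, THEN conjunct2, THEN conjunct1, rule_format])
 apply (fact assms[unfolded germ2_def, THEN conjunct2, THEN conjunct2, THEN conjunct2, rule_format])
 done

text \<open>The bounds are symmetric in the two variables, which lets each one-sided statement serve
  for the other direction as well.\<close>

lemma germ2_swap:
 assumes "germ2 T \<gamma> N r X" shows "germ2 T \<gamma> N r (%s1 t1 s2 t2. X s2 t2 s1 t1)"
proof -
 have 4: "norm ((X s2 t2 s1 t1 - X s2 t2 s1 m1 - X s2 t2 m1 t1)
     - (X s2 m2 s1 t1 - X s2 m2 s1 m1 - X s2 m2 m1 t1)
     - (X m2 t2 s1 t1 - X m2 t2 s1 m1 - X m2 t2 m1 t1))
    <= N * r * r * (t1 - s1) powr (\<gamma> + 1/2) * (t2 - s2) powr (\<gamma> + 1/2)"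
  if "0 <= s1" "s1 <= m1" "m1 <= t1" "t1 <= T" "0 <= s2" "s2 <= m2" "m2 <= t2" "t2 <= T"
  for s1 m1 t1 s2 m2 t2
 proof -
  have "norm ((X s2 t2 s1 t1 - X s2 m2 s1 t1 - X m2 t2 s1 t1)
     - (X s2 t2 s1 m1 - X s2 m2 s1 m1 - X m2 t2 s1 m1)
     - (X s2 t2 m1 t1 - X s2 m2 m1 t1 - X m2 t2 m1 t1))
    <= N * r * r * (t2 - s2) powr (\<gamma> + 1/2) * (t1 - s1) powr (\<gamma> + 1/2)"
   by (rule germ2D(4)[OF assms]) (use that in auto)
  then show ?thesis by (simp add: algebra_simps)
 qed
 have 1: "norm (X s2 t2 s1 t1) <= N * (t1 - s1) powr \<gamma> * (t2 - s2) powr \<gamma>"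
  if "0 <= s1" "s1 <= t1" "t1 <= T" "0 <= s2" "s2 <= t2" "t2 <= T" for s1 t1 s2 t2
 proof -
  have "norm (X s2 t2 s1 t1) <= N * (t2 - s2) powr \<gamma> * (t1 - s1) powr \<gamma>"
   by (rule germ2D(1)[OF assms]) (use that in auto)
  then show ?thesis by (simp add: mult_ac)
 qed
 have 2: "norm (X s2 t2 s1 t1 - X s2 t2 s1 m1 - X s2 t2 m1 t1)
    <= N * r * (t1 - s1) powr (\<gamma> + 1/2) * (t2 - s2) powr \<gamma>"
  if "0 <= s1" "s1 <= m1" "m1 <= t1" "t1 <= T" "0 <= s2" "s2 <= t2" "t2 <= T"
  for s1 m1 t1 s2 t2
 proof -
  have "norm (X s2 t2 s1 t1 - X s2 t2 s1 m1 - X s2 t2 m1 t1)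
    <= N * r * (t2 - s2) powr \<gamma> * (t1 - s1) powr (\<gamma> + 1/2)"
   by (rule germ2D(3)[OF assms]) (use that in auto)
  then show ?thesis by (simp add: mult_ac)
 qed
 have 3: "norm (X s2 t2 s1 t1 - X s2 m2 s1 t1 - X m2 t2 s1 t1)
    <= N * r * (t1 - s1) powr \<gamma> * (t2 - s2) powr (\<gamma> + 1/2)"
  if "0 <= s1" "s1 <= t1" "t1 <= T" "0 <= s2" "s2 <= m2" "m2 <= t2" "t2 <= T"
  for s1 t1 s2 m2 t2
 proof -
  have "norm (X s2 t2 s1 t1 - X s2 m2 s1 t1 - X m2 t2 s1 t1)
    <= N * r * (t2 - s2) powr (\<gamma> + 1/2) * (t1 - s1) powr \<gamma>"
   by (rule germ2D(2)[OF assms]) (use that in auto)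
  then show ?thesis by (simp add: mult_ac)
 qed
 show ?thesis unfolding germ2_def by (intro conjI allI impI; rule 1 2 3 4; assumption)
qed

lemma psum2_swap: "psum2 (%s1 t1 s2 t2. X s2 t2 s1 t1) Q P = psum2 X P Q"
 unfolding psum2_def by (rule psum_swap)

lemma psum2_diff: "psum2 (%s1 t1 s2 t2. X s1 t1 s2 t2 - Y s1 t1 s2 t2) P Q = psum2 X P Q - psum2 Y P Q"
 unfolding psum2_def psum_diff ..

definition gam :: "real => real" where "gam \<gamma> = sewC (\<gamma> + 1/2)"

text \<open>Writing \<open>(b - a) powr (\<gamma> + 1/2)\<close> as
  \<open>(b - a) powr \<gamma> * sqrt (b - a)\<close> puts the sewing error into the form of the
  size bound. The result is again a size bound of order \<open>\<gamma>\<close>, so the estimate can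
  be repeated in the other variable.\<close>

lemma sew_bound1:
 fixes Z :: "real => real => 'a::real_normed_vector"
 assumes \<gamma>: "1/2 < \<gamma>" and U: "0 <= U" and r: "0 <= r"
  and Z: "\<And>s m t. a <= s ==> s <= m ==> m <= t ==> t <= b ==>
   norm (Z s t - Z s m - Z m t) <= U * r * (t - s) powr (\<gamma> + 1/2)"
  and Zab: "norm (Z a b) <= U * (b - a) powr \<gamma>"
  and ch: "chain a b P"
 shows "norm (psum Z P) <= U * (b - a) powr \<gamma> * (1 + gam \<gamma> * r * sqrt (b - a))"
proof -
 have ab: "a <= b" using chain_le[OF ch] .
 have "norm (psum Z P - Z a b) <= sewC (\<gamma> + 1/2) * (U * r) * (b - a) powr (\<gamma> + 1/2)"
  by (rule sewing[where a0 = a and b0 = b, OF _ _ _ ch]) (use \<gamma> U r Z in auto)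
 moreover have "norm (psum Z P) <= norm (psum Z P - Z a b) + norm (Z a b)"
  using norm_path2[of "psum Z P" 0 "Z a b"] by simp
 moreover have "(b - a) powr (\<gamma> + 1/2) = (b - a) powr \<gamma> * sqrt (b - a)"
  using ab by (simp add: powr_add powr_half_sqrt)
 ultimately show ?thesis using Zab unfolding gam_def by (simp add: algebra_simps)
qed

context
 fixes X :: "real => real => real => real => 'a::real_normed_vector"
  and T \<gamma> N r a1 b1 a2 b2 :: real
 assumes \<gamma>: "1/2 < \<gamma>" and N: "0 <= N" and r: "0 <= r" and X: "germ2 T \<gamma> N r X"
  and rng: "0 <= a1" "b1 <= T" "0 <= a2" "b2 <= T"
begin

text \<open>Summation over the second variable with the first interval frozen; together with
  \<open>psum_inner_delta\<close> it shows that the inner sum is a one-parameter germ to which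
  sewing applies again.\<close>

lemma psum_inner:
 assumes Q: "chain a2 b2 Q" and "0 <= s1" "s1 <= t1" "t1 <= T"
 shows "norm (psum (X s1 t1) Q)
  <= N * (b2 - a2) powr \<gamma> * (1 + gam \<gamma> * r * sqrt (b2 - a2)) * (t1 - s1) powr \<gamma>"
proof -
 have "norm (psum (X s1 t1) Q) <= (N * (t1 - s1) powr \<gamma>) * (b2 - a2) powr \<gamma> * (1 + gam \<gamma> * r * sqrt (b2 - a2))"
 proof (rule sew_bound1[OF \<gamma> _ r _ _ Q])
  show "norm (X s1 t1 s t - X s1 t1 s m - X s1 t1 m t) <= N * (t1 - s1) powr \<gamma> * r * (t - s) powr (\<gamma> + 1/2)"
   if "a2 <= s" "s <= m" "m <= t" "t <= b2" for s m t
  proof -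
   have "0 <= s" "t <= T" using that rng by auto
   then have "norm (X s1 t1 s t - X s1 t1 s m - X s1 t1 m t) <= N * r * (t1 - s1) powr \<gamma> * (t - s) powr (\<gamma> + 1/2)"
    by (intro germ2D(3)[OF X]) (use that assms in auto)
   then show ?thesis by (simp add: mult_ac)
  qed
  show "norm (X s1 t1 a2 b2) <= N * (t1 - s1) powr \<gamma> * (b2 - a2) powr \<gamma>"
   by (rule germ2D(1)[OF X]) (use rng assms chain_le[OF Q] in auto)
 qed (use N in auto)
 then show ?thesis by (simp add: mult_ac)
qed

text \<open>The defect of a sum is the sum of the defects. As a germ in the second variable, the
  defects have their size controlled by the second bound of \<open>germ2\<close> and their own
  defect by the fourth.\<close>

lemma psum_inner_delta:
 assumes Q: "chain a2 b2 Q" and "0 <= s1" "s1 <= m1" "m1 <= t1" "t1 <= T"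
 shows "norm (psum (X s1 t1) Q - psum (X s1 m1) Q - psum (X m1 t1) Q)
  <= N * (b2 - a2) powr \<gamma> * (1 + gam \<gamma> * r * sqrt (b2 - a2)) * r * (t1 - s1) powr (\<gamma> + 1/2)"
proof -
 let ?Z = "%s t. X s1 t1 s t - X s1 m1 s t - X m1 t1 s t"
 have "norm (psum ?Z Q) <= (N * r * (t1 - s1) powr (\<gamma> + 1/2)) * (b2 - a2) powr \<gamma> * (1 + gam \<gamma> * r * sqrt (b2 - a2))"
 proof (rule sew_bound1[OF \<gamma> _ r _ _ Q])
  show "norm (?Z s t - ?Z s m - ?Z m t) <= N * r * (t1 - s1) powr (\<gamma> + 1/2) * r * (t - s) powr (\<gamma> + 1/2)"
   if "a2 <= s" "s <= m" "m <= t" "t <= b2" for s m t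
  proof -
   have "0 <= s" "t <= T" using that rng by auto
   then have "norm (?Z s t - ?Z s m - ?Z m t) <= N * r * r * (t1 - s1) powr (\<gamma> + 1/2) * (t - s) powr (\<gamma> + 1/2)"
    by (intro germ2D(4)[OF X]) (use that assms in auto)
   then show ?thesis by (simp add: mult_ac)
  qed
  show "norm (?Z a2 b2) <= N * r * (t1 - s1) powr (\<gamma> + 1/2) * (b2 - a2) powr \<gamma>"
   by (rule germ2D(2)[OF X]) (use rng assms chain_le[OF Q] in auto)
 qed (use N r in auto)
 then show ?thesis unfolding psum_diff by (simp add: mult_ac)
qed

lemma factor_nonneg: "0 <= gam \<gamma> * r * sqrt x" if "0 <= x"
 using sewC_pos[of "\<gamma> + 1/2"] \<gamma> r that by (auto simp: gam_def)

lemma psum2_bound: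
 assumes P: "chain a1 b1 P" and Q: "chain a2 b2 Q"
 shows "norm (psum2 X P Q) <= N * (b1 - a1) powr \<gamma> * (b2 - a2) powr \<gamma> *
  (1 + gam \<gamma> * r * sqrt (b1 - a1)) * (1 + gam \<gamma> * r * sqrt (b2 - a2))"
proof -
 define U where "U = N * (b2 - a2) powr \<gamma> * (1 + gam \<gamma> * r * sqrt (b2 - a2))"
 have U: "0 <= U" using N factor_nonneg[of "b2 - a2"] chain_le[OF Q] by (simp add: U_def)
 have "norm (psum2 X P Q) <= U * (b1 - a1) powr \<gamma> * (1 + gam \<gamma> * r * sqrt (b1 - a1))"
  unfolding psum2_def
  by (rule sew_bound1[OF \<gamma> U r _ _ P])
    (use psum_inner[OF Q] psum_inner_delta[OF Q] rng chain_le[OF P] in \<open>auto simp: U_def\<close>)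
 then show ?thesis by (simp add: U_def mult_ac)
qed

text \<open>What matters is the uniformity in \<open>Q\<close>: one direction can be refined while
  the other carries an arbitrary partition.\<close>

lemma psum2_refine:
 assumes P: "chain a1 b1 P" and P': "chain a1 b1 P'" and Q: "chain a2 b2 Q"
  and "set P \<subseteq> set P'" "mesh h P" "0 < h"
 shows "norm (psum2 X P' Q - psum2 X P Q)
  <= N * (b2 - a2) powr \<gamma> * (1 + gam \<gamma> * r * sqrt (b2 - a2)) * r * gam \<gamma> * (b1 - a1) * h powr (\<gamma> - 1/2)"
proof -
 define U where "U = N * (b2 - a2) powr \<gamma> * (1 + gam \<gamma> * r * sqrt (b2 - a2)) * r"
 have U: "0 <= U" using N r factor_nonneg[of "b2 - a2"] chain_le[OF Q] by (simp add: U_def)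
 have "norm (psum2 X P' Q - psum2 X P Q) <= sewC (\<gamma> + 1/2) * U * h powr ((\<gamma> + 1/2) - 1) * (b1 - a1)"
  unfolding psum2_def
  by (rule sewing_refine[where a0 = a1 and b0 = b1])
    (use psum_inner_delta[OF Q] rng assms U \<gamma> in \<open>auto simp: U_def\<close>)
 then show ?thesis by (simp add: U_def gam_def mult_ac)
qed

end

lemma chain_union:
 assumes "chain a b P" "chain a b Q"
 shows "\<exists>R. chain a b R \<and> set R = set P \<union> set Q"
 by (rule exI[of _ "sorted_list_of_set (set P \<union> set Q)"])
   (use assms in \<open>auto simp: chain_def strict_sorted_list_of_set\<close>)

text \<open>Two grids are compared through a common refinement, one direction at a time:
  \<open>P\<close> and \<open>P'\<close> are replaced by \<open>R\<close> over the fixed partition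
  \<open>S\<close>, and \<open>Q\<close>, \<open>Q'\<close> by \<open>S\<close> over
  \<open>P\<close> and \<open>P'\<close>. These are four applications of the refinement
  bound.\<close>

lemma psum2_cauchy:
 fixes X :: "real => real => real => real => 'a::real_normed_vector"
 assumes \<gamma>: "1/2 < \<gamma>" and N: "0 <= N" and r: "0 <= r" and X: "germ2 T \<gamma> N r X"
  and rng: "0 <= a1" "b1 <= T" "0 <= a2" "b2 <= T"
 shows "\<exists>c\<ge>0. \<forall>h h' P P' Q Q'. 0 < h \<and> 0 < h' \<and> chain a1 b1 P \<and> chain a1 b1 P' \<and> chain a2 b2 Q \<and> chain a2 b2 Q'
   \<and> mesh h P \<and> mesh h Q \<and> mesh h' P' \<and> mesh h' Q' -->
   norm (psum2 X P Q - psum2 X P' Q') <= c * (h powr (\<gamma> - 1/2) + h' powr (\<gamma> - 1/2))"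
proof (cases "a1 <= b1 \<and> a2 <= b2")
 case False
 then show ?thesis by (intro exI[of _ 0]) (auto dest: chain_le)
next
 case True
 define c1 where "c1 = N * (b2 - a2) powr \<gamma> * (1 + gam \<gamma> * r * sqrt (b2 - a2)) * r * gam \<gamma> * (b1 - a1)"
 define c2 where "c2 = N * (b1 - a1) powr \<gamma> * (1 + gam \<gamma> * r * sqrt (b1 - a1)) * r * gam \<gamma> * (b2 - a2)"
 have gp: "0 <= gam \<gamma>" using sewC_pos[of "\<gamma> + 1/2"] \<gamma> by (simp add: gam_def)
 have c: "0 <= c1" "0 <= c2" using True N r gp by (auto simp: c1_def c2_def)
 note r1 = psum2_refine[OF \<gamma> N r X rng]
 note r2 = psum2_refine[OF \<gamma> N r germ2_swap[OF X] rng(3,4) rng(1,2), unfolded psum2_swap[of X]]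
 have "norm (psum2 X P Q - psum2 X P' Q') <= (c1 + c2) * (h powr (\<gamma> - 1/2) + h' powr (\<gamma> - 1/2))"
  if *: "0 < h" "0 < h'" "chain a1 b1 P" "chain a1 b1 P'" "chain a2 b2 Q" "chain a2 b2 Q'"
   "mesh h P" "mesh h Q" "mesh h' P'" "mesh h' Q'" for h h' P P' Q Q'
 proof -
  obtain R where R: "chain a1 b1 R" "set R = set P \<union> set P'" using chain_union * by blast
  obtain S where S: "chain a2 b2 S" "set S = set Q \<union> set Q'" using chain_union * by blast
  have "norm (psum2 X R S - psum2 X P S) <= c1 * h powr (\<gamma> - 1/2)"
   unfolding c1_def by (rule r1) (use * R S in auto)
  moreover have "norm (psum2 X R S - psum2 X P' S) <= c1 * h' powr (\<gamma> - 1/2)"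
   unfolding c1_def by (rule r1) (use * R S in auto)
  moreover have "norm (psum2 X P S - psum2 X P Q) <= c2 * h powr (\<gamma> - 1/2)"
   unfolding c2_def by (rule r2) (use * R S in auto)
  moreover have "norm (psum2 X P' S - psum2 X P' Q') <= c2 * h' powr (\<gamma> - 1/2)"
   unfolding c2_def by (rule r2) (use * R S in auto)
  moreover have "norm (psum2 X P Q - psum2 X P' Q') <= norm (psum2 X R S - psum2 X P S) +
    norm (psum2 X R S - psum2 X P' S) + norm (psum2 X P S - psum2 X P Q) + norm (psum2 X P' S - psum2 X P' Q')"
   using norm_path4[of "psum2 X P Q" "psum2 X P' Q'" "psum2 X P S" "psum2 X R S" "psum2 X P' S"]
   by (simp add: norm_minus_commute)
  ultimately show ?thesis unfolding distrib_left distrib_right by linarith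
 qed
 note main = this
 show ?thesis
  by (rule exI[of _ "c1 + c2"], intro conjI allI impI, use c in simp, elim conjE, rule main) assumption+
qed

lemma chain_exists:
 assumes "a <= b" "0 < h" shows "\<exists>P. chain a b P \<and> mesh h P"
proof (cases "a = b")
 case True
 then show ?thesis by (intro exI[of _ "[a]"]) (auto simp: chain_def mesh_def)
next
 case False
 then have ab: "a < b" using assms by simp
 obtain n :: nat where n: "(b - a) / h < real n" using reals_Archimedean2 by blast
 have n0: "0 < n"
 proof (rule ccontr)
  assume "\<not> 0 < n"
  then have "(b - a) / h < 0" using n by simp
  moreover have "0 < (b - a) / h" using ab assms by simp
  ultimately show False by linarith
 qed
 define f where "f i = a + (b - a) * real i / real n" for i :: nat
 have mono: "f i < f j" if "i < j" for i j
  using that ab n0 by (auto simp: f_def divide_strict_right_mono)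
 have f0: "f 0 = a" and fn: "f n = b" using n0 by (auto simp: f_def)
 have sorted: "sorted_wrt (<) (map f [0..<Suc n])"
  by (auto simp: sorted_wrt_iff_nth_less intro: mono simp del: upt_Suc)
 have step: "f (Suc i) < f i + h" for i
 proof -
  have "f (Suc i) = f i + (b - a) / real n" using n0 by (simp add: f_def field_simps)
  also have "(b - a) / real n < h" using n n0 assms by (simp add: field_simps)
  finally show ?thesis by simp
 qed
 have mem: "f i \<in> {a..b}" if "i <= n" for i
  using that mono[of 0 i] mono[of i n] f0 fn by (cases "i = 0"; cases "i = n") auto
 have "chain a b (map f [0..<Suc n])"
  unfolding chain_def
 proof (intro conjI)
  show "a \<in> set (map f [0..<Suc n])" "b \<in> set (map f [0..<Suc n])"
   using f0 fn by (auto simp del: upt_Suc intro: image_eqI[of _ _ 0] image_eqI[of _ _ n])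
  show "set (map f [0..<Suc n]) \<subseteq> {a..b}" using mem by (auto simp del: upt_Suc)
 qed (rule sorted)
 moreover have "mesh h (map f [0..<Suc n])"
  unfolding mesh_def successively_conv_nth using step by (auto simp del: upt_Suc)
 ultimately show ?thesis by blast
qed

section \<open>The integral as limit of grid sums\<close>

definition has_int :: "(real => real => real => real => 'a::real_normed_vector)
  => real => real => real => real => 'a => bool" where
 "has_int X a1 b1 a2 b2 I \<longleftrightarrow> (\<forall>\<epsilon>>0. \<exists>h>0. \<forall>P Q.
   chain a1 b1 P \<and> mesh h P \<and> chain a2 b2 Q \<and> mesh h Q --> norm (psum2 X P Q - I) < \<epsilon>)"

lemma mesh_mono: "mesh h P ==> h <= h' ==> mesh h' P"
 unfolding mesh_def by (erule successively_mono) auto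

text \<open>The ordering of the end points ensures that there are partitions at all; for
  \<open>b1 < a1\<close> every value would satisfy \<open>has_int\<close> vacuously.\<close>

lemma has_int_unique:
 assumes "has_int X a1 b1 a2 b2 I" "has_int X a1 b1 a2 b2 J" "a1 <= b1" "a2 <= b2"
 shows "I = J"
proof (rule ccontr)
 assume "I \<noteq> J"
 define e where "e = norm (I - J) / 2"
 have e: "0 < e" using \<open>I \<noteq> J\<close> by (simp add: e_def)
 obtain h where h: "h > 0" "\<And>P Q. chain a1 b1 P \<and> mesh h P \<and> chain a2 b2 Q \<and> mesh h Q ==> norm (psum2 X P Q - I) < e"
  using assms(1) e unfolding has_int_def by blast
 obtain k where k: "k > 0" "\<And>P Q. chain a1 b1 P \<and> mesh k P \<and> chain a2 b2 Q \<and> mesh k Q ==> norm (psum2 X P Q - J) < e"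
  using assms(2) e unfolding has_int_def by blast
 obtain P where P: "chain a1 b1 P" "mesh (min h k) P" using chain_exists[OF assms(3), of "min h k"] h k by auto
 obtain Q where Q: "chain a2 b2 Q" "mesh (min h k) Q" using chain_exists[OF assms(4), of "min h k"] h k by auto
 have "norm (psum2 X P Q - I) < e" "norm (psum2 X P Q - J) < e"
  using h(2) k(2) P Q mesh_mono[of "min h k" _ h] mesh_mono[of "min h k" _ k] by auto
 moreover have "norm (I - J) <= norm (psum2 X P Q - I) + norm (psum2 X P Q - J)"
  using norm_path2[of I J "psum2 X P Q"] by (simp add: norm_minus_commute)
 ultimately show False by (simp add: e_def)
qed

lemma has_int_exists:
 fixes X :: "real => real => real => real => 'a::banach"
 assumes \<gamma>: "1/2 < \<gamma>" and N: "0 <= N" and r: "0 <= r" and X: "germ2 T \<gamma> N r X"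
  and rng: "0 <= a1" "a1 <= b1" "b1 <= T" "0 <= a2" "a2 <= b2" "b2 <= T"
 shows "\<exists>I. has_int X a1 b1 a2 b2 I"
proof -
 obtain c where c: "c \<ge> 0" "\<And>h h' P P' Q Q'. 0 < h \<and> 0 < h' \<and> chain a1 b1 P \<and> chain a1 b1 P' \<and> chain a2 b2 Q \<and> chain a2 b2 Q'
   \<and> mesh h P \<and> mesh h Q \<and> mesh h' P' \<and> mesh h' Q' ==>
   norm (psum2 X P Q - psum2 X P' Q') <= c * (h powr (\<gamma> - 1/2) + h' powr (\<gamma> - 1/2))"
  using psum2_cauchy[OF \<gamma> N r X rng(1,3,4,6)] by metis
 \<comment> \<open>One sequence of grids with mesh below \<open>k n\<close> produces the limit;
   arbitrary fine grids are then compared with it through the Cauchy bound.\<close>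
 define k where "k n = inverse (real (Suc n))" for n
 have kp: "0 < k n" for n by (simp add: k_def)
 have klim: "(%n. k n powr (\<gamma> - 1/2)) \<longlonglongrightarrow> 0"
  unfolding k_def
  by (rule tendsto_zero_powrI[OF LIMSEQ_inverse_real_of_nat tendsto_const]) (use \<gamma> in auto)
 have "\<forall>n. \<exists>P. chain a1 b1 P \<and> mesh (k n) P" using chain_exists[OF rng(2) kp] by blast
 then obtain P where P: "\<And>n. chain a1 b1 (P n)" "\<And>n. mesh (k n) (P n)" by metis
 have "\<forall>n. \<exists>P. chain a2 b2 P \<and> mesh (k n) P" using chain_exists[OF rng(5) kp] by blast
 then obtain Q where Q: "\<And>n. chain a2 b2 (Q n)" "\<And>n. mesh (k n) (Q n)" by metis
 define S where "S n = psum2 X (P n) (Q n)" for n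
 have small: "\<exists>M. \<forall>n\<ge>M. c * k n powr (\<gamma> - 1/2) < e" if "0 < e" for e
 proof -
  have "(%n. c * k n powr (\<gamma> - 1/2)) \<longlonglongrightarrow> c * 0" using klim by (intro tendsto_intros)
  then have "\<forall>\<^sub>F n in sequentially. c * k n powr (\<gamma> - 1/2) < e"
   using that by (intro order_tendstoD) auto
  then show ?thesis by (simp add: eventually_sequentially)
 qed
 have "Cauchy S"
 proof (rule CauchyI)
  fix e :: real assume "0 < e"
  then obtain M where M: "\<And>n. n \<ge> M ==> c * k n powr (\<gamma> - 1/2) < e / 2" using small[of "e/2"] by auto
  have "norm (S m - S n) < e" if "m \<ge> M" "n \<ge> M" for m n
  proof -
   have "norm (S m - S n) <= c * (k m powr (\<gamma> - 1/2) + k n powr (\<gamma> - 1/2))"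
    unfolding S_def by (rule c(2)) (use P Q kp in auto)
   also have "\<dots> < e" using M[OF that(1)] M[OF that(2)] by (simp add: algebra_simps)
   finally show ?thesis .
  qed
  then show "\<exists>M. \<forall>m\<ge>M. \<forall>n\<ge>M. norm (S m - S n) < e" by blast
 qed
 then obtain I where I: "S \<longlonglongrightarrow> I" using Cauchy_convergent convergent_def by blast
 have "has_int X a1 b1 a2 b2 I"
  unfolding has_int_def
 proof (intro allI impI)
  fix e :: real assume e: "0 < e"
  obtain M where M: "\<And>n. n \<ge> M ==> c * k n powr (\<gamma> - 1/2) < e / 4" using small[of "e/4"] e by auto
  have "norm (psum2 X P' Q' - I) < e" if *: "chain a1 b1 P'" "mesh (k M) P'" "chain a2 b2 Q'" "mesh (k M) Q'" for P' Q'
  proof -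
   have "norm (psum2 X P' Q' - S n) <= e / 2" if "n \<ge> M" for n
   proof -
    have "norm (psum2 X P' Q' - S n) <= c * (k M powr (\<gamma> - 1/2) + k n powr (\<gamma> - 1/2))"
     unfolding S_def by (rule c(2)) (use P Q kp * in auto)
    also have "\<dots> <= e / 2" using M[OF that] M[of M] by (simp add: algebra_simps)
    finally show ?thesis .
   qed
   then have "norm (psum2 X P' Q' - I) <= e / 2"
    by (intro LIMSEQ_le_const2[OF tendsto_norm[OF tendsto_diff[OF tendsto_const I]]]) auto
   then show ?thesis using e by simp
  qed
  then show "\<exists>h>0. \<forall>P Q. chain a1 b1 P \<and> mesh h P \<and> chain a2 b2 Q \<and> mesh h Q --> norm (psum2 X P Q - I) < e"
   using kp[of M] by blast
 qed
 then show ?thesis by blast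
qed

lemma has_int_bound:
 fixes X :: "real => real => real => real => 'a::real_normed_vector"
 assumes \<gamma>: "1/2 < \<gamma>" and N: "0 <= N" and r: "0 <= r" and X: "germ2 T \<gamma> N r X"
  and rng: "0 <= a1" "a1 <= b1" "b1 <= T" "0 <= a2" "a2 <= b2" "b2 <= T"
  and I: "has_int X a1 b1 a2 b2 I"
 shows "norm I <= N * (b1 - a1) powr \<gamma> * (b2 - a2) powr \<gamma> *
  (1 + gam \<gamma> * r * sqrt (b1 - a1)) * (1 + gam \<gamma> * r * sqrt (b2 - a2))" (is "_ <= ?B")
proof (rule field_le_epsilon)
 fix e :: real assume "0 < e"
 then obtain h where h: "h > 0" "\<And>P Q. chain a1 b1 P \<and> mesh h P \<and> chain a2 b2 Q \<and> mesh h Q ==> norm (psum2 X P Q - I) < e"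
  using I unfolding has_int_def by blast
 obtain P where P: "chain a1 b1 P" "mesh h P" using chain_exists[OF rng(2) h(1)] by blast
 obtain Q where Q: "chain a2 b2 Q" "mesh h Q" using chain_exists[OF rng(5) h(1)] by blast
 have "norm (psum2 X P Q - I) < e" using h P Q by blast
 moreover have "norm (psum2 X P Q) <= ?B" by (rule psum2_bound[OF \<gamma> N r X _ _ _ _ P(1) Q(1)]) (use rng in auto)
 moreover have "norm I <= norm (psum2 X P Q) + norm (psum2 X P Q - I)"
  using norm_path2[of I 0 "psum2 X P Q"] by (simp add: norm_minus_commute)
 ultimately show "norm I <= ?B + e" by linarith
qed

text \<open>The glued list is fixed before \<open>Z\<close>, because in \<open>has_int_join1\<close>
  the summand \<open>Z\<close> is an inner sum over the other variable.\<close>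

lemma chain_join:
 assumes P: "chain a b P" and Q: "chain b c Q" and h: "mesh h P" "mesh h Q" "0 < h"
 shows "\<exists>R. chain a c R \<and> mesh h R \<and> (\<forall>Z::real => real => 'a::real_normed_vector. psum Z R = psum Z P + psum Z Q)"
proof -
 obtain P' where P': "P = P' @ [b]"
  using chain_last[OF P] chain_nonempty[OF P] by (metis append_butlast_last_id)
 obtain Q' where Q': "Q = b # Q'"
  using chain_hd[OF Q] chain_nonempty[OF Q] by (metis list.collapse)
 let ?R = "P' @ b # Q'"
 have "chain a c ?R" using P Q unfolding P' Q' by (force simp: chain_def sorted_wrt_append)
 moreover have "mesh h ?R" using h unfolding P' Q' mesh_def successively_append_iff by auto
 moreover have "psum Z ?R = psum Z P + psum Z Q" for Z :: "real => real => 'a"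
  unfolding P' Q' using psum_join[of Z P' b Q'] by simp
 ultimately show ?thesis by blast
qed

lemma has_int_swap: "has_int X a1 b1 a2 b2 I ==> has_int (%s1 t1 s2 t2. X s2 t2 s1 t1) a2 b2 a1 b1 I"
 unfolding has_int_def psum2_swap[of X] by meson

lemma has_int_join1:
 fixes X :: "real => real => real => real => 'a::real_normed_vector"
 assumes I: "has_int X a1 c1 a2 b2 I" and J: "has_int X c1 b1 a2 b2 J" and K: "has_int X a1 b1 a2 b2 K"
  and le: "a1 <= c1" "c1 <= b1" "a2 <= b2"
 shows "K = I + J"
proof (rule ccontr)
 assume "K \<noteq> I + J"
 define e where "e = norm (K - (I + J)) / 3"
 have e: "0 < e" using \<open>K \<noteq> I + J\<close> by (simp add: e_def)
 obtain h where h: "h > 0" "\<And>P Q. chain a1 c1 P \<and> mesh h P \<and> chain a2 b2 Q \<and> mesh h Q ==> norm (psum2 X P Q - I) < e"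
  using I e unfolding has_int_def by blast
 obtain k where k: "k > 0" "\<And>P Q. chain c1 b1 P \<and> mesh k P \<and> chain a2 b2 Q \<and> mesh k Q ==> norm (psum2 X P Q - J) < e"
  using J e unfolding has_int_def by blast
 obtain l where l: "l > 0" "\<And>P Q. chain a1 b1 P \<and> mesh l P \<and> chain a2 b2 Q \<and> mesh l Q ==> norm (psum2 X P Q - K) < e"
  using K e unfolding has_int_def by blast
 define m where "m = min h (min k l)"
 have m: "0 < m" "m <= h" "m <= k" "m <= l" using h k l by (auto simp: m_def)
 obtain P where P: "chain a1 c1 P" "mesh m P" using chain_exists[OF le(1) m(1)] by auto
 obtain P' where P': "chain c1 b1 P'" "mesh m P'" using chain_exists[OF le(2) m(1)] by auto
 obtain Q where Q: "chain a2 b2 Q" "mesh m Q" using chain_exists[OF le(3) m(1)] by auto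
 obtain R where R: "chain a1 b1 R" "mesh m R" "\<And>Z::real => real => 'a. psum Z R = psum Z P + psum Z P'"
  using chain_join[OF P(1) P'(1) P(2) P'(2) m(1)] by blast
 have "norm (psum2 X P Q - I) < e" "norm (psum2 X P' Q - J) < e" "norm (psum2 X R Q - K) < e"
  using h(2) k(2) l(2) P P' Q R m mesh_mono by blast+
 moreover have "psum2 X R Q = psum2 X P Q + psum2 X P' Q" unfolding psum2_def by (rule R(3))
 then have "norm (K - (I + J)) <= norm (psum2 X P Q - I) + norm (psum2 X P' Q - J) + norm (psum2 X R Q - K)"
  using norm_path2[of "I + J" K "psum2 X R Q"] norm_triangle_ineq[of "psum2 X P Q - I" "psum2 X P' Q - J"]
  by (simp add: norm_minus_commute algebra_simps)
 ultimately show False by (simp add: e_def)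
qed

lemma has_int_diff:
 assumes I: "has_int X a1 b1 a2 b2 I" and J: "has_int Y a1 b1 a2 b2 J"
 shows "has_int (%s1 t1 s2 t2. X s1 t1 s2 t2 - Y s1 t1 s2 t2) a1 b1 a2 b2 (I - J)"
 unfolding has_int_def
proof (intro allI impI)
 fix e :: real assume e: "0 < e"
 obtain h where h: "h > 0" "\<And>P Q. chain a1 b1 P \<and> mesh h P \<and> chain a2 b2 Q \<and> mesh h Q ==> norm (psum2 X P Q - I) < e/2"
  using I half_gt_zero[OF e] unfolding has_int_def by blast
 obtain k where k: "k > 0" "\<And>P Q. chain a1 b1 P \<and> mesh k P \<and> chain a2 b2 Q \<and> mesh k Q ==> norm (psum2 Y P Q - J) < e/2"
  using J half_gt_zero[OF e] unfolding has_int_def by blast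
 have "norm (psum2 (%s1 t1 s2 t2. X s1 t1 s2 t2 - Y s1 t1 s2 t2) P Q - (I - J)) < e"
  if "chain a1 b1 P \<and> mesh (min h k) P \<and> chain a2 b2 Q \<and> mesh (min h k) Q" for P Q
 proof -
  have "norm (psum2 X P Q - I) < e/2" "norm (psum2 Y P Q - J) < e/2"
   using h(2) k(2) that mesh_mono[of "min h k" _ h] mesh_mono[of "min h k" _ k] by auto
  moreover have "norm ((psum2 X P Q - psum2 Y P Q) - (I - J)) <= norm (psum2 X P Q - I) + norm (psum2 Y P Q - J)"
   using norm_triangle_ineq4[of "psum2 X P Q - I" "psum2 Y P Q - J"] by (simp add: algebra_simps)
  ultimately show ?thesis unfolding psum2_diff by linarith
 qed
 then show "\<exists>h>0. \<forall>P Q. chain a1 b1 P \<and> mesh h P \<and> chain a2 b2 Q \<and> mesh h Q -->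
   norm (psum2 (%s1 t1 s2 t2. X s1 t1 s2 t2 - Y s1 t1 s2 t2) P Q - (I - J)) < e"
  using h k by (intro exI[of _ "min h k"]) auto
qed

text \<open>The square \<open>[0, t]^2\<close> exceeds \<open>[0, s]^2\<close> by the strips
  \<open>[s, t] x [0, t]\<close> and \<open>[0, s] x [s, t]\<close>, each with one short side. One
  root factor keeps the short length \<open>t - s\<close> instead of \<open>T\<close>: for
  \<open>t - s <= \<tau>\<close> and \<open>r = 1 / sqrt \<tau>\<close> it is bounded independently
  of \<open>\<tau>\<close>, on which \<open>existence\<close> relies.\<close>

lemma has_int_strips:
 fixes X :: "real => real => real => real => 'a::banach"
 assumes \<gamma>: "1/2 < \<gamma>" and N: "0 <= N" and r: "0 <= r" and X: "germ2 T \<gamma> N r X"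
  and st: "0 <= s" "s <= t" "t <= T"
  and I: "has_int X 0 t 0 t I" and J: "has_int X 0 s 0 s J"
 shows "norm (I - J) <= 2 * N * T powr \<gamma> * (1 + gam \<gamma> * r * sqrt T) * (1 + gam \<gamma> * r * sqrt (t - s)) * (t - s) powr \<gamma>"
proof -
 note ex = has_int_exists[OF \<gamma> N r X]
 note bd = has_int_bound[OF \<gamma> N r X]
 have gp: "0 <= gam \<gamma>" using sewC_pos[of "\<gamma> + 1/2"] \<gamma> by (simp add: gam_def)
 obtain A where A: "has_int X s t 0 t A" using ex[of s t 0 t] st by auto
 obtain B where B: "has_int X 0 s 0 t B" using ex[of 0 s 0 t] st by auto
 obtain C where C: "has_int X 0 s s t C" using ex[of 0 s s t] st by auto
 have "I = B + A" by (rule has_int_join1[OF B A I]) (use st in auto)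
 moreover have "B = J + C"
  by (rule has_int_join1[OF has_int_swap[OF J] has_int_swap[OF C] has_int_swap[OF B]]) (use st in auto)
 ultimately have IJ: "norm (I - J) <= norm A + norm C"
  using norm_triangle_ineq[of A C] by (simp add: add.commute)
 define F where "F x = 1 + gam \<gamma> * r * sqrt x" for x
 have F: "0 <= F x" "F x <= F T" if "0 <= x" "x <= T" for x
  using gp r that by (auto simp: F_def intro!: mult_left_mono)
 have pT: "x powr \<gamma> <= T powr \<gamma>" if "0 <= x" "x <= T" for x using that \<gamma> by (intro powr_mono2) auto
 have "norm A <= N * (t - s) powr \<gamma> * t powr \<gamma> * F (t - s) * F t"
  using bd[OF _ _ _ _ _ _ A] st by (simp add: F_def)
 also have "\<dots> <= N * (t - s) powr \<gamma> * T powr \<gamma> * F (t - s) * F T"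
  using N st F pT by (intro mult_mono mult_nonneg_nonneg) auto
 finally have 1: "norm A <= N * (t - s) powr \<gamma> * T powr \<gamma> * F (t - s) * F T" .
 have "norm C <= N * s powr \<gamma> * (t - s) powr \<gamma> * F s * F (t - s)"
  using bd[OF _ _ _ _ _ _ C] st by (simp add: F_def)
 also have "\<dots> <= N * T powr \<gamma> * (t - s) powr \<gamma> * F T * F (t - s)"
  using N st F pT by (intro mult_mono mult_nonneg_nonneg) auto
 finally have 2: "norm C <= N * T powr \<gamma> * (t - s) powr \<gamma> * F T * F (t - s)" .
 show ?thesis using IJ 1 2 unfolding F_def[symmetric] by (simp add: algebra_simps)
qed

section \<open>Nonlinear Young integrals\<close>

text \<open>Polymorphic in the entries: the lists carry weighted points of space in
  \<open>regular_field\<close> and weighted paths in \<open>germ\<close>.\<close>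

definition wsum :: "(real \<times> 'a) list => ('a => 'b::real_vector) => 'b" where
 "wsum l F = (\<Sum>(c, x)\<leftarrow>l. c *\<^sub>R F x)"

lemma wsum_Nil [simp]: "wsum [] F = 0"
 and wsum_Cons [simp]: "wsum ((c, x) # l) F = c *\<^sub>R F x + wsum l F"
 and wsum_append [simp]: "wsum (l @ l') F = wsum l F + wsum l' F"
 by (simp_all add: wsum_def)

lemma wsum_neg: "wsum (map (%(c, x). (- c, x)) l) F = - wsum l F"
 by (induction l) auto

lemma wsum_diff: "wsum l (%x. F x - G x) = wsum l F - wsum l G"
 by (induction l) (auto simp: algebra_simps)

lemma wsum_add: "wsum l (%x. F x + G x) = wsum l F + wsum l G"
 by (induction l) (auto simp: algebra_simps)

text \<open>\<open>B\<close> bounds the Fourier transform of a finite combination of point masses in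
  a weighted supremum norm. First and mixed second differences of \<open>A\<close> in space
  correspond to special lists, so this one condition replaces all derivatives of the field.\<close>

definition regular_field :: "real => real => real => (real => real => real^'n::finite => real^'n) => bool" where
 "regular_field T \<gamma> M A \<longleftrightarrow> (\<forall>s1 t1 s2 t2 l B.
   0 <= s1 --> s1 <= t1 --> t1 <= T --> 0 <= s2 --> s2 <= t2 --> t2 <= T -->
   (\<forall>\<xi>. cmod (wsum l (%x. cis (x \<bullet> \<xi>))) <= B * jb \<xi> powr (1 + 1 / \<gamma>)) -->
   norm (wsum l (%x. box (s1, s2) (t1, t2) (%r1 r2. A r1 r2 x)))
    <= M * (t1 - s1) powr \<gamma> * (t2 - s2) powr \<gamma> * B)"

text \<open>The list \<open>[(1, \<theta>)]\<close> gives the summands of the Young sums,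
  \<open>[(1, \<theta>), (-1, \<eta>)]\<close> the difference of the summands of two paths;
  \<open>germ_germ2\<close> treats both.\<close>

definition germ :: "(real => real => real^'n::finite => real^'n) => (real \<times> (real => real^'n)) list
  => real => real => real => real => real^'n" where
 "germ A l s1 t1 s2 t2 = wsum l (%\<theta>. box (s1, s2) (t1, t2) (%r1 r2. A r1 r2 (\<theta> s2 - \<theta> s1)))"

text \<open>The Fourier transform of the weighted points at which a germ with corner
  \<open>(r1, r2)\<close> evaluates the field.\<close>

definition symb :: "(real \<times> (real => real^'n::finite)) list => real^'n => real => real => complex" where
 "symb l \<xi> r1 r2 = wsum l (%\<theta>. cis ((\<theta> r2 - \<theta> r1) \<bullet> \<xi>))"

lemma bracket_ge_1: "1 <= jb \<xi>"
 by (simp add: japanese_bracket_def)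

lemma norm_le_bracket: "norm \<xi> <= jb \<xi>"
 unfolding japanese_bracket_def by (rule real_le_rsqrt) simp

lemma powr_sqrt_le:
 assumes "s <= m" "m <= t" "0 <= (\<gamma>::real)"
 shows "(t - m) powr \<gamma> * sqrt (m - s) <= (t - s) powr (\<gamma> + 1/2)"
proof -
 have "(t - m) powr \<gamma> * sqrt (m - s) <= (t - s) powr \<gamma> * sqrt (t - s)"
  using assms by (intro mult_mono powr_mono2) auto
 then show ?thesis using assms by (simp add: powr_add powr_half_sqrt)
qed

text \<open>Rectangular increments are additive, so in the defect at \<open>m1\<close> only the
  field increment over \<open>[m1, t1]\<close> survives, evaluated at the points for
  \<open>s1\<close> with positive and at those for \<open>m1\<close> with negative sign. The
  transform of this combination is an increment of \<open>symb\<close>, of order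
  \<open>sqrt (m1 - s1)\<close>. The second variable and the mixed defect work alike.\<close>

lemma germ_germ2:
 fixes A :: "real => real => real^'n::finite => real^'n"
 assumes A: "regular_field T \<gamma> M A" and ST: "S <= T" and M: "0 <= M" and N: "0 <= N" and r: "0 <= r" and \<gamma>: "1/2 < \<gamma>"
  and a: "\<And>\<xi> r1 r2. 0 <= r1 ==> r1 <= S ==> 0 <= r2 ==> r2 <= S ==>
   cmod (symb l \<xi> r1 r2) <= N * jb \<xi> powr (1 + 1 / \<gamma>)"
  and b: "\<And>\<xi> r1 r1' r2. 0 <= r1 ==> r1 <= r1' ==> r1' <= S ==> 0 <= r2 ==> r2 <= S ==>
   cmod (symb l \<xi> r1 r2 - symb l \<xi> r1' r2) <= N * r * sqrt (r1' - r1) * jb \<xi> powr (1 + 1 / \<gamma>)"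
  and c: "\<And>\<xi> r1 r2 r2'. 0 <= r2 ==> r2 <= r2' ==> r2' <= S ==> 0 <= r1 ==> r1 <= S ==>
   cmod (symb l \<xi> r1 r2 - symb l \<xi> r1 r2') <= N * r * sqrt (r2' - r2) * jb \<xi> powr (1 + 1 / \<gamma>)"
  and d: "\<And>\<xi> r1 r1' r2 r2'. 0 <= r1 ==> r1 <= r1' ==> r1' <= S ==> 0 <= r2 ==> r2 <= r2' ==> r2' <= S ==>
   cmod (symb l \<xi> r1 r2 - symb l \<xi> r1' r2 - symb l \<xi> r1 r2' + symb l \<xi> r1' r2')
    <= N * r * r * sqrt (r1' - r1) * sqrt (r2' - r2) * jb \<xi> powr (1 + 1 / \<gamma>)"
 shows "germ2 S \<gamma> (M * N) r (germ A l)"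
proof -
 define pts where "pts r1 r2 = map (%(c, \<theta>). (c, \<theta> r2 - \<theta> r1)) l" for r1 r2
 define npts where "npts r1 r2 = map (%(c, x). (- c, x)) (pts r1 r2)" for r1 r2
 have pts: "wsum (pts r1 r2) F = wsum l (%\<theta>. F (\<theta> r2 - \<theta> r1))" for r1 r2 and F :: "real^'n => 'c::real_vector"
  unfolding pts_def by (induction l) auto
 have npts: "wsum (npts r1 r2) F = - wsum l (%\<theta>. F (\<theta> r2 - \<theta> r1))" for r1 r2 and F :: "real^'n => 'c::real_vector"
  unfolding npts_def wsum_neg pts ..
 have reg: "norm (wsum k (%x. box (s1, s2) (t1, t2) (%r1 r2. A r1 r2 x)))
    <= M * (t1 - s1) powr \<gamma> * (t2 - s2) powr \<gamma> * B"
  if "0 <= s1" "s1 <= t1" "t1 <= S" "0 <= s2" "s2 <= t2" "t2 <= S"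
   "\<And>\<xi>. cmod (wsum k (%x. cis (x \<bullet> \<xi>))) <= B * jb \<xi> powr (1 + 1 / \<gamma>)" for k s1 t1 s2 t2 B
  using A[unfolded regular_field_def, rule_format, of s1 t1 s2 t2 k B] that ST by auto
 show ?thesis unfolding germ2_def
 proof (intro conjI allI impI)
  fix s1 t1 s2 t2 assume *: "0 <= s1" "s1 <= t1" "t1 <= S" "0 <= s2" "s2 <= t2" "t2 <= S"
  have "norm (wsum (pts s1 s2) (%x. box (s1, s2) (t1, t2) (%r1 r2. A r1 r2 x)))
    <= M * (t1 - s1) powr \<gamma> * (t2 - s2) powr \<gamma> * N"
   using * a by (intro reg) (auto simp: pts symb_def)
  then show "norm (germ A l s1 t1 s2 t2) <= M * N * (t1 - s1) powr \<gamma> * (t2 - s2) powr \<gamma>"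
   by (simp add: pts germ_def mult_ac)
 next
  fix s1 m1 t1 s2 t2 assume *: "0 <= s1" "s1 <= m1" "m1 <= t1" "t1 <= S" "0 <= s2" "s2 <= t2" "t2 <= S"
  have "norm (wsum (pts s1 s2 @ npts m1 s2) (%x. box (m1, s2) (t1, t2) (%r1 r2. A r1 r2 x)))
    <= M * (t1 - m1) powr \<gamma> * (t2 - s2) powr \<gamma> * (N * r * sqrt (m1 - s1))"
   using * b by (intro reg) (auto simp: pts npts symb_def)
  also have "\<dots> = M * N * r * (t2 - s2) powr \<gamma> * ((t1 - m1) powr \<gamma> * sqrt (m1 - s1))" by simp
  also have "\<dots> <= M * N * r * (t2 - s2) powr \<gamma> * (t1 - s1) powr (\<gamma> + 1/2)"
   using M N r * \<gamma> by (intro mult_left_mono powr_sqrt_le) auto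
  also have "wsum (pts s1 s2 @ npts m1 s2) (%x. box (m1, s2) (t1, t2) (%r1 r2. A r1 r2 x))
    = germ A l s1 t1 s2 t2 - germ A l s1 m1 s2 t2 - germ A l m1 t1 s2 t2"
   unfolding germ_def wsum_append pts npts add_uminus_conv_diff wsum_diff[symmetric]
   by (simp add: box_def algebra_simps)
  finally show "norm (germ A l s1 t1 s2 t2 - germ A l s1 m1 s2 t2 - germ A l m1 t1 s2 t2)
    <= M * N * r * (t1 - s1) powr (\<gamma> + 1/2) * (t2 - s2) powr \<gamma>" by (simp add: mult_ac)
 next
  fix s1 t1 s2 m2 t2 assume *: "0 <= s1" "s1 <= t1" "t1 <= S" "0 <= s2" "s2 <= m2" "m2 <= t2" "t2 <= S"
  have "norm (wsum (pts s1 s2 @ npts s1 m2) (%x. box (s1, m2) (t1, t2) (%r1 r2. A r1 r2 x)))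
    <= M * (t1 - s1) powr \<gamma> * (t2 - m2) powr \<gamma> * (N * r * sqrt (m2 - s2))"
   using * c by (intro reg) (auto simp: pts npts symb_def)
  also have "\<dots> = M * N * r * (t1 - s1) powr \<gamma> * ((t2 - m2) powr \<gamma> * sqrt (m2 - s2))" by simp
  also have "\<dots> <= M * N * r * (t1 - s1) powr \<gamma> * (t2 - s2) powr (\<gamma> + 1/2)"
   using M N r * \<gamma> by (intro mult_left_mono powr_sqrt_le) auto
  also have "wsum (pts s1 s2 @ npts s1 m2) (%x. box (s1, m2) (t1, t2) (%r1 r2. A r1 r2 x))
    = germ A l s1 t1 s2 t2 - germ A l s1 t1 s2 m2 - germ A l s1 t1 m2 t2"
   unfolding germ_def wsum_append pts npts add_uminus_conv_diff wsum_diff[symmetric]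
   by (simp add: box_def algebra_simps)
  finally show "norm (germ A l s1 t1 s2 t2 - germ A l s1 t1 s2 m2 - germ A l s1 t1 m2 t2)
    <= M * N * r * (t1 - s1) powr \<gamma> * (t2 - s2) powr (\<gamma> + 1/2)" by (simp add: mult_ac)
 next
  fix s1 m1 t1 s2 m2 t2
  assume *: "0 <= s1" "s1 <= m1" "m1 <= t1" "t1 <= S" "0 <= s2" "s2 <= m2" "m2 <= t2" "t2 <= S"
  \<comment> \<open>The mixed defect lives on the upper right rectangle
    \<open>[m1, t1] x [m2, t2]\<close> and evaluates the field at four families of points with the
    signs of a rectangular increment.\<close>
  let ?k = "(pts s1 s2 @ npts m1 s2) @ (npts s1 m2 @ pts m1 m2)"
  have "norm (wsum ?k (%x. box (m1, m2) (t1, t2) (%r1 r2. A r1 r2 x)))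
    <= M * (t1 - m1) powr \<gamma> * (t2 - m2) powr \<gamma> * (N * r * r * sqrt (m1 - s1) * sqrt (m2 - s2))"
  proof (rule reg)
   fix \<xi>
   have "wsum ?k (%x. cis (x \<bullet> \<xi>)) = symb l \<xi> s1 s2 - symb l \<xi> m1 s2 - symb l \<xi> s1 m2 + symb l \<xi> m1 m2"
    by (simp add: pts npts symb_def)
   then show "cmod (wsum ?k (%x. cis (x \<bullet> \<xi>)))
     <= N * r * r * sqrt (m1 - s1) * sqrt (m2 - s2) * jb \<xi> powr (1 + 1 / \<gamma>)"
    using d[of s1 m1 s2 m2 \<xi>] * by simp
  qed (use * in auto)
  also have "\<dots> = M * N * r * r * (((t1 - m1) powr \<gamma> * sqrt (m1 - s1)) * ((t2 - m2) powr \<gamma> * sqrt (m2 - s2)))" by simp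
  also have "\<dots> <= M * N * r * r * ((t1 - s1) powr (\<gamma> + 1/2) * (t2 - s2) powr (\<gamma> + 1/2))"
   using M N r * \<gamma> by (intro mult_left_mono mult_mono powr_sqrt_le) auto
  also have "wsum ?k (%x. box (m1, m2) (t1, t2) (%r1 r2. A r1 r2 x))
    = (germ A l s1 t1 s2 t2 - germ A l s1 m1 s2 t2 - germ A l m1 t1 s2 t2)
     - (germ A l s1 t1 s2 m2 - germ A l s1 m1 s2 m2 - germ A l m1 t1 s2 m2)
     - (germ A l s1 t1 m2 t2 - germ A l s1 m1 m2 t2 - germ A l m1 t1 m2 t2)"
   by (simp add: germ_def pts npts box_def wsum_diff wsum_add)
  finally show "norm ((germ A l s1 t1 s2 t2 - germ A l s1 m1 s2 t2 - germ A l m1 t1 s2 t2)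
     - (germ A l s1 t1 s2 m2 - germ A l s1 m1 s2 m2 - germ A l m1 t1 s2 m2)
     - (germ A l s1 t1 m2 t2 - germ A l s1 m1 m2 t2 - germ A l m1 t1 m2 t2))
    <= M * N * r * r * (t1 - s1) powr (\<gamma> + 1/2) * (t2 - s2) powr (\<gamma> + 1/2)" by (simp add: mult_ac)
 qed
qed

section \<open>Characters along Hoelder paths\<close>

text \<open>One number encodes constant and scale: over a lag up to \<open>\<tau>\<close> the path
  moves by at most 1. Longer lags are unrestricted, since for them characters are compared by the
  trivial bound 2. For \<open>\<gamma> > 0\<close> the condition gets weaker as
  \<open>\<tau>\<close> decreases.\<close>

definition hol :: "real => real => real => (real => real^'n::finite) => bool" where
 "hol \<tau> \<gamma> T \<theta> \<longleftrightarrow> (\<forall>s t. 0 <= s --> s <= t --> t <= T --> t - s <= \<tau> -->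
   norm (\<theta> t - \<theta> s) <= \<tau> powr (- \<gamma>) * (t - s) powr \<gamma>)"

lemma cmod_cis_diff: "cmod (cis a - cis b) <= \<bar>a - b\<bar>"
proof -
 have "cis a - cis b = cis b * (cis (a - b) - 1)" by (simp add: algebra_simps cis_mult)
 then have "cmod (cis a - cis b) = cmod (cis (a - b) - 1)" by (simp add: norm_mult)
 also have "\<dots> <= \<bar>a - b\<bar>" using iexp_approx1[of "a - b" 0] by (simp add: cis_conv_exp)
 finally show ?thesis .
qed

lemma cmod_cis_diff2: "cmod (cis a - cis b) <= 2"
 using norm_triangle_ineq4[of "cis a" "cis b"] by simp

text \<open>The difference is at most 2 and at most the Lipschitz bound \<open>u\<close>, hence at
  most \<open>2 * u powr \<alpha>\<close> for \<open>\<alpha>\<close> between 0 and 1. The choice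
  \<open>\<alpha> = 1 / (2 * \<gamma>)\<close> turns the exponent \<open>\<gamma>\<close> into
  \<open>1/2\<close> in time. For lags beyond \<open>\<tau>\<close> the right side is at least 2
  anyway.\<close>

lemma cis_hol:
 assumes \<theta>: "hol \<tau> \<gamma> T \<theta>" and \<tau>: "0 < \<tau>" and \<gamma>: "1/2 < \<gamma>" and st: "0 <= s" "s <= t" "t <= T"
 shows "cmod (cis (\<theta> t \<bullet> \<xi>) - cis (\<theta> s \<bullet> \<xi>))
  <= 2 * (1 / sqrt \<tau>) * jb \<xi> powr (1 / (2 * \<gamma>)) * sqrt (t - s)"
proof -
 define J where "J = jb \<xi>"
 define \<alpha> where "\<alpha> = 1 / (2 * \<gamma>)"
 have J: "1 <= J" "norm \<xi> <= J" by (simp_all add: J_def bracket_ge_1 norm_le_bracket)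
 have \<alpha>: "0 < \<alpha>" "\<alpha> < 1" "\<gamma> * \<alpha> = 1/2" using \<gamma> by (auto simp: \<alpha>_def)
 have J\<alpha>: "1 <= J powr \<alpha>" using J \<alpha> ge_one_powr_ge_zero by simp
 have key: "cmod (cis (\<theta> t \<bullet> \<xi>) - cis (\<theta> s \<bullet> \<xi>)) <= 2 * sqrt ((t - s) / \<tau>) * J powr \<alpha>"
 proof (cases "t - s <= \<tau>")
  case False
  then have "1 <= sqrt ((t - s) / \<tau>)" using \<tau> by simp
  then have "1 * 1 <= sqrt ((t - s) / \<tau>) * J powr \<alpha>" using J\<alpha> by (intro mult_mono) auto
  then show ?thesis using cmod_cis_diff2[of "\<theta> t \<bullet> \<xi>" "\<theta> s \<bullet> \<xi>"] by simp
 next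
  case True
  define u where "u = ((t - s) / \<tau>) powr \<gamma> * J"
  have u0: "0 <= u" using J by (simp add: u_def)
  have "cmod (cis (\<theta> t \<bullet> \<xi>) - cis (\<theta> s \<bullet> \<xi>)) <= \<bar>(\<theta> t - \<theta> s) \<bullet> \<xi>\<bar>"
   using cmod_cis_diff[of "\<theta> t \<bullet> \<xi>" "\<theta> s \<bullet> \<xi>"] by (simp add: inner_diff_left)
  also have "\<dots> <= norm (\<theta> t - \<theta> s) * norm \<xi>" by (rule Cauchy_Schwarz_ineq2)
  also have "\<dots> <= (\<tau> powr (- \<gamma>) * (t - s) powr \<gamma>) * J"
   using \<theta> st True J unfolding hol_def by (intro mult_mono) auto
  also have "\<dots> = u" using st \<tau> by (simp add: u_def powr_divide powr_minus field_simps)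
  finally have 1: "cmod (cis (\<theta> t \<bullet> \<xi>) - cis (\<theta> s \<bullet> \<xi>)) <= u" .
  have "cmod (cis (\<theta> t \<bullet> \<xi>) - cis (\<theta> s \<bullet> \<xi>)) <= 2 * u powr \<alpha>"
  proof (cases "u <= 1")
   case True
   have "u = u powr 1" using u0 by simp
   also have "\<dots> <= u powr \<alpha>" using True u0 \<alpha> by (intro powr_mono') auto
   finally show ?thesis using 1 powr_ge_zero[of u \<alpha>] by linarith
  next
   case False
   then have "1 <= u powr \<alpha>" using \<alpha> ge_one_powr_ge_zero[of u \<alpha>] by simp
   then show ?thesis using cmod_cis_diff2[of "\<theta> t \<bullet> \<xi>" "\<theta> s \<bullet> \<xi>"] by linarith
  qed
  also have "u powr \<alpha> = ((t - s) / \<tau>) powr (\<gamma> * \<alpha>) * J powr \<alpha>"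
   unfolding u_def using st \<tau> J by (simp add: powr_mult powr_powr)
  also have "((t - s) / \<tau>) powr (\<gamma> * \<alpha>) = sqrt ((t - s) / \<tau>)"
   unfolding \<alpha>(3) using st \<tau> by (simp add: powr_half_sqrt)
  finally show ?thesis by simp
 qed
 then show ?thesis unfolding J_def \<alpha>_def by (simp add: real_sqrt_divide mult_ac)
qed

text \<open>With separated variables every increment factors, and the mixed one is the product of
  the two single increments.\<close>

lemma prod_incr:
 fixes p q :: "real => complex"
 assumes "\<forall>t. 0 <= t --> t <= S --> cmod (p t) <= P"
  and "\<forall>s t. 0 <= s --> s <= t --> t <= S --> cmod (p t - p s) <= P' * sqrt (t - s)"
  and "\<forall>t. 0 <= t --> t <= S --> cmod (q t) <= Q"
  and "\<forall>s t. 0 <= s --> s <= t --> t <= S --> cmod (q t - q s) <= Q' * sqrt (t - s)"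
 shows "0 <= r1 ==> r1 <= S ==> 0 <= r2 ==> r2 <= S ==> cmod (p r2 * q r1) <= P * Q"
  and "0 <= r1 ==> r1 <= r1' ==> r1' <= S ==> 0 <= r2 ==> r2 <= S ==>
   cmod (p r2 * q r1 - p r2 * q r1') <= P * Q' * sqrt (r1' - r1)"
  and "0 <= r2 ==> r2 <= r2' ==> r2' <= S ==> 0 <= r1 ==> r1 <= S ==>
   cmod (p r2 * q r1 - p r2' * q r1) <= P' * Q * sqrt (r2' - r2)"
  and "0 <= r1 ==> r1 <= r1' ==> r1' <= S ==> 0 <= r2 ==> r2 <= r2' ==> r2' <= S ==>
   cmod (p r2 * q r1 - p r2 * q r1' - p r2' * q r1 + p r2' * q r1') <= P' * Q' * sqrt (r1' - r1) * sqrt (r2' - r2)"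
proof -
 note p = assms(1)[rule_format] and p' = assms(2)[rule_format]
  and q = assms(3)[rule_format] and q' = assms(4)[rule_format]
 show "cmod (p r2 * q r1) <= P * Q" if "0 <= r1" "r1 <= S" "0 <= r2" "r2 <= S"
  unfolding norm_mult using that p[of r2] q[of r1] order_trans[OF norm_ge_zero p[of r2]] by (intro mult_mono) auto
 show "cmod (p r2 * q r1 - p r2 * q r1') <= P * Q' * sqrt (r1' - r1)"
  if "0 <= r1" "r1 <= r1'" "r1' <= S" "0 <= r2" "r2 <= S"
 proof -
  have "cmod (p r2 * q r1 - p r2 * q r1') = cmod (p r2) * cmod (q r1' - q r1)"
   by (metis norm_mult norm_minus_commute right_diff_distrib)
  also have "\<dots> <= P * (Q' * sqrt (r1' - r1))"
   using that p[of r2] q'[of r1 r1'] order_trans[OF norm_ge_zero p[of r2]] by (intro mult_mono) auto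
  finally show ?thesis by simp
 qed
 show "cmod (p r2 * q r1 - p r2' * q r1) <= P' * Q * sqrt (r2' - r2)"
  if "0 <= r2" "r2 <= r2'" "r2' <= S" "0 <= r1" "r1 <= S"
 proof -
  have "cmod (p r2 * q r1 - p r2' * q r1) = cmod (p r2' - p r2) * cmod (q r1)"
   by (metis norm_mult norm_minus_commute left_diff_distrib)
  also have "\<dots> <= (P' * sqrt (r2' - r2)) * Q"
   using that q[of r1] p'[of r2 r2'] order_trans[OF norm_ge_zero p'[of r2 r2']] by (intro mult_mono) auto
  finally show ?thesis by (simp add: mult_ac)
 qed
 show "cmod (p r2 * q r1 - p r2 * q r1' - p r2' * q r1 + p r2' * q r1') <= P' * Q' * sqrt (r1' - r1) * sqrt (r2' - r2)"
  if "0 <= r1" "r1 <= r1'" "r1' <= S" "0 <= r2" "r2 <= r2'" "r2' <= S"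
 proof -
  have "p r2 * q r1 - p r2 * q r1' - p r2' * q r1 + p r2' * q r1' = (p r2' - p r2) * (q r1' - q r1)"
   by (simp add: algebra_simps)
  then have "cmod (p r2 * q r1 - p r2 * q r1' - p r2' * q r1 + p r2' * q r1') = cmod (p r2' - p r2) * cmod (q r1' - q r1)"
   by (simp add: norm_mult)
  also have "\<dots> <= (P' * sqrt (r2' - r2)) * (Q' * sqrt (r1' - r1))"
   using that p'[of r2 r2'] q'[of r1 r1'] order_trans[OF norm_ge_zero p'[of r2 r2']] by (intro mult_mono) auto
  finally show ?thesis by (simp add: mult_ac)
 qed
qed

lemma bracket_powr_mono: "x <= y ==> jb \<xi> powr x <= jb \<xi> powr y"
 using bracket_ge_1[of \<xi>] by (intro powr_mono) auto

lemma cis_neg_diff: "cmod (cis (- a) - cis (- b)) = cmod (cis a - cis b)"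
 by (metis cis_cnj complex_cnj_diff complex_mod_cnj)

text \<open>The character of \<open>\<theta> r2 - \<theta> r1\<close> splits into a factor in
  \<open>r2\<close> and one in \<open>r1\<close>, each with the constant 2 of \<open>cis_hol\<close>
  in its increments; the mixed increment accounts for \<open>4 = 2 * 2\<close>. Only the power
  \<open>1 / \<gamma>\<close> of the bracket is spent here.\<close>

lemma germ2_single:
 fixes A :: "real => real => real^'n::finite => real^'n"
 assumes A: "regular_field T \<gamma> M A" and M: "0 <= M" and \<gamma>: "1/2 < \<gamma>" and \<tau>: "0 < \<tau>"
  and \<theta>: "hol \<tau> \<gamma> T \<theta>"
 shows "germ2 T \<gamma> (M * 4) (1 / sqrt \<tau>) (germ A [(1, \<theta>)])"
proof (rule germ_germ2[OF A order_refl M])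
 define r where "r = 1 / sqrt \<tau>"
 have r: "0 < r" using \<tau> by (simp add: r_def)
 have s: "symb [(1, \<theta>)] \<xi> r1 r2 = cis (\<theta> r2 \<bullet> \<xi>) * cis (- (\<theta> r1 \<bullet> \<xi>))" for \<xi> r1 r2
  by (simp add: symb_def cis_mult inner_diff_left)
 define J where "J \<xi> = jb \<xi> powr (1 / (2 * \<gamma>))" for \<xi> :: "real^'n"
 have J1: "1 <= J \<xi>" for \<xi> using bracket_ge_1[of \<xi>] \<gamma> ge_one_powr_ge_zero by (auto simp: J_def)
 have pw: "1/(2*\<gamma>) + 1/(2*\<gamma>) <= 1 + 1/\<gamma>" "1/(2*\<gamma>) <= 1 + 1/\<gamma>" using \<gamma> by (auto simp: field_simps)
 have JJ: "J \<xi> * J \<xi> <= jb \<xi> powr (1 + 1 / \<gamma>)" for \<xi>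
  unfolding J_def powr_add[symmetric] using pw by (intro bracket_powr_mono)
 have JJ1: "J \<xi> <= jb \<xi> powr (1 + 1 / \<gamma>)" for \<xi>
  unfolding J_def using pw by (intro bracket_powr_mono)
 have JJ0: "1 <= jb \<xi> powr (1 + 1 / \<gamma>)" for \<xi> :: "real^'n" using J1 JJ1 order_trans by blast
 note pi = prod_incr[where S = T and p = "%t. cis (\<theta> t \<bullet> \<xi>)" and q = "%t. cis (- (\<theta> t \<bullet> \<xi>))"
   and P = 1 and Q = 1 and P' = "2 * r * J \<xi>" and Q' = "2 * r * J \<xi>" for \<xi>, folded s]
 have h: "cmod (cis (\<theta> t \<bullet> \<xi>) - cis (\<theta> s \<bullet> \<xi>)) <= 2 * r * J \<xi> * sqrt (t - s)"
   if "0 <= s" "s <= t" "t <= T" for s t \<xi>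
  unfolding r_def J_def by (rule cis_hol[OF \<theta> \<tau> \<gamma> that])
 note h' = h[unfolded cis_neg_diff[symmetric, of "\<theta> _ \<bullet> _"]]
 show "cmod (symb [(1, \<theta>)] \<xi> r1 r2) <= 4 * jb \<xi> powr (1 + 1 / \<gamma>)" for \<xi> r1 r2
  using JJ0[of \<xi>] by (simp add: s norm_mult)
 have w: "2 * r * J \<xi> * sqrt x <= 4 * (1 / sqrt \<tau>) * sqrt x * jb \<xi> powr (1 + 1 / \<gamma>)" if "0 <= x" for x \<xi>
 proof -
  have "2 * r * sqrt x * J \<xi> <= 4 * r * sqrt x * jb \<xi> powr (1 + 1 / \<gamma>)"
   using r JJ1[of \<xi>] J1[of \<xi>] that by (intro mult_mono) auto
  then show ?thesis unfolding r_def by (simp add: mult_ac)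
 qed
 show "cmod (symb [(1, \<theta>)] \<xi> r1 r2 - symb [(1, \<theta>)] \<xi> r1' r2)
   <= 4 * (1 / sqrt \<tau>) * sqrt (r1' - r1) * jb \<xi> powr (1 + 1 / \<gamma>)"
   if "0 <= r1" "r1 <= r1'" "r1' <= T" "0 <= r2" "r2 <= T" for \<xi> r1 r1' r2
 proof -
  have "cmod (symb [(1, \<theta>)] \<xi> r1 r2 - symb [(1, \<theta>)] \<xi> r1' r2) <= 1 * (2 * r * J \<xi>) * sqrt (r1' - r1)"
   by (rule pi(2)) (use that h h' in auto)
  then show ?thesis using w[of "r1' - r1" \<xi>] that by simp
 qed
 show "cmod (symb [(1, \<theta>)] \<xi> r1 r2 - symb [(1, \<theta>)] \<xi> r1 r2')
   <= 4 * (1 / sqrt \<tau>) * sqrt (r2' - r2) * jb \<xi> powr (1 + 1 / \<gamma>)"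
   if "0 <= r2" "r2 <= r2'" "r2' <= T" "0 <= r1" "r1 <= T" for \<xi> r1 r2' r2
 proof -
  have "cmod (symb [(1, \<theta>)] \<xi> r1 r2 - symb [(1, \<theta>)] \<xi> r1 r2') <= (2 * r * J \<xi>) * 1 * sqrt (r2' - r2)"
   by (rule pi(3)) (use that h h' in auto)
  then show ?thesis using w[of "r2' - r2" \<xi>] that by simp
 qed
 show "cmod (symb [(1, \<theta>)] \<xi> r1 r2 - symb [(1, \<theta>)] \<xi> r1' r2 - symb [(1, \<theta>)] \<xi> r1 r2' + symb [(1, \<theta>)] \<xi> r1' r2')
   <= 4 * (1 / sqrt \<tau>) * (1 / sqrt \<tau>) * sqrt (r1' - r1) * sqrt (r2' - r2) * jb \<xi> powr (1 + 1 / \<gamma>)"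
   if *: "0 <= r1" "r1 <= r1'" "r1' <= T" "0 <= r2" "r2 <= r2'" "r2' <= T" for \<xi> r1 r1' r2 r2'
 proof -
  have "cmod (symb [(1, \<theta>)] \<xi> r1 r2 - symb [(1, \<theta>)] \<xi> r1' r2 - symb [(1, \<theta>)] \<xi> r1 r2' + symb [(1, \<theta>)] \<xi> r1' r2')
   <= (2 * r * J \<xi>) * (2 * r * J \<xi>) * sqrt (r1' - r1) * sqrt (r2' - r2)"
   by (rule pi(4)) (use * h h' in auto)
  also have "\<dots> = 4 * r * r * sqrt (r1' - r1) * sqrt (r2' - r2) * (J \<xi> * J \<xi>)" by simp
  also have "\<dots> <= 4 * r * r * sqrt (r1' - r1) * sqrt (r2' - r2) * jb \<xi> powr (1 + 1 / \<gamma>)"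
   using r * JJ by (intro mult_left_mono) auto
  finally show ?thesis by (simp add: r_def)
 qed
qed (use \<tau> \<gamma> in auto)

text \<open>The difference of the two products is written as \<open>g + k\<close>, exchanging one
  factor at a time. The exchanged factor \<open>f\<close> is of size \<open>d\<close> times the
  bracket, which spends the remaining power 1. Bounds on the difference are asked on
  \<open>[0, S]\<close> only, so that the estimate can be used step by step in time.\<close>

lemma germ2_pair:
 fixes A :: "real => real => real^'n::finite => real^'n"
 assumes A: "regular_field T \<gamma> M A" and M: "0 <= M" and \<gamma>: "1/2 < \<gamma>" and \<tau>: "0 < \<tau>" and S: "S <= T"
  and \<theta>: "hol \<tau> \<gamma> T \<theta>" and \<eta>: "hol \<tau> \<gamma> T \<eta>"
  and L: "0 <= L" "\<And>s t. 0 <= s ==> s <= t ==> t <= S ==> norm ((\<theta> t - \<eta> t) - (\<theta> s - \<eta> s)) <= L * sqrt (t - s)"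
  and d: "0 <= d" "\<And>t. 0 <= t ==> t <= S ==> norm (\<theta> t - \<eta> t) <= d"
 shows "germ2 S \<gamma> (M * (8 * (L * sqrt \<tau> + d))) (1 / sqrt \<tau>) (germ A [(1, \<theta>), (-1, \<eta>)])"
proof (rule germ_germ2[OF A S M])
 define r where "r = 1 / sqrt \<tau>"
 have r: "0 < r" using \<tau> by (simp add: r_def)
 define N where "N = 8 * (L * sqrt \<tau> + d)"
 have Nr: "N * r = 8 * (L + d * r)" using \<tau> by (simp add: N_def r_def field_simps)
 let ?l = "[(1, \<theta>), (-1, \<eta>)]"
 define f where "f \<xi> t = cis (\<theta> t \<bullet> \<xi>) - cis (\<eta> t \<bullet> \<xi>)" for \<xi> t
 define f' where "f' \<xi> t = cis (- (\<theta> t \<bullet> \<xi>)) - cis (- (\<eta> t \<bullet> \<xi>))" for \<xi> t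
 have f': "f' \<xi> t = cnj (f \<xi> t)" for \<xi> t by (simp add: f_def f'_def cis_cnj)
 define g where "g \<xi> r1 r2 = f \<xi> r2 * cis (- (\<theta> r1 \<bullet> \<xi>))" for \<xi> r1 r2
 define k where "k \<xi> r1 r2 = cis (\<eta> r2 \<bullet> \<xi>) * f' \<xi> r1" for \<xi> r1 r2
 have s: "symb ?l \<xi> r1 r2 = g \<xi> r1 r2 + k \<xi> r1 r2" for \<xi> r1 r2
  by (simp add: symb_def g_def k_def f_def f'_def cis_mult inner_diff_left algebra_simps)
 define Z where "Z \<xi> = jb \<xi>" for \<xi> :: "real^'n"
 define J where "J \<xi> = jb \<xi> powr (1 / (2 * \<gamma>))" for \<xi> :: "real^'n"
 define W where "W \<xi> = jb \<xi> powr (1 + 1 / \<gamma>)" for \<xi> :: "real^'n"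
 have J1: "1 <= J \<xi>" for \<xi> using bracket_ge_1[of \<xi>] \<gamma> ge_one_powr_ge_zero by (auto simp: J_def)
 have Z1: "1 <= Z \<xi>" "norm \<xi> <= Z \<xi>" for \<xi> by (simp_all add: Z_def bracket_ge_1 norm_le_bracket)
 \<comment> \<open>The mixed increment uses the whole exponent: one factor for the difference of the
   paths and a power \<open>1 / (2 * \<gamma>)\<close> for each of the two increments.\<close>
 have WJ: "W \<xi> = Z \<xi> * J \<xi> * J \<xi>" for \<xi>
  unfolding W_def Z_def J_def using \<gamma> bracket_ge_1[of \<xi>]
  by (simp add: powr_add powr_one mult.assoc flip: powr_add)
    (simp add: powr_add powr_one)
 have W1: "Z \<xi> * J \<xi> <= W \<xi>" "Z \<xi> <= W \<xi>" for \<xi>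
  using J1[of \<xi>] Z1[of \<xi>] mult_left_mono[of 1 "J \<xi>" "Z \<xi> * J \<xi>"] mult_left_mono[of 1 "J \<xi>" "Z \<xi>"]
   mult_mono[of 1 "J \<xi>" 1 "J \<xi>"]
  by (auto simp: WJ)
 have W0: "0 <= W \<xi>" for \<xi> by (simp add: W_def)
 have h: "cmod (cis (\<zeta> t \<bullet> \<xi>) - cis (\<zeta> s \<bullet> \<xi>)) <= 2 * r * J \<xi> * sqrt (t - s)"
   if "0 <= s" "s <= t" "t <= S" "hol \<tau> \<gamma> T \<zeta>" for s t \<xi> \<zeta>
  unfolding r_def J_def by (rule cis_hol[where T = T]) (use that \<tau> \<gamma> S in auto)
 have F0: "cmod (f \<xi> t) <= d * Z \<xi>" if "0 <= t" "t <= S" for \<xi> t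
 proof -
  have "cmod (f \<xi> t) <= \<bar>(\<theta> t - \<eta> t) \<bullet> \<xi>\<bar>"
   using cmod_cis_diff[of "\<theta> t \<bullet> \<xi>" "\<eta> t \<bullet> \<xi>"] by (simp add: f_def inner_diff_left)
  also have "\<dots> <= norm (\<theta> t - \<eta> t) * norm \<xi>" by (rule Cauchy_Schwarz_ineq2)
  also have "\<dots> <= d * Z \<xi>" using that d Z1 by (intro mult_mono) auto
  finally show ?thesis .
 qed
 \<comment> \<open>Factoring out the character of \<open>\<eta>\<close> leaves that of
   \<open>\<theta> - \<eta>\<close> minus 1. The product rule then yields the two summands:
   \<open>2 * r * d\<close> from the increment of the former, \<open>L\<close> from that of the
   latter.\<close>
 have F1: "cmod (f \<xi> t - f \<xi> s) <= ((L + 2 * r * d) * (Z \<xi> * J \<xi>)) * sqrt (t - s)"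
  if "0 <= s" "s <= t" "t <= S" for \<xi> s t
 proof -
  let ?D = "%t. (\<theta> t - \<eta> t) \<bullet> \<xi>"
  have ff: "f \<xi> t = cis (\<eta> t \<bullet> \<xi>) * (cis (?D t) - 1)" for t
   by (simp add: f_def algebra_simps cis_mult inner_diff_left)
  have "f \<xi> t - f \<xi> s = (cis (\<eta> t \<bullet> \<xi>) - cis (\<eta> s \<bullet> \<xi>)) * (cis (?D t) - 1)
    + cis (\<eta> s \<bullet> \<xi>) * (cis (?D t) - cis (?D s))" unfolding ff by (simp add: algebra_simps)
  then have "cmod (f \<xi> t - f \<xi> s) <= cmod (cis (\<eta> t \<bullet> \<xi>) - cis (\<eta> s \<bullet> \<xi>)) * cmod (cis (?D t) - 1)
    + cmod (cis (?D t) - cis (?D s))"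
   by (metis (no_types, lifting) norm_triangle_ineq norm_mult norm_cis mult_1)
  also have "cmod (cis (?D t) - 1) = cmod (f \<xi> t)" by (simp add: ff norm_mult)
  also have "cmod (cis (\<eta> t \<bullet> \<xi>) - cis (\<eta> s \<bullet> \<xi>)) * cmod (f \<xi> t) <= (2 * r * J \<xi> * sqrt (t - s)) * (d * Z \<xi>)"
   using that h[OF that \<eta>, of \<xi>] F0[of t \<xi>] r J1[of \<xi>] by (intro mult_mono) auto
  also have "cmod (cis (?D t) - cis (?D s)) <= \<bar>((\<theta> t - \<eta> t) - (\<theta> s - \<eta> s)) \<bullet> \<xi>\<bar>"
   using cmod_cis_diff[of "?D t" "?D s"] by (simp add: inner_diff_left)
  also have "\<dots> <= norm ((\<theta> t - \<eta> t) - (\<theta> s - \<eta> s)) * norm \<xi>" by (rule Cauchy_Schwarz_ineq2)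
  also have "\<dots> <= (L * sqrt (t - s)) * (Z \<xi> * J \<xi>)"
  proof (intro mult_mono)
   show "norm \<xi> <= Z \<xi> * J \<xi>"
    using mult_mono[of "norm \<xi>" "Z \<xi>" 1 "J \<xi>"] Z1[of \<xi>] J1[of \<xi>] by simp
  qed (use that L in auto)
  finally show ?thesis by (simp add: algebra_simps)
 qed
 have F0': "cmod (f' \<xi> t) <= d * Z \<xi>" if "0 <= t" "t <= S" for \<xi> t using F0[OF that] by (simp add: f')
 have F1': "cmod (f' \<xi> t - f' \<xi> s) <= ((L + 2 * r * d) * (Z \<xi> * J \<xi>)) * sqrt (t - s)"
  if "0 <= s" "s <= t" "t <= S" for \<xi> s t using F1[OF that, of \<xi>] unfolding f' by (metis complex_cnj_diff complex_mod_cnj)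
 have n1: "cmod (cis x) <= 1" for x by simp
 have hn: "cmod (cis (- (\<theta> t \<bullet> \<xi>)) - cis (- (\<theta> s \<bullet> \<xi>))) <= 2 * r * J \<xi> * sqrt (t - s)"
  if "0 <= s" "s <= t" "t <= S" for s t \<xi> using h[OF that \<theta>, of \<xi>] by (simp only: cis_neg_diff)
 have o0: "\<forall>t. 0 <= t --> t <= S --> cmod (f \<xi> t) <= d * Z \<xi>"
  and o0': "\<forall>t. 0 <= t --> t <= S --> cmod (f' \<xi> t) <= d * Z \<xi>"
  and o1: "\<forall>s t. 0 <= s --> s <= t --> t <= S -->
   cmod (f \<xi> t - f \<xi> s) <= ((L + 2 * r * d) * (Z \<xi> * J \<xi>)) * sqrt (t - s)"
  and o1': "\<forall>s t. 0 <= s --> s <= t --> t <= S -->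
   cmod (f' \<xi> t - f' \<xi> s) <= ((L + 2 * r * d) * (Z \<xi> * J \<xi>)) * sqrt (t - s)"
  and oh: "\<forall>s t. 0 <= s --> s <= t --> t <= S -->
   cmod (cis (- (\<theta> t \<bullet> \<xi>)) - cis (- (\<theta> s \<bullet> \<xi>))) <= 2 * r * J \<xi> * sqrt (t - s)"
  and oh': "\<forall>s t. 0 <= s --> s <= t --> t <= S -->
   cmod (cis (\<eta> t \<bullet> \<xi>) - cis (\<eta> s \<bullet> \<xi>)) <= 2 * r * J \<xi> * sqrt (t - s)" for \<xi>
  using F0 F0' F1 F1' hn h \<eta> by simp_all
 have on: "\<forall>t. 0 <= t --> t <= S --> cmod (cis (u t)) <= 1" for u by simp
 note G = prod_incr[where S = S and p = "f \<xi>" and q = "%t. cis (- (\<theta> t \<bullet> \<xi>))" for \<xi>, OF o0 o1 on oh, folded g_def]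
 note K = prod_incr[where S = S and p = "%t. cis (\<eta> t \<bullet> \<xi>)" and q = "f' \<xi>" for \<xi>, OF on oh' o0' o1', folded k_def]
 show "cmod (symb ?l \<xi> r1 r2) <= 8 * (L * sqrt \<tau> + d) * jb \<xi> powr (1 + 1 / \<gamma>)"
  if "0 <= r1" "r1 <= S" "0 <= r2" "r2 <= S" for \<xi> r1 r2
 proof -
  have "cmod (symb ?l \<xi> r1 r2) <= d * Z \<xi> * 1 + 1 * (d * Z \<xi>)"
   unfolding s by (rule norm_triangle_mono[OF G(1)[OF that] K(1)[OF that]])
  also have "\<dots> = (2 * d) * Z \<xi>" by simp
  also have "\<dots> <= N * W \<xi>" using d L W1 Z1[of \<xi>] \<tau> by (intro mult_mono) (auto simp: N_def)
  finally show ?thesis by (simp add: N_def W_def)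
 qed
 have w: "d * Z \<xi> * (2 * r * J \<xi>) * sqrt x + 1 * ((L + 2 * r * d) * (Z \<xi> * J \<xi>)) * sqrt x <=
   8 * (L * sqrt \<tau> + d) * (1 / sqrt \<tau>) * sqrt x * jb \<xi> powr (1 + 1 / \<gamma>)" if "0 <= x" for x \<xi>
 proof -
  have "d * Z \<xi> * (2 * r * J \<xi>) * sqrt x + 1 * ((L + 2 * r * d) * (Z \<xi> * J \<xi>)) * sqrt x
    = (L + 4 * (d * r)) * sqrt x * (Z \<xi> * J \<xi>)" by (simp add: algebra_simps)
  also have "\<dots> <= (N * r) * sqrt x * W \<xi>"
   unfolding Nr using L d r that W1[of \<xi>] Z1[of \<xi>] J1[of \<xi>] by (intro mult_mono) auto
  finally show ?thesis by (simp add: N_def r_def W_def)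
 qed
 show "cmod (symb ?l \<xi> r1 r2 - symb ?l \<xi> r1' r2)
   <= 8 * (L * sqrt \<tau> + d) * (1 / sqrt \<tau>) * sqrt (r1' - r1) * jb \<xi> powr (1 + 1 / \<gamma>)"
   if "0 <= r1" "r1 <= r1'" "r1' <= S" "0 <= r2" "r2 <= S" for \<xi> r1 r1' r2
 proof -
  have "symb ?l \<xi> r1 r2 - symb ?l \<xi> r1' r2 = (g \<xi> r1 r2 - g \<xi> r1' r2) + (k \<xi> r1 r2 - k \<xi> r1' r2)" by (simp add: s)
  then show ?thesis
   using order_trans[OF norm_triangle_mono[OF G(2)[OF that, of \<xi>] K(2)[OF that, of \<xi>]] w[of "r1' - r1" \<xi>]] that by simp
 qed
 show "cmod (symb ?l \<xi> r1 r2 - symb ?l \<xi> r1 r2')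
   <= 8 * (L * sqrt \<tau> + d) * (1 / sqrt \<tau>) * sqrt (r2' - r2) * jb \<xi> powr (1 + 1 / \<gamma>)"
   if "0 <= r2" "r2 <= r2'" "r2' <= S" "0 <= r1" "r1 <= S" for \<xi> r1 r2 r2'
 proof -
  have "symb ?l \<xi> r1 r2 - symb ?l \<xi> r1 r2' = (k \<xi> r1 r2 - k \<xi> r1 r2') + (g \<xi> r1 r2 - g \<xi> r1 r2')" by (simp add: s)
  then have "cmod (symb ?l \<xi> r1 r2 - symb ?l \<xi> r1 r2') <= 2 * r * J \<xi> * (d * Z \<xi>) * sqrt (r2' - r2)
    + (L + 2 * r * d) * (Z \<xi> * J \<xi>) * 1 * sqrt (r2' - r2)"
   using norm_triangle_mono[OF K(3)[OF that, of \<xi>] G(3)[OF that, of \<xi>]] by simp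
  also have "\<dots> = d * Z \<xi> * (2 * r * J \<xi>) * sqrt (r2' - r2) + 1 * ((L + 2 * r * d) * (Z \<xi> * J \<xi>)) * sqrt (r2' - r2)" by simp
  also note w
  finally show ?thesis using that by simp
 qed
 show "cmod (symb ?l \<xi> r1 r2 - symb ?l \<xi> r1' r2 - symb ?l \<xi> r1 r2' + symb ?l \<xi> r1' r2')
   <= 8 * (L * sqrt \<tau> + d) * (1 / sqrt \<tau>) * (1 / sqrt \<tau>) * sqrt (r1' - r1) * sqrt (r2' - r2) * jb \<xi> powr (1 + 1 / \<gamma>)"
   if *: "0 <= r1" "r1 <= r1'" "r1' <= S" "0 <= r2" "r2 <= r2'" "r2' <= S" for \<xi> r1 r1' r2 r2'
 proof -
  have "symb ?l \<xi> r1 r2 - symb ?l \<xi> r1' r2 - symb ?l \<xi> r1 r2' + symb ?l \<xi> r1' r2' =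
   (g \<xi> r1 r2 - g \<xi> r1' r2 - g \<xi> r1 r2' + g \<xi> r1' r2') + (k \<xi> r1 r2 - k \<xi> r1' r2 - k \<xi> r1 r2' + k \<xi> r1' r2')" by (simp add: s)
  then have "cmod (symb ?l \<xi> r1 r2 - symb ?l \<xi> r1' r2 - symb ?l \<xi> r1 r2' + symb ?l \<xi> r1' r2')
    <= (L + 2 * r * d) * (Z \<xi> * J \<xi>) * (2 * r * J \<xi>) * sqrt (r1' - r1) * sqrt (r2' - r2)
    + (2 * r * J \<xi>) * ((L + 2 * r * d) * (Z \<xi> * J \<xi>)) * sqrt (r1' - r1) * sqrt (r2' - r2)"
   using norm_triangle_mono[OF G(4)[OF that, of \<xi>] K(4)[OF that, of \<xi>]] by simp
  also have "\<dots> = (4 * L + 8 * (d * r)) * r * sqrt (r1' - r1) * sqrt (r2' - r2) * W \<xi>"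
   by (simp add: WJ algebra_simps)
  also have "\<dots> <= (N * r) * r * sqrt (r1' - r1) * sqrt (r2' - r2) * W \<xi>"
   unfolding Nr using L d r * W0 by (intro mult_right_mono) auto
  finally show ?thesis by (simp add: r_def N_def W_def)
 qed
qed (use \<tau> \<gamma> L d in auto)

lemma has_int_0: "has_int X 0 0 0 0 I \<longleftrightarrow> I = 0"
proof -
 have "psum2 X P Q = 0" if "chain 0 0 P" "chain 0 0 Q" for P Q
  using that by (simp add: chain_refl_iff psum2_def)
 then have "has_int X 0 0 0 0 0"
  unfolding has_int_def by (metis diff_self norm_zero zero_less_one)
 then show ?thesis using has_int_unique[of X 0 0 0 0 I 0] by auto
qed

section \<open>Increments of integrals and a Gronwall estimate\<close>

definition solves :: "real => (real => real => real^'n::finite => real^'n) => real^'n => (real => real^'n) => bool" where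
 "solves T A u0 \<theta> \<longleftrightarrow> (\<forall>t\<in>{0..T}. has_int (germ A [(1, \<theta>)]) 0 t 0 t (\<theta> t - u0))"

lemma solves_0: "solves T A u0 \<theta> ==> 0 <= T ==> \<theta> 0 = u0"
 unfolding solves_def by (metis has_int_0 atLeastAtMost_iff order_refl right_minus_eq)

text \<open>The constant of \<open>has_int_strips\<close> with both root factors enlarged to the
  horizon \<open>T\<close>, so that it serves every \<open>S <= T\<close>.\<close>

definition bdC :: "real => real => real => real" where
 "bdC T \<gamma> \<tau> = 2 * T powr \<gamma> * (1 + gam \<gamma> * (1 / sqrt \<tau>) * sqrt T)\<^sup>2"

lemma gam_pos: "1/2 < \<gamma> ==> 0 < gam \<gamma>"
 using sewC_pos[of "\<gamma> + 1/2"] by (simp add: gam_def)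

lemma bdC_nonneg: "0 <= bdC T \<gamma> \<tau>"
 by (simp add: bdC_def)

lemma has_int_incr:
 fixes X :: "real => real => real => real => 'a::banach"
 assumes \<gamma>: "1/2 < \<gamma>" and N: "0 <= N" and \<tau>: "0 < \<tau>" and X: "germ2 S \<gamma> N (1 / sqrt \<tau>) X"
  and st: "0 <= s" "s <= t" "t <= S" "S <= T"
  and I: "has_int X 0 t 0 t I" and J: "has_int X 0 s 0 s J"
 shows "norm (I - J) <= N * bdC T \<gamma> \<tau> * (t - s) powr \<gamma>"
proof -
 define F where "F x = 1 + gam \<gamma> * (1 / sqrt \<tau>) * sqrt x" for x
 have F: "0 <= F x" "F x <= F T" if "0 <= x" "x <= T" for x
  using gam_pos[OF \<gamma>] \<tau> that by (auto simp: F_def intro!: mult_left_mono divide_right_mono)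
 have "norm (I - J) <= 2 * N * S powr \<gamma> * F S * F (t - s) * (t - s) powr \<gamma>"
  unfolding F_def by (rule has_int_strips[OF \<gamma> N _ X st(1-3) I J]) (use \<tau> in auto)
 also have "\<dots> <= 2 * N * T powr \<gamma> * F T * F T * (t - s) powr \<gamma>"
  using N st F[of S] F[of "t - s"] F[of T] \<gamma> by (intro mult_mono mult_nonneg_nonneg powr_mono2) auto
 also have "\<dots> = N * bdC T \<gamma> \<tau> * (t - s) powr \<gamma>" by (simp add: bdC_def F_def power2_eq_square)
 finally show ?thesis .
qed

lemma powr_le_sqrt:
 assumes "1/2 < \<gamma>" "0 <= x" "x <= h"
 shows "x powr \<gamma> <= h powr (\<gamma> - 1/2) * sqrt x"
proof (cases "x = 0")
 case False
 have "x powr \<gamma> = x powr (\<gamma> - 1/2) * x powr (1/2)" by (simp flip: powr_add)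
 also have "\<dots> <= h powr (\<gamma> - 1/2) * x powr (1/2)"
  using assms by (intro mult_right_mono powr_mono2) auto
 finally show ?thesis using assms by (simp add: powr_half_sqrt)
qed simp

text \<open>A Gronwall argument in the Hoelder scale: on each step of length \<open>h\<close> the gain
 \<open>h powr (\<gamma> - 1/2)\<close> makes the Volterra operator a contraction for the norm with weights \<open>4 ^ j\<close>.\<close>
definition wnorm_le :: "real => real => (real => 'a::real_normed_vector) => real => bool" where
 "wnorm_le T h D c \<longleftrightarrow> (\<forall>j s t. 0 <= s --> s <= t --> t <= T --> t <= real j * h -->
   norm (D t - D s) <= c * 4 ^ j * sqrt (t - s))"

text \<open>\<open>D\<close> and \<open>D'\<close> are kept apart so that the step serves a priori
  bounds, with \<open>D' = D\<close>, and successive differences of Picard iterates. An increment up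
  to time \<open>(j + 1) * h\<close> is split at \<open>j * h\<close>: the earlier part is the
  induction hypothesis, the later one lies within one step and profits from the small
  factor.\<close>

lemma wnorm_step:
 fixes D D' :: "real => 'a::real_normed_vector"
 assumes h: "0 < h" "C * h powr (\<gamma> - 1/2) <= 1/4" and C: "0 <= C" and e: "0 <= e" and c: "0 <= c" and \<gamma>: "1/2 < \<gamma>"
  and V: "\<And>S L. 0 <= S ==> S <= T ==> 0 <= L ==>
    (\<And>s t. 0 <= s ==> s <= t ==> t <= S ==> norm (D t - D s) <= L * sqrt (t - s)) ==>
    (\<And>s t. 0 <= s ==> s <= t ==> t <= S ==> norm (D' t - D' s) <= C * (L + e) * (t - s) powr \<gamma>)"
  and W: "wnorm_le T h D c"
 shows "wnorm_le T h D' (c / 2 + e)"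
proof -
 have "norm (D' t - D' s) <= (c / 2 + e) * 4 ^ j * sqrt (t - s)"
  if "0 <= s" "s <= t" "t <= T" "t <= real j * h" for j s t
  using that
 proof (induction j arbitrary: s t)
  case 0
  then have "t = s" by simp
  then show ?case by simp
 next
  case (Suc j)
  define c' where "c' = c / 2 + e"
  define q where "q = (4::real) ^ j"
  have q: "1 <= q" by (simp add: q_def)
  have c': "0 <= c'" using c e by (simp add: c'_def)
  define S where "S = min T (real (Suc j) * h)"
  define L where "L = c * 4 ^ Suc j"
  have L: "0 <= L" using c by (simp add: L_def)
  have S: "0 <= S" "S <= T" using Suc.prems h by (auto simp: S_def)
  have D: "norm (D t - D s) <= L * sqrt (t - s)" if "0 <= s" "s <= t" "t <= S" for s t
   using W[unfolded wnorm_le_def, rule_format, of s t "Suc j"] that by (auto simp: L_def S_def)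
  have loc: "norm (D' t - D' s) <= 1/4 * (L + e) * sqrt (t - s)"
   if "0 <= s" "s <= t" "t <= S" "t - s <= h" for s t
  proof -
   have "norm (D' t - D' s) <= C * (L + e) * (t - s) powr \<gamma>"
    by (rule V[OF S L D]) (use that in auto)
   also have "\<dots> <= C * (L + e) * (h powr (\<gamma> - 1/2) * sqrt (t - s))"
    using that C L e \<gamma> by (intro mult_left_mono powr_le_sqrt) auto
   also have "\<dots> = (C * h powr (\<gamma> - 1/2)) * ((L + e) * sqrt (t - s))" by simp
   also have "\<dots> <= 1/4 * ((L + e) * sqrt (t - s))"
    using that h L e by (intro mult_right_mono) auto
   finally show ?thesis by simp
  qed
  \<comment> \<open>This is where the base 4 matters. Up to terms in \<open>e\<close>, the new step
    contributes \<open>c * 4 ^ j\<close>, a quarter of \<open>L\<close>, and the past contributes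
    \<open>c / 2 * 4 ^ j\<close>; together they stay below \<open>c / 2 * 4 ^ Suc j\<close>.\<close>
  have le: "1/4 * (L + e) + c' * q <= c' * 4 ^ Suc j"
   using q c e mult_left_mono[OF q e] mult_left_mono[OF q c] by (simp add: L_def c'_def q_def[symmetric] algebra_simps)
  have "0 <= c' * q" using c' q by simp
  then have le2: "1/4 * (L + e) <= c' * 4 ^ Suc j" using le by linarith
  have tS: "t <= S" using Suc.prems by (auto simp: S_def)
  consider "t <= real j * h" | "real j * h <= s" | "s < real j * h" "real j * h < t" by linarith
  then show ?case
  proof cases
   case 1
   have "norm (D' t - D' s) <= c' * q * sqrt (t - s)"
    using Suc.IH[of s t] Suc.prems 1 by (simp add: c'_def q_def)
   also have "\<dots> <= c' * 4 ^ Suc j * sqrt (t - s)"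
    using c' q Suc.prems by (intro mult_right_mono mult_left_mono) (auto simp: q_def)
   finally show ?thesis unfolding c'_def .
  next
   case 2
   have "t - s <= h" using 2 Suc.prems by (simp add: algebra_simps)
   then have "norm (D' t - D' s) <= 1/4 * (L + e) * sqrt (t - s)" using loc Suc.prems tS by simp
   also have "\<dots> <= c' * 4 ^ Suc j * sqrt (t - s)"
    using Suc.prems by (intro mult_right_mono[OF le2]) auto
   finally show ?thesis unfolding c'_def .
  next
   case 3
   define m where "m = real j * h"
   have m: "s <= m" "m <= t" "0 <= m" using 3 h by (auto simp: m_def)
   have 1: "norm (D' m - D' s) <= c' * q * sqrt (m - s)"
    using Suc.IH[of s m] Suc.prems m by (simp add: c'_def q_def m_def)
   have 2: "norm (D' t - D' m) <= 1/4 * (L + e) * sqrt (t - m)"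
    using loc[of m t] m tS Suc.prems by (simp add: m_def algebra_simps)
   have "norm (D' t - D' s) <= norm (D' t - D' m) + norm (D' m - D' s)" by (rule norm_path2)
   also have "\<dots> <= 1/4 * (L + e) * sqrt (t - m) + c' * q * sqrt (m - s)" using 1 2 by simp
   also have "\<dots> <= 1/4 * (L + e) * sqrt (t - s) + c' * q * sqrt (t - s)"
    using m c' q L e by (intro add_mono mult_left_mono) auto
   also have "\<dots> = (1/4 * (L + e) + c' * q) * sqrt (t - s)" by (simp add: algebra_simps)
   also have "\<dots> <= c' * 4 ^ Suc j * sqrt (t - s)" using le Suc.prems by (intro mult_right_mono) auto
   finally show ?thesis unfolding c'_def .
  qed
 qed
 then show ?thesis unfolding wnorm_le_def by blast
qed

lemma step_exists:
 assumes "1/2 < \<gamma>" "0 <= (C::real)" shows "\<exists>h>0. C * h powr (\<gamma> - 1/2) <= 1/4"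
proof -
 define x where "x = 1 / (4 * (C + 1))"
 define h where "h = x powr (1 / (\<gamma> - 1/2))"
 have x: "0 < x" using assms by (simp add: x_def)
 have "h powr (\<gamma> - 1/2) = x" using x assms by (simp add: h_def powr_powr)
 moreover have "C * x <= 1/4" using assms by (simp add: x_def field_simps)
 moreover have "0 < h" using x by (simp add: h_def)
 ultimately show ?thesis by metis
qed

lemma wnorm_init:
 assumes "\<And>s t. 0 <= s ==> s <= t ==> t <= T ==> norm (D t - D s) <= c * sqrt (t - s)" "0 <= c"
 shows "wnorm_le T h D c"
 unfolding wnorm_le_def
proof (intro allI impI)
 fix j :: nat and s t :: real assume st: "0 <= s" "s <= t" "t <= T"
 have "norm (D t - D s) <= c * sqrt (t - s)" using assms st by simp
 also have "\<dots> <= c * 4 ^ j * sqrt (t - s)"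
  using mult_left_mono[of 1 "4 ^ j" c] assms st by (intro mult_right_mono) auto
 finally show "norm (D t - D s) <= c * 4 ^ j * sqrt (t - s)" .
qed

text \<open>\<open>wnorm_step\<close> with \<open>D' = D\<close> improves a constant
  \<open>c\<close> to \<open>c / 2 + e\<close>, whose fixed point is \<open>2 * e\<close>. Iteration
  removes the a priori bound \<open>c0\<close>, of which only finiteness matters, and leaves a
  constant depending on \<open>C\<close>, \<open>\<gamma>\<close> and \<open>T\<close>
  alone.\<close>

lemma volterra_gronwall:
 fixes T \<gamma> C :: real
 assumes \<gamma>: "1/2 < \<gamma>" and C: "0 <= C"
 shows "\<exists>C'\<ge>0. \<forall>(D :: real => 'a::real_normed_vector) e c0. 0 <= e --> 0 <= c0 -->
   (\<forall>s t. 0 <= s --> s <= t --> t <= T --> norm (D t - D s) <= c0 * sqrt (t - s)) -->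
   (\<forall>S L. 0 <= S --> S <= T --> 0 <= L -->
    (\<forall>s t. 0 <= s --> s <= t --> t <= S --> norm (D t - D s) <= L * sqrt (t - s)) -->
    (\<forall>s t. 0 <= s --> s <= t --> t <= S --> norm (D t - D s) <= C * (L + e) * (t - s) powr \<gamma>)) -->
   (\<forall>s t. 0 <= s --> s <= t --> t <= T --> norm (D t - D s) <= C' * e * sqrt (t - s))"
proof -
 obtain h where h: "h > 0" "C * h powr (\<gamma> - 1/2) <= 1/4" using step_exists[OF \<gamma> C] by blast
 obtain j0 :: nat where j0: "T / h <= real j0" using real_arch_simple by blast
 have Tj: "T <= real j0 * h" using j0 h by (simp add: field_simps)
 show ?thesis
 \<comment> \<open>\<open>2 * e\<close> is the limiting constant and \<open>4 ^ j0\<close> the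
   weight of the last of the \<open>j0\<close> steps that cover \<open>[0, T]\<close>.\<close>
 proof (intro exI[of _ "2 * 4 ^ j0"] conjI allI impI)
  fix D :: "real => 'a" and e c0 s t :: real
  assume e: "0 <= e" and c0: "0 <= c0"
   and D: "\<forall>s t. 0 <= s --> s <= t --> t <= T --> norm (D t - D s) <= c0 * sqrt (t - s)"
   and V: "\<forall>S L. 0 <= S --> S <= T --> 0 <= L -->
    (\<forall>s t. 0 <= s --> s <= t --> t <= S --> norm (D t - D s) <= L * sqrt (t - s)) -->
    (\<forall>s t. 0 <= s --> s <= t --> t <= S --> norm (D t - D s) <= C * (L + e) * (t - s) powr \<gamma>)"
   and st: "0 <= s" "s <= t" "t <= T"
  have "wnorm_le T h D (c0 / 2 ^ n + 2 * e)" for n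
  proof (induction n)
   case 0
   have "norm (D t - D s) <= (c0 + 2 * e) * sqrt (t - s)" if "0 <= s" "s <= t" "t <= T" for s t
    proof -
    have "0 <= 2 * e * sqrt (t - s)" using e that by simp
    then show ?thesis using D[rule_format, OF that] by (simp add: distrib_right)
   qed
   then show ?case using wnorm_init[of T D "c0 + 2 * e" h] c0 e by simp
  next
   case (Suc n)
   have "wnorm_le T h D ((c0 / 2 ^ n + 2 * e) / 2 + e)"
   proof (rule wnorm_step[OF h C e _ \<gamma> _ Suc])
    fix S L s t :: real assume *: "0 <= S" "S <= T" "0 <= L"
     "\<And>s t. 0 <= s ==> s <= t ==> t <= S ==> norm (D t - D s) <= L * sqrt (t - s)"
     "0 <= s" "s <= t" "t <= S"
    show "norm (D t - D s) <= C * (L + e) * (t - s) powr \<gamma>"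
     by (rule V[rule_format, of S L s t]) (use * in auto)
   qed (use c0 e in auto)
   moreover have "(c0 / 2 ^ n + 2 * e) / 2 + e = c0 / 2 ^ Suc n + 2 * e" by (simp add: field_simps)
   ultimately show ?case by simp
  qed
  then have b: "norm (D t - D s) <= (c0 / 2 ^ n + 2 * e) * 4 ^ j0 * sqrt (t - s)" for n
   using st Tj unfolding wnorm_le_def by (meson order_trans)
  have "(%n. c0 / 2 ^ n) \<longlonglongrightarrow> 0" by (rule LIMSEQ_divide_realpow_zero) simp
  then have "(%n. (c0 / 2 ^ n + 2 * e) * 4 ^ j0 * sqrt (t - s)) \<longlonglongrightarrow> (0 + 2 * e) * 4 ^ j0 * sqrt (t - s)"
   by (intro tendsto_intros)
  then have "norm (D t - D s) <= (0 + 2 * e) * 4 ^ j0 * sqrt (t - s)"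
   by (rule LIMSEQ_le_const) (use b in auto)
  then show "norm (D t - D s) <= 2 * 4 ^ j0 * e * sqrt (t - s)" by (simp add: mult_ac)
 qed simp
qed

lemma germ_pair: "germ A [(1, \<theta>)] s1 t1 s2 t2 - germ A [(1, \<eta>)] s1 t1 s2 t2 = germ A [(1, \<theta>), (-1, \<eta>)] s1 t1 s2 t2"
 by (simp add: germ_def)

lemma germ_field_diff:
 "germ A l s1 t1 s2 t2 - germ B l s1 t1 s2 t2 = germ (%t1 t2 x. A t1 t2 x - B t1 t2 x) l s1 t1 s2 t2"
 unfolding germ_def wsum_diff[symmetric] by (simp add: box_def algebra_simps)

lemma single_incr:
 fixes A :: "real => real => real^'n::finite => real^'n"
 assumes A: "regular_field T \<gamma> M A" and M: "0 <= M" and \<gamma>: "1/2 < \<gamma>" and \<tau>: "0 < \<tau>"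
  and \<theta>: "hol \<tau> \<gamma> T \<theta>" and st: "0 <= s" "s <= t" "t <= T"
  and I: "has_int (germ A [(1, \<theta>)]) 0 t 0 t I" and J: "has_int (germ A [(1, \<theta>)]) 0 s 0 s J"
 shows "norm (I - J) <= M * 4 * bdC T \<gamma> \<tau> * (t - s) powr \<gamma>"
 by (rule has_int_incr[OF \<gamma> _ \<tau> germ2_single[OF A M \<gamma> \<tau> \<theta>] st order_refl I J]) (use M in auto)

text \<open>On \<open>[0, S]\<close> the supremum of \<open>\<theta> - \<eta>\<close> is controlled
  by the initial difference and \<open>L * sqrt T\<close>, which eliminates the parameter
  \<open>d\<close> of \<open>germ2_pair\<close>.\<close>

lemma pair_incr:
 fixes A :: "real => real => real^'n::finite => real^'n"
 assumes A: "regular_field T \<gamma> M A" and M: "0 <= M" and \<gamma>: "1/2 < \<gamma>" and \<tau>: "0 < \<tau>" and S: "0 <= S" "S <= T"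
  and \<theta>: "hol \<tau> \<gamma> T \<theta>" and \<eta>: "hol \<tau> \<gamma> T \<eta>"
  and L: "0 <= L" "\<And>s t. 0 <= s ==> s <= t ==> t <= S ==> norm ((\<theta> t - \<eta> t) - (\<theta> s - \<eta> s)) <= L * sqrt (t - s)"
  and st: "0 <= s" "s <= t" "t <= S"
  and I: "has_int (germ A [(1, \<theta>)]) 0 t 0 t I" and J: "has_int (germ A [(1, \<theta>)]) 0 s 0 s J"
  and I': "has_int (germ A [(1, \<eta>)]) 0 t 0 t I'" and J': "has_int (germ A [(1, \<eta>)]) 0 s 0 s J'"
 shows "norm ((I - I') - (J - J')) <= 8 * M * bdC T \<gamma> \<tau> * (L * (sqrt \<tau> + sqrt T) + norm (\<theta> 0 - \<eta> 0)) * (t - s) powr \<gamma>"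
proof -
 define d where "d = L * sqrt T + norm (\<theta> 0 - \<eta> 0)"
 have d0: "0 <= d" using L S by (simp add: d_def)
 have d: "norm (\<theta> t - \<eta> t) <= d" if "0 <= t" "t <= S" for t
 proof -
  have "norm (\<theta> t - \<eta> t) <= norm ((\<theta> t - \<eta> t) - (\<theta> 0 - \<eta> 0)) + norm (\<theta> 0 - \<eta> 0)"
   using norm_triangle_sub[of "\<theta> t - \<eta> t" "\<theta> 0 - \<eta> 0"] by (simp add: add.commute)
  also have "\<dots> <= L * sqrt t + norm (\<theta> 0 - \<eta> 0)" using L(2)[of 0 t] that by simp
  also have "L * sqrt t <= L * sqrt T" using L that S by (intro mult_left_mono) auto
  finally show ?thesis by (simp add: d_def)
 qed
 have g: "germ2 S \<gamma> (M * (8 * (L * sqrt \<tau> + d))) (1 / sqrt \<tau>) (germ A [(1, \<theta>), (-1, \<eta>)])"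
  by (rule germ2_pair[OF A M \<gamma> \<tau> S(2) \<theta> \<eta> L d0 d])
 have h: "has_int (germ A [(1, \<theta>), (-1, \<eta>)]) 0 t 0 t (I - I')" "has_int (germ A [(1, \<theta>), (-1, \<eta>)]) 0 s 0 s (J - J')"
  using has_int_diff[OF I I'] has_int_diff[OF J J'] unfolding germ_pair by auto
 have "norm ((I - I') - (J - J')) <= (M * (8 * (L * sqrt \<tau> + d))) * bdC T \<gamma> \<tau> * (t - s) powr \<gamma>"
  by (rule has_int_incr[OF \<gamma> _ \<tau> g st S(2) h]) (use M L d0 \<tau> in auto)
 then show ?thesis by (simp add: d_def algebra_simps)
qed

text \<open>The integral \<open>I\<close> of the field \<open>A\<close> along
  \<open>\<theta>\<close> is inserted between the two solutions. Changing the field along the fixed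
  path costs \<open>M'\<close>; changing the path in the fixed field \<open>A\<close> is of Volterra
  type. Thus \<open>B\<close> enters only through its difference to \<open>A\<close>.\<close>

lemma stability:
 fixes T \<gamma> M \<tau> :: real
 assumes \<gamma>: "1/2 < \<gamma>" and M: "0 <= M" and \<tau>: "0 < \<tau>" and T: "0 < T"
 shows "\<exists>C\<ge>0. \<forall>(A :: real => real => real^'n::finite => real^'n) B M' u0 v0 \<theta> \<eta>.
   regular_field T \<gamma> M A --> 0 <= M' --> regular_field T \<gamma> M' (%t1 t2 x. B t1 t2 x - A t1 t2 x) -->
   hol \<tau> \<gamma> T \<theta> --> hol \<tau> \<gamma> T \<eta> --> solves T B v0 \<theta> --> solves T A u0 \<eta> -->
   (\<forall>s t. 0 <= s --> s <= t --> t <= T -->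
    norm ((\<theta> t - \<eta> t) - (\<theta> s - \<eta> s)) <= C * (M' + norm (v0 - u0)) * (t - s) powr \<gamma>)"
proof -
 define K where "K = bdC T \<gamma> \<tau>"
 have K: "0 <= K" by (simp add: K_def bdC_nonneg)
 define C where "C = 8 * K * (1 + M) * (1 + sqrt \<tau> + sqrt T)"
 have C: "0 <= C" using K M T \<tau> by (simp add: C_def)
 obtain C' where C': "C' \<ge> 0" "\<forall>(D :: real => real^'n) e c0. 0 <= e --> 0 <= c0 -->
   (\<forall>s t. 0 <= s --> s <= t --> t <= T --> norm (D t - D s) <= c0 * sqrt (t - s)) -->
   (\<forall>S L. 0 <= S --> S <= T --> 0 <= L -->
    (\<forall>s t. 0 <= s --> s <= t --> t <= S --> norm (D t - D s) <= L * sqrt (t - s)) -->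
    (\<forall>s t. 0 <= s --> s <= t --> t <= S --> norm (D t - D s) <= C * (L + e) * (t - s) powr \<gamma>)) -->
   (\<forall>s t. 0 <= s --> s <= t --> t <= T --> norm (D t - D s) <= C' * e * sqrt (t - s))"
  using volterra_gronwall[OF \<gamma> C, where T = T and 'a = "real^'n"] by blast
 show ?thesis
 proof (intro exI[of _ "C * (C' + 1)"] conjI allI impI)
  fix A B :: "real => real => real^'n => real^'n" and M' u0 v0 \<theta> \<eta>
  fix s t :: real
  assume A: "regular_field T \<gamma> M A" and M': "0 <= M'" and B: "regular_field T \<gamma> M' (%t1 t2 x. B t1 t2 x - A t1 t2 x)"
   and \<theta>: "hol \<tau> \<gamma> T \<theta>" and \<eta>: "hol \<tau> \<gamma> T \<eta>" and sB: "solves T B v0 \<theta>" and sA: "solves T A u0 \<eta>"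
   and st: "0 <= s" "s <= t" "t <= T"
  define e where "e = M' + norm (v0 - u0)"
  have e: "0 <= e" using M' by (simp add: e_def)
  define D where "D t = \<theta> t - \<eta> t" for t
  have D0: "D 0 = v0 - u0" using solves_0[OF sB] solves_0[OF sA] T by (simp add: D_def)
  have "\<forall>t. \<exists>I. 0 <= t \<and> t <= T --> has_int (germ A [(1, \<theta>)]) 0 t 0 t I"
   using has_int_exists[OF \<gamma> _ _ germ2_single[OF A M \<gamma> \<tau> \<theta>]] M \<tau> by fastforce
  then obtain I where I: "\<And>t. 0 <= t ==> t <= T ==> has_int (germ A [(1, \<theta>)]) 0 t 0 t (I t)" by metis
  have hA: "has_int (germ A [(1, \<eta>)]) 0 t 0 t (\<eta> t - u0)" if "0 <= t" "t <= T" for t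
   using sA that by (auto simp: solves_def)
  have hB: "has_int (germ (%t1 t2 x. B t1 t2 x - A t1 t2 x) [(1, \<theta>)]) 0 t 0 t (\<theta> t - v0 - I t)" if "0 <= t" "t <= T" for t
   unfolding germ_field_diff[symmetric]
   by (rule has_int_diff) (use sB I that in \<open>auto simp: solves_def\<close>)
  have b1: "norm ((\<theta> t - v0 - I t) - (\<theta> s - v0 - I s)) <= M' * 4 * K * (t - s) powr \<gamma>"
   if "0 <= s" "s <= t" "t <= T" for s t
   unfolding K_def by (rule single_incr[OF B M' \<gamma> \<tau> \<theta> that]) (use hB that in auto)
  have dec: "D t - D s = ((\<theta> t - v0 - I t) - (\<theta> s - v0 - I s)) + ((I t - (\<eta> t - u0)) - (I s - (\<eta> s - u0)))" for s t
   by (simp add: D_def)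
  have V: "norm (D t - D s) <= C * (L + e) * (t - s) powr \<gamma>"
   if S: "0 <= S" "S <= T" "0 <= L" and L: "\<And>s t. 0 <= s ==> s <= t ==> t <= S ==> norm (D t - D s) <= L * sqrt (t - s)"
    and st: "0 <= s" "s <= t" "t <= S" for S L s t
  proof -
   have "norm ((I t - (\<eta> t - u0)) - (I s - (\<eta> s - u0))) <= 8 * M * K * (L * (sqrt \<tau> + sqrt T) + norm (\<theta> 0 - \<eta> 0)) * (t - s) powr \<gamma>"
    unfolding K_def using L S st
    by (intro pair_incr[OF A M \<gamma> \<tau> S(1,2) \<theta> \<eta> S(3) _ st] I hA) (auto simp: D_def)
   then have "norm (D t - D s) <= M' * 4 * K * (t - s) powr \<gamma> + 8 * M * K * (L * (sqrt \<tau> + sqrt T) + norm (\<theta> 0 - \<eta> 0)) * (t - s) powr \<gamma>"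
    unfolding dec using b1[of s t] st S by (intro norm_triangle_mono) auto
   also have "\<dots> = 8 * K * (M' / 2 + M * (L * (sqrt \<tau> + sqrt T) + norm (v0 - u0))) * (t - s) powr \<gamma>"
    using D0 unfolding D_def by (simp only:) (simp add: algebra_simps)
   also have "\<dots> <= 8 * K * ((1 + M) * (1 + sqrt \<tau> + sqrt T) * (L + e)) * (t - s) powr \<gamma>"
   proof (intro mult_right_mono mult_left_mono)
    have nn: "0 <= sqrt \<tau>" "0 <= sqrt T" using \<tau> T by auto
    have "M' / 2 + M * (L * (sqrt \<tau> + sqrt T) + norm (v0 - u0)) <= e + M * (L * (sqrt \<tau> + sqrt T) + e)"
     using M M' S(3) by (intro add_mono mult_left_mono) (auto simp: e_def)
    also have "\<dots> <= (1 + M) * (1 + sqrt \<tau> + sqrt T) * (L + e)"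
     using M nn S e by (simp add: algebra_simps)
    finally show "M' / 2 + M * (L * (sqrt \<tau> + sqrt T) + norm (v0 - u0)) <= (1 + M) * (1 + sqrt \<tau> + sqrt T) * (L + e)" .
   qed (use K in auto)
   also have "\<dots> = C * (L + e) * (t - s) powr \<gamma>" by (simp only: C_def mult.assoc)
   finally show ?thesis .
  qed
  \<comment> \<open>A crude a priori bound from the three integrals separately; it may depend on all
    data, since \<open>volterra_gronwall\<close> discards it.\<close>
  define c0 where "c0 = (M' * 4 * K + M * 4 * K + M * 4 * K) * T powr (\<gamma> - 1/2)"
  have c0: "0 <= c0" using M M' K by (simp add: c0_def)
  have init: "norm (D t - D s) <= c0 * sqrt (t - s)" if "0 <= s" "s <= t" "t <= T" for s t
  proof -
   have 1: "norm (I t - I s) <= M * 4 * K * (t - s) powr \<gamma>"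
    unfolding K_def by (rule single_incr[OF A M \<gamma> \<tau> \<theta> that]) (use I that in auto)
   have 2: "norm ((\<eta> t - u0) - (\<eta> s - u0)) <= M * 4 * K * (t - s) powr \<gamma>"
    unfolding K_def by (rule single_incr[OF A M \<gamma> \<tau> \<eta> that]) (use hA that in auto)
   have "norm (D t - D s) <= norm ((\<theta> t - v0 - I t) - (\<theta> s - v0 - I s)) + (norm (I t - I s) + norm ((\<eta> t - u0) - (\<eta> s - u0)))"
    unfolding dec
    using norm_triangle_ineq4[of "I t - I s" "(\<eta> t - u0) - (\<eta> s - u0)"]
    by (intro norm_triangle_mono) (auto simp: algebra_simps)
   also have "\<dots> <= (M' * 4 * K + M * 4 * K + M * 4 * K) * (t - s) powr \<gamma>"
    using b1[OF that] 1 2 by (simp add: algebra_simps)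
   also have "\<dots> <= (M' * 4 * K + M * 4 * K + M * 4 * K) * (T powr (\<gamma> - 1/2) * sqrt (t - s))"
    using that M M' K by (intro mult_left_mono powr_le_sqrt[OF \<gamma>]) auto
   finally show ?thesis by (simp add: c0_def mult_ac)
  qed
  have i': "\<forall>s t. 0 <= s --> s <= t --> t <= T --> norm (D t - D s) <= c0 * sqrt (t - s)"
   by (intro allI impI) (rule init)
  have V': "\<forall>S L. 0 <= S --> S <= T --> 0 <= L -->
    (\<forall>s t. 0 <= s --> s <= t --> t <= S --> norm (D t - D s) <= L * sqrt (t - s)) -->
    (\<forall>s t. 0 <= s --> s <= t --> t <= S --> norm (D t - D s) <= C * (L + e) * (t - s) powr \<gamma>)"
  proof (intro allI impI)
   fix S L s t assume *: "0 <= S" "S <= T" "0 <= L"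
    "\<forall>s t. 0 <= s --> s <= t --> t <= S --> norm (D t - D s) <= L * sqrt (t - s)"
    "0 <= s" "s <= t" "t <= S"
   show "norm (D t - D s) <= C * (L + e) * (t - s) powr \<gamma>"
    by (rule V[OF *(1,2,3) *(4)[rule_format] *(5-7)])
  qed
  have g: "\<forall>s t. 0 <= s --> s <= t --> t <= T --> norm (D t - D s) <= C' * e * sqrt (t - s)"
   by (rule C'(2)[THEN spec, THEN spec, THEN spec, THEN mp, THEN mp, THEN mp, THEN mp, OF e c0 i' V'])
  \<comment> \<open>The Gronwall bound is only 1/2-Hoelder; inserting it once more into the estimate
    \<open>V\<close> on \<open>[0, T]\<close> restores the exponent \<open>\<gamma>\<close>.\<close>
  have "norm (D t - D s) <= C * (C' * e + e) * (t - s) powr \<gamma>"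
   by (rule V[OF _ order_refl _ g[rule_format] st]) (use T C'(1) e in auto)
  then show "norm ((\<theta> t - \<eta> t) - (\<theta> s - \<eta> s)) <= C * (C' + 1) * (M' + norm (v0 - u0)) * (t - s) powr \<gamma>"
   by (simp add: D_def e_def algebra_simps)
 qed (use C C' in auto)
qed

section \<open>Existence by Picard iteration\<close>

text \<open>The condition under which integration preserves \<open>hol\<close>: the left side is the
  constant of \<open>has_int_strips\<close> for \<open>N = 4 * M\<close>, where the factor with the
  short length \<open>t - s <= \<tau>\<close> is at most \<open>1 + gam \<gamma>\<close>.\<close>

definition small_scale :: "real => real => real => real => bool" where
 "small_scale T \<gamma> M \<tau> \<longleftrightarrow> 0 < \<tau> \<and>
  8 * M * T powr \<gamma> * (1 + gam \<gamma> * (1 / sqrt \<tau>) * sqrt T) * (1 + gam \<gamma>) <= \<tau> powr (- \<gamma>)"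

text \<open>The left side of the condition grows like \<open>1 / sqrt \<tau>\<close>, the right side
  is \<open>\<tau> powr (- \<gamma>)\<close> and wins for small \<open>\<tau>\<close> because
  \<open>\<gamma> > 1/2\<close>.\<close>

lemma small_scale_exists:
 assumes \<gamma>: "1/2 < \<gamma>" and M: "0 <= M" and T: "0 < T" shows "\<exists>\<tau>. small_scale T \<gamma> M \<tau>"
proof -
 define c where "c = 8 * M * T powr \<gamma> * (1 + gam \<gamma> * sqrt T) * (1 + gam \<gamma>) + 1"
 have g: "0 < gam \<gamma>" by (rule gam_pos[OF \<gamma>])
 have c: "1 <= c" using g M T by (simp add: c_def)
 \<comment> \<open>Solves \<open>\<tau> powr (- (\<gamma> - 1/2)) = c\<close>. The summand 1 in
   \<open>c\<close> ensures \<open>\<tau> <= 1\<close>, so that the factor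
   \<open>1 / sqrt \<tau>\<close> can be pulled out.\<close>
 define \<tau> where "\<tau> = c powr (- (1 / (\<gamma> - 1/2)))"
 have \<tau>0: "0 < \<tau>" using c by (simp add: \<tau>_def)
 have \<tau>1: "\<tau> <= 1" using c \<gamma> powr_mono[of "- (1 / (\<gamma> - 1/2))" 0 c] by (simp add: \<tau>_def)
 have pw: "\<tau> powr (- (\<gamma> - 1/2)) = c"
 proof -
  have "\<tau> powr (- (\<gamma> - 1/2)) = c powr ((- (1 / (\<gamma> - 1/2))) * (- (\<gamma> - 1/2)))"
   unfolding \<tau>_def powr_powr ..
  also have "(- (1 / (\<gamma> - 1/2))) * (- (\<gamma> - 1/2)) = 1"
  proof -
   have "\<gamma> - 1/2 \<noteq> 0" using \<gamma> by simp
   then show ?thesis unfolding minus_mult_minus by (metis nonzero_eq_divide_eq)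
  qed
  finally show ?thesis using c by simp
 qed
 have r: "1 <= 1 / sqrt \<tau>" using \<tau>0 \<tau>1 by simp
 have "1 + gam \<gamma> * (1 / sqrt \<tau>) * sqrt T <= (1 + gam \<gamma> * sqrt T) * (1 / sqrt \<tau>)"
  using r \<tau>0 by (simp add: algebra_simps)
 then have "8 * M * T powr \<gamma> * (1 + gam \<gamma> * (1 / sqrt \<tau>) * sqrt T) * (1 + gam \<gamma>)
   <= 8 * M * T powr \<gamma> * ((1 + gam \<gamma> * sqrt T) * (1 / sqrt \<tau>)) * (1 + gam \<gamma>)"
  using M g \<tau>0 by (intro mult_right_mono mult_left_mono) auto
 also have "\<dots> = (c - 1) * (1 / sqrt \<tau>)" by (simp add: c_def)
 also have "\<dots> <= c * (1 / sqrt \<tau>)" using r \<tau>0 by (intro mult_right_mono) auto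
 also have "\<dots> = \<tau> powr (- (\<gamma> - 1/2)) * \<tau> powr (- (1/2))"
 proof -
  have "\<tau> powr (- (1/2)) = 1 / \<tau> powr (1/2)" by (rule powr_minus_divide)
  also have "\<tau> powr (1/2) = sqrt \<tau>" using \<tau>0 by (intro powr_half_sqrt) simp
  finally show ?thesis unfolding pw by simp
 qed
 also have "\<dots> = \<tau> powr (- (\<gamma> - 1/2) + - (1/2))" by (rule powr_add[symmetric])
 also have "- (\<gamma> - 1/2) + - (1/2) = - \<gamma>" by simp
 finally show ?thesis using \<tau>0 unfolding small_scale_def by (intro exI[of _ \<tau>] conjI)
qed

text \<open>The iteration runs on the whole interval: a small scale \<open>\<tau>\<close> makes the
  set of \<open>hol\<close> paths invariant however large \<open>M\<close> and \<open>T\<close> are,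
  and the weighted norms make successive differences decay geometrically. The bound
  \<open>hol\<close> passes to the pointwise limit.\<close>

lemma existence:
 fixes A :: "real => real => real^'n::finite => real^'n"
 assumes A: "regular_field T \<gamma> M A" and M: "0 <= M" and \<gamma>: "1/2 < \<gamma>" and T: "0 < T"
  and sm: "small_scale T \<gamma> M \<tau>"
 shows "\<exists>\<theta>. hol \<tau> \<gamma> T \<theta> \<and> solves T A u0 \<theta>"
proof -
 have \<tau>: "0 < \<tau>" using sm by (simp add: small_scale_def)
 define K where "K = bdC T \<gamma> \<tau>"
 have K: "0 <= K" by (simp add: K_def bdC_nonneg)
 define I where "I \<theta> t = (SOME I. has_int (germ A [(1, \<theta>)]) 0 t 0 t I)" for \<theta> t
 have I: "has_int (germ A [(1, \<theta>)]) 0 t 0 t (I \<theta> t)" if "hol \<tau> \<gamma> T \<theta>" "0 <= t" "t <= T" for \<theta> t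
 proof -
  have "\<exists>J. has_int (germ A [(1, \<theta>)]) 0 t 0 t J"
   using has_int_exists[OF \<gamma> _ _ germ2_single[OF A M \<gamma> \<tau> that(1)], of 0 t 0 t] that M \<tau> by auto
  then show ?thesis unfolding I_def by (rule someI_ex)
 qed
 have I0: "I \<theta> 0 = 0" if "hol \<tau> \<gamma> T \<theta>" for \<theta> using I[OF that, of 0] T has_int_0 by force
 define G where "G \<theta> t = u0 + I \<theta> t" for \<theta> t
 have inv: "hol \<tau> \<gamma> T (G \<theta>)" if \<theta>: "hol \<tau> \<gamma> T \<theta>" for \<theta>
  unfolding hol_def
 proof (intro allI impI)
  fix s t assume st: "0 <= s" "s <= t" "t <= T" "t - s <= \<tau>"
  define r where "r = 1 / sqrt \<tau>"
  have r: "0 < r" using \<tau> by (simp add: r_def)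
  have g: "0 < gam \<gamma>" by (rule gam_pos[OF \<gamma>])
  have "r * sqrt (t - s) <= 1" using \<tau> st by (simp add: r_def)
  then have rs: "1 + gam \<gamma> * r * sqrt (t - s) <= 1 + gam \<gamma>"
   using g mult_left_mono[of "r * sqrt (t - s)" 1 "gam \<gamma>"] by simp
  have "norm (G \<theta> t - G \<theta> s) = norm (I \<theta> t - I \<theta> s)" by (simp add: G_def)
  also have "\<dots> <= 2 * (M * 4) * T powr \<gamma> * (1 + gam \<gamma> * r * sqrt T) * (1 + gam \<gamma> * r * sqrt (t - s)) * (t - s) powr \<gamma>"
   by (rule has_int_strips[OF \<gamma> _ _ germ2_single[OF A M \<gamma> \<tau> \<theta>, folded r_def] st(1-3) I[OF \<theta>] I[OF \<theta>]])
     (use M r st in auto)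
  also have "\<dots> <= 2 * (M * 4) * T powr \<gamma> * (1 + gam \<gamma> * r * sqrt T) * (1 + gam \<gamma>) * (t - s) powr \<gamma>"
   using M r g T rs by (intro mult_right_mono mult_left_mono mult_nonneg_nonneg) auto
  also have "\<dots> <= \<tau> powr (- \<gamma>) * (t - s) powr \<gamma>"
   using sm unfolding small_scale_def r_def[symmetric] by (intro mult_right_mono) (auto simp: mult_ac)
  finally show "norm (G \<theta> t - G \<theta> s) <= \<tau> powr (- \<gamma>) * (t - s) powr \<gamma>" .
 qed
 define p where "p k = (G ^^ k) (%_. u0)" for k
 have p: "hol \<tau> \<gamma> T (p k)" for k
  by (induction k) (auto simp: p_def inv, auto simp: hol_def)
 have pS: "p (Suc k) = G (p k)" for k by (simp add: p_def)
 \<comment> \<open>All iterates start at \<open>u0\<close>, so the initial difference in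
   \<open>pair_incr\<close> vanishes.\<close>
 have p0: "p k 0 = u0" for k
  using I0[OF p] by (cases k) (auto simp: pS G_def, simp add: p_def)
 define C where "C = 8 * M * K * (sqrt \<tau> + sqrt T)"
 have C: "0 <= C" using K M T \<tau> by (simp add: C_def)
 have V: "norm ((G \<theta> t - G \<eta> t) - (G \<theta> s - G \<eta> s)) <= C * L * (t - s) powr \<gamma>"
  if "hol \<tau> \<gamma> T \<theta>" "hol \<tau> \<gamma> T \<eta>" "\<theta> 0 = \<eta> 0" "0 <= S" "S <= T" "0 <= L"
   "\<And>s t. 0 <= s ==> s <= t ==> t <= S ==> norm ((\<theta> t - \<eta> t) - (\<theta> s - \<eta> s)) <= L * sqrt (t - s)"
   "0 <= s" "s <= t" "t <= S" for \<theta> \<eta> S L s t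
 proof -
  have "norm ((I \<theta> t - I \<eta> t) - (I \<theta> s - I \<eta> s)) <= 8 * M * bdC T \<gamma> \<tau> * (L * (sqrt \<tau> + sqrt T) + norm (\<theta> 0 - \<eta> 0)) * (t - s) powr \<gamma>"
   by (rule pair_incr[OF A M \<gamma> \<tau> that(4,5,1,2,6,7,8,9,10)]) (use that I in auto)
  then show ?thesis using that(3) by (simp add: G_def C_def K_def algebra_simps)
 qed
 obtain h where h: "h > 0" "C * h powr (\<gamma> - 1/2) <= 1/4" using step_exists[OF \<gamma> C] by blast
 obtain j0 :: nat where j0: "T / h <= real j0" using real_arch_simple by blast
 have Tj: "T <= real j0 * h" using j0 h by (simp add: field_simps)
 define c0 where "c0 = M * 4 * K * T powr (\<gamma> - 1/2)"
 have c0: "0 <= c0" using M K by (simp add: c0_def)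
 have W: "wnorm_le T h (%t. p (Suc k) t - p k t) (c0 / 2 ^ k)" for k
 proof (induction k)
  case 0
  have "norm ((p 1 t - p 0 t) - (p 1 s - p 0 s)) <= c0 * sqrt (t - s)" if "0 <= s" "s <= t" "t <= T" for s t
  proof -
   have "norm ((p 1 t - p 0 t) - (p 1 s - p 0 s)) = norm (I (p 0) t - I (p 0) s)"
    using pS[of 0] by (simp add: G_def p_def)
   also have "\<dots> <= M * 4 * K * (t - s) powr \<gamma>"
    unfolding K_def by (rule single_incr[OF A M \<gamma> \<tau> p[of 0] that]) (use I p that in auto)
   also have "\<dots> <= M * 4 * K * (T powr (\<gamma> - 1/2) * sqrt (t - s))"
    using that M K by (intro mult_left_mono powr_le_sqrt[OF \<gamma>]) auto
   finally show ?thesis by (simp add: c0_def mult_ac)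
  qed
  then show ?case using wnorm_init[of T "%t. p 1 t - p 0 t" c0 h] c0 by simp
 next
  case (Suc k)
  have "wnorm_le T h (%t. p (Suc (Suc k)) t - p (Suc k) t) (c0 / 2 ^ k / 2 + 0)"
  proof (rule wnorm_step[OF h C order_refl _ \<gamma> _ Suc])
   fix S L s t :: real assume *: "0 <= S" "S <= T" "0 <= L"
    "\<And>s t. 0 <= s ==> s <= t ==> t <= S ==> norm ((p (Suc k) t - p k t) - (p (Suc k) s - p k s)) <= L * sqrt (t - s)"
    "0 <= s" "s <= t" "t <= S"
   show "norm ((p (Suc (Suc k)) t - p (Suc k) t) - (p (Suc (Suc k)) s - p (Suc k) s)) <= C * (L + 0) * (t - s) powr \<gamma>"
   proof -
    have "p (Suc k) 0 = p k 0" using p0 by metis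
    from V[OF p p this *] show ?thesis unfolding pS by simp
   qed
  qed (use c0 in auto)
  then show ?case by (simp add: mult.commute)
 qed
 define c1 where "c1 = c0 * 4 ^ j0"
 have c1: "0 <= c1" using c0 by (simp add: c1_def)
 have step: "norm ((p (Suc k) t - p k t) - (p (Suc k) s - p k s)) <= c1 * sqrt (t - s) * (1/2) ^ k"
  if "0 <= s" "s <= t" "t <= T" for s t k
 proof -
  have "norm ((p (Suc k) t - p k t) - (p (Suc k) s - p k s)) <= c0 / 2 ^ k * 4 ^ j0 * sqrt (t - s)"
   using W[of k] that Tj unfolding wnorm_le_def by (meson order_trans)
  then show ?thesis by (simp add: c1_def power_divide mult_ac)
 qed
 have conv: "\<exists>l. (%k. p k t) \<longlonglongrightarrow> l" if "0 <= t" "t <= T" for t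
 proof -
  have "summable (%k. p (Suc k) t - p k t)"
  proof (rule summable_comparison_test)
   show "\<exists>N. \<forall>n\<ge>N. norm (p (Suc n) t - p n t) <= c1 * sqrt t * (1/2) ^ n"
    using step[of 0 t] that by (auto simp: p0)
   show "summable (%n. c1 * sqrt t * (1/2) ^ n)" by (intro summable_mult summable_geometric) simp
  qed
  then have "convergent (%n. \<Sum>k<n. p (Suc k) t - p k t)" by (simp add: summable_iff_convergent)
  from convergent_add[OF this[unfolded sum_lessThan_telescope[of "%k. p k t"]] convergent_const[of "p 0 t"]]
  have "convergent (%n. p n t)" by (simp only: diff_add_cancel)
  then show ?thesis by (simp add: convergent_def)
 qed
 define \<theta> where "\<theta> t = lim (%k. p k t)" for t
 have lim: "(%k. p k t) \<longlonglongrightarrow> \<theta> t" if "0 <= t" "t <= T" for t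
  unfolding \<theta>_def using conv[OF that] limI by metis
 have hol\<theta>: "hol \<tau> \<gamma> T \<theta>"
  unfolding hol_def
 proof (intro allI impI)
  fix s t assume st: "0 <= s" "s <= t" "t <= T" "t - s <= \<tau>"
  have "(%k. norm (p k t - p k s)) \<longlonglongrightarrow> norm (\<theta> t - \<theta> s)"
   by (intro tendsto_intros lim) (use st in auto)
  then show "norm (\<theta> t - \<theta> s) <= \<tau> powr (- \<gamma>) * (t - s) powr \<gamma>"
   by (rule LIMSEQ_le_const2) (use p st in \<open>auto simp: hol_def\<close>)
 qed
 have \<theta>0: "\<theta> 0 = u0" using lim[of 0] T by (simp add: p0 LIMSEQ_const_iff)
 \<comment> \<open>The distance of the limit to the iterates is needed in the 1/2-Hoelder seminorm:
   the estimate \<open>V\<close> for the integral operator is stated in it, and pointwise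
   convergence alone would not pass through the integral.\<close>
 have tail: "norm ((\<theta> t - p k t) - (\<theta> s - p k s)) <= 2 * c1 * (1/2) ^ k * sqrt (t - s)"
  if st: "0 <= s" "s <= t" "t <= T" for s t k
 proof -
  have "norm ((p (k + n) t - p k t) - (p (k + n) s - p k s)) <= 2 * c1 * (1/2) ^ k * sqrt (t - s)" for n
  proof -
   have "norm ((p (k + n) t - p k t) - (p (k + n) s - p k s)) <= c1 * sqrt (t - s) * (2 * (1/2) ^ k * (1 - (1/2) ^ n))"
   proof (induction n)
    case (Suc n)
    let ?q = "%k. p k t - p k s"
    have "norm ((p (k + Suc n) t - p k t) - (p (k + Suc n) s - p k s)) =
     norm (((p (Suc (k + n)) t - p (k + n) t) - (p (Suc (k + n)) s - p (k + n) s)) +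
      ((p (k + n) t - p k t) - (p (k + n) s - p k s)))" by (simp add: algebra_simps)
    also have "\<dots> <= c1 * sqrt (t - s) * (1/2) ^ (k + n) + c1 * sqrt (t - s) * (2 * (1/2) ^ k * (1 - (1/2) ^ n))"
     by (rule norm_triangle_mono[OF step[OF st] Suc])
    also have "\<dots> = c1 * sqrt (t - s) * (2 * (1/2) ^ k * (1 - (1/2) ^ Suc n))"
     by (simp add: power_add algebra_simps)
    finally show ?case .
   qed simp
   also have "\<dots> <= c1 * sqrt (t - s) * (2 * (1/2) ^ k * 1)"
    using c1 st by (intro mult_left_mono) auto
   finally show ?thesis by (simp add: mult_ac)
  qed
  moreover have "(%n. p (k + n) r) \<longlonglongrightarrow> \<theta> r" if "0 <= r" "r <= T" for r
   using LIMSEQ_ignore_initial_segment[OF lim[OF that], of k] by (simp add: add.commute)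
  then have "(%n. norm ((p (k + n) t - p k t) - (p (k + n) s - p k s))) \<longlonglongrightarrow> norm ((\<theta> t - p k t) - (\<theta> s - p k s))"
   by (intro tendsto_intros) (use st in auto)
  ultimately show ?thesis by (intro LIMSEQ_le_const2) auto
 qed
 have "\<theta> t - u0 = I \<theta> t" if t: "0 <= t" "t <= T" for t
 proof -
  have b: "norm (G \<theta> t - p (Suc k) t) <= C * (2 * c1 * (1/2) ^ k) * t powr \<gamma>" for k
  proof -
   have "norm ((G \<theta> t - G (p k) t) - (G \<theta> 0 - G (p k) 0)) <= C * (2 * c1 * (1/2) ^ k) * (t - 0) powr \<gamma>"
    by (rule V[OF hol\<theta> p, where S = T]) (use \<theta>0 p0 t T c1 tail in auto)
   then show ?thesis using I0[OF hol\<theta>] I0[OF p] by (simp add: pS G_def)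
  qed
  have "(%k. C * (2 * c1 * (1/2) ^ k) * t powr \<gamma>) \<longlonglongrightarrow> C * (2 * c1 * 0) * t powr \<gamma>"
   by (intro tendsto_intros LIMSEQ_realpow_zero) auto
  moreover have "C * (2 * c1 * 0) * t powr \<gamma> = 0" by simp
  ultimately have "(%k. C * (2 * c1 * (1/2) ^ k) * t powr \<gamma>) \<longlonglongrightarrow> 0" by (simp only:)
  from Lim_null_comparison[OF always_eventually[OF allI[OF b]] this]
  have "(%k. G \<theta> t - p (Suc k) t) \<longlonglongrightarrow> 0" .
  moreover have "(%k. G \<theta> t - p (Suc k) t) \<longlonglongrightarrow> G \<theta> t - \<theta> t"
   by (intro tendsto_intros LIMSEQ_Suc lim t)
  ultimately have "G \<theta> t - \<theta> t = 0" using LIMSEQ_unique by blast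
  then show ?thesis by (simp add: G_def algebra_simps)
 qed
 then have "solves T A u0 \<theta>" using I[OF hol\<theta>] by (simp add: solves_def)
 then show ?thesis using hol\<theta> by blast
qed

section \<open>Fourier transform on Schwartz functions\<close>

lemma borel_measurable_cis [measurable]: "f \<in> borel_measurable M ==> (%x. cis (f x)) \<in> borel_measurable M"
 by (rule borel_measurable_continuous_on[where f = cis]) (auto intro!: continuous_intros)

section \<open>Gaussian integrals and Fourier inversion\<close>

lemma integral_euclidean_prod:
 fixes f :: "'a::euclidean_space => real => complex"
 assumes f: "\<And>b. b \<in> Basis ==> integrable lborel (f b)"
 shows "integrable lborel (%x. \<Prod>b\<in>Basis. f b (x \<bullet> b))"
  and "(LINT x|lborel. (\<Prod>b\<in>Basis. f b (x \<bullet> b))) = (\<Prod>b\<in>Basis. (LINT y|lborel. f b y))"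
proof -
 interpret product_sigma_finite "%b::'a. lborel::real measure" ..
 let ?M = "\<Pi>\<^sub>M b\<in>(Basis::'a set). (lborel::real measure)" and ?T = "%y. \<Sum>b\<in>(Basis::'a set). y b *\<^sub>R b"
 have fm: "f b \<in> borel_measurable borel" if "b \<in> Basis" for b
  using borel_measurable_integrable[OF f[OF that]] by simp
 have m: "(%x. \<Prod>b\<in>Basis. f b (x \<bullet> b)) \<in> borel_measurable borel"
  by (intro borel_measurable_prod measurable_compose[OF _ fm]) auto
 have T: "?T \<in> measurable ?M borel" by measurable
 have eq: "(\<Prod>b\<in>Basis. f b (?T y \<bullet> b)) = (\<Prod>b\<in>Basis. f b (y b))" for y
  by (intro prod.cong) (simp_all add: inner_sum_left_Basis)
 have L: "(lborel :: 'a measure) = distr ?M borel ?T" by (rule lborel_eq)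
 have "integrable ?M (%y. \<Prod>b\<in>Basis. f b (y b))"
  by (rule product_integrable_prod) (use f in auto)
 then show "integrable lborel (%x. \<Prod>b\<in>Basis. f b (x \<bullet> b))"
  unfolding L integrable_distr_eq[OF T m] eq .
 have "integral\<^sup>L ?M (%y. \<Prod>b\<in>Basis. f b (y b)) = (\<Prod>b\<in>Basis. (LINT y|lborel. f b y))"
  by (rule product_integral_prod) (use f in auto)
 then show "(LINT x|lborel. (\<Prod>b\<in>Basis. f b (x \<bullet> b))) = (\<Prod>b\<in>Basis. (LINT y|lborel. f b y))"
  unfolding L integral_distr[OF T m] eq .
qed

text \<open>The characteristic function of the standard normal law, freed of the normalising factor
  of the density.\<close>

lemma gauss_char_1:
 "integrable lborel (%x. cis (a * x) * of_real (exp (- x\<^sup>2 / 2)))"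
 "(LINT x|lborel. cis (a * x) * of_real (exp (- x\<^sup>2 / 2))) = of_real (sqrt (2 * pi) * exp (- a\<^sup>2 / 2))"
proof -
 have n: "exp (- x\<^sup>2 / 2) = sqrt (2 * pi) * std_normal_density x" for x :: real
  by (simp add: std_normal_density_def)
 have i: "integrable lborel std_normal_density" using integrable_std_normal_moment[of 0] by simp
 then have "integrable lborel (%x::real. exp (- x\<^sup>2 / 2))" unfolding n by (rule integrable_mult_right)
 then show "integrable lborel (%x. cis (a * x) * of_real (exp (- x\<^sup>2 / 2)))"
  by (rule int_bound) (auto simp: norm_mult)
 have "(LINT x|std_normal_distribution. cis (a * x)) = of_real (exp (- (a^2) / 2))"
  using fun_cong[OF char_std_normal_distribution, of a] by (simp add: char_def cis_conv_exp)
 also have "(LINT x|std_normal_distribution. cis (a * x)) = (LINT x|lborel. std_normal_density x *\<^sub>R cis (a * x))"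
  by (rule integral_density) (auto simp: normal_density_nonneg)
 finally have c: "(LINT x|lborel. std_normal_density x *\<^sub>R cis (a * x)) = of_real (exp (- (a^2) / 2))" .
 have "(LINT x|lborel. cis (a * x) * of_real (exp (- x\<^sup>2 / 2)))
   = (LINT x|lborel. of_real (sqrt (2 * pi)) * (std_normal_density x *\<^sub>R cis (a * x)))"
  unfolding n by (intro LINT_cong) (auto simp: scaleR_conv_of_real)
 also have "\<dots> = of_real (sqrt (2 * pi)) * (LINT x|lborel. std_normal_density x *\<^sub>R cis (a * x))"
  by (rule integral_mult_right_zero)
 finally show "(LINT x|lborel. cis (a * x) * of_real (exp (- x\<^sup>2 / 2))) = of_real (sqrt (2 * pi) * exp (- a\<^sup>2 / 2))"
  unfolding c by simp
qed

text \<open>Left unnormalised, so that its Fourier transform is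
  \<open>sqrt (2 * pi) ^ DIM('a)\<close> times \<open>gs\<close> itself.\<close>

definition gs :: "'a::euclidean_space => real" where "gs x = exp (- (norm x)\<^sup>2 / 2)"

lemma gs_measurable [measurable]: "gs \<in> borel_measurable borel"
 unfolding gs_def by measurable

lemma cis_sum: "finite A ==> cis (sum f A) = (\<Prod>a\<in>A. cis (f a))"
 by (induction A rule: finite_induct) (auto simp: cis_mult[symmetric])

lemma gs_prod: "gs x = (\<Prod>b\<in>Basis. exp (- (x \<bullet> b)\<^sup>2 / 2))"
proof -
 have "(norm x)\<^sup>2 = (\<Sum>b\<in>Basis. (x \<bullet> b)\<^sup>2)"
  unfolding power2_norm_eq_inner by (subst euclidean_inner) (simp add: power2_eq_square)
 then have "- (norm x)\<^sup>2 / 2 = (\<Sum>b\<in>Basis. - (x \<bullet> b)\<^sup>2 / 2)"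
  by (simp add: sum_divide_distrib[symmetric] sum_negf)
 then show ?thesis unfolding gs_def by (simp only: exp_sum[OF finite_Basis])
qed

lemma gauss_char:
 fixes \<xi> :: "'a::euclidean_space"
 shows "integrable lborel (%x. cis (x \<bullet> \<xi>) * of_real (gs x))"
  and "(LINT x|lborel. cis (x \<bullet> \<xi>) * of_real (gs x)) = of_real (sqrt (2 * pi) ^ DIM('a) * gs \<xi>)"
proof -
 have p: "cis (x \<bullet> \<xi>) * of_real (gs x) = (\<Prod>b\<in>Basis. cis ((\<xi> \<bullet> b) * (x \<bullet> b)) * of_real (exp (- (x \<bullet> b)\<^sup>2 / 2)))" for x :: 'a
  unfolding prod.distrib gs_prod of_real_prod
  by (subst euclidean_inner) (simp add: cis_sum mult.commute)
 show "integrable lborel (%x. cis (x \<bullet> \<xi>) * of_real (gs x))"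
  unfolding p by (rule integral_euclidean_prod(1)[OF gauss_char_1(1)])
 have "(LINT x|lborel. cis (x \<bullet> \<xi>) * of_real (gs x)) = (\<Prod>b\<in>(Basis::'a set). of_real (sqrt (2 * pi) * exp (- (\<xi> \<bullet> b)\<^sup>2 / 2)))"
  unfolding p
  by (subst integral_euclidean_prod(2)[of "%b y. cis ((\<xi> \<bullet> b) * y) * of_real (exp (- y\<^sup>2 / 2))", OF gauss_char_1(1)])
    (simp only: gauss_char_1(2))
 also have "\<dots> = of_real (sqrt (2 * pi) ^ DIM('a) * gs \<xi>)"
  unfolding gs_prod of_real_prod[symmetric] prod.distrib by simp
 finally show "(LINT x|lborel. cis (x \<bullet> \<xi>) * of_real (gs x)) = of_real (sqrt (2 * pi) ^ DIM('a) * gs \<xi>)" .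
qed

lemma integrable_gs: "integrable lborel (gs :: 'a::euclidean_space => real)"
 using integrable_norm[OF gauss_char(1)[of "0::'a"]] by (simp add: gs_def[abs_def])

lemma integral_lborel_affine:
 fixes f :: "'a::euclidean_space => complex"
 assumes f [measurable]: "f \<in> borel_measurable borel" and c: "c \<noteq> 0"
 shows "(LINT x|lborel. f x) = of_real (\<bar>c\<bar> ^ DIM('a)) * (LINT x|lborel. f (t + c *\<^sub>R x))"
proof -
 have "(LINT x|lborel. f x) = (LINT x|density (distr lborel borel (%x. t + c *\<^sub>R x)) (%_. ennreal (\<bar>c\<bar>^DIM('a))). f x)"
  using lborel_affine[OF c, of t] by (simp add: ennreal_power)
 also have "\<dots> = (LINT x|distr lborel borel (%x. t + c *\<^sub>R x). (\<bar>c\<bar>^DIM('a)) *\<^sub>R f x)"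
  by (rule integral_density) auto
 also have "\<dots> = (LINT x|lborel. (\<bar>c\<bar>^DIM('a)) *\<^sub>R f (t + c *\<^sub>R x))"
  by (rule integral_distr) auto
 finally show ?thesis by (simp add: scaleR_conv_of_real)
qed

lemma integrable_translate:
 fixes f :: "'a::euclidean_space => complex"
 assumes "integrable lborel f" shows "integrable lborel (%x. f (t + x))"
proof -
 have "integrable (distr lborel borel ((+) t)) f" using assms by (simp add: lborel_distr_plus)
 then show ?thesis
  using borel_measurable_integrable[OF assms] by (subst (asm) integrable_distr_eq) auto
qed

text \<open>The form in which Fubini's theorem is applied to oscillatory and convolution integrals:
  a bounded kernel absorbs whatever depends on both variables, and integrability rests on the two
  separate factors.\<close>

lemma kernel_fubini:
 fixes u :: "'a => complex" and v :: "'b => complex" and k :: "'a => 'b => complex"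
 assumes "sigma_finite_measure M1" "sigma_finite_measure M2"
  and u: "integrable M1 u" and v: "integrable M2 v"
  and k [measurable]: "(%(x, y). k x y) \<in> borel_measurable (M1 \<Otimes>\<^sub>M M2)"
  and B: "\<And>x y. cmod (k x y) <= B"
 shows "integrable (M1 \<Otimes>\<^sub>M M2) (%(x, y). k x y * u x * v y)"
  and "(LINT x|M1. (LINT y|M2. k x y * u x * v y)) = (LINT y|M2. (LINT x|M1. k x y * u x * v y))"
  and "integrable M1 (%x. LINT y|M2. k x y * u x * v y)"
proof -
 interpret M1: sigma_finite_measure M1 by fact
 interpret M2: sigma_finite_measure M2 by fact
 interpret pair_sigma_finite M1 M2 ..
 have [measurable]: "u \<in> borel_measurable M1" "v \<in> borel_measurable M2" using u v by auto
 have B0: "0 <= B" using B[of undefined undefined] norm_ge_zero order_trans by blast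
 have bd: "cmod (k x y * u x * v y) <= B * cmod (u x) * cmod (v y)" for x y
  unfolding norm_mult using B by (intro mult_right_mono) auto
 have i2: "integrable M2 (%y. k x y * u x * v y)" if "x \<in> space M1" for x
 proof (rule int_bound)
  show "integrable M2 (%y. B * cmod (u x) * cmod (v y))" using v by auto
  have "(%y. k x y) \<in> borel_measurable M2" using measurable_Pair2[OF k that] by simp
  then show "(%y. k x y * u x * v y) \<in> borel_measurable M2" by measurable
 qed (use bd B0 in auto)
 show main: "integrable (M1 \<Otimes>\<^sub>M M2) (%(x, y). k x y * u x * v y)"
 proof (rule Fubini_integrable)
  show "(%(x, y). k x y * u x * v y) \<in> borel_measurable (M1 \<Otimes>\<^sub>M M2)" by measurable
  show "AE x in M1. integrable M2 (%y. case (x, y) of (x, y) => k x y * u x * v y)"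
   using i2 by auto
  show "integrable M1 (%x. LINT y|M2. norm (case (x, y) of (x, y) => k x y * u x * v y))"
  proof (rule int_bound)
   show "integrable M1 (%x. B * cmod (u x) * (LINT y|M2. cmod (v y)))" using u by auto
   show "(%x. LINT y|M2. norm (case (x, y) of (x, y) => k x y * u x * v y)) \<in> borel_measurable M1"
    by measurable
   show "AE x in M1. norm (LINT y|M2. norm (case (x, y) of (x, y) => k x y * u x * v y))
     <= norm (B * cmod (u x) * (LINT y|M2. cmod (v y)))"
   proof (rule AE_I2)
    fix x assume x: "x \<in> space M1"
    have "(LINT y|M2. norm (k x y * u x * v y)) <= (LINT y|M2. B * cmod (u x) * cmod (v y))"
     using i2[OF x] v bd by (intro integral_mono) auto
    moreover have "0 <= (LINT y|M2. norm (k x y * u x * v y))" by (rule integral_nonneg_AE) auto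
    ultimately show "norm (LINT y|M2. norm (case (x, y) of (x, y) => k x y * u x * v y))
     <= norm (B * cmod (u x) * (LINT y|M2. cmod (v y)))" by simp
   qed
  qed
 qed
 show "(LINT x|M1. (LINT y|M2. k x y * u x * v y)) = (LINT y|M2. (LINT x|M1. k x y * u x * v y))"
  using Fubini_integral[OF main] by simp
 show "integrable M1 (%x. LINT y|M2. k x y * u x * v y)"
  using integrable_fst'[OF main] by simp
qed

text \<open>The sign \<open>s\<close> covers the Fourier transform and, up to a constant, its
  inverse, so that each property is proved once.\<close>

definition FF :: "real => ('a::euclidean_space => complex) => 'a => complex" where
 "FF s \<phi> \<xi> = (LINT x|lborel. cis (s * (x \<bullet> \<xi>)) * \<phi> x)"

lemma fourier_FF: "fourier \<phi> = FF (-1) \<phi>"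
 by (simp add: fun_eq_iff fourier_def FF_def cis_conv_exp)

lemma inv_fourier_FF: "inv_fourier \<phi> (x :: real^'n::finite) = FF 1 \<phi> x / of_real ((2 * pi) ^ CARD('n))"
 by (simp add: inv_fourier_def FF_def cis_conv_exp inner_commute)

lemma FF_measurable [measurable]:
 assumes [measurable]: "\<phi> \<in> borel_measurable borel"
 shows "FF s \<phi> \<in> borel_measurable borel"
 unfolding FF_def[abs_def] by measurable

text \<open>The undamped double integral need not converge absolutely. A factor
  \<open>gs (\<epsilon> *\<^sub>R \<xi>)\<close> permits the exchange and turns the inner integral
  into a narrow Gaussian around \<open>x\<close>. As \<open>\<epsilon>\<close> tends to 0,
  \<open>L\<close> converges by integrability of \<open>FF s \<phi>\<close> and \<open>R\<close> by
  boundedness and continuity of \<open>\<phi>\<close>. One factor \<open>q\<close> is the transform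
  constant of the Gaussian, the other its mass.\<close>

theorem FF_inversion:
 fixes \<phi> :: "'a::euclidean_space => complex"
 assumes cont: "continuous_on UNIV \<phi>" and bnd: "\<And>x. cmod (\<phi> x) <= B"
  and int: "integrable lborel \<phi>" and int': "integrable lborel (FF s \<phi>)" and s: "\<bar>s\<bar> = 1"
 shows "FF (- s) (FF s \<phi>) x = of_real ((2 * pi) ^ DIM('a)) * \<phi> x"
proof -
 define d where "d = DIM('a)"
 define q where "q = sqrt (2 * pi) ^ d"
 have qq: "q * q = (2 * pi) ^ d" unfolding q_def using power_mult_distrib[of "sqrt (2 * pi)" "sqrt (2 * pi)" d] by simp
 have [measurable]: "\<phi> \<in> borel_measurable borel" using cont by (rule borel_measurable_continuous_onI)
 define L where "L \<epsilon> = (LINT \<xi>|lborel. cis (- s * (\<xi> \<bullet> x)) * FF s \<phi> \<xi> * of_real (gs (\<epsilon> *\<^sub>R \<xi>)))" for \<epsilon>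
 define R where "R \<epsilon> = (LINT v|lborel. \<phi> (x + \<epsilon> *\<^sub>R v) * of_real (gs v))" for \<epsilon>
 have LR: "L \<epsilon> = of_real q * R \<epsilon>" if \<epsilon>: "0 < \<epsilon>" for \<epsilon>
 proof -
  have ig: "integrable lborel (%\<xi>::'a. complex_of_real (gs (\<epsilon> *\<^sub>R \<xi>)))"
  proof -
   have "integrable lborel (gs :: 'a => real)" by (rule integrable_gs)
   then have "integrable (density (distr lborel borel (%x. 0 + \<epsilon> *\<^sub>R x)) (%_. ennreal (\<bar>\<epsilon>\<bar>^DIM('a)))) (gs :: 'a => real)"
    using lborel_affine[of \<epsilon> "0::'a"] \<epsilon> by (simp add: ennreal_power)
   then have "integrable lborel (%x::'a. (\<bar>\<epsilon>\<bar>^DIM('a)) *\<^sub>R gs (0 + \<epsilon> *\<^sub>R x))"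
    by (subst (asm) integrable_density) (auto simp: integrable_distr_eq)
   then show ?thesis using \<epsilon> by simp
  qed
  have inner: "(LINT \<xi>|lborel. cis (a \<bullet> \<xi>) * of_real (gs (\<epsilon> *\<^sub>R \<xi>))) = of_real ((1/\<epsilon>) ^ d * q * gs ((1/\<epsilon>) *\<^sub>R a))" for a :: 'a
  proof -
   have "(LINT \<xi>|lborel. cis (a \<bullet> \<xi>) * of_real (gs (\<epsilon> *\<^sub>R \<xi>)))
     = of_real (\<bar>1/\<epsilon>\<bar> ^ d) * (LINT \<xi>|lborel. cis (a \<bullet> (0 + (1/\<epsilon>) *\<^sub>R \<xi>)) * of_real (gs (\<epsilon> *\<^sub>R (0 + (1/\<epsilon>) *\<^sub>R \<xi>))))"
    unfolding d_def by (rule integral_lborel_affine) (use \<epsilon> in auto)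
   also have "(%\<xi>. cis (a \<bullet> (0 + (1/\<epsilon>) *\<^sub>R \<xi>)) * complex_of_real (gs (\<epsilon> *\<^sub>R (0 + (1/\<epsilon>) *\<^sub>R \<xi>))))
     = (%\<xi>. cis (\<xi> \<bullet> ((1/\<epsilon>) *\<^sub>R a)) * of_real (gs \<xi>))"
    using \<epsilon> by (simp add: inner_commute fun_eq_iff)
   also have "integral\<^sup>L lborel \<dots> = of_real (q * gs ((1/\<epsilon>) *\<^sub>R a))"
    unfolding q_def d_def by (rule gauss_char)
   finally show ?thesis using \<epsilon> by simp
  qed
  have km: "(%(\<xi>, y). cis (s * (y \<bullet> \<xi>) - s * (\<xi> \<bullet> x))) \<in> borel_measurable (lborel \<Otimes>\<^sub>M lborel)"
   by measurable
  note fub = kernel_fubini(2)[OF sigma_finite_lborel sigma_finite_lborel ig int km, of 1]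
  have "L \<epsilon> = (LINT \<xi>|lborel. (LINT y|lborel. cis (s * (y \<bullet> \<xi>) - s * (\<xi> \<bullet> x)) * of_real (gs (\<epsilon> *\<^sub>R \<xi>)) * \<phi> y))"
   unfolding L_def FF_def
  proof (rule LINT_cong[OF refl])
   fix \<xi> :: 'a
   have "(LINT y|lborel. cis (s * (y \<bullet> \<xi>) - s * (\<xi> \<bullet> x)) * of_real (gs (\<epsilon> *\<^sub>R \<xi>)) * \<phi> y) =
    (LINT y|lborel. (cis (- s * (\<xi> \<bullet> x)) * of_real (gs (\<epsilon> *\<^sub>R \<xi>))) * (cis (s * (y \<bullet> \<xi>)) * \<phi> y))"
    by (intro LINT_cong[OF refl])
      (simp only: diff_conv_add_uminus cis_mult[symmetric] mult_minus_left mult_ac)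
   also have "\<dots> = (cis (- s * (\<xi> \<bullet> x)) * of_real (gs (\<epsilon> *\<^sub>R \<xi>))) * (LINT y|lborel. cis (s * (y \<bullet> \<xi>)) * \<phi> y)"
    by (rule integral_mult_right_zero)
   finally show "cis (- s * (\<xi> \<bullet> x)) * (LINT y|lborel. cis (s * (y \<bullet> \<xi>)) * \<phi> y) * of_real (gs (\<epsilon> *\<^sub>R \<xi>)) =
    (LINT y|lborel. cis (s * (y \<bullet> \<xi>) - s * (\<xi> \<bullet> x)) * of_real (gs (\<epsilon> *\<^sub>R \<xi>)) * \<phi> y)"
    by (simp only: mult_ac)
  qed
  also have "\<dots> = (LINT y|lborel. (LINT \<xi>|lborel. cis (s * (y \<bullet> \<xi>) - s * (\<xi> \<bullet> x)) * of_real (gs (\<epsilon> *\<^sub>R \<xi>)) * \<phi> y))"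
   by (rule fub) simp
  also have "\<dots> = (LINT y|lborel. of_real ((1/\<epsilon>) ^ d * q * gs ((1/\<epsilon>) *\<^sub>R (s *\<^sub>R (y - x)))) * \<phi> y)"
  proof (rule LINT_cong[OF refl])
   fix y :: 'a
   have "(LINT \<xi>|lborel. cis (s * (y \<bullet> \<xi>) - s * (\<xi> \<bullet> x)) * of_real (gs (\<epsilon> *\<^sub>R \<xi>)) * \<phi> y)
    = (LINT \<xi>|lborel. (cis ((s *\<^sub>R (y - x)) \<bullet> \<xi>) * of_real (gs (\<epsilon> *\<^sub>R \<xi>))) * \<phi> y)"
   proof -
    have "s * (y \<bullet> \<xi>) - s * (\<xi> \<bullet> x) = (s *\<^sub>R (y - x)) \<bullet> \<xi>" for \<xi>
     by (simp add: inner_diff_left right_diff_distrib inner_commute[of \<xi> x])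
    then show ?thesis by (simp only:)
   qed
   also have "\<dots> = (LINT \<xi>|lborel. (cis ((s *\<^sub>R (y - x)) \<bullet> \<xi>) * of_real (gs (\<epsilon> *\<^sub>R \<xi>)))) * \<phi> y"
    by (rule integral_mult_left_zero)
   finally show "(LINT \<xi>|lborel. cis (s * (y \<bullet> \<xi>) - s * (\<xi> \<bullet> x)) * of_real (gs (\<epsilon> *\<^sub>R \<xi>)) * \<phi> y)
    = of_real ((1/\<epsilon>) ^ d * q * gs ((1/\<epsilon>) *\<^sub>R (s *\<^sub>R (y - x)))) * \<phi> y"
    unfolding inner .
  qed
  also have "\<dots> = of_real (\<bar>\<epsilon>\<bar> ^ d) * (LINT v|lborel. of_real ((1/\<epsilon>) ^ d * q * gs ((1/\<epsilon>) *\<^sub>R (s *\<^sub>R ((x + \<epsilon> *\<^sub>R v) - x)))) * \<phi> (x + \<epsilon> *\<^sub>R v))"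
   unfolding d_def by (rule integral_lborel_affine) (use \<epsilon> in auto)
  also have "(%v. complex_of_real ((1/\<epsilon>) ^ d * q * gs ((1/\<epsilon>) *\<^sub>R (s *\<^sub>R ((x + \<epsilon> *\<^sub>R v) - x)))) * \<phi> (x + \<epsilon> *\<^sub>R v))
    = (%v. of_real ((1/\<epsilon>) ^ d * q) * (\<phi> (x + \<epsilon> *\<^sub>R v) * of_real (gs v)))"
   using \<epsilon> s by (simp add: fun_eq_iff gs_def power_mult_distrib)
  also have "integral\<^sup>L lborel \<dots> = of_real ((1/\<epsilon>) ^ d * q) * R \<epsilon>"
   unfolding R_def by (rule integral_mult_right_zero)
  also have "of_real (\<bar>\<epsilon>\<bar> ^ d) * (of_real ((1/\<epsilon>) ^ d * q) * R \<epsilon>) = of_real q * R \<epsilon>"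
  proof -
   have "\<bar>\<epsilon>\<bar> ^ d * ((1/\<epsilon>) ^ d) = 1" using \<epsilon> power_mult_distrib[of "\<bar>\<epsilon>\<bar>" "1/\<epsilon>" d] by simp
   then have "\<bar>\<epsilon>\<bar> ^ d * ((1/\<epsilon>) ^ d * q) = q" by (metis mult.assoc mult_1)
   then show ?thesis by (metis mult.assoc of_real_mult)
  qed
  finally show ?thesis .
 qed
 define e where "e n = inverse (real (Suc n))" for n
 have e0: "0 < e n" for n by (simp add: e_def)
 have elim: "e \<longlonglongrightarrow> 0" unfolding e_def by (rule LIMSEQ_inverse_real_of_nat)
 have gcont: "isCont (gs :: 'a => real) y" for y unfolding gs_def by (intro continuous_intros) simp
 have gs1: "0 <= gs y" "gs y <= 1" for y :: 'a by (simp_all add: gs_def)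
 have Ll: "(%n. L (e n)) \<longlonglongrightarrow> FF (- s) (FF s \<phi>) x"
  unfolding L_def FF_def[of "- s"]
 proof (rule integral_dominated_convergence[where w = "%\<xi>. cmod (FF s \<phi> \<xi>)"])
  show "AE \<xi> in lborel. (%n. cis (- s * (\<xi> \<bullet> x)) * FF s \<phi> \<xi> * of_real (gs (e n *\<^sub>R \<xi>))) \<longlonglongrightarrow> cis (- s * (\<xi> \<bullet> x)) * FF s \<phi> \<xi>"
  proof (rule AE_I2)
   fix \<xi> :: 'a
   have "(%n. gs (e n *\<^sub>R \<xi>)) \<longlonglongrightarrow> gs (0 *\<^sub>R \<xi>)"
    by (rule isCont_tendsto_compose[OF gcont tendsto_scaleR[OF elim tendsto_const]])
   then have "(%n. cis (- s * (\<xi> \<bullet> x)) * FF s \<phi> \<xi> * of_real (gs (e n *\<^sub>R \<xi>))) \<longlonglongrightarrow> cis (- s * (\<xi> \<bullet> x)) * FF s \<phi> \<xi> * of_real (gs (0 *\<^sub>R \<xi>))"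
    by (intro tendsto_mult tendsto_const tendsto_of_real)
   then show "(%n. cis (- s * (\<xi> \<bullet> x)) * FF s \<phi> \<xi> * of_real (gs (e n *\<^sub>R \<xi>))) \<longlonglongrightarrow> cis (- s * (\<xi> \<bullet> x)) * FF s \<phi> \<xi>"
    by (simp add: gs_def)
  qed
  show "AE \<xi> in lborel. cmod (cis (- s * (\<xi> \<bullet> x)) * FF s \<phi> \<xi> * of_real (gs (e n *\<^sub>R \<xi>))) <= cmod (FF s \<phi> \<xi>)" for n
   using gs1 by (intro AE_I2) (simp add: norm_mult mult_left_le)
 qed (use int' in auto)
 have Rl: "(%n. R (e n)) \<longlonglongrightarrow> (LINT v|lborel. \<phi> x * of_real (gs (v::'a)))"
  unfolding R_def
 proof (rule integral_dominated_convergence[where w = "%v. B * gs v"])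
  show "AE v in lborel. (%n. \<phi> (x + e n *\<^sub>R v) * of_real (gs v)) \<longlonglongrightarrow> \<phi> x * of_real (gs v)"
  proof (rule AE_I2)
   fix v :: 'a
   have "isCont \<phi> (x + 0 *\<^sub>R v)" using cont by (simp add: continuous_on_eq_continuous_at)
   then have "(%n. \<phi> (x + e n *\<^sub>R v)) \<longlonglongrightarrow> \<phi> (x + 0 *\<^sub>R v)"
    by (rule isCont_tendsto_compose) (intro tendsto_intros elim)
   then show "(%n. \<phi> (x + e n *\<^sub>R v) * of_real (gs v)) \<longlonglongrightarrow> \<phi> x * of_real (gs v)"
    by (intro tendsto_mult tendsto_const) simp
  qed
  show "AE v in lborel. cmod (\<phi> (x + e n *\<^sub>R v) * of_real (gs v)) <= B * gs v" for n
   using bnd gs1 by (intro AE_I2) (simp add: norm_mult mult_right_mono)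
 qed (use integrable_gs in auto)
 have "(LINT v|lborel. \<phi> x * of_real (gs (v::'a))) = \<phi> x * (LINT v|lborel. of_real (gs (v::'a)))"
  by (rule integral_mult_right_zero)
 also have "(LINT v|lborel. complex_of_real (gs (v::'a))) = of_real q"
  using gauss_char(2)[of "0::'a"] by (simp add: q_def d_def gs_def)
 finally have eq: "(LINT v|lborel. \<phi> x * of_real (gs (v::'a))) = \<phi> x * of_real q" .
 have Rl': "(%n. R (e n)) \<longlonglongrightarrow> \<phi> x * of_real q" using Rl unfolding eq .
 have "(%n. L (e n)) \<longlonglongrightarrow> of_real q * (\<phi> x * of_real q)"
  unfolding LR[OF e0] by (intro tendsto_mult tendsto_const Rl')
 then have "FF (- s) (FF s \<phi>) x = of_real q * (\<phi> x * of_real q)" by (rule LIMSEQ_unique[OF Ll])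
 also have "\<dots> = of_real (q * q) * \<phi> x" by simp
 finally show ?thesis unfolding qq d_def .
qed

section \<open>Schwartz functions and their multipliers\<close>

definition rapid :: "('a::real_normed_vector => 'b::real_normed_vector) => bool" where
 "rapid f \<longleftrightarrow> (\<forall>k. bounded (range (%x. (1 + norm x) ^ k *\<^sub>R f x)))"

lemma rapid_bound:
 assumes "rapid f" shows "\<exists>C\<ge>0. \<forall>x. (1 + norm x) ^ k * norm (f x) <= C"
proof -
 obtain C where "\<forall>y\<in>range (%x. (1 + norm x) ^ k *\<^sub>R f x). norm y <= C"
  using assms unfolding rapid_def bounded_iff by blast
 then have C: "(1 + norm x) ^ k * norm (f x) <= C" for x by (auto simp: abs_of_nonneg)
 have "0 <= (1 + norm (0::'a)) ^ k * norm (f 0)" by simp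
 then have "0 <= C" using C[of 0] by linarith
 then show ?thesis using C by blast
qed

lemma rapidI:
 assumes "\<And>k. \<exists>C. \<forall>x. (1 + norm x) ^ k * norm (f x) <= C" shows "rapid f"
 unfolding rapid_def
proof
 fix k
 obtain C where C: "\<forall>x. (1 + norm x) ^ k * norm (f x) <= C" using assms by blast
 show "bounded (range (%x. (1 + norm x) ^ k *\<^sub>R f x))"
  by (rule boundedI[of _ C]) (use C in \<open>auto simp: abs_of_nonneg\<close>)
qed

lemma rapid_add:
 assumes "rapid f" "rapid g" shows "rapid (%x. f x + g x)"
proof (rule rapidI)
 fix k
 obtain C where C: "\<forall>x. (1 + norm x) ^ k * norm (f x) <= C" using rapid_bound[OF assms(1)] by blast
 obtain D where D: "\<forall>x. (1 + norm x) ^ k * norm (g x) <= D" using rapid_bound[OF assms(2)] by blast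
 have "(1 + norm x) ^ k * norm (f x + g x) <= C + D" for x
 proof -
  have "(1 + norm x) ^ k * norm (f x + g x) <= (1 + norm x) ^ k * (norm (f x) + norm (g x))"
   by (intro mult_left_mono norm_triangle_ineq) auto
  then show ?thesis using C[rule_format, of x] D[rule_format, of x] by (simp add: distrib_left)
 qed
 then show "\<exists>C. \<forall>x. (1 + norm x) ^ k * norm (f x + g x) <= C" by blast
qed

lemma pderiv_atI: "(f has_derivative D) (at x) ==> pderiv_at i f x = D (axis i 1)"
 unfolding pderiv_at_def using frechet_derivative_at by metis

lemma differentiable_deriv:
 assumes "f differentiable (at x)" shows "(f has_derivative frechet_derivative f (at x)) (at x)"
 using assms by (simp add: frechet_derivative_works)

lemma pderivs_Cons: "pderivs (i # is) f = pderiv_at i (pderivs is f)"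
 and pderivs_Nil: "pderivs [] f = f"
 and pderivs_snoc: "pderivs (is @ [i]) f = pderivs is (pderiv_at i f)"
 by (simp_all add: pderivs_def)

text \<open>A coinduction principle: one derivative at a time suffices, which avoids formulas for
  iterated derivatives of products and Fourier integrals.\<close>

lemma schwartz_coinduct:
 fixes f :: "real^'n::finite => complex"
 assumes f: "X f"
  and diff: "\<And>g x. X g ==> g differentiable (at x)"
  and rap: "\<And>g. X g ==> rapid g"
  and pd: "\<And>g i. X g ==> X (pderiv_at i g)"
 shows "f \<in> schwartz"
proof -
 have "X (pderivs is f)" for "is"
  by (induction "is") (auto simp: pderivs_Nil pderivs_Cons f pd)
 then have "pderivs is f differentiable (at x)" "rapid (pderivs is f)" for "is" x
  using diff rap by auto
 then show ?thesis by (simp add: schwartz_def smooth_def rapid_def)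
qed

lemma schwartzD:
 assumes "f \<in> schwartz" shows "pderivs is f differentiable (at x)" "rapid (pderivs is f)"
 using assms by (auto simp: schwartz_def smooth_def rapid_def)

lemma schwartz_differentiable: "f \<in> schwartz ==> f differentiable (at x)"
 by (drule schwartzD(1)[of _ "[]"]) (simp add: pderivs_Nil)

lemma schwartz_rapid: "f \<in> schwartz ==> rapid f"
 by (drule schwartzD(2)[of _ "[]"]) (simp add: pderivs_Nil)

lemma schwartz_pderiv: "f \<in> schwartz ==> pderiv_at i f \<in> schwartz"
 using schwartzD[of f "_ @ [i]"] by (simp add: pderivs_snoc schwartz_def smooth_def rapid_def)

lemma schwartz_continuous: "f \<in> schwartz ==> continuous_on UNIV f"
 using schwartz_differentiable
 by (metis continuous_at_imp_continuous_on differentiable_imp_continuous_within)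

lemma schwartz_measurable [measurable_dest]: "f \<in> schwartz ==> f \<in> borel_measurable borel"
 by (rule borel_measurable_continuous_onI[OF schwartz_continuous])

lemma schwartz_bounded:
 assumes "f \<in> schwartz" shows "\<exists>B\<ge>0. \<forall>x. cmod (f x) <= B"
 using rapid_bound[OF schwartz_rapid[OF assms], of 0] by simp

text \<open>The pointwise multipliers of Schwartz space: the power of growth may depend on the
  derivative.\<close>

definition slow :: "(real^'n::finite => complex) => bool" where
 "slow m \<longleftrightarrow> (\<forall>is. (\<forall>x. pderivs is m differentiable (at x)) \<and>
   (\<exists>k C. \<forall>x. norm (pderivs is m x) <= C * (1 + norm x) ^ k))"

lemma slowD:
 assumes "slow f" shows "pderivs is f differentiable (at x)" "\<exists>k C. \<forall>x. norm (pderivs is f x) <= C * (1 + norm x) ^ k"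
 using assms by (auto simp: slow_def)

lemma slow_coinduct:
 fixes f :: "real^'n::finite => complex"
 assumes f: "X f"
  and diff: "\<And>g x. X g ==> g differentiable (at x)"
  and rap: "\<And>g. X g ==> \<exists>k C. \<forall>x. norm (g x) <= C * (1 + norm x) ^ k"
  and pd: "\<And>g i. X g ==> X (pderiv_at i g)"
 shows "slow f"
proof -
 have "X (pderivs is f)" for "is"
  by (induction "is") (auto simp: pderivs_Nil pderivs_Cons f pd)
 then have "pderivs is f differentiable (at x)" "\<exists>k C. \<forall>x. norm (pderivs is f x) <= C * (1 + norm x) ^ k" for "is" x
  using diff rap by auto
 then show ?thesis by (simp add: slow_def)
qed

lemma slow_differentiable: "slow f ==> f differentiable (at x)"
 by (drule slowD(1)[of _ "[]"]) (simp add: pderivs_Nil)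

lemma slow_growth: "slow f ==> \<exists>k C. \<forall>x. norm (f x) <= C * (1 + norm x) ^ k"
 by (drule slowD(2)[of _ "[]"]) (simp add: pderivs_Nil)

lemma slow_pderiv: "slow f ==> slow (pderiv_at i f)"
 using slowD[of f "_ @ [i]"] by (simp add: pderivs_snoc slow_def)

lemma schwartz_slow:
 assumes "f \<in> schwartz" shows "slow f"
proof (rule slow_coinduct[where X = "%f. f \<in> schwartz", OF assms])
 fix g :: "real^'a => complex" assume "g \<in> schwartz"
 then obtain B where "\<forall>x. cmod (g x) <= B" using schwartz_bounded by blast
 then show "\<exists>k C. \<forall>x. cmod (g x) <= C * (1 + norm x) ^ k"
  by (intro exI[of _ 0] exI[of _ B]) simp
qed (auto intro: schwartz_differentiable schwartz_pderiv)

text \<open>Products alone are not visibly closed under differentiation; with sums added the Leibniz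
  rule stays inside the class, as \<open>schwartz_coinduct\<close> demands.\<close>

inductive slow_times_schwartz :: "(real^'n::finite => complex) => bool" where
 "slow m ==> \<phi> \<in> schwartz ==> slow_times_schwartz (%x. m x * \<phi> x)"
| "slow_times_schwartz f ==> slow_times_schwartz g ==> slow_times_schwartz (%x. f x + g x)"

lemma slow_times_schwartz_differentiable: "slow_times_schwartz f ==> f differentiable (at x)"
 by (induction rule: slow_times_schwartz.induct)
   (auto intro: differentiable_mult differentiable_add slow_differentiable schwartz_differentiable)

lemma slow_times_schwartz_rapid: "slow_times_schwartz f ==> rapid f"
proof (induction rule: slow_times_schwartz.induct)
 case (1 m \<phi>)
 obtain k C where m: "\<forall>x. norm (m x) <= C * (1 + norm x) ^ k" using slow_growth[OF 1(1)] by blast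
 have C: "0 <= C" using order_trans[OF norm_ge_zero m[rule_format, of 0]] by simp
 show ?case
 proof (rule rapidI)
  fix l
  obtain B where B: "\<forall>x. (1 + norm x) ^ (l + k) * norm (\<phi> x) <= B"
   using rapid_bound[OF schwartz_rapid[OF 1(2)]] by blast
  have "(1 + norm x) ^ l * norm (m x * \<phi> x) <= C * B" for x
  proof -
   have "(1 + norm x) ^ l * norm (m x * \<phi> x) = norm (m x) * ((1 + norm x) ^ l * norm (\<phi> x))"
    by (simp add: norm_mult)
   also have "\<dots> <= (C * (1 + norm x) ^ k) * ((1 + norm x) ^ l * norm (\<phi> x))"
    using m by (intro mult_right_mono) auto
   also have "\<dots> = C * ((1 + norm x) ^ (l + k) * norm (\<phi> x))" by (simp add: power_add)
   also have "\<dots> <= C * B" using B C by (intro mult_left_mono) auto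
   finally show ?thesis .
  qed
  then show "\<exists>D. \<forall>x. (1 + norm x) ^ l * norm (m x * \<phi> x) <= D" by blast
 qed
next
 case (2 f g)
 then show ?case by (intro rapid_add)
qed

lemma slow_times_schwartz_pderiv: "slow_times_schwartz f ==> slow_times_schwartz (pderiv_at i f)"
proof (induction rule: slow_times_schwartz.induct)
 case (1 m \<phi>)
 have "pderiv_at i (%x. m x * \<phi> x) = (%x. m x * pderiv_at i \<phi> x + pderiv_at i m x * \<phi> x)"
 proof
  fix x
  have "((%x. m x * \<phi> x) has_derivative (%h. m x * frechet_derivative \<phi> (at x) h + frechet_derivative m (at x) h * \<phi> x)) (at x)"
   by (intro has_derivative_mult differentiable_deriv slow_differentiable schwartz_differentiable 1)
  then show "pderiv_at i (%x. m x * \<phi> x) x = m x * pderiv_at i \<phi> x + pderiv_at i m x * \<phi> x"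
   by (subst pderiv_atI, assumption) (simp add: pderiv_at_def)
 qed
 then show ?case
  using slow_times_schwartz.intros(1)[OF 1(1) schwartz_pderiv[OF 1(2), of i]]
   slow_times_schwartz.intros(1)[OF slow_pderiv[OF 1(1), of i] 1(2)]
   slow_times_schwartz.intros(2) by simp
next
 case (2 f g)
 have "pderiv_at i (%x. f x + g x) = (%x. pderiv_at i f x + pderiv_at i g x)"
 proof
  fix x
  have "((%x. f x + g x) has_derivative (%h. frechet_derivative f (at x) h + frechet_derivative g (at x) h)) (at x)"
   by (intro has_derivative_add differentiable_deriv slow_times_schwartz_differentiable 2)
  then show "pderiv_at i (%x. f x + g x) x = pderiv_at i f x + pderiv_at i g x"
   by (subst pderiv_atI, assumption) (simp add: pderiv_at_def)
 qed
 then show ?case using slow_times_schwartz.intros(2)[OF 2(3,4)] by simp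
qed

lemma schwartz_mult: "slow m ==> \<phi> \<in> schwartz ==> (%x. m x * \<phi> x) \<in> schwartz"
 by (rule schwartz_coinduct[where X = slow_times_schwartz])
   (auto intro: slow_times_schwartz.intros slow_times_schwartz_differentiable
    slow_times_schwartz_rapid slow_times_schwartz_pderiv)

lemma pderiv_at_const: "pderiv_at i (%_. c) = (%_. 0)"
 by (intro ext, subst pderiv_atI[OF has_derivative_const]) simp

lemma slow_const: "slow (%_. c)"
proof (rule slow_coinduct[where X = "%f. \<exists>c. f = (%_. c)"])
 fix g :: "real^'a => complex" assume "\<exists>c. g = (%_. c)"
 then obtain c where g: "g = (%_. c)" by blast
 show "g differentiable (at x)" for x unfolding g by simp
 show "\<exists>k C. \<forall>x. norm (g x) <= C * (1 + norm x) ^ k"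
  unfolding g by (intro exI[of _ 0] exI[of _ "norm c"]) simp
 show "\<exists>c. pderiv_at i g = (%_. c)" for i unfolding g pderiv_at_const by blast
qed blast

lemma slow_coord: "slow (%x :: real^'n::finite. c * of_real (x $ i))"
proof (rule slow_coinduct[where X = "%f. slow f \<or> f = (%x :: real^'n. c * of_real (x $ i))"])
 have D: "((%x :: real^'n. c * of_real (x $ i)) has_derivative (%h. c * of_real (h $ i))) (at x)" for x
  by (intro bounded_linear_imp_has_derivative bounded_linear_const_mult
     bounded_linear_compose[OF bounded_linear_of_real bounded_linear_vec_nth])
 fix g :: "real^'n => complex" assume g: "slow g \<or> g = (%x. c * of_real (x $ i))"
 then show "g differentiable (at x)" for x
  using D slow_differentiable unfolding differentiable_def by blast
 show "\<exists>k C. \<forall>x. norm (g x) <= C * (1 + norm x) ^ k"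
 proof (cases "slow g")
  case False
  with g have "g = (%x. c * of_real (x $ i))" by blast
  moreover have "norm (c * of_real (x $ i)) <= norm c * (1 + norm x) ^ 1" for x :: "real^'n"
   using component_le_norm_cart[of x i] by (simp add: norm_mult mult_left_mono)
  ultimately show ?thesis by blast
 qed (use slow_growth in blast)
 show "slow (pderiv_at j g) \<or> pderiv_at j g = (%x. c * of_real (x $ i))" for j
 proof (cases "slow g")
  case False
  with g have "g = (%x. c * of_real (x $ i))" by blast
  then have "pderiv_at j g = (%x. c * of_real (axis j 1 $ i))" using pderiv_atI[OF D] by auto
  then show ?thesis using slow_const[where 'a = 'n, of "c * complex_of_real (axis j 1 $ i)"] by simp
 qed (use slow_pderiv in blast)
qed simp

lemma schwartz_cmult: "\<phi> \<in> schwartz ==> (%x. c * \<phi> x) \<in> schwartz"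
 by (rule schwartz_mult[OF slow_const])

lemma schwartz_add:
 assumes "f \<in> schwartz" "g \<in> schwartz" shows "(%x. f x + g x) \<in> schwartz"
proof (rule schwartz_coinduct[where X = slow_times_schwartz])
 show "slow_times_schwartz (%x. f x + g x)"
  using slow_times_schwartz.intros(2)[OF slow_times_schwartz.intros(1)[OF slow_const[of 1] assms(1)]
    slow_times_schwartz.intros(1)[OF slow_const[of 1] assms(2)]] by simp
qed (auto intro: slow_times_schwartz_differentiable slow_times_schwartz_rapid slow_times_schwartz_pderiv)

text \<open>Each coordinate satisfies
  \<open>1 + (x \<bullet> b)\<^sup>2 <= (1 + norm x)\<^sup>2\<close>, so a product of
  one-dimensional Cauchy densities is a majorant; this is the origin of the exponent, twice the
  dimension.\<close>

lemma integrable_decay: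
 "integrable lborel (%x::'a::euclidean_space. 1 / (1 + norm x) ^ (2 * DIM('a)))"
proof -
 have "set_integrable lborel (einterval (-\<infinity>) \<infinity>) (%x. inverse (1 + x\<^sup>2))"
  by (rule integrable_inverse_1_plus_square)
 then have "integrable lborel (%x::real. inverse (1 + x\<^sup>2))" by (simp add: set_integrable_def)
 then have 1: "integrable lborel (%x::real. complex_of_real (inverse (1 + x\<^sup>2)))"
  by (rule integrable_of_real)
 have "integrable lborel (%x::'a. \<Prod>b\<in>Basis. complex_of_real (inverse (1 + (x \<bullet> b)\<^sup>2)))"
  by (rule integral_euclidean_prod(1)[OF 1])
 then show ?thesis
 proof (rule int_bound)
  show "AE x::'a in lborel. norm (1 / (1 + norm x) ^ (2 * DIM('a))) <= norm (\<Prod>b\<in>Basis. complex_of_real (inverse (1 + (x \<bullet> b)\<^sup>2)))"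
  proof (rule AE_I2)
   fix x :: 'a
   have "inverse ((1 + norm x)\<^sup>2) <= inverse (1 + (x \<bullet> b)\<^sup>2)" if "b \<in> Basis" for b
   proof (rule le_imp_inverse_le)
    have "\<bar>x \<bullet> b\<bar> <= norm x" using that by (rule Basis_le_norm)
    then have "(x \<bullet> b)\<^sup>2 <= (norm x)\<^sup>2" by (metis abs_ge_zero power2_abs power_mono)
    then show "1 + (x \<bullet> b)\<^sup>2 <= (1 + norm x)\<^sup>2" by (simp add: power2_sum add_increasing2)
    show "0 < 1 + (x \<bullet> b)\<^sup>2" by (simp add: add_pos_nonneg)
   qed
   then have "(\<Prod>b\<in>(Basis::'a set). inverse ((1 + norm x)\<^sup>2)) <= (\<Prod>b\<in>Basis. inverse (1 + (x \<bullet> b)\<^sup>2))"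
    by (intro prod_mono) auto
   also have "(\<Prod>b\<in>(Basis::'a set). inverse ((1 + norm x)\<^sup>2)) = 1 / (1 + norm x) ^ (2 * DIM('a))"
    by (simp add: power_inverse power_mult divide_inverse)
   finally show "norm (1 / (1 + norm x) ^ (2 * DIM('a))) <= norm (\<Prod>b\<in>Basis. complex_of_real (inverse (1 + (x \<bullet> b)\<^sup>2)))"
    by (simp add: prod_nonneg abs_of_nonneg flip: of_real_prod of_real_inverse)
  qed
 qed simp
qed

lemma integrable_rapid:
 fixes f :: "'a::euclidean_space => complex"
 assumes [measurable]: "f \<in> borel_measurable borel" and "rapid f"
 shows "integrable lborel (%x. (1 + norm x) ^ k *\<^sub>R f x)"
proof -
 obtain C where C: "C \<ge> 0" "\<forall>x. (1 + norm x) ^ (k + 2 * DIM('a)) * norm (f x) <= C" using rapid_bound[OF assms(2)] by blast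
 have "integrable lborel (%x::'a. C * (1 / (1 + norm x) ^ (2 * DIM('a))))"
  by (rule integrable_mult_right[OF integrable_decay])
 then show ?thesis
 proof (rule int_bound)
  show "AE x in lborel. norm ((1 + norm x) ^ k *\<^sub>R f x) <= norm (C * (1 / (1 + norm x) ^ (2 * DIM('a))))"
  proof (rule AE_I2)
   fix x :: 'a
   have p: "0 < (1 + norm x) ^ (2 * DIM('a))" by (intro zero_less_power) (simp add: add_pos_nonneg)
   have "(1 + norm x) ^ k * norm (f x) <= C / (1 + norm x) ^ (2 * DIM('a))"
    using C(2)[rule_format, of x] p by (simp add: power_add field_simps)
   then show "norm ((1 + norm x) ^ k *\<^sub>R f x) <= norm (C * (1 / (1 + norm x) ^ (2 * DIM('a))))"
    using C(1) by (simp add: abs_of_nonneg)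
  qed
 qed measurable
qed

lemma schwartz_integrable: "f \<in> schwartz ==> integrable lborel f"
 using integrable_rapid[of f 0, OF schwartz_measurable schwartz_rapid] by simp

text \<open>The second order Taylor remainder of the character is quadratic in \<open>h\<close> and
  in \<open>Z\<close>, so the second moment condition gives the derivative directly with a quadratic
  error. A general \<open>Z\<close> is allowed because the lemma serves the transform of functions,
  with \<open>Z\<close> the identity, and that of image measures, with \<open>Z\<close> a path
  difference.\<close>

lemma char_integral_deriv:
 fixes Z :: "'a => real^'n::finite" and V :: "'a => complex"
 assumes Z [measurable]: "Z \<in> borel_measurable M" and V [measurable]: "V \<in> borel_measurable M"
  and int: "integrable M (%r. (1 + norm (Z r)) ^ 2 *\<^sub>R V r)" and s: "\<bar>s\<bar> = 1"
 defines "\<Phi> \<equiv> %\<xi>. (LINT r|M. cis (s * (Z r \<bullet> \<xi>)) * V r)"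
 shows "(\<Phi> has_derivative (%h. LINT r|M. cis (s * (Z r \<bullet> \<xi>)) * (\<i> * of_real (s * (Z r \<bullet> h)) * V r))) (at \<xi>)"
  and "pderiv_at i \<Phi> \<xi> = (LINT r|M. cis (s * (Z r \<bullet> \<xi>)) * (\<i> * of_real (s * Z r $ i) * V r))"
  and "\<Phi> differentiable (at \<xi>)"
  and "cmod (\<Phi> \<xi>) <= (LINT r|M. cmod (V r))"
proof -
 have n1: "1 <= (1 + norm (Z r)) ^ 2" for r by (intro one_le_power) auto
 have i0: "integrable M V"
 proof (rule int_bound[OF int V], rule AE_I2)
  fix r
  have "1 * norm (V r) <= (1 + norm (Z r)) ^ 2 * norm (V r)" by (rule mult_right_mono[OF n1]) simp
  then show "norm (V r) <= norm ((1 + norm (Z r)) ^ 2 *\<^sub>R V r)" by simp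
 qed
 have icis: "integrable M (%r. cis (s * (Z r \<bullet> \<xi>)) * V r)" for \<xi>
  by (rule int_bound[OF i0]) (auto simp: norm_mult)
 have ih: "integrable M (%r. cis (s * (Z r \<bullet> \<xi>)) * (\<i> * of_real (s * (Z r \<bullet> h)) * V r))" for h \<xi>
 proof (rule int_bound)
  show "integrable M (%r. norm h *\<^sub>R ((1 + norm (Z r)) ^ 2 *\<^sub>R V r))" using int by (rule integrable_scaleR_right)
  show "AE r in M. norm (cis (s * (Z r \<bullet> \<xi>)) * (\<i> * of_real (s * (Z r \<bullet> h)) * V r)) <= norm (norm h *\<^sub>R ((1 + norm (Z r)) ^ 2 *\<^sub>R V r))"
  proof (rule AE_I2)
   fix r
   have "\<bar>Z r \<bullet> h\<bar> <= norm (Z r) * norm h" by (rule Cauchy_Schwarz_ineq2)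
   also have "\<dots> <= (1 + norm (Z r)) ^ 2 * norm h"
    by (intro mult_right_mono) (auto simp: power2_sum)
   finally have "\<bar>Z r \<bullet> h\<bar> * norm (V r) <= (1 + norm (Z r)) ^ 2 * norm h * norm (V r)" by (intro mult_right_mono) auto
   then show "norm (cis (s * (Z r \<bullet> \<xi>)) * (\<i> * of_real (s * (Z r \<bullet> h)) * V r)) <= norm (norm h *\<^sub>R ((1 + norm (Z r)) ^ 2 *\<^sub>R V r))"
    using s by (simp add: norm_mult abs_mult mult_ac)
  qed
 qed measurable
 define K where "K = (LINT r|M. norm ((1 + norm (Z r)) ^ 2 *\<^sub>R V r))"
 define D where "D \<xi> h = (LINT r|M. cis (s * (Z r \<bullet> \<xi>)) * (\<i> * of_real (s * (Z r \<bullet> h)) * V r))" for \<xi> h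
 have Db: "norm (D \<xi> h) <= norm h * K" for \<xi> h
 proof -
  have "norm (D \<xi> h) <= (LINT r|M. norm (cis (s * (Z r \<bullet> \<xi>)) * (\<i> * of_real (s * (Z r \<bullet> h)) * V r)))"
   unfolding D_def by (rule integral_norm_bound)
  also have "\<dots> <= (LINT r|M. norm h * norm ((1 + norm (Z r)) ^ 2 *\<^sub>R V r))"
  proof (rule integral_mono)
   show "integrable M (%r. norm (cis (s * (Z r \<bullet> \<xi>)) * (\<i> * of_real (s * (Z r \<bullet> h)) * V r)))"
    by (rule integrable_norm[OF ih])
   show "integrable M (%r. norm h * norm ((1 + norm (Z r)) ^ 2 *\<^sub>R V r))"
    by (rule integrable_mult_right[OF integrable_norm[OF int]])
   fix r
   have "\<bar>Z r \<bullet> h\<bar> <= norm (Z r) * norm h" by (rule Cauchy_Schwarz_ineq2)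
   also have "\<dots> <= (1 + norm (Z r)) ^ 2 * norm h"
    by (intro mult_right_mono) (auto simp: power2_sum)
   finally have "\<bar>Z r \<bullet> h\<bar> * norm (V r) <= (1 + norm (Z r)) ^ 2 * norm h * norm (V r)" by (intro mult_right_mono) auto
   then show "norm (cis (s * (Z r \<bullet> \<xi>)) * (\<i> * of_real (s * (Z r \<bullet> h)) * V r)) <= norm h * norm ((1 + norm (Z r)) ^ 2 *\<^sub>R V r)"
    using s by (simp add: norm_mult abs_mult mult_ac)
  qed
  also have "\<dots> = norm h * K" unfolding K_def by (rule integral_mult_right_zero)
  finally show ?thesis .
 qed
 have bl: "bounded_linear (D \<xi>)" for \<xi>
 proof (rule bounded_linear_intro)
  show "D \<xi> (x + y) = D \<xi> x + D \<xi> y" for x y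
   unfolding D_def LINT_add[OF ih ih, symmetric]
   by (intro LINT_cong) (auto simp: inner_add_right algebra_simps)
  show "D \<xi> (c *\<^sub>R x) = c *\<^sub>R D \<xi> x" for c x
   unfolding D_def integral_scaleR_right[symmetric]
   by (intro LINT_cong) (simp_all add: scaleR_conv_of_real[where 'a = complex] mult_ac)
  show "norm (D \<xi> x) <= norm x * K" for x by (rule Db)
 qed
 have rem: "norm ((\<Phi> y - \<Phi> \<xi>) - D \<xi> (y - \<xi>)) <= norm (y - \<xi>) ^ 2 * K" for y \<xi>
 proof -
  define h where "h = y - \<xi>"
  have "(\<Phi> y - \<Phi> \<xi>) - D \<xi> h = (LINT r|M. (cis (s * (Z r \<bullet> y)) * V r - cis (s * (Z r \<bullet> \<xi>)) * V r)
    - cis (s * (Z r \<bullet> \<xi>)) * (\<i> * of_real (s * (Z r \<bullet> h)) * V r))"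
   unfolding \<Phi>_def D_def
   using LINT_diff[OF int_diff[OF icis[of y] icis[of \<xi>]] ih[of \<xi> h]]
    LINT_diff[OF icis[of y] icis[of \<xi>]] by simp
  also have "norm \<dots> <= (LINT r|M. norm ((cis (s * (Z r \<bullet> y)) * V r - cis (s * (Z r \<bullet> \<xi>)) * V r)
    - cis (s * (Z r \<bullet> \<xi>)) * (\<i> * of_real (s * (Z r \<bullet> h)) * V r)))" by (rule integral_norm_bound)
  also have "\<dots> <= (LINT r|M. norm h ^ 2 * norm ((1 + norm (Z r)) ^ 2 *\<^sub>R V r))"
  proof (rule integral_mono)
   show "integrable M (%r. norm ((cis (s * (Z r \<bullet> y)) * V r - cis (s * (Z r \<bullet> \<xi>)) * V r)
    - cis (s * (Z r \<bullet> \<xi>)) * (\<i> * of_real (s * (Z r \<bullet> h)) * V r)))"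
    by (intro integrable_norm int_diff icis ih)
   show "integrable M (%r. norm h ^ 2 * norm ((1 + norm (Z r)) ^ 2 *\<^sub>R V r))"
    by (rule integrable_mult_right[OF integrable_norm[OF int]])
   fix r
   let ?x = "s * (Z r \<bullet> h)"
   have "s * (Z r \<bullet> y) = s * (Z r \<bullet> \<xi>) + ?x" by (simp add: h_def inner_diff_right algebra_simps)
   then have "(cis (s * (Z r \<bullet> y)) * V r - cis (s * (Z r \<bullet> \<xi>)) * V r) - cis (s * (Z r \<bullet> \<xi>)) * (\<i> * of_real ?x * V r)
     = cis (s * (Z r \<bullet> \<xi>)) * (cis ?x - 1 - \<i> * of_real ?x) * V r"
    by (simp only: cis_mult[symmetric]) (simp add: algebra_simps)
   then have "norm ((cis (s * (Z r \<bullet> y)) * V r - cis (s * (Z r \<bullet> \<xi>)) * V r) - cis (s * (Z r \<bullet> \<xi>)) * (\<i> * of_real ?x * V r))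
     = norm (cis ?x - 1 - \<i> * of_real ?x) * norm (V r)" by (simp add: norm_mult)
   also have "norm (cis ?x - 1 - \<i> * of_real ?x) <= \<bar>?x\<bar> ^ 2 / 2"
    using iexp_approx1[of ?x 1] by (simp add: cis_conv_exp numeral_2_eq_2 algebra_simps)
   also have "\<dots> <= norm h ^ 2 * (1 + norm (Z r)) ^ 2"
   proof -
    have "\<bar>?x\<bar> <= norm (Z r) * norm h" using s Cauchy_Schwarz_ineq2[of "Z r" h] by (simp add: abs_mult)
    also have "\<dots> <= norm h * (1 + norm (Z r))" by (simp add: algebra_simps)
    finally have "\<bar>?x\<bar> ^ 2 <= (norm h * (1 + norm (Z r))) ^ 2" by (intro power_mono) auto
    moreover have "(norm h * (1 + norm (Z r))) ^ 2 / 2 <= (norm h * (1 + norm (Z r))) ^ 2" by simp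
    ultimately have "\<bar>?x\<bar> ^ 2 / 2 <= (norm h * (1 + norm (Z r))) ^ 2" by linarith
    then show ?thesis unfolding power_mult_distrib .
   qed
   finally show "norm ((cis (s * (Z r \<bullet> y)) * V r - cis (s * (Z r \<bullet> \<xi>)) * V r) - cis (s * (Z r \<bullet> \<xi>)) * (\<i> * of_real ?x * V r))
    <= norm h ^ 2 * norm ((1 + norm (Z r)) ^ 2 *\<^sub>R V r)" by (simp add: mult_right_mono abs_of_nonneg mult.assoc)
  qed
  also have "\<dots> = norm h ^ 2 * K" unfolding K_def by (rule integral_mult_right_zero)
  finally show ?thesis unfolding h_def .
 qed
 show der: "(\<Phi> has_derivative (%h. LINT r|M. cis (s * (Z r \<bullet> \<xi>)) * (\<i> * of_real (s * (Z r \<bullet> h)) * V r))) (at \<xi>)" for \<xi>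
 proof -
  have "(\<Phi> has_derivative D \<xi>) (at \<xi>)"
  proof (rule has_derivativeI_sandwich[of 1 _ _ _ _ "%y. norm (y - \<xi>) * K"])
   fix y assume "y \<noteq> \<xi>"
   have "norm ((\<Phi> y - \<Phi> \<xi>) - D \<xi> (y - \<xi>)) / norm (y - \<xi>) <= (norm (y - \<xi>) ^ 2 * K) / norm (y - \<xi>)"
    by (rule divide_right_mono[OF rem]) simp
   also have "\<dots> = norm (y - \<xi>) * K" using \<open>y \<noteq> \<xi>\<close> by (simp add: power2_eq_square)
   finally show "norm ((\<Phi> y - \<Phi> \<xi>) - D \<xi> (y - \<xi>)) / norm (y - \<xi>) <= norm (y - \<xi>) * K" .
  next
   have "((%y. norm (y - \<xi>) * K) \<longlongrightarrow> norm (\<xi> - \<xi>) * K) (at \<xi>)" by (intro tendsto_intros)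
   then show "((%y. norm (y - \<xi>) * K) \<longlongrightarrow> 0) (at \<xi>)" by simp
  qed (use bl in auto)
  then show ?thesis unfolding D_def[abs_def] .
 qed
 show "pderiv_at i \<Phi> \<xi> = (LINT r|M. cis (s * (Z r \<bullet> \<xi>)) * (\<i> * of_real (s * Z r $ i) * V r))"
  unfolding pderiv_atI[OF der] by (simp add: inner_axis)
 show "\<Phi> differentiable (at \<xi>)" using der unfolding differentiable_def by blast
 have "cmod (\<Phi> \<xi>) <= (LINT r|M. cmod (cis (s * (Z r \<bullet> \<xi>)) * V r))" unfolding \<Phi>_def by (rule integral_norm_bound)
 then show "cmod (\<Phi> \<xi>) <= (LINT r|M. cmod (V r))" by (simp add: norm_mult)
qed

lemma FF_schwartz_deriv:
 fixes \<phi> :: "real^'n::finite => complex"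
 assumes \<phi>: "\<phi> \<in> schwartz" and s: "\<bar>s\<bar> = 1"
 shows "pderiv_at i (FF s \<phi>) = FF s (%x. (\<i> * of_real s) * of_real (x $ i) * \<phi> x)"
  and "FF s \<phi> differentiable (at \<xi>)"
  and "cmod (FF s \<phi> \<xi>) <= (LINT x|lborel. cmod (\<phi> x))"
proof -
 have i: "integrable lborel (%x::real^'n. (1 + norm x) ^ 2 *\<^sub>R \<phi> x)"
  by (rule integrable_rapid[OF schwartz_measurable[OF \<phi>] schwartz_rapid[OF \<phi>]])
 have m: "\<phi> \<in> borel_measurable lborel" using schwartz_measurable[OF \<phi>] by simp
 note c = char_integral_deriv[where Z = "%x::real^'n. x" and M = lborel, OF _ m i s, folded FF_def[abs_def]]
 show "FF s \<phi> differentiable (at \<xi>)" "cmod (FF s \<phi> \<xi>) <= (LINT x|lborel. cmod (\<phi> x))"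
  using c(3,4) by (simp_all add: FF_def[abs_def])
 show "pderiv_at i (FF s \<phi>) = FF s (%x. (\<i> * of_real s) * of_real (x $ i) * \<phi> x)"
 proof
  fix \<xi>
  have "pderiv_at i (FF s \<phi>) \<xi> = (LINT x|lborel. cis (s * (x \<bullet> \<xi>)) * (\<i> * of_real (s * x $ i) * \<phi> x))"
   unfolding FF_def[abs_def] by (rule char_integral_deriv(2)[OF _ m i s]) simp
  then show "pderiv_at i (FF s \<phi>) \<xi> = FF s (%x. (\<i> * of_real s) * of_real (x $ i) * \<phi> x) \<xi>"
   by (simp add: FF_def mult.assoc)
 qed
qed

lemma schwartz_line_deriv:
 fixes \<phi> :: "real^'n::finite => complex"
 assumes \<phi>: "\<phi> \<in> schwartz"
 shows "((%\<tau>. \<phi> (x + \<tau> *\<^sub>R axis i 1)) has_derivative (%h. h *\<^sub>R pderiv_at i \<phi> (x + \<tau> *\<^sub>R axis i 1))) (at \<tau> within A)"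
proof -
 let ?D = "frechet_derivative \<phi> (at (x + \<tau> *\<^sub>R axis i 1))"
 have D: "(\<phi> has_derivative ?D) (at (x + \<tau> *\<^sub>R axis i 1))"
  by (rule differentiable_deriv[OF schwartz_differentiable[OF \<phi>]])
 have l: "((%\<tau>. x + \<tau> *\<^sub>R axis i (1::real)) has_derivative (%h. h *\<^sub>R axis i 1)) (at \<tau> within A)"
  by (auto intro!: derivative_eq_intros)
 have "((%\<tau>. \<phi> (x + \<tau> *\<^sub>R axis i 1)) has_derivative (%h. ?D (h *\<^sub>R axis i 1))) (at \<tau> within A)"
  by (rule has_derivative_compose[OF l D])
 moreover have "?D (h *\<^sub>R axis i 1) = h *\<^sub>R pderiv_at i \<phi> (x + \<tau> *\<^sub>R axis i 1)" for h
  using linear_scale[OF has_derivative_linear[OF D]] by (simp add: pderiv_at_def)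
 ultimately show ?thesis by simp
qed

text \<open>Provides the integrable majorant for difference quotients. The mean value inequality
  bounds the increment by the derivative along the segment, and \<open>t <= 1\<close> makes the
  weights there and at \<open>x\<close> comparable up to \<open>2 ^ k\<close>.\<close>

lemma schwartz_increment_bound:
 fixes \<phi> :: "real^'n::finite => complex"
 assumes \<phi>: "\<phi> \<in> schwartz"
 shows "\<exists>C\<ge>0. \<forall>x t. 0 <= t --> t <= 1 --> cmod (\<phi> (x + t *\<^sub>R axis i 1) - \<phi> x) <= C / (1 + norm x) ^ k * t"
proof -
 obtain C where C: "C \<ge> 0" "\<forall>x. (1 + norm x) ^ k * norm (pderiv_at i \<phi> x) <= C"
  using rapid_bound[OF schwartz_rapid[OF schwartz_pderiv[OF \<phi>]]] by blast
 have "cmod (\<phi> (x + t *\<^sub>R axis i 1) - \<phi> x) <= (2 ^ k * C) / (1 + norm x) ^ k * t" if t: "0 <= t" "t <= 1" for x t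
 proof -
  define B where "B = (2 ^ k * C) / (1 + norm x) ^ k"
  have B0: "0 <= B" using C by (simp add: B_def)
  have p: "0 < (1 + norm x) ^ k" for x :: "real^'n" by (intro zero_less_power) (simp add: add_pos_nonneg)
  have B: "norm (pderiv_at i \<phi> (x + \<tau> *\<^sub>R axis i 1)) <= B" if \<tau>: "\<tau> \<in> {0..1}" for \<tau>
  proof -
   let ?y = "x + \<tau> *\<^sub>R axis i 1"
   have "norm x <= norm ?y + norm (\<tau> *\<^sub>R axis i (1::real) :: real^'n)"
    using norm_triangle_ineq4[of ?y "\<tau> *\<^sub>R axis i 1"] by simp
   moreover have "norm (\<tau> *\<^sub>R axis i (1::real) :: real^'n) <= 1" using \<tau> by (simp add: norm_axis_1)
   ultimately have "1 + norm x <= 2 * (1 + norm ?y)" using norm_ge_zero[of ?y] unfolding distrib_left by linarith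
   then have "(1 + norm x) ^ k <= (2 * (1 + norm ?y)) ^ k" by (intro power_mono) auto
   then have "(1 + norm x) ^ k * norm (pderiv_at i \<phi> ?y) <= (2 * (1 + norm ?y)) ^ k * norm (pderiv_at i \<phi> ?y)"
    by (intro mult_right_mono) auto
   also have "\<dots> = 2 ^ k * ((1 + norm ?y) ^ k * norm (pderiv_at i \<phi> ?y))"
    by (simp only: power_mult_distrib mult.assoc)
   also have "\<dots> <= 2 ^ k * C" using C by (intro mult_left_mono) auto
   finally show ?thesis using p[of x] by (simp add: B_def field_simps)
  qed
  have "norm (\<phi> (x + t *\<^sub>R axis i 1) - \<phi> (x + 0 *\<^sub>R axis i 1)) <= B * norm (t - 0)"
  proof (rule differentiable_bound[where S = "{0..1}"])
   fix \<tau> :: real assume \<tau>: "\<tau> \<in> {0..1}"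
   show "((%\<tau>. \<phi> (x + \<tau> *\<^sub>R axis i 1)) has_derivative (%h. h *\<^sub>R pderiv_at i \<phi> (x + \<tau> *\<^sub>R axis i 1))) (at \<tau> within {0..1})"
    by (rule schwartz_line_deriv[OF \<phi>])
   show "onorm (%h. h *\<^sub>R pderiv_at i \<phi> (x + \<tau> *\<^sub>R axis i 1)) <= B"
   proof (rule onorm_bound[OF B0])
    fix h :: real
    show "norm (h *\<^sub>R pderiv_at i \<phi> (x + \<tau> *\<^sub>R axis i 1)) <= B * norm h"
     using mult_right_mono[OF B[OF \<tau>], of "\<bar>h\<bar>"] by (simp add: mult.commute)
   qed
  qed (use t in auto)
  then show ?thesis using t by (simp add: B_def)
 qed
 then show ?thesis using C by (intro exI[of _ "2 ^ k * C"]) auto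
qed

lemma FF_translate:
 fixes \<phi> :: "real^'n::finite => complex"
 assumes [measurable]: "\<phi> \<in> borel_measurable borel"
 shows "(LINT x|lborel. cis (s * (x \<bullet> \<xi>)) * \<phi> (a + x)) = cis (- s * (a \<bullet> \<xi>)) * FF s \<phi> \<xi>"
proof -
 have "cis (- s * (a \<bullet> \<xi>)) * FF s \<phi> \<xi> = (LINT x|lborel. cis (- s * (a \<bullet> \<xi>)) * (cis (s * (x \<bullet> \<xi>)) * \<phi> x))"
  unfolding FF_def by (rule integral_mult_right_zero[symmetric])
 also have "\<dots> = of_real (\<bar>1\<bar> ^ DIM(real^'n)) * (LINT x|lborel. cis (- s * (a \<bullet> \<xi>)) * (cis (s * ((a + 1 *\<^sub>R x) \<bullet> \<xi>)) * \<phi> (a + 1 *\<^sub>R x)))"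
  by (rule integral_lborel_affine) auto
 also have "(%x. cis (- s * (a \<bullet> \<xi>)) * (cis (s * ((a + 1 *\<^sub>R x) \<bullet> \<xi>)) * \<phi> (a + 1 *\<^sub>R x))) = (%x. cis (s * (x \<bullet> \<xi>)) * \<phi> (a + x))"
  unfolding mult.assoc[symmetric] cis_mult by (simp add: inner_add_left algebra_simps)
 finally show ?thesis by simp
qed

lemma cis_remainder: "cmod (cis x - 1 - \<i> * of_real x) <= x\<^sup>2 / 2"
 using iexp_approx1[of x 1] by (simp add: cis_conv_exp numeral_2_eq_2 algebra_simps)

text \<open>Integration by parts through difference quotients: translating the integration variable
  moves the shift onto the character, whose difference quotient converges to the factor in
  front.\<close>

lemma FF_pderiv:
 fixes \<phi> :: "real^'n::finite => complex"
 assumes \<phi>: "\<phi> \<in> schwartz"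
 shows "FF s (pderiv_at i \<phi>) \<xi> = - (\<i> * of_real (s * \<xi> $ i)) * FF s \<phi> \<xi>"
proof -
 have [measurable]: "\<phi> \<in> borel_measurable borel" "pderiv_at i \<phi> \<in> borel_measurable borel"
  using schwartz_measurable schwartz_pderiv \<phi> by auto
 define N where "N = 2 * DIM(real^'n)"
 define e where "e k = inverse (real (Suc k))" for k
 have e: "0 < e k" "e k <= 1" for k by (auto simp: e_def field_simps)
 have elim: "e \<longlonglongrightarrow> 0" unfolding e_def by (rule LIMSEQ_inverse_real_of_nat)
 define a where "a = axis i (1::real)"
 define q where "q k x = of_real (1 / e k) * (\<phi> (e k *\<^sub>R a + x) - \<phi> x)" for k x
 obtain C where C: "C \<ge> 0" "\<And>x t. 0 <= t ==> t <= 1 ==> cmod (\<phi> (x + t *\<^sub>R a) - \<phi> x) <= C / (1 + norm x) ^ N * t"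
  using schwartz_increment_bound[OF \<phi>, of i N] unfolding a_def by blast
 have qb: "cmod (q k x) <= C * (1 / (1 + norm x) ^ N)" for k x
 proof -
  have "cmod (q k x) = (1 / e k) * cmod (\<phi> (x + e k *\<^sub>R a) - \<phi> x)"
   using e[of k] unfolding q_def norm_mult by (simp add: add.commute norm_divide)
  also have "\<dots> <= (1 / e k) * (C / (1 + norm x) ^ N * e k)"
   using e[of k] C by (intro mult_left_mono C(2)) auto
  also have "\<dots> = C * (1 / (1 + norm x) ^ N)" using e[of k] by simp
  finally show ?thesis .
 qed
 have ql: "(%k. q k x) \<longlonglongrightarrow> pderiv_at i \<phi> x" for x
 proof -
  have "((%\<tau>. \<phi> (x + \<tau> *\<^sub>R a)) has_derivative (%h. h *\<^sub>R pderiv_at i \<phi> x)) (at 0)"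
   using schwartz_line_deriv[OF \<phi>, of x i 0 UNIV] by (simp add: a_def)
  then have "((%h. norm (\<phi> (x + (0 + h) *\<^sub>R a) - \<phi> (x + 0 *\<^sub>R a) - h *\<^sub>R pderiv_at i \<phi> x) / norm h) \<longlongrightarrow> 0) (at 0)"
   unfolding has_derivative_at by blast
  moreover have "filterlim e (at 0) sequentially"
   using elim e by (intro filterlim_atI) (auto simp: less_imp_neq[symmetric] eventually_sequentially)
  ultimately have "(%k. norm (\<phi> (x + (0 + e k) *\<^sub>R a) - \<phi> (x + 0 *\<^sub>R a) - e k *\<^sub>R pderiv_at i \<phi> x) / norm (e k)) \<longlonglongrightarrow> 0"
   by (rule filterlim_compose)
  moreover have "norm (\<phi> (x + (0 + e k) *\<^sub>R a) - \<phi> (x + 0 *\<^sub>R a) - e k *\<^sub>R pderiv_at i \<phi> x) / norm (e k) = norm (q k x - pderiv_at i \<phi> x)" for k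
  proof -
   have "\<phi> (x + e k *\<^sub>R a) - \<phi> x - e k *\<^sub>R pderiv_at i \<phi> x = of_real (e k) * (q k x - pderiv_at i \<phi> x)"
    using e[of k] by (simp add: q_def scaleR_conv_of_real algebra_simps)
   then show ?thesis using e[of k] by (simp add: norm_mult)
  qed
  ultimately have "(%k. norm (q k x - pderiv_at i \<phi> x)) \<longlonglongrightarrow> 0" by simp
  then show ?thesis by (simp add: tendsto_norm_zero_iff LIM_zero_iff)
 qed
 have 1: "(%k. FF s (q k) \<xi>) \<longlonglongrightarrow> FF s (pderiv_at i \<phi>) \<xi>"
  unfolding FF_def
 proof (rule integral_dominated_convergence[where w = "%x. C * (1 / (1 + norm x) ^ N)"])
  show "integrable lborel (%x::real^'n. C * (1 / (1 + norm x) ^ N))"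
   unfolding N_def by (rule integrable_mult_right[OF integrable_decay])
  show "AE x in lborel. (%k. cis (s * (x \<bullet> \<xi>)) * q k x) \<longlonglongrightarrow> cis (s * (x \<bullet> \<xi>)) * pderiv_at i \<phi> x"
   by (intro AE_I2 tendsto_mult tendsto_const ql)
  show "AE x in lborel. cmod (cis (s * (x \<bullet> \<xi>)) * q k x) <= C * (1 / (1 + norm x) ^ N)" for k
   using qb by (intro AE_I2) (simp add: norm_mult)
  show "(%x. cis (s * (x \<bullet> \<xi>)) * q k x) \<in> borel_measurable lborel" for k
   unfolding q_def by measurable
 qed measurable
 define c where "c = \<xi> $ i"
 have ac: "a \<bullet> \<xi> = c" by (simp add: a_def c_def inner_axis inner_commute)
 have 2: "FF s (q k) \<xi> = of_real (1 / e k) * (cis (- s * e k * c) - 1) * FF s \<phi> \<xi>" for k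
 proof -
  have i: "integrable lborel (%x. cis (s * (x \<bullet> \<xi>)) * \<phi> x)"
   by (rule int_bound[OF schwartz_integrable[OF \<phi>]]) (auto simp: norm_mult)
  have i2: "integrable lborel (%x. cis (s * (x \<bullet> \<xi>)) * \<phi> (e k *\<^sub>R a + x))"
   by (rule int_bound[OF integrable_translate[OF schwartz_integrable[OF \<phi>]]]) (auto simp: norm_mult)
  have "FF s (q k) \<xi> = (LINT x|lborel. of_real (1 / e k) * (cis (s * (x \<bullet> \<xi>)) * \<phi> (e k *\<^sub>R a + x) - cis (s * (x \<bullet> \<xi>)) * \<phi> x))"
   unfolding FF_def q_def by (intro LINT_cong) (auto simp: algebra_simps)
  also have "\<dots> = of_real (1 / e k) * (LINT x|lborel. cis (s * (x \<bullet> \<xi>)) * \<phi> (e k *\<^sub>R a + x) - cis (s * (x \<bullet> \<xi>)) * \<phi> x)"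
   by (rule integral_mult_right_zero)
  also have "(LINT x|lborel. cis (s * (x \<bullet> \<xi>)) * \<phi> (e k *\<^sub>R a + x) - cis (s * (x \<bullet> \<xi>)) * \<phi> x)
   = cis (- s * ((e k *\<^sub>R a) \<bullet> \<xi>)) * FF s \<phi> \<xi> - FF s \<phi> \<xi>"
   unfolding LINT_diff[OF i2 i] by (subst FF_translate) (simp_all add: FF_def)
  finally show ?thesis by (simp add: ac algebra_simps)
 qed
 have 3: "(%k. of_real (1 / e k) * (cis (- s * e k * c) - 1)) \<longlonglongrightarrow> - (\<i> * of_real (s * c))"
 proof -
  have bd: "norm (of_real (1 / e k) * (cis (- s * e k * c) - 1) - - (\<i> * of_real (s * c))) <= e k * ((s * c)\<^sup>2 / 2)" for k
  proof -
   let ?x = "- s * e k * c"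
   have "of_real (1 / e k) * (cis ?x - 1) - - (\<i> * of_real (s * c)) = of_real (1 / e k) * (cis ?x - 1 - \<i> * of_real ?x)"
    using e[of k] by (simp add: field_simps)
   then have "norm (of_real (1 / e k) * (cis ?x - 1) - - (\<i> * of_real (s * c))) = (1 / e k) * norm (cis ?x - 1 - \<i> * of_real ?x)"
    using e[of k] by (simp only: norm_mult norm_of_real abs_of_pos zero_less_divide_1_iff)
   also have "\<dots> <= (1 / e k) * (?x\<^sup>2 / 2)" using e[of k] by (intro mult_left_mono cis_remainder) auto
   also have "\<dots> = e k * ((s * c)\<^sup>2 / 2)" using e[of k] by (simp add: power2_eq_square field_simps)
   finally show ?thesis .
  qed
  have "(%k. e k * ((s * c)\<^sup>2 / 2)) \<longlonglongrightarrow> 0 * ((s * c)\<^sup>2 / 2)" by (intro tendsto_mult elim tendsto_const)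
  then have l0: "(%k. e k * ((s * c)\<^sup>2 / 2)) \<longlonglongrightarrow> 0" by (simp only: mult_zero_left)
  have "(%k. of_real (1 / e k) * (cis (- s * e k * c) - 1) - - (\<i> * of_real (s * c))) \<longlonglongrightarrow> 0"
   by (rule Lim_null_comparison[OF always_eventually[OF allI[OF bd]] l0])
  then show ?thesis by (rule LIM_zero_cancel)
 qed
 have "(%k. FF s (q k) \<xi>) \<longlonglongrightarrow> - (\<i> * of_real (s * c)) * FF s \<phi> \<xi>"
  unfolding 2 by (intro tendsto_mult 3 tendsto_const)
 then show ?thesis unfolding c_def by (rule LIMSEQ_unique[OF 1])
qed

text \<open>A further power of \<open>norm \<xi>\<close> is bounded by the sum of the coordinates,
  and a coordinate is absorbed by differentiating \<open>\<phi>\<close>; hence the induction over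
  all Schwartz functions at once.\<close>

lemma FF_schwartz_rapid:
 fixes \<phi> :: "real^'n::finite => complex"
 assumes "\<phi> \<in> schwartz" and s: "\<bar>s\<bar> = 1"
 shows "rapid (FF s \<phi>)"
proof (rule rapidI)
 fix k
 show "\<exists>C. \<forall>\<xi>. (1 + norm \<xi>) ^ k * norm (FF s \<phi> \<xi>) <= C"
  using assms(1)
 proof (induction k arbitrary: \<phi>)
  case 0
  then show ?case using FF_schwartz_deriv(3)[OF 0 s] by auto
 next
  case (Suc k)
  obtain C where C: "\<forall>\<xi>. (1 + norm \<xi>) ^ k * norm (FF s \<phi> \<xi>) <= C" using Suc by blast
  have "\<forall>i. \<exists>C. \<forall>\<xi>. (1 + norm \<xi>) ^ k * norm (FF s (pderiv_at i \<phi>) \<xi>) <= C"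
   using Suc.IH schwartz_pderiv[OF Suc.prems] by blast
  then obtain D where D: "\<And>i \<xi>. (1 + norm \<xi>) ^ k * norm (FF s (pderiv_at i \<phi>) \<xi>) <= D i" by metis
  have "(1 + norm \<xi>) ^ Suc k * norm (FF s \<phi> \<xi>) <= C + (\<Sum>i\<in>UNIV. D i)" for \<xi>
  proof -
   let ?P = "(1 + norm \<xi>) ^ k"
   have "norm \<xi> * norm (FF s \<phi> \<xi>) <= (\<Sum>i\<in>UNIV. \<bar>\<xi> $ i\<bar>) * norm (FF s \<phi> \<xi>)"
    by (intro mult_right_mono norm_le_l1_cart) simp
   also have "\<dots> = (\<Sum>i\<in>UNIV. norm (FF s (pderiv_at i \<phi>) \<xi>))"
    unfolding FF_pderiv[OF Suc.prems] sum_distrib_right using s by (simp add: norm_mult abs_mult)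
   finally have n: "norm \<xi> * norm (FF s \<phi> \<xi>) <= (\<Sum>i\<in>UNIV. norm (FF s (pderiv_at i \<phi>) \<xi>))" .
   have "(1 + norm \<xi>) ^ Suc k * norm (FF s \<phi> \<xi>) = ?P * norm (FF s \<phi> \<xi>) + ?P * (norm \<xi> * norm (FF s \<phi> \<xi>))"
    by (simp add: algebra_simps)
   also have "\<dots> <= C + ?P * (\<Sum>i\<in>UNIV. norm (FF s (pderiv_at i \<phi>) \<xi>))"
    using C n by (intro add_mono mult_left_mono) auto
   also have "\<dots> <= C + (\<Sum>i\<in>UNIV. D i)"
    unfolding sum_distrib_left using D by (intro add_left_mono sum_mono)
   finally show ?thesis .
  qed
  then show ?case by blast
 qed
qed

lemma FF_schwartz:
 fixes \<phi> :: "real^'n::finite => complex"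
 assumes "\<phi> \<in> schwartz" and s: "\<bar>s\<bar> = 1"
 shows "FF s \<phi> \<in> schwartz"
proof (rule schwartz_coinduct[where X = "%f. \<exists>\<phi>\<in>schwartz. f = FF s \<phi>"])
 show "\<exists>\<psi>\<in>schwartz. FF s \<phi> = FF s \<psi>" using assms by blast
 fix g :: "real^'n => complex" assume "\<exists>\<phi>\<in>schwartz. g = FF s \<phi>"
 then obtain \<psi> where \<psi>: "\<psi> \<in> schwartz" "g = FF s \<psi>" by blast
 show "g differentiable (at x)" for x unfolding \<psi>(2) by (rule FF_schwartz_deriv(2)[OF \<psi>(1) s])
 show "rapid g" unfolding \<psi>(2) by (rule FF_schwartz_rapid[OF \<psi>(1) s])
 show "\<exists>\<phi>\<in>schwartz. pderiv_at i g = FF s \<phi>" for i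
  unfolding \<psi>(2) FF_schwartz_deriv(1)[OF \<psi>(1) s]
  using schwartz_mult[OF slow_coord \<psi>(1)] by blast
qed

lemma inv_fourier_eq: "inv_fourier \<phi> = (%x::real^'n::finite. (1 / of_real ((2 * pi) ^ CARD('n))) * FF 1 \<phi> x)"
 by (simp add: fun_eq_iff inv_fourier_FF)

lemma fourier_schwartz: "\<phi> \<in> schwartz ==> fourier \<phi> \<in> schwartz"
 unfolding fourier_FF by (rule FF_schwartz) auto

lemma inv_fourier_schwartz: "\<phi> \<in> schwartz ==> inv_fourier \<phi> \<in> schwartz"
 unfolding inv_fourier_eq by (rule schwartz_cmult[OF FF_schwartz]) auto

lemma FF_cmult: "FF s (%x. c * \<phi> x) \<xi> = c * FF s \<phi> \<xi>"
proof -
 have "FF s (%x. c * \<phi> x) \<xi> = (LINT x|lborel. c * (cis (s * (x \<bullet> \<xi>)) * \<phi> x))"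
  unfolding FF_def by (simp add: mult_ac)
 then show ?thesis unfolding FF_def by (simp only: integral_mult_right_zero)
qed

lemma FF_inversion_schwartz:
 fixes \<phi> :: "real^'n::finite => complex"
 assumes \<phi>: "\<phi> \<in> schwartz" and s: "\<bar>s\<bar> = 1"
 shows "FF (- s) (FF s \<phi>) x = of_real ((2 * pi) ^ CARD('n)) * \<phi> x"
proof -
 obtain B where "\<forall>x. cmod (\<phi> x) <= B" using schwartz_bounded[OF \<phi>] by blast
 then show ?thesis
  using FF_inversion[OF schwartz_continuous[OF \<phi>] _ schwartz_integrable[OF \<phi>]
   schwartz_integrable[OF FF_schwartz[OF \<phi> s]] s, of B x] by simp
qed

lemma fourier_inv_fourier:
 fixes \<phi> :: "real^'n::finite => complex"
 assumes "\<phi> \<in> schwartz" shows "fourier (inv_fourier \<phi>) = \<phi>"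
proof
 fix x
 have "FF (- 1) (FF 1 \<phi>) x = of_real ((2 * pi) ^ CARD('n)) * \<phi> x"
  using FF_inversion_schwartz[OF assms, of 1] by simp
 then show "fourier (inv_fourier \<phi>) x = \<phi> x"
  unfolding fourier_FF inv_fourier_eq FF_cmult by simp
qed

lemma inv_fourier_fourier:
 fixes \<phi> :: "real^'n::finite => complex"
 assumes "\<phi> \<in> schwartz" shows "inv_fourier (fourier \<phi>) = \<phi>"
 using FF_inversion_schwartz[OF assms, of "-1"] unfolding fourier_FF inv_fourier_eq
 by (auto simp: fun_eq_iff)

lemma smooth_pderiv: "smooth g ==> smooth (pderiv_at i g)"
 unfolding smooth_def by (metis pderivs_snoc)

lemma smooth_differentiable: "smooth g ==> g differentiable (at x)"
 unfolding smooth_def by (metis pderivs_Nil)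

lemma pderiv_at_of_real:
 assumes "g differentiable (at x)"
 shows "(%x. complex_of_real (g x)) differentiable (at x)"
  and "pderiv_at i (%x. complex_of_real (g x)) x = of_real (pderiv_at i g x)"
proof -
 have D: "((%x. complex_of_real (g x)) has_derivative (%h. of_real (frechet_derivative g (at x) h))) (at x)"
  by (rule has_derivative_of_real[OF differentiable_deriv[OF assms]])
 then show "(%x. complex_of_real (g x)) differentiable (at x)" unfolding differentiable_def by blast
 show "pderiv_at i (%x. complex_of_real (g x)) x = of_real (pderiv_at i g x)"
  unfolding pderiv_atI[OF D] by (simp add: pderiv_at_def)
qed

lemma compact_smooth_schwartz:
 fixes g :: "real^'n::finite => real"
 assumes "smooth g" "\<And>x. R < norm x ==> g x = 0"
 shows "(%x. complex_of_real (g x)) \<in> schwartz"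
proof (rule schwartz_coinduct[where X = "%f. \<exists>g. smooth g \<and> (\<forall>x. R < norm x --> g x = 0) \<and> f = (%x. complex_of_real (g x))"])
 show "\<exists>h. smooth h \<and> (\<forall>x. R < norm x --> h x = 0) \<and> (%x. complex_of_real (g x)) = (%x. complex_of_real (h x))"
  using assms by blast
 fix f assume "\<exists>g. smooth g \<and> (\<forall>x::real^'n. R < norm x --> g x = 0) \<and> f = (%x. complex_of_real (g x))"
 then obtain g :: "real^'n => real" where g: "smooth g" "\<And>x. R < norm x ==> g x = 0" and f: "f = (%x. complex_of_real (g x))" by blast
 show "f differentiable (at x)" for x
  unfolding f by (rule pderiv_at_of_real(1)[OF smooth_differentiable[OF g(1)]])
 show "\<exists>g. smooth g \<and> (\<forall>x. R < norm x --> g x = 0) \<and> pderiv_at i f = (%x. complex_of_real (g x))" for i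
 proof (intro exI[of _ "pderiv_at i g"] conjI allI impI)
  show "smooth (pderiv_at i g)" by (rule smooth_pderiv[OF g(1)])
  show "pderiv_at i f = (%x. complex_of_real (pderiv_at i g x))"
   unfolding f using pderiv_at_of_real(2)[OF smooth_differentiable[OF g(1)]] by blast
  fix x :: "real^'n" assume x: "R < norm x"
  have "(g has_derivative (%_. 0)) (at x)"
  proof (rule has_derivative_transform_within_open[OF has_derivative_const])
   show "open {y :: real^'n. R < norm y}" by (intro open_Collect_less continuous_intros)
  qed (use x g(2) in auto)
  then show "pderiv_at i g x = 0" by (rule pderiv_atI)
 qed
 show "rapid f"
 proof (rule rapidI)
  fix k
  have "continuous_on UNIV g"
   using smooth_differentiable[OF g(1)]
   by (metis continuous_at_imp_continuous_on differentiable_imp_continuous_within)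
  then have gc: "continuous_on (cball 0 R) g" by (rule continuous_on_subset) simp
  have "continuous_on (cball 0 R) (%x. (1 + norm x) ^ k * g x)"
   by (intro continuous_on_mult continuous_on_power continuous_on_add continuous_on_const
      continuous_on_norm continuous_on_id gc)
  then have "bounded ((%x. (1 + norm x) ^ k * g x) ` cball 0 R)"
   by (intro compact_imp_bounded compact_continuous_image compact_cball)
  then obtain C where C: "\<forall>y\<in>(%x. (1 + norm x) ^ k * g x) ` cball 0 R. norm y <= C" unfolding bounded_iff by blast
  have "(1 + norm x) ^ k * norm (f x) <= max C 0" for x
  proof (cases "norm x <= R")
   case True
   then have "norm ((1 + norm x) ^ k * g x) <= C" using C by auto
   then show ?thesis by (simp add: f abs_mult)
  qed (use g(2) in \<open>simp add: f\<close>)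
  then show "\<exists>C. \<forall>x. (1 + norm x) ^ k * norm (f x) <= C" by blast
 qed
qed

lemma smooth_scale:
 fixes f :: "real^'n::finite => real"
 assumes "smooth f" shows "smooth (%x. f (c *\<^sub>R x))"
proof -
 have D: "((%x. a * g (c *\<^sub>R x)) has_derivative (%h. a * frechet_derivative g (at (c *\<^sub>R x)) (c *\<^sub>R h))) (at x)"
  if "\<And>x. g differentiable (at x)" for g :: "real^'n => real" and a x
 proof -
  have l: "((%x :: real^'n. c *\<^sub>R x) has_derivative (%h. c *\<^sub>R h)) (at x)" by (auto intro!: derivative_eq_intros)
  show ?thesis
   by (rule has_derivative_mult_right[OF has_derivative_compose[OF l differentiable_deriv[OF that]]])
 qed
 have *: "pderivs is (%x. f (c *\<^sub>R x)) = (%x. c ^ length is * pderivs is f (c *\<^sub>R x))" for "is"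
 proof (induction "is")
  case (Cons i "is")
  have d: "pderivs is f differentiable (at x)" for x using assms unfolding smooth_def by blast
  have "pderiv_at i (%x. c ^ length is * pderivs is f (c *\<^sub>R x)) x = c ^ length (i # is) * pderiv_at i (pderivs is f) (c *\<^sub>R x)" for x
   unfolding pderiv_atI[OF D[OF d]]
   using linear_scale[OF has_derivative_linear[OF differentiable_deriv[OF d[of "c *\<^sub>R x"]]], of c "axis i 1"]
   by (simp add: pderiv_at_def mult_ac)
  then show ?case unfolding pderivs_Cons Cons.IH by blast
 qed (simp add: pderivs_Nil)
 show ?thesis unfolding smooth_def *
  using D assms unfolding smooth_def differentiable_def by meson
qed

section \<open>Uniqueness of representing functions\<close>

lemma elementary_prod:
 "finite I ==> (\<And>i. i \<in> I ==> elementary (f i)) ==> elementary (%x. \<Prod>i\<in>I. f i x)"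
 by (induction I rule: finite_induct) (auto intro: elementary.intros)

text \<open>Inside the box each factor is \<open>exp (- 1 / (k * c))\<close> with \<open>c\<close>
  the distance to a face, so for \<open>k\<close> to infinity the product tends to the indicator of
  the open box. Differences are written as sums to match the introduction rules of
  \<open>elementary\<close>.\<close>

definition bump :: "real => real^'n::finite => real^'n => real^'n => real" where
 "bump k a b x = (\<Prod>i\<in>UNIV. flat_exp 1 (k * (x $ i + (- (a $ i)))) * flat_exp 1 (k * (b $ i + (-1) * x $ i)))"

lemma bump_smooth: "smooth (bump k a b)"
 unfolding bump_def[abs_def] by (intro elementary_smooth elementary_prod elementary.intros) simp

lemma flat_exp_le_1: "flat_exp 1 t <= 1"
 by (auto simp: flat_exp_def)

lemma bump_bounds: "0 <= bump k a b x" "bump k a b x <= 1"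
 unfolding bump_def by (auto intro!: prod_nonneg prod_le_1 mult_nonneg_nonneg mult_le_one flat_exp_nonneg flat_exp_le_1)

text \<open>The open box under a name of its own, since \<open>box\<close> denotes rectangular
  increments here.\<close>

definition obox :: "real^'n::finite => real^'n => (real^'n) set" where
 "obox a b = {x. \<forall>i. a $ i < x $ i \<and> x $ i < b $ i}"

lemma obox_eq: "obox a b = Topology_Euclidean_Space.box a b"
 by (auto simp: obox_def mem_box_cart)

lemma bump_outside:
 assumes "0 < k" "x \<notin> obox a b" shows "bump k a b x = 0"
proof -
 obtain i where i: "x $ i <= a $ i \<or> b $ i <= x $ i" using assms(2) unfolding obox_def mem_Collect_eq by (meson not_le)
 then have "flat_exp 1 (k * (x $ i + (- (a $ i)))) * flat_exp 1 (k * (b $ i + (-1) * x $ i)) = 0"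
  using assms(1) by (auto simp: flat_exp_def zero_less_mult_iff)
 then show ?thesis unfolding bump_def by (metis (no_types, lifting) UNIV_I finite_class.finite_UNIV prod_zero_iff)
qed

lemma flat_exp_tendsto_1:
 assumes "0 < c" shows "(%k. flat_exp 1 (real (Suc k) * c)) \<longlonglongrightarrow> 1"
proof -
 have "(%k. exp (- (inverse (real (Suc k)) * (1 / c)))) \<longlonglongrightarrow> exp (- (0 * (1 / c)))"
  by (intro tendsto_intros LIMSEQ_inverse_real_of_nat)
 moreover have "flat_exp 1 (real (Suc k) * c) = exp (- (inverse (real (Suc k)) * (1 / c)))" for k
  using assms by (simp add: flat_exp_def divide_inverse)
 ultimately show ?thesis by simp
qed

lemma bump_limit: "(%k. bump (real (Suc k)) a b x) \<longlonglongrightarrow> indicator (obox a b) x"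
proof (cases "x \<in> obox a b")
 case True
 have "(%k. bump (real (Suc k)) a b x) \<longlonglongrightarrow> (\<Prod>i\<in>(UNIV :: 'a set). 1 * 1)"
  unfolding bump_def using True
  by (intro tendsto_prod tendsto_mult flat_exp_tendsto_1) (auto simp: obox_def)
 then show ?thesis using True by simp
qed (simp add: bump_outside)

lemma obox_bounded: "\<exists>R>0. \<forall>x\<in>obox a b. norm x <= R"
 using bounded_box[of a b] unfolding obox_eq bounded_pos .

lemma bump_schwartz:
 assumes "0 < k" shows "(%x. complex_of_real (bump k a b x)) \<in> schwartz"
proof -
 obtain R where R: "\<forall>x\<in>obox a b. norm x <= R" using obox_bounded by blast
 show ?thesis
 proof (rule compact_smooth_schwartz[OF bump_smooth])
  fix x :: "real^'a" assume "R < norm x"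
  then have "x \<notin> obox a b" using R by (meson not_le)
  then show "bump k a b x = 0" by (rule bump_outside[OF assms])
 qed
qed

lemma cutoff_schwartz: "\<exists>\<phi>\<in>schwartz. \<forall>x. norm x <= R --> \<phi> x = (1 :: complex)"
proof -
 define R' where "R' = max R 1"
 have R': "0 < R'" "R <= R'" by (auto simp: R'_def)
 \<comment> \<open>\<open>cutoff\<close> equals 1 up to 9/16 and 0 from 16/9 on; after this scaling
   it is 1 for \<open>norm x <= R'\<close> and 0 beyond \<open>2 * R'\<close>, because
   \<open>4 * 9/16 > 16/9\<close>.\<close>
 define c where "c = (9/16) / R'\<^sup>2"
 have "(%x :: real^'a. complex_of_real (cutoff (c * (x \<bullet> x)))) \<in> schwartz"
 proof (rule compact_smooth_schwartz[where R = "2 * R'"])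
  show "smooth (%x :: real^'a. cutoff (c * (x \<bullet> x)))" by (rule elementary_smooth[OF elementary_cutoff])
  fix x :: "real^'a" assume x: "2 * R' < norm x"
  have "(2 * R')\<^sup>2 <= (norm x)\<^sup>2" using x R' by (intro power_mono) auto
  then have "4 * R'\<^sup>2 <= (norm x)\<^sup>2" by (simp add: power_mult_distrib)
  then have "256 * R'\<^sup>2 <= 81 * (norm x)\<^sup>2" using zero_le_power2[of R'] by linarith
  then have "16/9 <= c * (x \<bullet> x)"
   using R' by (simp add: c_def power2_norm_eq_inner[symmetric] field_simps)
  then show "cutoff (c * (x \<bullet> x)) = 0" by (rule cutoff_eq_0)
 qed
 moreover have "complex_of_real (cutoff (c * (x \<bullet> x))) = 1" if "norm x <= R" for x :: "real^'a"
 proof -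
  have "(norm x)\<^sup>2 <= R'\<^sup>2" using that R' by (intro power_mono) auto
  then have "c * (x \<bullet> x) <= 9/16"
   using R' by (simp add: c_def power2_norm_eq_inner[symmetric] field_simps)
  then show ?thesis by (simp add: cutoff_eq_1)
 qed
 ultimately show ?thesis by (intro bexI[of _ "%x. complex_of_real (cutoff (c * (x \<bullet> x)))"]) auto
qed

text \<open>The bumps of the box converge to its indicator and stay below it. A cut-off equal to 1
  on the box shows that \<open>d\<close> is integrable there, which supplies the majorant.\<close>

lemma obox_integral_zero:
 fixes d :: "real^'n::finite => complex"
 assumes m [measurable]: "d \<in> borel_measurable borel"
  and z: "\<And>\<phi>. \<phi> \<in> schwartz ==> integrable lborel (%x. d x * \<phi> x) \<and> (LINT x|lborel. d x * \<phi> x) = 0"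
 shows "integrable lborel (%x. d x * indicator (obox a b) x)" (is "integrable lborel ?f")
  and "(LINT x|lborel. d x * indicator (obox a b) x) = 0"
proof -
 have mb [measurable]: "obox a b \<in> sets borel" unfolding obox_eq by simp
 obtain R where R: "\<forall>x\<in>obox a b. norm x <= R" using obox_bounded by blast
 obtain \<zeta> :: "real^'n => complex" where \<zeta>: "\<zeta> \<in> schwartz" "\<forall>x. norm x <= R --> \<zeta> x = (1::complex)" using cutoff_schwartz[where 'a = 'n] by blast
 show i: "integrable lborel ?f"
  by (rule int_bound[OF z[OF \<zeta>(1), THEN conjunct1]])
    (use R \<zeta> in \<open>auto intro!: AE_I2 simp: indicator_def\<close>)
 have "(%k. (LINT x|lborel. d x * complex_of_real (bump (real (Suc k)) a b x))) \<longlonglongrightarrow> (LINT x|lborel. ?f x)"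
 proof (rule integral_dominated_convergence[where w = "%x. norm (?f x)"])
  show "AE x in lborel. (%k. d x * complex_of_real (bump (real (Suc k)) a b x)) \<longlonglongrightarrow> ?f x"
  proof (rule AE_I2)
   fix x
   have "(%k. complex_of_real (bump (real (Suc k)) a b x)) \<longlonglongrightarrow> of_real (indicator (obox a b) x)"
    by (rule tendsto_of_real[OF bump_limit])
   also have "complex_of_real (indicator (obox a b) x) = indicator (obox a b) x"
    by (simp add: indicator_def)
   finally show "(%k. d x * complex_of_real (bump (real (Suc k)) a b x)) \<longlonglongrightarrow> ?f x"
    by (intro tendsto_mult tendsto_const)
  qed
  show "AE x in lborel. norm (d x * complex_of_real (bump (real (Suc k)) a b x)) <= norm (?f x)" for k
  proof (rule AE_I2)
   fix x
   show "norm (d x * complex_of_real (bump (real (Suc k)) a b x)) <= norm (?f x)"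
    using bump_bounds[of "real (Suc k)" a b x] bump_outside[of "real (Suc k)" x a b]
    by (cases "x \<in> obox a b") (auto simp: norm_mult mult_left_le)
  qed
  show "(%x. d x * complex_of_real (bump (real (Suc k)) a b x)) \<in> borel_measurable lborel" for k
   using schwartz_measurable[OF bump_schwartz[of "real (Suc k)" a b]] by measurable
 qed (use i in auto)
 moreover have "(LINT x|lborel. d x * complex_of_real (bump (real (Suc k)) a b x)) = 0" for k
  using z[OF bump_schwartz[of "real (Suc k)" a b]] by simp
 ultimately have "(%k::nat. 0) \<longlonglongrightarrow> (LINT x|lborel. ?f x)" by (simp only:)
 then show "(LINT x|lborel. ?f x) = 0" by (simp add: LIMSEQ_const_iff)
qed

text \<open>On a bounded box the positive and the negative part of \<open>f\<close> define finite
  measures that agree on the intersection-stable system of boxes, hence everywhere. Equal densities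
  force the value 0, since at each point one of the two parts vanishes.\<close>

lemma AE_zero_of_obox:
 fixes f :: "real^'n::finite => real"
 assumes m [measurable]: "f \<in> borel_measurable borel"
  and i: "\<And>a b. integrable lborel (%x. f x * indicator (obox a b) x)"
  and z: "\<And>a b. (LINT x|lborel. f x * indicator (obox a b) x) = 0"
 shows "AE x in lborel. f x = 0"
proof -
 let ?A = "%n::nat. Topology_Euclidean_Space.box (- (real n *\<^sub>R One)) (real n *\<^sub>R One) :: (real^'n) set"
 let ?E = "range (%(a, b). Topology_Euclidean_Space.box a b :: (real^'n) set)"
 have "AE x in lborel. f x * indicator (?A N) x = 0" for N
 proof -
  define F where "F x = f x * indicator (?A N) x" for x
  have [measurable]: "F \<in> borel_measurable borel" unfolding F_def by measurable
  have Fi: "integrable lborel F" using i unfolding F_def obox_eq .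
  define P where "P = density lborel (%x. ennreal (F x))"
  define Q where "Q = density lborel (%x. ennreal (- F x))"
  have fin: "integral\<^sup>N lborel (%x. ennreal (F x)) \<noteq> \<infinity>" "integral\<^sup>N lborel (%x. ennreal (- F x)) \<noteq> \<infinity>"
   using Fi unfolding real_integrable_def by auto
  have PQ: "emeasure P X = emeasure Q X" if XE: "X \<in> ?E" for X
  proof -
   obtain a b where X: "X = Topology_Euclidean_Space.box a b" using XE by auto
   have [measurable]: "X \<in> sets borel" by (simp add: X)
   obtain a' b' :: "real^'n" where ab: "?A N \<inter> X = Topology_Euclidean_Space.box a' b'" unfolding X box_Int_box by blast
   define G where "G x = f x * indicator (obox a' b') x" for x
   have G: "G x = F x * indicator X x" for x
    unfolding G_def F_def obox_eq ab[symmetric] by (simp add: indicator_inter_arith)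
   have Gi: "integrable lborel G" "integral\<^sup>L lborel G = 0" using i z unfolding G_def by auto
   have "integral\<^sup>N lborel (%x. ennreal (G x)) \<noteq> \<infinity>" "integral\<^sup>N lborel (%x. ennreal (- G x)) \<noteq> \<infinity>"
    using Gi(1) unfolding real_integrable_def by auto
   moreover have "enn2real (integral\<^sup>N lborel (%x. ennreal (G x))) = enn2real (integral\<^sup>N lborel (%x. ennreal (- G x)))"
    using Gi(2) real_lebesgue_integral_def[OF Gi(1)] by simp
   ultimately have "integral\<^sup>N lborel (%x. ennreal (G x)) = integral\<^sup>N lborel (%x. ennreal (- G x))"
    by (metis ennreal_enn2real infinity_ennreal_def less_top)
   moreover have "emeasure P X = integral\<^sup>N lborel (%x. ennreal (G x))"
    unfolding P_def G by (subst emeasure_density) (auto intro!: nn_integral_cong simp: indicator_def)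
   moreover have "emeasure Q X = integral\<^sup>N lborel (%x. ennreal (- G x))"
    unfolding Q_def G by (subst emeasure_density) (auto intro!: nn_integral_cong simp: indicator_def)
   ultimately show ?thesis by simp
  qed
  have "P = Q"
  proof (rule measure_eqI_generator_eq)
   show "Int_stable ?E" by (auto simp: Int_stable_def box_Int_box)
   show "?E \<subseteq> Pow UNIV" "sets P = sigma_sets UNIV ?E" "sets Q = sigma_sets UNIV ?E"
    by (simp_all add: borel_eq_box P_def Q_def)
   show "range ?A \<subseteq> ?E" "(\<Union>i. ?A i) = UNIV" unfolding UN_box_eq_UNIV by auto
   show "emeasure P (?A i) \<noteq> \<infinity>" for i
   proof -
    have "emeasure P (?A i) <= emeasure P (space P)" by (rule emeasure_space)
    also have "\<dots> = integral\<^sup>N lborel (%x. ennreal (F x))" unfolding P_def by (simp add: emeasure_density)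
    finally show ?thesis using fin(1) by (auto simp: top_unique)
   qed
  qed (use PQ in auto)
  then have "AE x in lborel. ennreal (F x) = ennreal (- F x)"
   unfolding P_def Q_def by (subst (asm) finite_density_unique) (use fin in auto)
  then show ?thesis unfolding F_def[symmetric]
  proof (rule AE_mp, intro AE_I2 impI)
   fix x assume "ennreal (F x) = ennreal (- F x)"
   then show "F x = 0" by (cases "F x" "0::real" rule: linorder_cases) (auto simp: ennreal_neg)
  qed
 qed
 then have "AE x in lborel. \<forall>N. f x * indicator (?A N) x = 0" unfolding AE_all_countable by blast
 then show ?thesis
 proof (rule AE_mp, intro AE_I2 impI)
  fix x assume *: "\<forall>N. f x * indicator (?A N) x = 0"
  have "x \<in> (\<Union>i. ?A i)" unfolding UN_box_eq_UNIV by simp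
  then obtain N where "x \<in> ?A N" by blast
  then show "f x = 0" using *[rule_format, of N] by simp
 qed
qed

lemma represents_unique:
 assumes g: "represents g u" and h: "represents h u"
 shows "AE x in lborel. g x = h x"
proof -
 define d where "d x = g x - h x" for x
 have gm [measurable]: "g \<in> borel_measurable borel" "h \<in> borel_measurable borel" using g h by (auto simp: represents_def)
 have dm [measurable]: "d \<in> borel_measurable borel" unfolding d_def by measurable
 have z: "integrable lborel (%x. d x * \<phi> x) \<and> (LINT x|lborel. d x * \<phi> x) = 0" if \<phi>: "\<phi> \<in> schwartz" for \<phi>
 proof -
  have i: "integrable lborel (%x. g x * \<phi> x)" "integrable lborel (%x. h x * \<phi> x)"
   and e: "(LINT x|lborel. g x * \<phi> x) = (LINT x|lborel. h x * \<phi> x)"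
   using g h \<phi> unfolding represents_def fun_distr_def by auto
  show ?thesis
   using int_diff[OF i] LINT_diff[OF i] e
   by (simp add: d_def left_diff_distrib)
 qed
 note oi = obox_integral_zero[OF dm z]
 have re: "Re (d x * indicator A x) = Re (d x) * indicator A x" "Im (d x * indicator A x) = Im (d x) * indicator A x" for x A
  by (simp_all add: indicator_def)
 have "AE x in lborel. Re (d x) = 0"
 proof (rule AE_zero_of_obox)
  fix a b
  show "integrable lborel (%x. Re (d x) * indicator (obox a b) x)"
   using integrable_Re[OF oi(1)[of a b]] by (simp only: re)
  show "(LINT x|lborel. Re (d x) * indicator (obox a b) x) = 0"
   using integral_Re[OF oi(1)[of a b]] oi(2)[of a b] by (simp only: re zero_complex.simps)
 qed measurable
 moreover have "AE x in lborel. Im (d x) = 0"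
 proof (rule AE_zero_of_obox)
  fix a b
  show "integrable lborel (%x. Im (d x) * indicator (obox a b) x)"
   using integrable_Im[OF oi(1)[of a b]] by (simp only: re)
  show "(LINT x|lborel. Im (d x) * indicator (obox a b) x) = 0"
   using integral_Im[OF oi(1)[of a b]] oi(2)[of a b] by (simp only: re zero_complex.simps)
 qed measurable
 ultimately show ?thesis by (rule AE_mp[OF _ AE_mp]) (auto simp: d_def complex_eq_iff)
qed

lemma represents_density_of: "represents g u ==> represents (density_of u) u"
 unfolding density_of_def by (rule someI[of "%g. represents g u"])

lemma density_of_AE: "represents g u ==> AE x in lborel. density_of u x = g x"
 by (rule represents_unique[OF represents_density_of])

text \<open>Continuous functions agree on a closed set, and a closed set of full Lebesgue measure is
  the whole space.\<close>

lemma represents_continuous_unique: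
 assumes "represents f u" "represents g u" "continuous_on UNIV f" "continuous_on UNIV g"
 shows "f = g"
proof
 fix x
 have "closed {x. f x = g x}" using assms by (intro closed_Collect_eq) auto
 moreover have "AE x in lebesgue. x \<in> {x. f x = g x}"
  using AE_completion[OF represents_unique[OF assms(1,2)]] by simp
 ultimately have "x \<in> {x. f x = g x}" by (rule mem_closed_if_AE_lebesgue)
 then show "f x = g x" by simp
qed

lemma continuous_version_eq:
 assumes "represents f u" "continuous_on UNIV f" "bounded (range f)"
 shows "continuous_version u = f"
 unfolding continuous_version_def
 by (rule the_equality) (use assms represents_continuous_unique in auto)

section \<open>Signed measures\<close>

lemma ennreal_integral_le:
 assumes "integrable M f" shows "ennreal (integral\<^sup>L M f) <= (\<integral>\<^sup>+x. ennreal (f x) \<partial>M)"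
proof -
 have fin: "(\<integral>\<^sup>+x. ennreal (f x) \<partial>M) \<noteq> \<infinity>" using assms unfolding real_integrable_def by auto
 have "integral\<^sup>L M f <= enn2real (\<integral>\<^sup>+x. ennreal (f x) \<partial>M)"
  unfolding real_lebesgue_integral_def[OF assms] by simp
 then have "ennreal (integral\<^sup>L M f) <= ennreal (enn2real (\<integral>\<^sup>+x. ennreal (f x) \<partial>M))" by (rule ennreal_leI)
 also have "\<dots> = (\<integral>\<^sup>+x. ennreal (f x) \<partial>M)" using fin by (simp add: less_top)
 finally show ?thesis .
qed

text \<open>The supremum is attained at the part of \<open>C\<close> where \<open>h\<close> is
  positive, the Hahn decomposition of a measure with density.\<close>

lemma positive_variation_density:
 fixes \<mu> :: "'a::topological_space measure" and h :: "'a => real"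
 assumes s [measurable_cong]: "sets \<mu> = sets borel" and h: "integrable \<mu> h"
  and \<nu>: "\<And>C. C \<in> sets borel ==> \<nu> C = (LINT x|\<mu>. h x * indicator C x)"
 shows "positive_variation \<nu> = density \<mu> (%x. ennreal (h x))"
proof -
 have [measurable]: "h \<in> borel_measurable \<mu>" using h by simp
 let ?D = "density \<mu> (%x. ennreal (h x))"
 have eq: "(SUP B\<in>{B \<in> sets borel. B \<subseteq> C}. ennreal (\<nu> B)) = emeasure ?D C" if C: "C \<in> sets borel" for C
 proof (rule antisym)
  have Cm [measurable]: "C \<in> sets \<mu>" using C s by simp
  show "(SUP B\<in>{B \<in> sets borel. B \<subseteq> C}. ennreal (\<nu> B)) <= emeasure ?D C"
  proof (rule SUP_least)
   fix B :: "'a set" assume B: "B \<in> {B \<in> sets borel. B \<subseteq> C}"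
   then have Bm [measurable]: "B \<in> sets \<mu>" using s by simp
   have i: "integrable \<mu> (%x. h x * indicator B x)" using h by (rule integrable_real_mult_indicator[OF Bm])
   have "ennreal (\<nu> B) <= (\<integral>\<^sup>+x. ennreal (h x * indicator B x) \<partial>\<mu>)"
    using B \<nu>[of B] ennreal_integral_le[OF i] by simp
   also have "\<dots> <= (\<integral>\<^sup>+x. ennreal (h x) * indicator C x \<partial>\<mu>)"
    using B by (intro nn_integral_mono) (auto simp: indicator_def)
   also have "\<dots> = emeasure ?D C" by (simp add: emeasure_density)
   finally show "ennreal (\<nu> B) <= emeasure ?D C" .
  qed
  define B where "B = C \<inter> {x \<in> space \<mu>. 0 < h x}"
  have sp: "space \<mu> = UNIV" using sets_eq_imp_space_eq[OF s] by simp
  have Bm [measurable]: "B \<in> sets \<mu>" unfolding B_def by measurable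
  have i: "integrable \<mu> (%x. h x * indicator B x)" using h by (rule integrable_real_mult_indicator[OF Bm])
  have "emeasure ?D C = (\<integral>\<^sup>+x. ennreal (h x) * indicator C x \<partial>\<mu>)" by (simp add: emeasure_density)
  also have "\<dots> = (\<integral>\<^sup>+x. ennreal (h x * indicator B x) \<partial>\<mu>)"
   by (intro nn_integral_cong) (auto simp: indicator_def B_def ennreal_neg)
  also have "\<dots> = ennreal (LINT x|\<mu>. h x * indicator B x)"
   by (rule nn_integral_eq_integral[OF i]) (auto simp: indicator_def B_def)
  also have "\<dots> = ennreal (\<nu> B)" using Bm s \<nu>[of B] by simp
  also have "\<dots> <= (SUP B\<in>{B \<in> sets borel. B \<subseteq> C}. ennreal (\<nu> B))"
   by (rule SUP_upper) (use Bm s in \<open>auto simp: B_def\<close>)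
  finally show "emeasure ?D C <= (SUP B\<in>{B \<in> sets borel. B \<subseteq> C}. ennreal (\<nu> B))" .
 qed
 have sD: "sets ?D = sets borel" "space ?D = UNIV" using s sets_eq_imp_space_eq[OF s] by auto
 have "positive_variation \<nu> = measure_of UNIV (sets borel) (emeasure ?D)"
  unfolding positive_variation_def
 proof (rule measure_of_eq)
  fix C :: "'a set" assume "C \<in> sigma_sets UNIV (sets borel)"
  then have "C \<in> sets borel" using sets.sigma_sets_eq[of "borel :: 'a measure"] by simp
  then show "(SUP B\<in>{B \<in> sets borel. B \<subseteq> C}. ennreal (\<nu> B)) = emeasure ?D C" by (rule eq)
 qed simp
 also have "\<dots> = ?D" using measure_of_of_measure[of ?D] sD by simp
 finally show ?thesis .
qed

lemma signed_integral_density: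
 fixes \<mu> :: "'a::topological_space measure" and h :: "'a => real" and f :: "'a => complex"
 assumes s [measurable_cong]: "sets \<mu> = sets borel" and h: "integrable \<mu> h"
  and \<nu>: "\<And>C. C \<in> sets borel ==> \<nu> C = (LINT x|\<mu>. h x * indicator C x)"
  and f [measurable]: "f \<in> borel_measurable borel" and b: "\<And>x. cmod (f x) <= B"
 shows "signed_integral \<nu> f = (LINT x|\<mu>. of_real (h x) * f x)"
proof -
 have [measurable]: "h \<in> borel_measurable \<mu>" "f \<in> borel_measurable \<mu>" using h f s measurable_cong_sets by auto
 have B: "0 <= B" using b[of undefined] norm_ge_zero order_trans by blast
 have D: "integral\<^sup>L (density \<mu> (%x. ennreal (k x))) f = (LINT x|\<mu>. of_real (max 0 (k x)) * f x)"
  if [measurable]: "k \<in> borel_measurable \<mu>" for k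
 proof -
  have "(%x. ennreal (k x)) = (%x. ennreal (max 0 (k x)))" by (auto simp: fun_eq_iff max_def ennreal_neg)
  then have "integral\<^sup>L (density \<mu> (%x. ennreal (k x))) f = integral\<^sup>L (density \<mu> (%x. ennreal (max 0 (k x)))) f" by simp
  also have "\<dots> = (LINT x|\<mu>. max 0 (k x) *\<^sub>R f x)" by (rule integral_density) auto
  finally show ?thesis by (simp add: scaleR_conv_of_real)
 qed
 have i: "integrable \<mu> (%x. of_real (max 0 (k x)) * f x)" if k: "integrable \<mu> k" for k
 proof (rule int_bound)
  show "integrable \<mu> (%x. B * k x)" using k by (rule integrable_mult_right)
  show "(%x. of_real (max 0 (k x)) * f x) \<in> borel_measurable \<mu>" using borel_measurable_integrable[OF k] by measurable
  show "AE x in \<mu>. norm (of_real (max 0 (k x)) * f x) <= norm (B * k x)"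
  proof (rule AE_I2)
   fix x
   have "norm (of_real (max 0 (k x)) * f x) <= \<bar>k x\<bar> * B"
    unfolding norm_mult using b B by (intro mult_mono) auto
   then show "norm (of_real (max 0 (k x)) * f x) <= norm (B * k x)" using B by (simp add: abs_mult mult.commute)
  qed
 qed
 have 1: "positive_variation \<nu> = density \<mu> (%x. ennreal (h x))"
  by (rule positive_variation_density[OF s h \<nu>])
 have 2: "positive_variation (%C. - \<nu> C) = density \<mu> (%x. ennreal (- h x))"
  by (rule positive_variation_density[OF s]) (use h \<nu> in auto)
 have hm: "(%x. - h x) \<in> borel_measurable \<mu>" by measurable
 have hi: "integrable \<mu> (%x. - h x)" using h by simp
 have "signed_integral \<nu> f = (LINT x|\<mu>. of_real (max 0 (h x)) * f x) - (LINT x|\<mu>. of_real (max 0 (- h x)) * f x)"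
  unfolding signed_integral_def 1 2 by (simp only: D[OF borel_measurable_integrable[OF h]] D[OF hm])
 also have "\<dots> = (LINT x|\<mu>. of_real (max 0 (h x)) * f x - of_real (max 0 (- h x)) * f x)"
  by (rule LINT_diff[symmetric, OF i[OF h] i[OF hi]])
 also have "\<dots> = (LINT x|\<mu>. of_real (h x) * f x)"
  by (intro LINT_cong) (auto simp: max_def)
 finally show ?thesis .
qed

text \<open>The density is the conditional expectation of \<open>U\<close> given \<open>Z\<close>,
  obtained by Radon-Nikodym. It is finite almost everywhere because the total mass is, and
  \<open>enn2real\<close> makes it real on the remaining null set.\<close>

lemma pushforward_density:
 fixes Z :: "'a => 'b::topological_space" and U :: "'a => real"
 assumes fin: "finite_measure M" and Z [measurable]: "Z \<in> borel_measurable M"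
  and U: "integrable M U" and U0: "\<And>x. 0 <= U x"
 shows "\<exists>p. (\<forall>x. 0 <= p x) \<and> integrable (distr M borel Z) p \<and>
  distr (density M (%x. ennreal (U x))) borel Z = density (distr M borel Z) (%x. ennreal (p x))"
proof -
 interpret M: finite_measure M by fact
 have [measurable]: "U \<in> borel_measurable M" using U by simp
 let ?\<mu> = "distr M borel Z" and ?P = "distr (density M (%x. ennreal (U x))) borel Z"
 interpret \<mu>: finite_measure ?\<mu> by (rule M.finite_measure_distr) measurable
 have ac: "absolutely_continuous ?\<mu> ?P"
  unfolding absolutely_continuous_def
 proof
  fix A assume A: "A \<in> null_sets ?\<mu>"
  then have Am: "A \<in> sets borel" and "emeasure M (Z -` A \<inter> space M) = 0" by (auto simp: null_sets_def emeasure_distr)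
  then have N: "Z -` A \<inter> space M \<in> null_sets M" by auto
  have "emeasure ?P A = emeasure (density M (%x. ennreal (U x))) (Z -` A \<inter> space M)"
   using Am by (subst emeasure_distr) auto
  also have "\<dots> = 0"
  proof -
   have "Z -` A \<inter> space M \<in> null_sets (density M (%x. ennreal (U x)))"
    using absolutely_continuousI_density[of "%x. ennreal (U x)" M] N unfolding absolutely_continuous_def by auto
   then show ?thesis by auto
  qed
  finally show "A \<in> null_sets ?P" using Am by auto
 qed
 obtain f where f [measurable]: "f \<in> borel_measurable ?\<mu>" and fP: "density ?\<mu> f = ?P"
  using \<mu>.Radon_Nikodym[OF ac] by auto
 have tot: "(\<integral>\<^sup>+x. f x \<partial>?\<mu>) < \<infinity>"
 proof -
  have "(\<integral>\<^sup>+x. f x \<partial>?\<mu>) = emeasure (density ?\<mu> f) UNIV" by (subst emeasure_density) auto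
  also have "\<dots> = emeasure (density M (%x. ennreal (U x))) (space M)" unfolding fP by (subst emeasure_distr) auto
  also have "\<dots> = (\<integral>\<^sup>+x. ennreal (U x) \<partial>M)" by (subst emeasure_density) (auto intro!: nn_integral_cong)
  also have "\<dots> < \<infinity>" using U U0 by (simp add: nn_integral_eq_integral)
  finally show ?thesis .
 qed
 then have fae: "AE x in ?\<mu>. f x \<noteq> \<infinity>" by (intro nn_integral_noteq_infinite) auto
 define p where "p x = enn2real (f x)" for x
 have [measurable]: "p \<in> borel_measurable ?\<mu>" unfolding p_def by measurable
 have ae: "AE x in ?\<mu>. ennreal (p x) = f x"
  using fae by (rule AE_mp) (auto simp: p_def less_top)
 have "density ?\<mu> (%x. ennreal (p x)) = density ?\<mu> f"
  by (rule density_cong) (use ae in auto)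
 moreover have "integrable ?\<mu> p"
 proof (rule integrableI_nonneg)
  have "(\<integral>\<^sup>+x. ennreal (p x) \<partial>?\<mu>) = (\<integral>\<^sup>+x. f x \<partial>?\<mu>)" using ae by (rule nn_integral_cong_AE)
  then show "(\<integral>\<^sup>+x. ennreal (p x) \<partial>?\<mu>) < \<infinity>" using tot by simp
 qed (auto simp: p_def)
 ultimately show ?thesis using fP by (intro exI[of _ p]) (auto simp: p_def)
qed

text \<open>The Jordan decomposition of an image measure is in general not the image of the
  decomposition, as masses of opposite sign may meet at one point. So both parts of \<open>U\<close>
  are first pushed to densities \<open>p\<close> and \<open>n\<close> on the target, where
  \<open>signed_integral_density\<close> applies to \<open>p - n\<close>.\<close>

lemma signed_integral_pushforward:
 fixes Z :: "'a => 'b::topological_space" and U :: "'a => real" and f :: "'b => complex"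
 assumes fin: "finite_measure M" and Z [measurable]: "Z \<in> borel_measurable M"
  and U: "integrable M U"
  and \<nu>: "\<And>C. C \<in> sets borel ==> \<nu> C = (LINT x|M. U x * indicator C (Z x))"
  and f [measurable]: "f \<in> borel_measurable borel" and b: "\<And>x. cmod (f x) <= B"
 shows "signed_integral \<nu> f = (LINT x|M. of_real (U x) * f (Z x))"
proof -
 have [measurable]: "U \<in> borel_measurable M" using U by simp
 let ?\<mu> = "distr M borel Z"
 define V where "V x = max 0 (U x)" for x
 define V' where "V' x = max 0 (- U x)" for x
 have UV: "U x = V x - V' x" for x by (simp add: V_def V'_def)
 have V: "integrable M V" "\<And>x. 0 <= V x" "integrable M V'" "\<And>x. 0 <= V' x"
  using U unfolding V_def V'_def by (auto intro!: integrable_max)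
 have [measurable]: "V \<in> borel_measurable M" "V' \<in> borel_measurable M" using V by auto
 obtain p where p: "\<And>x. 0 <= p x" "integrable ?\<mu> p"
   "distr (density M (%x. ennreal (V x))) borel Z = density ?\<mu> (%x. ennreal (p x))"
  using pushforward_density[OF fin Z V(1,2)] by blast
 obtain n where n: "\<And>x. 0 <= n x" "integrable ?\<mu> n"
   "distr (density M (%x. ennreal (V' x))) borel Z = density ?\<mu> (%x. ennreal (n x))"
  using pushforward_density[OF fin Z V(3,4)] by blast
 have [measurable]: "p \<in> borel_measurable borel" "n \<in> borel_measurable borel" using p n by auto
 have tr: "(LINT x|?\<mu>. q x *\<^sub>R k x) = (LINT x|M. Q x *\<^sub>R k (Z x))"
  if q: "\<And>x. 0 <= q x" and [measurable]: "q \<in> borel_measurable borel" "Q \<in> borel_measurable M" "k \<in> borel_measurable borel"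
   and Q: "\<And>x. 0 <= Q x"
   and eq: "distr (density M (%x. ennreal (Q x))) borel Z = density ?\<mu> (%x. ennreal (q x))"
  for q Q and k :: "'b => 'c::{banach, second_countable_topology}"
 proof -
  have "(LINT x|?\<mu>. q x *\<^sub>R k x) = integral\<^sup>L (density ?\<mu> (%x. ennreal (q x))) k"
   by (rule integral_density[symmetric]) (use q in auto)
  also have "\<dots> = (LINT x|density M (%x. ennreal (Q x)). k (Z x))"
   unfolding eq[symmetric] by (rule integral_distr) auto
  also have "\<dots> = (LINT x|M. Q x *\<^sub>R k (Z x))" by (rule integral_density) (use Q in auto)
  finally show ?thesis .
 qed
 have ib: "integrable M (%x. Q x *\<^sub>R k (Z x))"
  if Q: "integrable M Q" and [measurable]: "k \<in> borel_measurable borel" and k: "\<And>x. norm (k x) <= K"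
  for Q and k :: "'b => 'c::{banach, second_countable_topology}" and K
 proof (rule int_bound[OF integrable_mult_right[OF Q, of K]])
  show "(%x. Q x *\<^sub>R k (Z x)) \<in> borel_measurable M" using borel_measurable_integrable[OF Q] by measurable
  show "AE x in M. norm (Q x *\<^sub>R k (Z x)) <= norm (K * Q x)"
  proof (rule AE_I2)
   fix x
   have "\<bar>Q x\<bar> * norm (k (Z x)) <= \<bar>Q x\<bar> * \<bar>K\<bar>" using order_trans[OF k abs_ge_self] by (intro mult_left_mono) auto
   then show "norm (Q x *\<^sub>R k (Z x)) <= norm (K * Q x)" by (simp add: abs_mult mult.commute)
  qed
 qed
 have ib\<mu>: "integrable ?\<mu> (%x. Q x *\<^sub>R k x)"
  if Q: "integrable ?\<mu> Q" and [measurable]: "k \<in> borel_measurable borel" and k: "\<And>x. norm (k x) <= K"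
  for Q and k :: "'b => 'c::{banach, second_countable_topology}" and K
 proof (rule int_bound[OF integrable_mult_right[OF Q, of K]])
  show "(%x. Q x *\<^sub>R k x) \<in> borel_measurable ?\<mu>" using borel_measurable_integrable[OF Q] by measurable
  show "AE x in ?\<mu>. norm (Q x *\<^sub>R k x) <= norm (K * Q x)"
  proof (rule AE_I2)
   fix x
   have "\<bar>Q x\<bar> * norm (k x) <= \<bar>Q x\<bar> * \<bar>K\<bar>" using order_trans[OF k abs_ge_self] by (intro mult_left_mono) auto
   then show "norm (Q x *\<^sub>R k x) <= norm (K * Q x)" by (simp add: abs_mult mult.commute)
  qed
 qed
 have key: "(LINT x|?\<mu>. (p x - n x) *\<^sub>R k x) = (LINT x|M. U x *\<^sub>R k (Z x))"
  if [measurable]: "k \<in> borel_measurable borel" and k: "\<And>x. norm (k x) <= K"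
  for k :: "'b => 'c::{banach, second_countable_topology}" and K
 proof -
  have "(LINT x|?\<mu>. (p x - n x) *\<^sub>R k x) = (LINT x|?\<mu>. p x *\<^sub>R k x - n x *\<^sub>R k x)" by (simp add: scaleR_left_diff_distrib)
  also have "\<dots> = (LINT x|?\<mu>. p x *\<^sub>R k x) - (LINT x|?\<mu>. n x *\<^sub>R k x)"
   by (rule LINT_diff[OF ib\<mu>[OF p(2) that] ib\<mu>[OF n(2) that]])
  also have "\<dots> = (LINT x|M. V x *\<^sub>R k (Z x)) - (LINT x|M. V' x *\<^sub>R k (Z x))"
   using tr[OF p(1) _ _ _ V(2) p(3), of k] tr[OF n(1) _ _ _ V(4) n(3), of k] by simp
  also have "\<dots> = (LINT x|M. V x *\<^sub>R k (Z x) - V' x *\<^sub>R k (Z x))"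
   by (rule LINT_diff[symmetric, OF ib[OF V(1) that] ib[OF V(3) that]])
  finally show ?thesis by (simp add: UV scaleR_left_diff_distrib)
 qed
 have "signed_integral \<nu> f = (LINT x|?\<mu>. of_real (p x - n x) * f x)"
 proof (rule signed_integral_density[OF _ _ _ f b])
  show "integrable ?\<mu> (%x. p x - n x)" using p n by auto
  fix C :: "'b set" assume [measurable]: "C \<in> sets borel"
  show "\<nu> C = (LINT x|?\<mu>. (p x - n x) * indicator C x)"
   using key[of "indicator C :: 'b => real" 1] \<nu>[of C] by (simp add: indicator_def)
 qed simp
 also have "\<dots> = (LINT x|M. of_real (U x) * f (Z x))"
  using key[OF f b] by (simp add: scaleR_conv_of_real)
 finally show ?thesis .
qed

section \<open>Lebesgue measure on the time square\<close>

text \<open>A measure on all Borel sets of the line rather than on a subspace, so that measurability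
  remains that of Borel functions.\<close>

definition time_measure :: "real => real measure" where
 "time_measure T = density lborel (%r. ennreal (indicator {0..T} r))"

lemma sets_time_measure [measurable_cong]: "sets (time_measure T) = sets borel"
 by (simp add: time_measure_def)

lemma finite_time_measure: "finite_measure (time_measure T)"
proof
 have "emeasure (time_measure T) (space (time_measure T)) = (\<integral>\<^sup>+r. indicator {0..T} r \<partial>lborel)"
  unfolding time_measure_def by (subst emeasure_density) (simp_all add: ennreal_indicator)
 also have "\<dots> = emeasure lborel {0..T}" by (rule nn_integral_indicator) simp
 finally show "emeasure (time_measure T) (space (time_measure T)) \<noteq> \<infinity>"
  using emeasure_lborel_cbox_finite[of 0 T] by (simp add: less_top)
qed

lemma integral_time_measure:
 fixes f :: "real => 'a::{banach, second_countable_topology}"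
 assumes [measurable]: "f \<in> borel_measurable borel"
 shows "(LINT r|time_measure T. f r) = (LINT r:{0..T}|lborel. f r)"
 unfolding time_measure_def set_lebesgue_integral_def by (rule integral_density) auto

abbreviation time_square :: "real => (real \<times> real) measure" where
 "time_square T \<equiv> time_measure T \<Otimes>\<^sub>M time_measure T"

lemma finite_time_square: "finite_measure (time_square T)"
 by (rule finite_measure_pair_measure) (rule finite_time_measure)+

section \<open>Distributions with integrable Fourier transform\<close>

text \<open>Says that the Fourier transform of \<open>u\<close> is the integrable function
  \<open>a\<close>: inserting \<open>\<phi> = fourier \<psi>\<close> recovers the usual
  pairing.\<close>

definition spec :: "(real^'n::finite => complex) => 'n distribution => bool" where
 "spec a u \<longleftrightarrow> integrable lborel a \<and> (\<forall>\<phi>\<in>schwartz. u \<phi> = (LINT \<xi>|lborel. a \<xi> * inv_fourier \<phi> \<xi>))"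

definition hfun :: "(real^'n::finite => complex) => real^'n => complex" where
 "hfun a x = (1 / of_real ((2 * pi) ^ CARD('n))) * (LINT \<xi>|lborel. cis (x \<bullet> \<xi>) * a \<xi>)"

lemma two_pi_ge_1: "1 <= (2 * pi) ^ k"
proof (rule one_le_power)
 show "1 <= 2 * pi" using pi_gt3 by linarith
qed

lemma integrable_cis_mult:
 fixes a :: "real^'n::finite => complex"
 assumes "integrable lborel a" shows "integrable lborel (%\<xi>. cis (s * (x \<bullet> \<xi>)) * a \<xi>)"
 by (rule int_bound[OF assms])
   (use borel_measurable_integrable[OF assms] in \<open>auto simp: norm_mult\<close>)

lemma integrable_cis_mult':
 fixes a :: "real^'n::finite => complex"
 assumes "integrable lborel a" shows "integrable lborel (%\<xi>. cis (x \<bullet> \<xi>) * a \<xi>)"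
 using integrable_cis_mult[OF assms, of 1 x] by simp

lemma hfun_bound:
 assumes "integrable lborel a" shows "cmod (hfun a x) <= (LINT \<xi>|lborel. cmod (a \<xi>))"
proof -
 have "cmod (LINT \<xi>|lborel. cis (x \<bullet> \<xi>) * a \<xi>) <= (LINT \<xi>|lborel. cmod (cis (x \<bullet> \<xi>) * a \<xi>))" by (rule integral_norm_bound)
 then have b: "cmod (LINT \<xi>|lborel. cis (x \<bullet> \<xi>) * a \<xi>) <= (LINT \<xi>|lborel. cmod (a \<xi>))" by (simp add: norm_mult)
 define c where "c = (2 * pi) ^ CARD('a)"
 have c: "1 <= c" unfolding c_def by (rule two_pi_ge_1)
 have "cmod (hfun a x) = (1 / c) * cmod (LINT \<xi>|lborel. cis (x \<bullet> \<xi>) * a \<xi>)"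
  using c unfolding hfun_def c_def[symmetric] by (simp add: norm_mult norm_divide)
 also have "\<dots> <= 1 * cmod (LINT \<xi>|lborel. cis (x \<bullet> \<xi>) * a \<xi>)" using c by (intro mult_right_mono) auto
 finally show ?thesis using b by simp
qed

lemma hfun_continuous:
 assumes a: "integrable lborel a" shows "continuous_on UNIV (hfun a)"
 unfolding continuous_on_eq_continuous_at[OF open_UNIV] continuous_at_sequentially o_def
proof (intro ballI allI impI)
 fix x and y :: "nat => real^'a" assume y: "y \<longlonglongrightarrow> x"
 have [measurable]: "a \<in> borel_measurable borel" using borel_measurable_integrable[OF a] by simp
 have "(%k. (LINT \<xi>|lborel. cis (y k \<bullet> \<xi>) * a \<xi>)) \<longlonglongrightarrow> (LINT \<xi>|lborel. cis (x \<bullet> \<xi>) * a \<xi>)"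
 proof (rule integral_dominated_convergence[where w = "%\<xi>. cmod (a \<xi>)"])
  show "AE \<xi> in lborel. (%k. cis (y k \<bullet> \<xi>) * a \<xi>) \<longlonglongrightarrow> cis (x \<bullet> \<xi>) * a \<xi>"
  proof (rule AE_I2)
   fix \<xi>
   have "(%k. y k \<bullet> \<xi>) \<longlonglongrightarrow> x \<bullet> \<xi>" by (intro tendsto_inner y tendsto_const)
   then have "(%k. cis (y k \<bullet> \<xi>)) \<longlonglongrightarrow> cis (x \<bullet> \<xi>)" by (rule tendsto_cis)
   then show "(%k. cis (y k \<bullet> \<xi>) * a \<xi>) \<longlonglongrightarrow> cis (x \<bullet> \<xi>) * a \<xi>" by (intro tendsto_mult tendsto_const)
  qed
 qed (use a in \<open>auto simp: norm_mult\<close>)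
 then show "(%k. hfun a (y k)) \<longlonglongrightarrow> hfun a x" unfolding hfun_def by (intro tendsto_mult tendsto_const)
qed

lemma hfun_represents:
 fixes u :: "'n::finite distribution"
 assumes "spec a u" shows "represents (hfun a) u"
proof -
 have a: "integrable lborel a" and u: "\<And>\<phi>. \<phi> \<in> schwartz ==> u \<phi> = (LINT \<xi>|lborel. a \<xi> * inv_fourier \<phi> \<xi>)"
  using assms by (auto simp: spec_def)
 have hm [measurable]: "hfun a \<in> borel_measurable borel" by (rule borel_measurable_continuous_onI[OF hfun_continuous[OF a]])
 have "integrable lborel (%x. hfun a x * \<phi> x) \<and> u \<phi> = fun_distr (hfun a) \<phi>" if \<phi>: "\<phi> \<in> schwartz" for \<phi>
 proof
  have pm [measurable]: "\<phi> \<in> borel_measurable borel" by (rule schwartz_measurable[OF \<phi>])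
  define K where "K = (LINT \<xi>|lborel. cmod (a \<xi>))"
  have K: "cmod (hfun a x) <= K" for x unfolding K_def by (rule hfun_bound[OF a])
  have K0: "0 <= K" using order_trans[OF norm_ge_zero K] .
  show "integrable lborel (%x. hfun a x * \<phi> x)"
  proof (rule int_bound[OF integrable_mult_right[OF schwartz_integrable[OF \<phi>], of "of_real K"]])
   show "AE x in lborel. norm (hfun a x * \<phi> x) <= norm (of_real K * \<phi> x)"
    using K K0 by (intro AE_I2) (auto simp: norm_mult intro!: mult_right_mono)
  qed measurable
  define c where "c = 1 / complex_of_real ((2 * pi) ^ CARD('n))"
  have km: "(%(\<xi>, x). cis (x \<bullet> \<xi>)) \<in> borel_measurable (lborel \<Otimes>\<^sub>M (lborel :: (real^'n) measure))" by measurable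
  have "u \<phi> = (LINT \<xi>|lborel. (LINT x|lborel. cis (x \<bullet> \<xi>) * (c * a \<xi>) * \<phi> x))"
   unfolding u[OF \<phi>]
  proof (rule LINT_cong[OF refl])
   fix \<xi>
   have "a \<xi> * inv_fourier \<phi> \<xi> = (c * a \<xi>) * (LINT x|lborel. cis (1 * (x \<bullet> \<xi>)) * \<phi> x)"
    unfolding inv_fourier_eq FF_def c_def by simp
   also have "\<dots> = (LINT x|lborel. (c * a \<xi>) * (cis (1 * (x \<bullet> \<xi>)) * \<phi> x))"
    by (rule integral_mult_right_zero[symmetric])
   finally show "a \<xi> * inv_fourier \<phi> \<xi> = (LINT x|lborel. cis (x \<bullet> \<xi>) * (c * a \<xi>) * \<phi> x)"
    by (simp only: mult_1 mult_ac)
  qed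
  also have "\<dots> = (LINT x|lborel. (LINT \<xi>|lborel. cis (x \<bullet> \<xi>) * (c * a \<xi>) * \<phi> x))"
   by (rule kernel_fubini(2)[OF sigma_finite_lborel sigma_finite_lborel _ schwartz_integrable[OF \<phi>] km, of _ 1])
     (use a in auto)
  also have "\<dots> = (LINT x|lborel. hfun a x * \<phi> x)"
  proof (rule LINT_cong[OF refl])
   fix x
   have "hfun a x * \<phi> x = (c * \<phi> x) * (LINT \<xi>|lborel. cis (x \<bullet> \<xi>) * a \<xi>)"
    unfolding hfun_def c_def by simp
   also have "\<dots> = (LINT \<xi>|lborel. (c * \<phi> x) * (cis (x \<bullet> \<xi>) * a \<xi>))"
    by (rule integral_mult_right_zero[symmetric])
   finally show "(LINT \<xi>|lborel. cis (x \<bullet> \<xi>) * (c * a \<xi>) * \<phi> x) = hfun a x * \<phi> x"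
    by (simp only: mult_ac)
  qed
  finally show "u \<phi> = fun_distr (hfun a) \<phi>" unfolding fun_distr_def .
 qed
 then show ?thesis unfolding represents_def by simp
qed

lemma spec_continuous_version: "spec a u ==> continuous_version u = hfun a"
proof (rule continuous_version_eq)
 assume s: "spec a u"
 then have a: "integrable lborel a" by (simp add: spec_def)
 show "represents (hfun a) u" by (rule hfun_represents[OF s])
 show "continuous_on UNIV (hfun a)" by (rule hfun_continuous[OF a])
 show "bounded (range (hfun a))" by (rule boundedI) (use hfun_bound[OF a] in auto)
qed

lemma spec_Linfty:
 assumes s: "spec a u" shows "Linfty_distr_norm u <= ennreal (LINT \<xi>|lborel. cmod (a \<xi>))"
proof -
 have a: "integrable lborel a" using s by (simp add: spec_def)
 have r: "represents (hfun a) u" by (rule hfun_represents[OF s])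
 have dm: "density_of u \<in> borel_measurable borel" using represents_density_of[OF r] by (simp add: represents_def)
 have "esssup lborel (%x. ennreal (norm (density_of u x))) <= ennreal (LINT \<xi>|lborel. cmod (a \<xi>))"
 proof (rule esssup_I)
  show "(%x. ennreal (norm (density_of u x))) \<in> borel_measurable lborel" using dm by measurable
  show "AE x in lborel. ennreal (norm (density_of u x)) <= ennreal (LINT \<xi>|lborel. cmod (a \<xi>))"
   using density_of_AE[OF r] by (rule AE_mp) (use hfun_bound[OF a] in \<open>auto intro!: ennreal_leI\<close>)
 qed
 then show ?thesis unfolding Linfty_distr_norm_def Lp_norm_def using r by auto
qed

lemma schwartz_seminorm_ge:
 assumes "\<phi> \<in> schwartz" shows "(1 + norm x) ^ k * norm (\<phi> x) <= schwartz_seminorm k 0 \<phi>"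
proof -
 obtain C where C: "\<forall>x. (1 + norm x) ^ k * norm (\<phi> x) <= C" using rapid_bound[OF schwartz_rapid[OF assms]] by blast
 have "(%(is, x). (1 + norm x) ^ k * norm (pderivs is \<phi> x)) ([], x) <=
   (SUP (is, x)\<in>{is. length is <= 0} \<times> UNIV. (1 + norm x) ^ k * norm (pderivs is \<phi> x))"
 proof (rule cSUP_upper)
  show "bdd_above ((%(is, x). (1 + norm x) ^ k * norm (pderivs is \<phi> x)) ` ({is. length is <= 0} \<times> UNIV))"
   by (rule bdd_aboveI[of _ C]) (use C in \<open>auto simp: pderivs_Nil\<close>)
 qed simp
 then show ?thesis by (simp add: schwartz_seminorm_def pderivs_Nil)
qed

lemma inv_fourier_bound: "cmod (inv_fourier \<phi> (\<xi> :: real^'n::finite)) <= (LINT x|lborel. cmod (\<phi> x))"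
proof -
 define c where "c = (2 * pi) ^ CARD('n)"
 have c: "1 <= c" unfolding c_def by (rule two_pi_ge_1)
 have "cmod (FF 1 \<phi> \<xi>) <= (LINT x|lborel. cmod (cis (1 * (x \<bullet> \<xi>)) * \<phi> x))" unfolding FF_def by (rule integral_norm_bound)
 then have b: "cmod (FF 1 \<phi> \<xi>) <= (LINT x|lborel. cmod (\<phi> x))" by (simp add: norm_mult)
 have "cmod (inv_fourier \<phi> \<xi>) = (1 / c) * cmod (FF 1 \<phi> \<xi>)"
  using c unfolding inv_fourier_eq c_def[symmetric] by (simp add: norm_mult norm_divide)
 also have "\<dots> <= 1 * cmod (FF 1 \<phi> \<xi>)" using c by (intro mult_right_mono) auto
 finally show ?thesis using b by simp
qed

lemma inv_fourier_add:
 fixes \<phi> \<psi> :: "real^'n::finite => complex"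
 assumes "\<phi> \<in> schwartz" "\<psi> \<in> schwartz"
 shows "inv_fourier (%x. \<phi> x + \<psi> x) \<xi> = inv_fourier \<phi> \<xi> + inv_fourier \<psi> \<xi>"
proof -
 have i: "integrable lborel (%x. cis (1 * (x \<bullet> \<xi>)) * \<phi> x)" if "\<phi> \<in> schwartz" for \<phi>
  using integrable_cis_mult[OF schwartz_integrable[OF that], of 1 \<xi>] by (simp add: inner_commute)
 have "FF 1 (%x. \<phi> x + \<psi> x) \<xi> = FF 1 \<phi> \<xi> + FF 1 \<psi> \<xi>"
  unfolding FF_def distrib_left by (rule LINT_add[OF i i]) (use assms in auto)
 then show ?thesis unfolding inv_fourier_eq by (simp only: distrib_left)
qed

lemma inv_fourier_cmult: "inv_fourier (%x. c * \<phi> x) \<xi> = c * inv_fourier \<phi> (\<xi> :: real^'n::finite)"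
 unfolding inv_fourier_eq FF_cmult by (simp only: mult_ac)

lemma integrable_times_inv_fourier:
 fixes a :: "real^'n::finite => complex"
 assumes a: "integrable lborel a" and \<phi>: "\<phi> \<in> schwartz"
 shows "integrable lborel (%\<xi>. a \<xi> * inv_fourier \<phi> \<xi>)"
proof (rule int_bound[OF integrable_mult_right[OF a, of "of_real (LINT x|lborel. cmod (\<phi> x))"]])
 have [measurable]: "inv_fourier \<phi> \<in> borel_measurable borel" "a \<in> borel_measurable borel"
  using schwartz_measurable[OF inv_fourier_schwartz[OF \<phi>]] borel_measurable_integrable[OF a] by auto
 show "(%\<xi>. a \<xi> * inv_fourier \<phi> \<xi>) \<in> borel_measurable lborel" by measurable
 have n: "0 <= (LINT x|lborel. cmod (\<phi> x))" by (rule integral_nonneg_AE) simp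
 show "AE \<xi> in lborel. norm (a \<xi> * inv_fourier \<phi> \<xi>) <= norm (of_real (LINT x|lborel. cmod (\<phi> x)) * a \<xi>)"
 proof (rule AE_I2)
  fix \<xi>
  show "norm (a \<xi> * inv_fourier \<phi> \<xi>) <= norm (of_real (LINT x|lborel. cmod (\<phi> x)) * a \<xi>)"
   using mult_left_mono[OF inv_fourier_bound[of \<phi> \<xi>] norm_ge_zero[of "a \<xi>"]] n
   by (simp add: norm_mult mult.commute)
 qed
qed

text \<open>\<open>inv_fourier \<phi>\<close> is bounded by the integral of
  \<open>cmod (\<phi> x)\<close>, which a seminorm with weight of order twice the dimension controls
  without any derivatives.\<close>

lemma spec_tempered:
 fixes u :: "'n::finite distribution"
 assumes s: "spec a u" shows "tempered u"
proof -
 have a: "integrable lborel a" and u: "\<And>\<phi>. \<phi> \<in> schwartz ==> u \<phi> = (LINT \<xi>|lborel. a \<xi> * inv_fourier \<phi> \<xi>)"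
  using s by (auto simp: spec_def)
 define A where "A = (LINT \<xi>|lborel. cmod (a \<xi>))"
 have A: "0 <= A" unfolding A_def by (rule integral_nonneg_AE) simp
 define N where "N = 2 * DIM(real^'n)"
 define J where "J = (LINT x::real^'n|lborel. 1 / (1 + norm x) ^ N)"
 have "norm (u \<phi>) <= (A * J) * schwartz_seminorm N 0 \<phi>" if \<phi>: "\<phi> \<in> schwartz" for \<phi>
 proof -
  define S where "S = schwartz_seminorm N 0 \<phi>"
  have "(LINT x|lborel. cmod (\<phi> x)) <= (LINT x::real^'n|lborel. S * (1 / (1 + norm x) ^ N))"
  proof (rule integral_mono)
   show "integrable lborel (%x. cmod (\<phi> x))" by (rule integrable_norm[OF schwartz_integrable[OF \<phi>]])
   show "integrable lborel (%x::real^'n. S * (1 / (1 + norm x) ^ N))" unfolding N_def by (rule integrable_mult_right[OF integrable_decay])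
   fix x :: "real^'n"
   have "0 < (1 + norm x) ^ N" by (intro zero_less_power) (simp add: add_pos_nonneg)
   then show "cmod (\<phi> x) <= S * (1 / (1 + norm x) ^ N)"
    using schwartz_seminorm_ge[OF \<phi>, of x N] unfolding S_def by (simp add: field_simps)
  qed
  also have "\<dots> = S * J" unfolding J_def by (rule integral_mult_right_zero)
  finally have b: "(LINT x|lborel. cmod (\<phi> x)) <= S * J" .
  have "norm (u \<phi>) <= (LINT \<xi>|lborel. cmod (a \<xi> * inv_fourier \<phi> \<xi>))" unfolding u[OF \<phi>] by (rule integral_norm_bound)
  also have "\<dots> <= (LINT \<xi>|lborel. cmod (a \<xi>) * (S * J))"
  proof (rule integral_mono)
   show "integrable lborel (%\<xi>. cmod (a \<xi> * inv_fourier \<phi> \<xi>))" by (rule integrable_norm[OF integrable_times_inv_fourier[OF a \<phi>]])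
   show "integrable lborel (%\<xi>. cmod (a \<xi>) * (S * J))" using a by auto
   show "cmod (a \<xi> * inv_fourier \<phi> \<xi>) <= cmod (a \<xi>) * (S * J)" for \<xi>
    unfolding norm_mult by (rule mult_left_mono[OF order_trans[OF inv_fourier_bound b]]) simp
  qed
  also have "\<dots> = A * (S * J)" unfolding A_def by (rule integral_mult_left_zero)
  finally show ?thesis by (simp add: S_def mult_ac)
 qed
 moreover have "u (%x. \<phi> x + \<psi> x) = u \<phi> + u \<psi>" if "\<phi> \<in> schwartz" "\<psi> \<in> schwartz" for \<phi> \<psi>
  unfolding u[OF schwartz_add[OF that]] u[OF that(1)] u[OF that(2)] inv_fourier_add[OF that] distrib_left
  by (intro LINT_add integrable_times_inv_fourier a that)
 moreover have "u (%x. c * \<phi> x) = c * u \<phi>" if "\<phi> \<in> schwartz" for \<phi> c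
  unfolding u[OF schwartz_cmult[OF that]] u[OF that] inv_fourier_cmult integral_mult_right_zero[symmetric]
  by (simp only: mult_ac)
 ultimately show ?thesis unfolding tempered_def by blast
qed

section \<open>Littlewood-Paley blocks and the Zygmund norm\<close>

lemma the_dyadic_partition: "dyadic_partition (fst the_dyadic_partition) (snd (the_dyadic_partition :: (real^'n::finite => real) \<times> _))"
proof -
 obtain \<psi> \<rho> :: "real^'n => real" where "dyadic_partition \<psi> \<rho>" using dyadic_partition_exists by blast
 then have "case (\<psi>, \<rho>) of (\<psi>, \<rho>) => dyadic_partition \<psi> \<rho>" by simp
 then have "case (the_dyadic_partition :: (real^'n => real) \<times> _) of (\<psi>, \<rho>) => dyadic_partition \<psi> \<rho>"
  unfolding the_dyadic_partition_def by (rule someI)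
 then show ?thesis by (simp add: case_prod_beta)
qed

text \<open>Where the symbol of a block \<open>j >= 0\<close> does not vanish,
  \<open>norm \<xi>\<close> is at least \<open>3/4 * 2 ^ j\<close>; so the squared dyadic weight is
  at most \<open>16/9\<close> times the squared bracket, rounded up to 2. The block
  \<open>-1\<close> has weight 1/4.\<close>

lemma lp_symbol:
 fixes \<xi> :: "real^'n::finite"
 assumes j: "-1 <= j"
 shows "\<bar>littlewood_paley_symbol j \<xi>\<bar> <= 1"
  and "2 powr (real_of_int j * 2) * \<bar>littlewood_paley_symbol j \<xi>\<bar> <= 2 * (jb \<xi>)\<^sup>2"
  and "(%\<xi> :: real^'n. complex_of_real (littlewood_paley_symbol j \<xi>)) \<in> schwartz"
proof -
 define \<psi> \<rho> :: "real^'n => real" where "\<psi> = fst the_dyadic_partition" and "\<rho> = snd the_dyadic_partition"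
 have D: "dyadic_partition \<psi> \<rho>" unfolding \<psi>_def \<rho>_def by (rule the_dyadic_partition)
 have sm: "smooth \<psi>" "smooth \<rho>" using D by (auto simp: dyadic_partition_def)
 have "range \<psi> \<subseteq> {0..1}" "range \<rho> \<subseteq> {0..1}" and nz: "\<forall>\<xi>. \<psi> \<xi> \<noteq> 0 --> norm \<xi> <= 4/3"
  "\<forall>\<xi>. \<rho> \<xi> \<noteq> 0 --> 3/4 <= norm \<xi> \<and> norm \<xi> <= 8/3"
  using D unfolding dyadic_partition_def by blast+
 then have rg: "0 <= \<psi> \<xi>" "\<psi> \<xi> <= 1" "0 <= \<rho> \<xi>" "\<rho> \<xi> <= 1" for \<xi> by (auto simp: image_subset_iff)
 have s\<psi>: "\<psi> \<xi> = 0" if "4/3 < norm \<xi>" for \<xi> using nz(1)[rule_format, of \<xi>] that by linarith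
 have s\<rho>: "\<rho> \<xi> \<noteq> 0 ==> 3/4 <= norm \<xi>" "8/3 < norm \<xi> ==> \<rho> \<xi> = 0" for \<xi>
  using nz(2)[rule_format, of \<xi>] by linarith+
 have lp: "littlewood_paley_symbol j \<xi> = (if j = -1 then \<psi> \<xi> else \<rho> ((2 powr - real_of_int j) *\<^sub>R \<xi>))" for \<xi>
  by (simp add: littlewood_paley_symbol_def \<psi>_def \<rho>_def)
 show 1: "\<bar>littlewood_paley_symbol j \<xi>\<bar> <= 1" for \<xi> :: "real^'n"
  using rg[of \<xi>] rg[of "(2 powr - real_of_int j) *\<^sub>R \<xi>"] by (simp add: lp)
 define c where "c = 2 powr (- real_of_int j)"
 have c: "0 < c" by (simp add: c_def)
 have jb: "1 <= (jb \<xi>)\<^sup>2" "(norm \<xi>)\<^sup>2 <= (jb \<xi>)\<^sup>2"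
  by (simp_all add: japanese_bracket_def)
 show "2 powr (real_of_int j * 2) * \<bar>littlewood_paley_symbol j \<xi>\<bar> <= 2 * (jb \<xi>)\<^sup>2"
 proof (cases "j = -1 \<or> littlewood_paley_symbol j \<xi> = 0")
  case True
  then show ?thesis
  proof
   assume "j = -1"
   then have "2 powr (real_of_int j * 2) <= 2 powr 0" by (intro powr_mono) auto
   then have "2 powr (real_of_int j * 2) * \<bar>littlewood_paley_symbol j \<xi>\<bar> <= 1 * 1" using 1[of \<xi>] by (intro mult_mono) auto
   then show ?thesis using jb by simp
  qed simp
 next
  case False
  then have "\<rho> (c *\<^sub>R \<xi>) \<noteq> 0" by (auto simp: lp c_def split: if_splits)
  then have n: "3/4 <= c * norm \<xi>" using s\<rho>(1)[of "c *\<^sub>R \<xi>"] c by simp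
  have cc: "2 powr (real_of_int j * 2) = (1 / c)\<^sup>2"
  proof -
   have "(1 / c)\<^sup>2 = (2 powr real_of_int j) powr 2" unfolding c_def by (simp add: powr_minus_divide)
   then show ?thesis by (simp only: powr_powr)
  qed
  have "1 / c <= 4/3 * norm \<xi>" using n c by (simp add: field_simps)
  then have "(1 / c)\<^sup>2 <= (4/3 * norm \<xi>)\<^sup>2" using c by (intro power_mono) auto
  also have "\<dots> <= 2 * (jb \<xi>)\<^sup>2" using jb by (simp add: power_mult_distrib power_divide)
  finally have "2 powr (real_of_int j * 2) <= 2 * (jb \<xi>)\<^sup>2" unfolding cc .
  then have "2 powr (real_of_int j * 2) * \<bar>littlewood_paley_symbol j \<xi>\<bar> <= (2 * (jb \<xi>)\<^sup>2) * 1"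
   using 1[of \<xi>] by (intro mult_mono) auto
  then show ?thesis by simp
 qed
 show "(%\<xi> :: real^'n. complex_of_real (littlewood_paley_symbol j \<xi>)) \<in> schwartz"
 proof (cases "j = -1")
  case True
  then have "(%\<xi> :: real^'n. complex_of_real (littlewood_paley_symbol j \<xi>)) = (%\<xi>. complex_of_real (\<psi> \<xi>))"
   unfolding lp by simp
  then show ?thesis using compact_smooth_schwartz[OF sm(1), of "4/3"] s\<psi> by simp
 next
  case False
  have "(%\<xi>. complex_of_real (\<rho> (c *\<^sub>R \<xi>))) \<in> schwartz"
  proof (rule compact_smooth_schwartz[OF smooth_scale[OF sm(2)]])
   fix x :: "real^'n" assume "8/3 / c < norm x"
   then show "\<rho> (c *\<^sub>R x) = 0" using c by (intro s\<rho>(2)) (simp add: field_simps)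
  qed
  then show ?thesis using False unfolding lp c_def by simp
 qed
qed

lemma spec_littlewood_paley:
 fixes u :: "'n::finite distribution"
 assumes s: "spec a u" and j: "-1 <= j"
 shows "spec (%\<xi>. a \<xi> * of_real (littlewood_paley_symbol j \<xi>)) (littlewood_paley j u)"
proof -
 have a: "integrable lborel a" and u: "\<And>\<phi>. \<phi> \<in> schwartz ==> u \<phi> = (LINT \<xi>|lborel. a \<xi> * inv_fourier \<phi> \<xi>)"
  using s by (auto simp: spec_def)
 let ?m = "littlewood_paley_symbol j :: real^'n => real"
 have [measurable]: "a \<in> borel_measurable borel" "(%\<xi>. complex_of_real (?m \<xi>)) \<in> borel_measurable borel"
  using borel_measurable_integrable[OF a] schwartz_measurable[OF lp_symbol(3)[OF j]] by auto
 have "integrable lborel (%\<xi>. a \<xi> * of_real (?m \<xi>))"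
 proof (rule int_bound[OF a])
  show "AE \<xi> in lborel. norm (a \<xi> * of_real (?m \<xi>)) <= norm (a \<xi>)"
  proof (rule AE_I2)
   fix \<xi> :: "real^'n"
   show "norm (a \<xi> * of_real (?m \<xi>)) <= norm (a \<xi>)"
    using mult_left_mono[OF lp_symbol(1)[OF j, of \<xi>] norm_ge_zero[of "a \<xi>"]] by (simp add: norm_mult)
  qed
 qed measurable
 moreover have "littlewood_paley j u \<phi> = (LINT \<xi>|lborel. a \<xi> * of_real (?m \<xi>) * inv_fourier \<phi> \<xi>)" if \<phi>: "\<phi> \<in> schwartz" for \<phi>
 proof -
  have m: "(%x. complex_of_real (?m x) * inv_fourier \<phi> x) \<in> schwartz"
   by (rule schwartz_mult[OF schwartz_slow[OF lp_symbol(3)[OF j]] inv_fourier_schwartz[OF \<phi>]])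
  have "littlewood_paley j u \<phi> = u (fourier (%x. complex_of_real (?m x) * inv_fourier \<phi> x))"
   by (simp add: littlewood_paley_def inv_fourier_distr_def mult_distr_def fourier_distr_def)
  also have "\<dots> = (LINT \<xi>|lborel. a \<xi> * (complex_of_real (?m \<xi>) * inv_fourier \<phi> \<xi>))"
   unfolding u[OF fourier_schwartz[OF m]] inv_fourier_fourier[OF m] ..
  finally show ?thesis by (simp only: mult.assoc)
 qed
 ultimately show ?thesis unfolding spec_def by blast
qed

text \<open>The supremum norm of a block is at most the integral of the modulus of its Fourier
  transform. There the dyadic weight is traded for the squared bracket by \<open>lp_symbol\<close>,
  uniformly in \<open>j\<close>.\<close>

lemma spec_zygmund:
 fixes u :: "'n::finite distribution"
 assumes s: "spec a u" and i: "integrable lborel (%\<xi>. (jb \<xi>)\<^sup>2 * cmod (a \<xi>))"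
 shows "zygmund_norm 2 u <= ennreal (2 * (LINT \<xi>|lborel. (jb \<xi>)\<^sup>2 * cmod (a \<xi>)))"
proof -
 define I where "I = 2 * (LINT \<xi>|lborel. (jb \<xi>)\<^sup>2 * cmod (a \<xi>))"
 have a: "integrable lborel a" using s by (simp add: spec_def)
 have "ennreal (2 powr (real_of_int j * 2)) * Linfty_distr_norm (littlewood_paley j u) <= ennreal I" if j: "-1 <= j" for j
 proof -
  let ?m = "littlewood_paley_symbol j :: real^'n => real"
  have sj: "spec (%\<xi>. a \<xi> * of_real (?m \<xi>)) (littlewood_paley j u)" by (rule spec_littlewood_paley[OF s j])
  then have ij: "integrable lborel (%\<xi>. a \<xi> * of_real (?m \<xi>))" by (simp add: spec_def)
  have "2 powr (real_of_int j * 2) * (LINT \<xi>|lborel. cmod (a \<xi> * of_real (?m \<xi>))) =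
    (LINT \<xi>|lborel. 2 powr (real_of_int j * 2) * cmod (a \<xi> * of_real (?m \<xi>)))" by (rule integral_mult_right_zero[symmetric])
  also have "\<dots> <= (LINT \<xi>|lborel. 2 * ((jb \<xi>)\<^sup>2 * cmod (a \<xi>)))"
  proof (rule integral_mono)
   show "integrable lborel (%\<xi>. 2 powr (real_of_int j * 2) * cmod (a \<xi> * of_real (?m \<xi>)))"
    by (rule integrable_mult_right[OF integrable_norm[OF ij]])
   show "integrable lborel (%\<xi>. 2 * ((jb \<xi>)\<^sup>2 * cmod (a \<xi>)))" by (rule integrable_mult_right[OF i])
   fix \<xi> :: "real^'n"
   show "2 powr (real_of_int j * 2) * cmod (a \<xi> * of_real (?m \<xi>)) <= 2 * ((jb \<xi>)\<^sup>2 * cmod (a \<xi>))"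
    using mult_right_mono[OF lp_symbol(2)[OF j, of \<xi>] norm_ge_zero[of "a \<xi>"]] by (simp add: norm_mult mult_ac)
  qed
  also have "\<dots> = I" unfolding I_def by (rule integral_mult_right_zero)
  finally have b: "2 powr (real_of_int j * 2) * (LINT \<xi>|lborel. cmod (a \<xi> * of_real (?m \<xi>))) <= I" .
  have "ennreal (2 powr (real_of_int j * 2)) * Linfty_distr_norm (littlewood_paley j u)
    <= ennreal (2 powr (real_of_int j * 2)) * ennreal (LINT \<xi>|lborel. cmod (a \<xi> * of_real (?m \<xi>)))"
   by (intro mult_left_mono spec_Linfty[OF sj]) simp
  also have "\<dots> = ennreal (2 powr (real_of_int j * 2) * (LINT \<xi>|lborel. cmod (a \<xi> * of_real (?m \<xi>))))"
   by (rule ennreal_mult'[symmetric]) simp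
  also have "\<dots> <= ennreal I" by (rule ennreal_leI[OF b])
  finally show ?thesis .
 qed
 then have "(SUP j\<in>{-1..}. ennreal (2 powr (real_of_int j * 2)) * Linfty_distr_norm (littlewood_paley j u)) <= ennreal I"
  by (intro SUP_least) auto
 then show ?thesis unfolding zygmund_norm_def I_def using spec_tempered[OF s] by simp
qed

section \<open>Hoelder's inequality for extended nonnegative norms\<close>

lemma Lp_norm_cong_AE:
 assumes "f \<in> borel_measurable M" "g \<in> borel_measurable M" "AE x in M. f x = g x"
 shows "Lp_norm p M f = Lp_norm p M g"
proof -
 have "esssup M (%x. ennreal (norm (f x))) = esssup M (%x. ennreal (norm (g x)))"
  by (rule esssup_AE_cong) (use assms in auto)
 moreover have "(\<integral>\<^sup>+x. ennreal (norm (f x) powr enn2real p) \<partial>M) = (\<integral>\<^sup>+x. ennreal (norm (g x) powr enn2real p) \<partial>M)"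
  by (rule nn_integral_cong_AE) (use assms in auto)
 ultimately show ?thesis by (simp add: Lp_norm_def)
qed

text \<open>The end points are treated by the essential supremum. Otherwise Young's inequality is
  applied to \<open>f\<close> and \<open>g\<close> divided by their norms \<open>a\<close> and
  \<open>b\<close>, which must be positive; if one of them vanishes, so does the product almost
  everywhere.\<close>

lemma Holder_inequality:
 fixes f :: "'a => 'b::{real_normed_vector, second_countable_topology}" and g :: "'a => 'c::{real_normed_vector, second_countable_topology}"
 assumes f [measurable]: "f \<in> borel_measurable M" and g [measurable]: "g \<in> borel_measurable M"
  and q: "1 <= q" "1 <= q'" "1 / q + 1 / q' = (1 :: ennreal)"
  and fin: "Lp_norm q M f < \<infinity>" "Lp_norm q' M g < \<infinity>"
 shows "(\<integral>\<^sup>+x. ennreal (norm (f x) * norm (g x)) \<partial>M) <= Lp_norm q M f * Lp_norm q' M g"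
proof -
 \<comment> \<open>Stated for fresh functions and value types, since the second end point uses it
   with the roles of \<open>f\<close> and \<open>g\<close> exchanged.\<close>
 have inf: "(\<integral>\<^sup>+x. ennreal (norm (f x) * norm (g x)) \<partial>M) <= Lp_norm \<infinity> M f * Lp_norm 1 M g"
  if [measurable]: "f \<in> borel_measurable M" "g \<in> borel_measurable M" and fin: "Lp_norm 1 M g < \<infinity>"
  for f :: "'a => 'd::{real_normed_vector, second_countable_topology}" and g :: "'a => 'e::{real_normed_vector, second_countable_topology}"
 proof -
  let ?E = "esssup M (%x. ennreal (norm (f x)))"
  have g1: "Lp_norm 1 M g = (\<integral>\<^sup>+x. ennreal (norm (g x)) \<partial>M)"
   using fin by (auto simp: Lp_norm_def Let_def less_top split: if_splits)
  have "(\<integral>\<^sup>+x. ennreal (norm (f x) * norm (g x)) \<partial>M) <= (\<integral>\<^sup>+x. ?E * ennreal (norm (g x)) \<partial>M)"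
  proof (rule nn_integral_mono_AE)
   have "AE x in M. ennreal (norm (f x)) <= ?E" by (rule esssup_AE)
   then show "AE x in M. ennreal (norm (f x) * norm (g x)) <= ?E * ennreal (norm (g x))"
    by (rule AE_mp) (auto intro!: AE_I2 mult_right_mono simp: ennreal_mult)
  qed
  also have "\<dots> = ?E * (\<integral>\<^sup>+x. ennreal (norm (g x)) \<partial>M)" by (rule nn_integral_cmult) measurable
  finally show ?thesis unfolding g1 by (simp add: Lp_norm_def)
 qed
 have one: "q' = 1" if "1 / q' = (1 :: ennreal)" for q' :: ennreal
  using that by (simp add: divide_eq_1_ennreal)
 show ?thesis
 proof (cases "q = \<infinity>")
  case True
  then have "1 / q' = 1" using q(3) by simp
  then have "q' = 1" by (rule one)
  then show ?thesis using inf[OF f g] fin True by simp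
 next
  case qf: False
  show ?thesis
  proof (cases "q' = \<infinity>")
   case True
   then have "1 / q = 1" using q(3) by simp
   then have "q = 1" by (rule one)
   then show ?thesis using inf[OF g f] fin True by (simp add: mult.commute)
  next
   case q'f: False
   define p p' where "p = enn2real q" and "p' = enn2real q'"
   have pq: "q = ennreal p" "q' = ennreal p'" using qf q'f by (auto simp: p_def p'_def less_top)
   have p1: "1 <= p" "1 <= p'" using q(1,2) unfolding pq by (simp_all add: ennreal_le_iff2 flip: ennreal_1)
   have pp: "1 / p + 1 / p' = 1"
   proof -
    have "ennreal (1 / p) = 1 / q" "ennreal (1 / p') = 1 / q'" using p1 unfolding pq by (simp_all add: divide_ennreal flip: ennreal_1)
    then have "ennreal (1 / p + 1 / p') = ennreal 1" using q(3) p1 by (subst ennreal_plus) auto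
    then show ?thesis using p1 by (subst (asm) ennreal_inj) auto
   qed
   have p2: "1 < p" "1 < p'"
   proof -
    have "p \<noteq> 1" "p' \<noteq> 1" using pp p1 by (auto simp: field_simps)
    then show "1 < p" "1 < p'" using p1 by auto
   qed
   define F where "F = (\<integral>\<^sup>+x. ennreal (norm (f x) powr p) \<partial>M)"
   define G where "G = (\<integral>\<^sup>+x. ennreal (norm (g x) powr p') \<partial>M)"
   have FG: "F < \<infinity>" "G < \<infinity>" "Lp_norm q M f = ennreal (enn2real F powr (1 / p))" "Lp_norm q' M g = ennreal (enn2real G powr (1 / p'))"
    using fin qf q'f by (auto simp: Lp_norm_def Let_def F_def G_def p_def p'_def less_top split: if_splits)
   define a b where "a = enn2real F powr (1 / p)" and "b = enn2real G powr (1 / p')"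
   have ap: "ennreal (a powr p) = F" "ennreal (b powr p') = G"
    using p1 FG by (simp_all add: a_def b_def powr_powr less_top)
   show ?thesis
   proof (cases "F = 0 \<or> G = 0")
    case True
    have "AE x in M. norm (f x) * norm (g x) = 0"
    proof (cases "F = 0")
     case True
     then have "AE x in M. ennreal (norm (f x) powr p) = 0" unfolding F_def by (subst (asm) nn_integral_0_iff_AE) auto
     then show ?thesis by (rule AE_mp) (auto intro!: AE_I2)
    next
     case False
     then have "G = 0" using \<open>F = 0 \<or> G = 0\<close> by simp
     then have "AE x in M. ennreal (norm (g x) powr p') = 0" unfolding G_def by (subst (asm) nn_integral_0_iff_AE) auto
     then show ?thesis by (rule AE_mp) (auto intro!: AE_I2)
    qed
    then have "(\<integral>\<^sup>+x. ennreal (norm (f x) * norm (g x)) \<partial>M) = (\<integral>\<^sup>+x. 0 \<partial>M)"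
     by (intro nn_integral_cong_AE) auto
    then show ?thesis by simp
   next
    case False
    then have "0 < enn2real F" "0 < enn2real G" using FG(1,2) by (auto simp: enn2real_positive_iff less_top zero_less_iff_neq_zero)
    then have ab: "0 < a" "0 < b" by (auto simp: a_def b_def)
    have "(\<integral>\<^sup>+x. ennreal (norm (f x) * norm (g x)) \<partial>M) <=
     (\<integral>\<^sup>+x. ennreal (a * b / (p * a powr p)) * ennreal (norm (f x) powr p) + ennreal (a * b / (p' * b powr p')) * ennreal (norm (g x) powr p') \<partial>M)"
    proof (rule nn_integral_mono)
     fix x
     have "(norm (f x) / a) * (norm (g x) / b) <= (norm (f x) / a) powr p / p + (norm (g x) / b) powr p' / p'"
      using ab by (intro Youngs_inequality p2 pp) auto
     then have "a * b * ((norm (f x) / a) * (norm (g x) / b)) <= a * b * ((norm (f x) / a) powr p / p + (norm (g x) / b) powr p' / p')"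
      using ab by (intro mult_left_mono) auto
     then have "norm (f x) * norm (g x) <= a * b / (p * a powr p) * norm (f x) powr p + a * b / (p' * b powr p') * norm (g x) powr p'"
      using ab by (simp add: powr_divide field_simps)
     then have "ennreal (norm (f x) * norm (g x)) <= ennreal (a * b / (p * a powr p) * norm (f x) powr p + a * b / (p' * b powr p') * norm (g x) powr p')"
      by (rule ennreal_leI)
     also have "\<dots> = ennreal (a * b / (p * a powr p) * norm (f x) powr p) + ennreal (a * b / (p' * b powr p') * norm (g x) powr p')"
      using ab p1 by (intro ennreal_plus) auto
     also have "\<dots> = ennreal (a * b / (p * a powr p)) * ennreal (norm (f x) powr p) + ennreal (a * b / (p' * b powr p')) * ennreal (norm (g x) powr p')"
      using ab p1 by (intro arg_cong2[where f = "(+)"] ennreal_mult) auto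
     finally show "ennreal (norm (f x) * norm (g x)) <= ennreal (a * b / (p * a powr p)) * ennreal (norm (f x) powr p) + ennreal (a * b / (p' * b powr p')) * ennreal (norm (g x) powr p')" .
    qed
    also have "\<dots> = ennreal (a * b / (p * a powr p)) * F + ennreal (a * b / (p' * b powr p')) * G"
     unfolding F_def G_def by (subst nn_integral_add) (auto simp: nn_integral_cmult)
    also have "\<dots> = ennreal (a * b / (p * a powr p) * a powr p + a * b / (p' * b powr p') * b powr p')"
     unfolding ap[symmetric] using ab p1
     by (subst ennreal_mult'[symmetric], simp, subst ennreal_mult'[symmetric], simp, subst ennreal_plus[symmetric]) auto
    also have "a * b / (p * a powr p) * a powr p + a * b / (p' * b powr p') * b powr p' = a * b * (1 / p + 1 / p')"
     using ab by (simp add: field_simps)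
    also have "ennreal (a * b * (1 / p + 1 / p')) = ennreal a * ennreal b" unfolding pp using ab by (simp add: ennreal_mult')
    finally show ?thesis unfolding FG(3,4) a_def b_def .
   qed
  qed
 qed
qed

section \<open>The averaged field\<close>

text \<open>Globally bounded Borel versions of the weight and the path: the weight of the theorem is only
 essentially bounded, and neither function is constrained outside \<open>[0, T]\<close>.\<close>
locale path_setting =
 fixes T B R :: real and w :: "real => real" and z :: "real => real^'n::finite"
 assumes T: "0 < T" and w_meas [measurable]: "w \<in> borel_measurable borel" and w_bound: "\<And>r. \<bar>w r\<bar> <= B"
  and z_meas [measurable]: "z \<in> borel_measurable borel" and z_bound: "\<And>r. norm (z r) <= R"
begin

abbreviation "M \<equiv> time_square T"

text \<open>The first component of a point of the square is the outer variable \<open>r2\<close>,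
  the second is \<open>r1\<close>; \<open>zd\<close> and \<open>wt\<close> thus follow the order of
  integration in \<open>two_param_measure\<close>.\<close>

definition zd :: "real \<times> real => real^'n" where "zd p = z (fst p) - z (snd p)"

definition wt :: "real => real => real \<times> real => real" where
 "wt t1 t2 p = indicator {0..t2} (fst p) * indicator {0..t1} (snd p) * (w (snd p) * w (fst p))"

lemma zd_meas [measurable]: "zd \<in> borel_measurable M"
 unfolding zd_def by measurable

lemma zd_bound: "norm (zd p) <= 2 * R"
 using norm_triangle_ineq4[of "z (fst p)" "z (snd p)"] z_bound[of "fst p"] z_bound[of "snd p"] by (simp add: zd_def)

lemma R_nonneg: "0 <= R" using order_trans[OF norm_ge_zero z_bound] .
lemma B_nonneg: "0 <= B" using order_trans[OF abs_ge_zero w_bound] .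

sublocale M: finite_measure M by (rule finite_time_square)

text \<open>Bounded measurable densities on the finite measure \<open>M\<close> are integrable, and
  they are stable under sums, products and Lipschitz maps.\<close>

definition bm :: "(real \<times> real => 'b::{banach, second_countable_topology}) => bool" where
 "bm V \<longleftrightarrow> V \<in> borel_measurable M \<and> (\<exists>K. \<forall>p. norm (V p) <= K)"

lemma bm_integrable: "bm V ==> integrable M V"
 unfolding bm_def using M.integrable_const_bound by blast

lemma bm_diff:
 assumes "bm V" "bm V'" shows "bm (%p. V p - V' p)"
proof -
 obtain K K' where "\<forall>p. norm (V p) <= K" "\<forall>p. norm (V' p) <= K'" using assms unfolding bm_def by blast
 then have "norm (V p - V' p) <= K + K'" for p using norm_triangle_ineq4[of "V p" "V' p"] by (meson add_mono order_trans)
 then show ?thesis using assms unfolding bm_def by auto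
qed

lemma bm_add:
 assumes "bm V" "bm V'" shows "bm (%p. V p + V' p)"
proof -
 obtain K K' where "\<forall>p. norm (V p) <= K" "\<forall>p. norm (V' p) <= K'" using assms unfolding bm_def by blast
 then have "norm (V p + V' p) <= K + K'" for p using norm_triangle_ineq[of "V p" "V' p"] by (meson add_mono order_trans)
 then show ?thesis using assms unfolding bm_def by auto
qed

lemma bm_wt: "bm (wt t1 t2)"
proof -
 have "norm (wt t1 t2 p) <= B * B" for p
 proof -
  have "\<bar>w (snd p) * w (fst p)\<bar> <= B * B" unfolding abs_mult using w_bound B_nonneg by (intro mult_mono) auto
  then show ?thesis using mult_nonneg_nonneg[OF B_nonneg B_nonneg] by (simp add: wt_def indicator_def abs_mult)
 qed
 moreover have "wt t1 t2 \<in> borel_measurable M" unfolding wt_def by measurable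
 ultimately show ?thesis unfolding bm_def by blast
qed

lemma bm_of_real: "bm V ==> bm (%p. complex_of_real (V p))"
 unfolding bm_def by auto

section \<open>Fourier transforms of image measures\<close>

text \<open>The Fourier transform, with sign \<open>s\<close>, of the image under \<open>zd\<close>
  of the measure with density \<open>V\<close>.\<close>

definition mch :: "real => (real \<times> real => complex) => real^'n => complex" where
 "mch s V \<xi> = (LINT p|M. cis (s * (zd p \<bullet> \<xi>)) * V p)"

lemma mch_deriv:
 assumes V: "bm V" and s: "\<bar>s\<bar> = 1"
 shows "mch s V differentiable (at \<xi>)" "pderiv_at i (mch s V) \<xi> = mch s (%p. \<i> * of_real (s * zd p $ i) * V p) \<xi>"
  "cmod (mch s V \<xi>) <= (LINT p|M. cmod (V p))"
proof -
 have [measurable]: "V \<in> borel_measurable M" using V by (simp add: bm_def)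
 obtain K where K: "\<forall>p. norm (V p) <= K" using V unfolding bm_def by blast
 have "integrable M (%p. (1 + norm (zd p)) ^ 2 *\<^sub>R V p)"
 proof (rule M.integrable_const_bound[where B = "(1 + 2 * R) ^ 2 * K"])
  show "AE p in M. norm ((1 + norm (zd p)) ^ 2 *\<^sub>R V p) <= (1 + 2 * R) ^ 2 * K"
  proof (rule AE_I2)
   fix p
   have "(1 + norm (zd p)) ^ 2 * norm (V p) <= (1 + 2 * R) ^ 2 * K"
    using zd_bound[of p] K[rule_format, of p] R_nonneg by (intro mult_mono power_mono) auto
   then show "norm ((1 + norm (zd p)) ^ 2 *\<^sub>R V p) <= (1 + 2 * R) ^ 2 * K" by simp
  qed
 qed measurable
 note c = char_integral_deriv[OF zd_meas _ this s]
 show "mch s V differentiable (at \<xi>)" "cmod (mch s V \<xi>) <= (LINT p|M. cmod (V p))"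
  unfolding mch_def[abs_def] by (rule c(3) c(4), measurable)+
 show "pderiv_at i (mch s V) \<xi> = mch s (%p. \<i> * of_real (s * zd p $ i) * V p) \<xi>"
  unfolding mch_def[abs_def] by (rule c(2)) measurable
qed

text \<open>Differentiation multiplies \<open>V\<close> by a coordinate of \<open>zd\<close>, which
  is bounded; so the class is closed and all derivatives are bounded. Hence these transforms
  multiply Schwartz space into itself.\<close>

lemma mch_slow:
 assumes V: "bm V" and s: "\<bar>s\<bar> = 1" shows "slow (mch s V)"
proof (rule slow_coinduct[where X = "%f. \<exists>V. bm V \<and> f = mch s V"])
 show "\<exists>V'. bm V' \<and> mch s V = mch s V'" using V by blast
 fix g assume "\<exists>V. bm V \<and> g = mch s V"
 then obtain V where V: "bm V" and g: "g = mch s V" by blast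
 show "g differentiable (at x)" for x unfolding g by (rule mch_deriv(1)[OF V s])
 show "\<exists>k C. \<forall>x. norm (g x) <= C * (1 + norm x) ^ k"
  unfolding g using mch_deriv(3)[OF V s] by (intro exI[of _ 0] exI[of _ "LINT p|M. cmod (V p)"]) simp
 show "\<exists>V. bm V \<and> pderiv_at i g = mch s V" for i
 proof (intro exI conjI)
  show "pderiv_at i g = mch s (%p. \<i> * of_real (s * zd p $ i) * V p)"
   unfolding g using mch_deriv(2)[OF V s] by blast
  obtain K where K: "\<forall>p. norm (V p) <= K" using V unfolding bm_def by blast
  have "norm (\<i> * of_real (s * zd p $ i) * V p) <= (2 * R) * K" for p
  proof -
   have "\<bar>zd p $ i\<bar> <= 2 * R" using component_le_norm_cart[of "zd p" i] zd_bound[of p] by linarith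
   then have "\<bar>zd p $ i\<bar> * norm (V p) <= (2 * R) * K" using K[rule_format, of p] R_nonneg by (intro mult_mono) auto
   then show ?thesis using s by (simp add: norm_mult abs_mult)
  qed
  moreover have "(%p. \<i> * of_real (s * zd p $ i) * V p) \<in> borel_measurable M"
  proof -
   have v: "V \<in> borel_measurable M" using V by (simp add: bm_def)
   have "(%x :: real^'n. \<i> * complex_of_real (s * x $ i)) \<in> borel_measurable borel"
    by (intro borel_measurable_continuous_onI continuous_intros)
   from borel_measurable_times[OF measurable_compose[OF zd_meas this] v] show ?thesis .
  qed
  ultimately show "bm (%p. \<i> * of_real (s * zd p $ i) * V p)" unfolding bm_def by blast
 qed
qed

lemma mch_meas [measurable]: "bm V ==> \<bar>s\<bar> = 1 ==> mch s V \<in> borel_measurable borel"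
 by (rule borel_measurable_continuous_onI)
   (metis slow_differentiable mch_slow continuous_at_imp_continuous_on differentiable_imp_continuous_within)

lemma mch_integrable: "bm V ==> integrable M (%p. cis (s * (zd p \<bullet> \<xi>)) * V p)"
proof -
 assume V: "bm V"
 then have [measurable]: "V \<in> borel_measurable M" by (simp add: bm_def)
 show ?thesis
  by (rule int_bound[OF bm_integrable[OF V]]) (auto simp: norm_mult)
qed

lemma mch_diff: "bm V ==> bm V' ==> mch s (%p. V p - V' p) \<xi> = mch s V \<xi> - mch s V' \<xi>"
 unfolding mch_def right_diff_distrib by (rule LINT_diff[OF mch_integrable mch_integrable])

lemma mch_add: "bm V ==> bm V' ==> mch s (%p. V p + V' p) \<xi> = mch s V \<xi> + mch s V' \<xi>"
 unfolding mch_def distrib_left by (rule LINT_add[OF mch_integrable mch_integrable])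

text \<open>For real \<open>V\<close> the sign of the frequency does not affect the modulus; this is
  why the norm of the measure also controls the transform of its reflection.\<close>

lemma mch_cnj: "cmod (mch (-1) (%p. of_real (V p)) \<xi>) = cmod (mch 1 (%p. of_real (V p)) \<xi>)"
proof -
 have "mch (-1) (%p. of_real (V p)) \<xi> = (LINT p|M. cnj (cis (1 * (zd p \<bullet> \<xi>)) * of_real (V p)))"
  unfolding mch_def by (simp add: cis_cnj)
 also have "\<dots> = cnj (mch 1 (%p. of_real (V p)) \<xi>)" unfolding mch_def by (rule Bochner_Integration.integral_cnj)
 finally show ?thesis by simp
qed

text \<open>Linear in the pair of \<open>V\<close> and \<open>v\<close>, unlike the Jordan
  decomposition behind \<open>signed_integral\<close>; time increments of the measure are handled
  through it.\<close>

definition measd :: "(real \<times> real => real) => 'n distribution => bool" where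
 "measd V v \<longleftrightarrow> bm V \<and> (\<forall>f\<in>borel_measurable borel. (\<exists>K. \<forall>x. cmod (f x) <= K) -->
   v f = (LINT p|M. of_real (V p) * f (zd p)))"

lemma measd_int:
 assumes V: "bm (V :: _ => real)" and f [measurable]: "f \<in> borel_measurable borel" and K: "\<forall>x. cmod (f x) <= K"
 shows "integrable M (%p. of_real (V p) * f (zd p))"
proof (rule int_bound[OF integrable_mult_right[OF bm_integrable[OF V], of K]])
 have [measurable]: "V \<in> borel_measurable M" using V by (simp add: bm_def)
 show "(%p. of_real (V p) * f (zd p)) \<in> borel_measurable M" by measurable
 have K0: "0 <= K" using K norm_ge_zero order_trans by blast
 show "AE p in M. norm (of_real (V p) * f (zd p)) <= norm (K * V p)"
 proof (rule AE_I2)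
  fix p
  show "norm (of_real (V p) * f (zd p)) <= norm (K * V p)"
   using mult_left_mono[OF K[rule_format, of "zd p"] abs_ge_zero[of "V p"]] K0 by (simp add: norm_mult abs_mult mult.commute)
 qed
qed

lemma measd_apply:
 assumes "measd V v" "f \<in> borel_measurable borel" "\<forall>x. cmod (f x) <= K"
 shows "v f = (LINT p|M. of_real (V p) * f (zd p))"
 using assms unfolding measd_def by blast

lemma measd_diff:
 assumes "measd V v" "measd V' v'" shows "measd (%p. V p - V' p) (v - v')"
 unfolding measd_def
proof (intro conjI ballI impI)
 show "bm (%p. V p - V' p)" using assms by (auto simp: measd_def intro: bm_diff)
 fix f :: "real^'n => complex" assume f: "f \<in> borel_measurable borel" and "\<exists>K. \<forall>x. cmod (f x) <= K"
 then obtain K where K: "\<forall>x. cmod (f x) <= K" by blast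
 have b: "bm V" "bm V'" using assms by (auto simp: measd_def)
 have "(v - v') f = (LINT p|M. of_real (V p) * f (zd p)) - (LINT p|M. of_real (V' p) * f (zd p))"
  using measd_apply[OF assms(1) f K] measd_apply[OF assms(2) f K] by simp
 then show "(v - v') f = (LINT p|M. of_real (V p - V' p) * f (zd p))"
  using LINT_diff[OF measd_int[OF b(1) f K] measd_int[OF b(2) f K]] by (simp add: left_diff_distrib)
qed

lemma measd_add:
 assumes "measd V v" "measd V' v'" shows "measd (%p. V p + V' p) (v + v')"
 unfolding measd_def
proof (intro conjI ballI impI)
 show "bm (%p. V p + V' p)" using assms by (auto simp: measd_def intro: bm_add)
 fix f :: "real^'n => complex" assume f: "f \<in> borel_measurable borel" and "\<exists>K. \<forall>x. cmod (f x) <= K"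
 then obtain K where K: "\<forall>x. cmod (f x) <= K" by blast
 have b: "bm V" "bm V'" using assms by (auto simp: measd_def)
 have "(v + v') f = (LINT p|M. of_real (V p) * f (zd p)) + (LINT p|M. of_real (V' p) * f (zd p))"
  using measd_apply[OF assms(1) f K] measd_apply[OF assms(2) f K] by simp
 then show "(v + v') f = (LINT p|M. of_real (V p + V' p) * f (zd p))"
  using LINT_add[OF measd_int[OF b(1) f K] measd_int[OF b(2) f K]] by (simp add: distrib_right)
qed

lemma measd_represents:
 assumes v: "measd V v" shows "represents (mch (-1) (%p. of_real (V p))) (fourier_distr v)"
proof -
 have V: "bm V" using v by (simp add: measd_def)
 have Vc: "bm (%p. complex_of_real (V p))" by (rule bm_of_real[OF V])
 have Vm [measurable]: "V \<in> borel_measurable M" using V by (simp add: bm_def)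
 have mm [measurable]: "mch (-1) (%p. of_real (V p)) \<in> borel_measurable borel" by (rule mch_meas[OF Vc]) simp
 define K where "K = (LINT p|M. cmod (complex_of_real (V p)))"
 have K: "cmod (mch (-1) (%p. of_real (V p)) \<xi>) <= K" for \<xi> unfolding K_def by (rule mch_deriv(3)[OF Vc]) simp
 have K0: "0 <= K" using order_trans[OF norm_ge_zero K] .
 have "integrable lborel (%x. mch (-1) (%p. of_real (V p)) x * \<phi> x) \<and> fourier_distr v \<phi> = fun_distr (mch (-1) (%p. of_real (V p))) \<phi>"
  if \<phi>: "\<phi> \<in> schwartz" for \<phi>
 proof
  have pm [measurable]: "\<phi> \<in> borel_measurable borel" by (rule schwartz_measurable[OF \<phi>])
  show "integrable lborel (%x. mch (-1) (%p. of_real (V p)) x * \<phi> x)"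
  proof (rule int_bound[OF integrable_mult_right[OF schwartz_integrable[OF \<phi>], of "of_real K"]])
   show "AE x in lborel. norm (mch (-1) (%p. of_real (V p)) x * \<phi> x) <= norm (of_real K * \<phi> x)"
    using K K0 by (intro AE_I2) (auto simp: norm_mult intro!: mult_right_mono)
  qed measurable
  have F: "fourier \<phi> \<in> schwartz" by (rule fourier_schwartz[OF \<phi>])
  have "fourier_distr v \<phi> = (LINT p|M. of_real (V p) * fourier \<phi> (zd p))"
   using v schwartz_measurable[OF F] schwartz_bounded[OF F] unfolding measd_def fourier_distr_def by blast
  also have "\<dots> = (LINT p|M. (LINT x|lborel. cis (- (zd p \<bullet> x)) * of_real (V p) * \<phi> x))"
  proof (rule LINT_cong[OF refl])
   fix p
   have "of_real (V p) * fourier \<phi> (zd p) = (LINT x|lborel. of_real (V p) * (cis (- 1 * (x \<bullet> zd p)) * \<phi> x))"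
    unfolding fourier_FF FF_def by (rule integral_mult_right_zero[symmetric])
   then show "of_real (V p) * fourier \<phi> (zd p) = (LINT x|lborel. cis (- (zd p \<bullet> x)) * of_real (V p) * \<phi> x)"
    by (simp add: inner_commute mult_ac)
  qed
  also have "\<dots> = (LINT x|lborel. (LINT p|M. cis (- (zd p \<bullet> x)) * of_real (V p) * \<phi> x))"
  proof (rule kernel_fubini(2)[OF _ sigma_finite_lborel bm_integrable[OF Vc] schwartz_integrable[OF \<phi>], of _ 1])
   show "(%(p, x). cis (- (zd p \<bullet> x))) \<in> borel_measurable (M \<Otimes>\<^sub>M lborel)" by measurable
   show "sigma_finite_measure M" by (rule M.sigma_finite_measure_axioms)
  qed simp
  also have "\<dots> = (LINT x|lborel. mch (-1) (%p. of_real (V p)) x * \<phi> x)"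
  proof (rule LINT_cong[OF refl])
   fix x
   have "mch (-1) (%p. of_real (V p)) x * \<phi> x = (LINT p|M. (cis (- 1 * (zd p \<bullet> x)) * of_real (V p)) * \<phi> x)"
    unfolding mch_def by (rule integral_mult_left_zero[symmetric])
   then show "(LINT p|M. cis (- (zd p \<bullet> x)) * of_real (V p) * \<phi> x) = mch (-1) (%p. of_real (V p)) x * \<phi> x" by (simp only: mult_minus1)
  qed
  finally show "fourier_distr v \<phi> = fun_distr (mch (-1) (%p. of_real (V p))) \<phi>" unfolding fun_distr_def .
 qed
 then show ?thesis unfolding represents_def using mm by blast
qed

abbreviation mc :: "(real \<times> real => real) => real^'n => complex" where
 "mc V \<equiv> mch 1 (%p. complex_of_real (V p))"

lemma mc_meas: "bm V ==> mc V \<in> borel_measurable borel"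
 by (rule mch_meas[OF bm_of_real]) auto

lemma mc_diff: "bm V ==> bm V' ==> mc (%p. V p - V' p) \<xi> = mc V \<xi> - mc V' \<xi>"
 using mch_diff[OF bm_of_real bm_of_real] by simp

lemma mc_add: "bm V ==> bm V' ==> mc (%p. V p + V' p) \<xi> = mc V \<xi> + mc V' \<xi>"
 using mch_add[OF bm_of_real bm_of_real] by simp

lemma mc_norm_FL:
 assumes v: "measd V v" and fin: "FL_norm q \<kappa> v < \<infinity>"
 shows "Lp_norm q lborel (%\<xi>. jb \<xi> powr \<kappa> *\<^sub>R mc V \<xi>) = FL_norm q \<kappa> v"
proof -
 have V: "bm V" using v by (simp add: measd_def)
 let ?G = "mch (-1) (%p. complex_of_real (V p))"
 have r: "represents ?G (fourier_distr v)" by (rule measd_represents[OF v])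
 have [measurable]: "?G \<in> borel_measurable borel" "mc V \<in> borel_measurable borel" "density_of (fourier_distr v) \<in> borel_measurable borel"
  "(jb :: real^'n => real) \<in> borel_measurable borel"
  using mch_meas[OF bm_of_real[OF V]] mc_meas[OF V] represents_density_of[OF r]
  by (auto simp: represents_def japanese_bracket_def[abs_def])
 have "FL_norm q \<kappa> v = Lp_norm q lborel (%\<xi>. jb \<xi> powr \<kappa> *\<^sub>R density_of (fourier_distr v) \<xi>)"
  using fin unfolding FL_norm_def by (auto split: if_splits)
 also have "\<dots> = Lp_norm q lborel (%\<xi>. jb \<xi> powr \<kappa> *\<^sub>R ?G \<xi>)"
 proof (rule Lp_norm_cong_AE)
  show "AE \<xi> in lborel. jb \<xi> powr \<kappa> *\<^sub>R density_of (fourier_distr v) \<xi> = jb \<xi> powr \<kappa> *\<^sub>R ?G \<xi>"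
   using density_of_AE[OF r] by (rule AE_mp) auto
 qed measurable
 also have "\<dots> = Lp_norm q lborel (%\<xi>. jb \<xi> powr \<kappa> *\<^sub>R mc V \<xi>)"
  unfolding Lp_norm_def by (simp add: mch_cnj)
 finally show ?thesis by simp
qed

text \<open>The weight is distributed as \<open>\<kappa>\<close> on the measure and
  \<open>\<delta>\<close> on \<open>g\<close>, and Hoelder's inequality with \<open>q\<close>,
  \<open>q'\<close> separates them. Here the two Fourier-Lebesgue spaces meet.\<close>

lemma weight_estimate:
 assumes v: "measd V v" and fin: "FL_norm q \<kappa> v < \<infinity>"
  and q: "1 <= q" "1 <= q'" "1 / q + 1 / q' = (1 :: ennreal)"
  and g [measurable]: "g \<in> borel_measurable borel" and gN: "Lp_norm q' lborel (%\<xi>. jb \<xi> powr \<delta> *\<^sub>R g \<xi>) <= N" "N < \<infinity>"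
  and s: "s <= \<delta> + \<kappa>"
 shows "integrable lborel (%\<xi>. jb \<xi> powr s * cmod (g \<xi> * mc V \<xi>))"
  and "ennreal (LINT \<xi>|lborel. jb \<xi> powr s * cmod (g \<xi> * mc V \<xi>)) <= N * FL_norm q \<kappa> v"
proof -
 have V: "bm V" using v by (simp add: measd_def)
 have [measurable]: "mc V \<in> borel_measurable borel" "(jb :: real^'n => real) \<in> borel_measurable borel"
  using mc_meas[OF V] by (auto simp: japanese_bracket_def[abs_def])
 let ?f = "%\<xi>. jb \<xi> powr \<kappa> *\<^sub>R mc V \<xi>" and ?g = "%\<xi>. jb \<xi> powr \<delta> *\<^sub>R g \<xi>"
 have "(\<integral>\<^sup>+\<xi>. ennreal (jb \<xi> powr s * cmod (g \<xi> * mc V \<xi>)) \<partial>lborel) <= (\<integral>\<^sup>+\<xi>. ennreal (norm (?f \<xi>) * norm (?g \<xi>)) \<partial>lborel)"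
 proof (intro nn_integral_mono ennreal_leI)
  fix \<xi> :: "real^'n"
  have "jb \<xi> powr s <= jb \<xi> powr (\<kappa> + \<delta>)" using s by (intro bracket_powr_mono) simp
  then have "jb \<xi> powr s * cmod (g \<xi> * mc V \<xi>) <= jb \<xi> powr (\<kappa> + \<delta>) * cmod (g \<xi> * mc V \<xi>)"
   by (intro mult_right_mono) auto
  also have "\<dots> = norm (?f \<xi>) * norm (?g \<xi>)" by (simp add: powr_add norm_mult)
  finally show "jb \<xi> powr s * cmod (g \<xi> * mc V \<xi>) <= norm (?f \<xi>) * norm (?g \<xi>)" .
 qed
 also have "\<dots> <= Lp_norm q lborel ?f * Lp_norm q' lborel ?g"
  by (rule Holder_inequality[OF _ _ q]) (use gN fin in \<open>auto simp: mc_norm_FL[OF v fin] intro: le_less_trans\<close>)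
 also have "\<dots> <= FL_norm q \<kappa> v * N"
  unfolding mc_norm_FL[OF v fin] using gN by (intro mult_left_mono) auto
 finally have le: "(\<integral>\<^sup>+\<xi>. ennreal (jb \<xi> powr s * cmod (g \<xi> * mc V \<xi>)) \<partial>lborel) <= N * FL_norm q \<kappa> v"
  by (simp add: mult.commute)
 show i: "integrable lborel (%\<xi>. jb \<xi> powr s * cmod (g \<xi> * mc V \<xi>))"
 proof (rule integrableI_nonneg)
  have "N * FL_norm q \<kappa> v < \<infinity>" using gN fin by (auto simp: ennreal_mult_less_top)
  then show "(\<integral>\<^sup>+\<xi>. ennreal (jb \<xi> powr s * cmod (g \<xi> * mc V \<xi>)) \<partial>lborel) < \<infinity>" using le by (rule le_less_trans[rotated])
 qed auto
 have "ennreal (LINT \<xi>|lborel. jb \<xi> powr s * cmod (g \<xi> * mc V \<xi>)) = (\<integral>\<^sup>+\<xi>. ennreal (jb \<xi> powr s * cmod (g \<xi> * mc V \<xi>)) \<partial>lborel)"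
  by (rule nn_integral_eq_integral[symmetric, OF i]) auto
 then show "ennreal (LINT \<xi>|lborel. jb \<xi> powr s * cmod (g \<xi> * mc V \<xi>)) <= N * FL_norm q \<kappa> v" using le by simp
qed

section \<open>Convolution of a distribution with the image measure\<close>

text \<open>A weak form of \<open>spec\<close> for the transform \<open>g * mc V\<close>, integrated
  only against test functions. It is available without a norm bound on the measure and is linear in
  \<open>V\<close>, so time increments can be formed before finiteness is known.\<close>

definition pairD :: "(real^'n => complex) => (real \<times> real => real) => 'n distribution => bool" where
 "pairD g V u \<longleftrightarrow> bm V \<and> (\<forall>\<phi>\<in>schwartz. integrable lborel (%\<xi>. g \<xi> * (mc V \<xi> * inv_fourier \<phi> \<xi>)) \<and>
   u \<phi> = (LINT \<xi>|lborel. g \<xi> * (mc V \<xi> * inv_fourier \<phi> \<xi>)))"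

lemma pairD_diff:
 assumes "pairD g V u" "pairD g V' u'" shows "pairD g (%p. V p - V' p) (u - u')"
 unfolding pairD_def
proof (intro conjI ballI)
 have b: "bm V" "bm V'" using assms by (auto simp: pairD_def)
 then show "bm (%p. V p - V' p)" by (rule bm_diff)
 fix \<phi> :: "real^'n => complex" assume \<phi>: "\<phi> \<in> schwartz"
 have i: "integrable lborel (%\<xi>. g \<xi> * (mc V \<xi> * inv_fourier \<phi> \<xi>))" "integrable lborel (%\<xi>. g \<xi> * (mc V' \<xi> * inv_fourier \<phi> \<xi>))"
  "u \<phi> = (LINT \<xi>|lborel. g \<xi> * (mc V \<xi> * inv_fourier \<phi> \<xi>))" "u' \<phi> = (LINT \<xi>|lborel. g \<xi> * (mc V' \<xi> * inv_fourier \<phi> \<xi>))"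
  using assms \<phi> by (auto simp: pairD_def)
 have e: "g \<xi> * (mc (%p. V p - V' p) \<xi> * inv_fourier \<phi> \<xi>) = g \<xi> * (mc V \<xi> * inv_fourier \<phi> \<xi>) - g \<xi> * (mc V' \<xi> * inv_fourier \<phi> \<xi>)" for \<xi>
  unfolding mc_diff[OF b] by (simp add: algebra_simps)
 show "integrable lborel (%\<xi>. g \<xi> * (mc (%p. V p - V' p) \<xi> * inv_fourier \<phi> \<xi>))"
  unfolding e by (rule int_diff[OF i(1,2)])
 show "(u - u') \<phi> = (LINT \<xi>|lborel. g \<xi> * (mc (%p. V p - V' p) \<xi> * inv_fourier \<phi> \<xi>))"
  unfolding e LINT_diff[OF i(1,2)] using i(3,4) by simp
qed

lemma pairD_add:
 assumes "pairD g V u" "pairD g V' u'" shows "pairD g (%p. V p + V' p) (u + u')"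
 unfolding pairD_def
proof (intro conjI ballI)
 have b: "bm V" "bm V'" using assms by (auto simp: pairD_def)
 then show "bm (%p. V p + V' p)" by (rule bm_add)
 fix \<phi> :: "real^'n => complex" assume \<phi>: "\<phi> \<in> schwartz"
 have i: "integrable lborel (%\<xi>. g \<xi> * (mc V \<xi> * inv_fourier \<phi> \<xi>))" "integrable lborel (%\<xi>. g \<xi> * (mc V' \<xi> * inv_fourier \<phi> \<xi>))"
  "u \<phi> = (LINT \<xi>|lborel. g \<xi> * (mc V \<xi> * inv_fourier \<phi> \<xi>))" "u' \<phi> = (LINT \<xi>|lborel. g \<xi> * (mc V' \<xi> * inv_fourier \<phi> \<xi>))"
  using assms \<phi> by (auto simp: pairD_def)
 have e: "g \<xi> * (mc (%p. V p + V' p) \<xi> * inv_fourier \<phi> \<xi>) = g \<xi> * (mc V \<xi> * inv_fourier \<phi> \<xi>) + g \<xi> * (mc V' \<xi> * inv_fourier \<phi> \<xi>)" for \<xi>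
  unfolding mc_add[OF b] by (simp add: algebra_simps)
 show "integrable lborel (%\<xi>. g \<xi> * (mc (%p. V p + V' p) \<xi> * inv_fourier \<phi> \<xi>))"
  unfolding e by (rule int_add[OF i(1,2)])
 show "(u + u') \<phi> = (LINT \<xi>|lborel. g \<xi> * (mc (%p. V p + V' p) \<xi> * inv_fourier \<phi> \<xi>))"
  unfolding e LINT_add[OF i(1,2)] using i(3,4) by simp
qed

text \<open>Convolution becomes multiplication: \<open>mc V * inv_fourier \<phi>\<close> is a
  Schwartz function whose Fourier transform is the average of translates on which \<open>u0\<close>
  acts.\<close>

lemma pairD_convolution:
 assumes g: "represents g (fourier_distr u0)" and V: "bm V"
  and u: "\<And>\<phi>. \<phi> \<in> schwartz ==> u \<phi> = u0 (%x. LINT p|M. of_real (V p) * \<phi> (x - zd p))"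
 shows "pairD g V u"
 unfolding pairD_def
proof (intro conjI ballI V)
 fix \<phi> :: "real^'n => complex" assume \<phi>: "\<phi> \<in> schwartz"
 have Vc: "bm (%p. complex_of_real (V p))" by (rule bm_of_real[OF V])
 have Vm [measurable]: "V \<in> borel_measurable M" using V by (simp add: bm_def)
 have I: "inv_fourier \<phi> \<in> schwartz" by (rule inv_fourier_schwartz[OF \<phi>])
 have X: "(%\<xi>. mc V \<xi> * inv_fourier \<phi> \<xi>) \<in> schwartz" by (rule schwartz_mult[OF mch_slow[OF Vc] I]) simp
 have F: "fourier (%\<xi>. mc V \<xi> * inv_fourier \<phi> \<xi>) = (%x. LINT p|M. of_real (V p) * \<phi> (x - zd p))"
 proof
  fix x
  have "fourier (%\<xi>. mc V \<xi> * inv_fourier \<phi> \<xi>) x = (LINT \<xi>|lborel. (LINT p|M. cis (zd p \<bullet> \<xi> - \<xi> \<bullet> x) * inv_fourier \<phi> \<xi> * of_real (V p)))"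
   unfolding fourier_FF FF_def
  proof (rule LINT_cong[OF refl])
   fix \<xi>
   have "cis (- 1 * (\<xi> \<bullet> x)) * (mc V \<xi> * inv_fourier \<phi> \<xi>) = (cis (- (\<xi> \<bullet> x)) * inv_fourier \<phi> \<xi>) * (LINT p|M. cis (1 * (zd p \<bullet> \<xi>)) * of_real (V p))"
    unfolding mch_def by (simp add: mult_ac)
   also have "\<dots> = (LINT p|M. (cis (- (\<xi> \<bullet> x)) * inv_fourier \<phi> \<xi>) * (cis (1 * (zd p \<bullet> \<xi>)) * of_real (V p)))"
    by (rule integral_mult_right_zero[symmetric])
   also have "\<dots> = (LINT p|M. cis (zd p \<bullet> \<xi> - \<xi> \<bullet> x) * inv_fourier \<phi> \<xi> * of_real (V p))"
    by (intro LINT_cong[OF refl])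
      (simp only: diff_conv_add_uminus cis_mult[symmetric] mult_1 mult_ac)
   finally show "cis (- 1 * (\<xi> \<bullet> x)) * (mc V \<xi> * inv_fourier \<phi> \<xi>) = (LINT p|M. cis (zd p \<bullet> \<xi> - \<xi> \<bullet> x) * inv_fourier \<phi> \<xi> * of_real (V p))" .
  qed
  also have "\<dots> = (LINT p|M. (LINT \<xi>|lborel. cis (zd p \<bullet> \<xi> - \<xi> \<bullet> x) * inv_fourier \<phi> \<xi> * of_real (V p)))"
  proof (rule kernel_fubini(2)[OF sigma_finite_lborel _ schwartz_integrable[OF I] bm_integrable[OF Vc], of _ 1])
   show "(%(\<xi>, p). cis (zd p \<bullet> \<xi> - \<xi> \<bullet> x)) \<in> borel_measurable (lborel \<Otimes>\<^sub>M M)" by measurable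
   show "sigma_finite_measure M" by (rule M.sigma_finite_measure_axioms)
  qed simp
  also have "\<dots> = (LINT p|M. of_real (V p) * \<phi> (x - zd p))"
  proof (rule LINT_cong[OF refl])
   fix p
   have "(LINT \<xi>|lborel. cis (zd p \<bullet> \<xi> - \<xi> \<bullet> x) * inv_fourier \<phi> \<xi> * of_real (V p))
     = (LINT \<xi>|lborel. (cis (- 1 * (\<xi> \<bullet> (x - zd p))) * inv_fourier \<phi> \<xi>) * of_real (V p))"
    by (simp add: inner_diff_right inner_commute)
   also have "\<dots> = (LINT \<xi>|lborel. cis (- 1 * (\<xi> \<bullet> (x - zd p))) * inv_fourier \<phi> \<xi>) * of_real (V p)"
    by (rule integral_mult_left_zero)
   also have "(LINT \<xi>|lborel. cis (- 1 * (\<xi> \<bullet> (x - zd p))) * inv_fourier \<phi> \<xi>) = fourier (inv_fourier \<phi>) (x - zd p)"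
    unfolding fourier_FF FF_def ..
   finally show "(LINT \<xi>|lborel. cis (zd p \<bullet> \<xi> - \<xi> \<bullet> x) * inv_fourier \<phi> \<xi> * of_real (V p)) = of_real (V p) * \<phi> (x - zd p)"
    unfolding fourier_inv_fourier[OF \<phi>] by simp
  qed
  finally show "fourier (%\<xi>. mc V \<xi> * inv_fourier \<phi> \<xi>) x = (LINT p|M. of_real (V p) * \<phi> (x - zd p))" .
 qed
 have "integrable lborel (%\<xi>. g \<xi> * (mc V \<xi> * inv_fourier \<phi> \<xi>)) \<and>
   fourier_distr u0 (%\<xi>. mc V \<xi> * inv_fourier \<phi> \<xi>) = fun_distr g (%\<xi>. mc V \<xi> * inv_fourier \<phi> \<xi>)"
  using bspec[OF conjunct2[OF g[unfolded represents_def]] X] .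
 then show "integrable lborel (%\<xi>. g \<xi> * (mc V \<xi> * inv_fourier \<phi> \<xi>))"
  and "u \<phi> = (LINT \<xi>|lborel. g \<xi> * (mc V \<xi> * inv_fourier \<phi> \<xi>))"
  unfolding fourier_distr_def fun_distr_def F u[OF \<phi>] by auto
qed

lemma nested_integral:
 fixes k :: "real => real => 'b::{banach, second_countable_topology}"
 assumes k: "(%(r2, r1). k r2 r1) \<in> borel_measurable (borel \<Otimes>\<^sub>M borel)" and K: "\<And>r2 r1. norm (k r2 r1) <= K"
  and t: "t1 <= T" "t2 <= T"
 shows "(LINT r2:{0..t2}|lborel. (LINT r1:{0..t1}|lborel. (w r1 * w r2) *\<^sub>R k r2 r1)) = (LINT p|M. wt t1 t2 p *\<^sub>R k (fst p) (snd p))"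
  and "bm (%p. wt t1 t2 p *\<^sub>R k (fst p) (snd p))"
proof -
 have k' [measurable]: "(%p. k (fst p) (snd p)) \<in> borel_measurable M" using k by (simp add: case_prod_beta)
 have km: "(%p. k (fst p) (snd p)) \<in> borel_measurable (borel \<Otimes>\<^sub>M borel)" using k by (simp add: case_prod_beta)
 have km1 [measurable]: "(%r1. k r2 r1) \<in> borel_measurable borel" for r2
  using measurable_compose[OF _ km, of "%r1. (r2, r1)" borel] by simp
 show bmk: "bm (%p. wt t1 t2 p *\<^sub>R k (fst p) (snd p))"
 proof -
  have [measurable]: "wt t1 t2 \<in> borel_measurable M" using bm_wt by (simp add: bm_def)
  obtain C where C: "\<forall>p. norm (wt t1 t2 p) <= C" using bm_wt unfolding bm_def by blast
  have "norm (wt t1 t2 p *\<^sub>R k (fst p) (snd p)) <= C * K" for p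
   using C[rule_format, of p] K[of "fst p" "snd p"] unfolding norm_scaleR by (intro mult_mono) auto
  then show ?thesis unfolding bm_def by (intro conjI) (measurable, blast)
 qed
 interpret L: finite_measure "time_measure T" by (rule finite_time_measure)
 interpret pair_sigma_finite "time_measure T" "time_measure T" ..
 have "(LINT p|M. wt t1 t2 p *\<^sub>R k (fst p) (snd p)) = (LINT r2|time_measure T. (LINT r1|time_measure T. wt t1 t2 (r2, r1) *\<^sub>R k r2 r1))"
  using integral_fst'[OF bm_integrable[OF bmk]] by simp
 also have "\<dots> = (LINT r2:{0..T}|lborel. (LINT r1|time_measure T. wt t1 t2 (r2, r1) *\<^sub>R k r2 r1))"
 proof (rule integral_time_measure)
  have "(%r2. (LINT r1|time_measure T. (%p. wt t1 t2 p *\<^sub>R k (fst p) (snd p)) (r2, r1))) \<in> borel_measurable (time_measure T)"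
   using borel_measurable_integrable[OF bm_integrable[OF bmk]] by measurable
  then show "(%r2. (LINT r1|time_measure T. wt t1 t2 (r2, r1) *\<^sub>R k r2 r1)) \<in> borel_measurable borel"
   by (simp cong: measurable_cong_sets add: sets_time_measure)
 qed
 also have "\<dots> = (LINT r2:{0..t2}|lborel. (LINT r1:{0..t1}|lborel. (w r1 * w r2) *\<^sub>R k r2 r1))"
  unfolding set_lebesgue_integral_def
 proof (rule LINT_cong[OF refl])
  fix r2
  have m: "(%r1. wt t1 t2 (r2, r1) *\<^sub>R k r2 r1) \<in> borel_measurable borel"
   unfolding wt_def fst_conv snd_conv by measurable
  have "(LINT r1|time_measure T. wt t1 t2 (r2, r1) *\<^sub>R k r2 r1) = (LINT r1|lborel. indicator {0..T} r1 *\<^sub>R (wt t1 t2 (r2, r1) *\<^sub>R k r2 r1))"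
   unfolding integral_time_measure[OF m] set_lebesgue_integral_def ..
  also have "\<dots> = (LINT r1|lborel. indicator {0..t2} r2 *\<^sub>R (indicator {0..t1} r1 *\<^sub>R (w r1 * w r2) *\<^sub>R k r2 r1))"
   using t by (intro LINT_cong[OF refl]) (simp add: wt_def indicator_def)
  also have "\<dots> = indicator {0..t2} r2 *\<^sub>R (LINT r1|lborel. indicator {0..t1} r1 *\<^sub>R (w r1 * w r2) *\<^sub>R k r2 r1)"
   by (rule integral_scaleR_right)
  finally show "indicator {0..T} r2 *\<^sub>R (LINT r1|time_measure T. wt t1 t2 (r2, r1) *\<^sub>R k r2 r1)
   = indicator {0..t2} r2 *\<^sub>R (LINT r1|lborel. indicator {0..t1} r1 *\<^sub>R (w r1 * w r2) *\<^sub>R k r2 r1)"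
   using t by (simp add: indicator_def)
 qed
 finally show "(LINT r2:{0..t2}|lborel. (LINT r1:{0..t1}|lborel. (w r1 * w r2) *\<^sub>R k r2 r1)) = (LINT p|M. wt t1 t2 p *\<^sub>R k (fst p) (snd p))" ..
qed

text \<open>The integrand contains two values of the weight, and a null set of times has to be
  discarded in each variable separately: in the inner integral for fixed \<open>r2\<close>, then in
  the outer one. On \<open>[0, T]\<close> the given weight \<open>w0\<close> equals the Borel
  function \<open>w1\<close>, which provides the measurability for both exchanges.\<close>

lemma nested_transfer:
 fixes k k0 :: "real => real => 'b::{banach, second_countable_topology}"
 assumes k: "(%(r2, r1). k r2 r1) \<in> borel_measurable (borel \<Otimes>\<^sub>M borel)" and K: "\<And>r2 r1. norm (k r2 r1) <= K"
  and t: "t1 <= T" "t2 <= T"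
  and w1 [measurable]: "w1 \<in> borel_measurable borel" and w01: "\<And>r. r \<in> {0..T} ==> w0 r = w1 r"
  and ae: "AE r in lborel. r \<in> {0..T} --> w1 r = w r"
  and k0: "\<And>r2 r1. r2 \<in> {0..T} ==> r1 \<in> {0..T} ==> k0 r2 r1 = k r2 r1"
 shows "(LINT r2:{0..t2}|lborel. (LINT r1:{0..t1}|lborel. (w0 r1 * w0 r2) *\<^sub>R k0 r2 r1)) = (LINT p|M. wt t1 t2 p *\<^sub>R k (fst p) (snd p))"
proof -
 have km: "(%p. k (fst p) (snd p)) \<in> borel_measurable (borel \<Otimes>\<^sub>M borel)" using k by (simp add: case_prod_beta)
 have km1 [measurable]: "(%r1. k r2 r1) \<in> borel_measurable borel" for r2
  using measurable_compose[OF _ km, of "%r1. (r2, r1)" borel] by simp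
 have inner: "indicator {0..t2} r2 *\<^sub>R (LINT r1|lborel. indicator {0..t1} r1 *\<^sub>R (w0 r1 * w0 r2) *\<^sub>R k0 r2 r1)
   = (indicator {0..t2} r2 * w1 r2) *\<^sub>R (LINT r1|lborel. (indicator {0..t1} r1 * w r1) *\<^sub>R k r2 r1)" for r2
 proof (cases "r2 \<in> {0..t2}")
  case True
  then have r2: "r2 \<in> {0..T}" using t by auto
  have "(LINT r1|lborel. indicator {0..t1} r1 *\<^sub>R (w0 r1 * w0 r2) *\<^sub>R k0 r2 r1)
    = (LINT r1|lborel. w1 r2 *\<^sub>R ((indicator {0..t1} r1 * w1 r1) *\<^sub>R k r2 r1))"
   using t r2 w01 k0 by (intro LINT_cong[OF refl]) (auto simp: indicator_def)
  also have "\<dots> = w1 r2 *\<^sub>R (LINT r1|lborel. (indicator {0..t1} r1 * w1 r1) *\<^sub>R k r2 r1)" by (rule integral_scaleR_right)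
  also have "(LINT r1|lborel. (indicator {0..t1} r1 * w1 r1) *\<^sub>R k r2 r1) = (LINT r1|lborel. (indicator {0..t1} r1 * w r1) *\<^sub>R k r2 r1)"
  proof (rule integral_cong_AE)
   show "AE r1 in lborel. (indicator {0..t1} r1 * w1 r1) *\<^sub>R k r2 r1 = (indicator {0..t1} r1 * w r1) *\<^sub>R k r2 r1"
    using ae by (rule AE_mp) (use t in \<open>auto simp: indicator_def\<close>)
  qed measurable
  finally show ?thesis using True by simp
 qed simp
 have outer: "(%r2. (LINT r1|lborel. (indicator {0..t1} r1 * w r1) *\<^sub>R k r2 r1)) \<in> borel_measurable borel"
 proof -
  have "(%p. (indicator {0..t1} (snd p) * w (snd p)) *\<^sub>R k (fst p) (snd p)) \<in> borel_measurable (borel \<Otimes>\<^sub>M lborel)"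
   using km by measurable
  then have "(%(r2, r1). (indicator {0..t1} r1 * w r1) *\<^sub>R k r2 r1) \<in> borel_measurable (borel \<Otimes>\<^sub>M lborel)"
   by (simp add: case_prod_beta)
  then show ?thesis by (rule lborel.borel_measurable_lebesgue_integral)
 qed
 have "(LINT r2:{0..t2}|lborel. (LINT r1:{0..t1}|lborel. (w0 r1 * w0 r2) *\<^sub>R k0 r2 r1))
   = (LINT r2|lborel. (indicator {0..t2} r2 * w1 r2) *\<^sub>R (LINT r1|lborel. (indicator {0..t1} r1 * w r1) *\<^sub>R k r2 r1))"
  unfolding set_lebesgue_integral_def inner ..
 also have "\<dots> = (LINT r2|lborel. (indicator {0..t2} r2 * w r2) *\<^sub>R (LINT r1|lborel. (indicator {0..t1} r1 * w r1) *\<^sub>R k r2 r1))"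
 proof (rule integral_cong_AE)
  show "AE r2 in lborel. (indicator {0..t2} r2 * w1 r2) *\<^sub>R (LINT r1|lborel. (indicator {0..t1} r1 * w r1) *\<^sub>R k r2 r1)
    = (indicator {0..t2} r2 * w r2) *\<^sub>R (LINT r1|lborel. (indicator {0..t1} r1 * w r1) *\<^sub>R k r2 r1)"
   using ae by (rule AE_mp) (use t in \<open>auto simp: indicator_def\<close>)
 qed (use outer in measurable)
 also have "\<dots> = (LINT r2:{0..t2}|lborel. (LINT r1:{0..t1}|lborel. (w r1 * w r2) *\<^sub>R k r2 r1))"
  unfolding set_lebesgue_integral_def
 proof (rule LINT_cong[OF refl])
  fix r2
  have "(LINT r1|lborel. indicator {0..t1} r1 *\<^sub>R (w r1 * w r2) *\<^sub>R k r2 r1) = (LINT r1|lborel. w r2 *\<^sub>R ((indicator {0..t1} r1 * w r1) *\<^sub>R k r2 r1))"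
   by (simp add: mult_ac)
  also have "\<dots> = w r2 *\<^sub>R (LINT r1|lborel. (indicator {0..t1} r1 * w r1) *\<^sub>R k r2 r1)" by (rule integral_scaleR_right)
  finally show "(indicator {0..t2} r2 * w r2) *\<^sub>R (LINT r1|lborel. (indicator {0..t1} r1 * w r1) *\<^sub>R k r2 r1)
   = indicator {0..t2} r2 *\<^sub>R (LINT r1|lborel. indicator {0..t1} r1 *\<^sub>R (w r1 * w r2) *\<^sub>R k r2 r1)" by simp
 qed
 also have "\<dots> = (LINT p|M. wt t1 t2 p *\<^sub>R k (fst p) (snd p))" by (rule nested_integral(1)[OF k K t])
 finally show ?thesis .
qed

end

section \<open>Young solutions\<close>

lemma is_partition_less:
 assumes p: "is_partition t m p" and ij: "i < j" "j <= m" shows "p i < p j"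
 using ij
proof (induction j)
 case (Suc j)
 then have "p j < p (Suc j)" using p by (auto simp: is_partition_def)
 then show ?case using Suc by (cases "i = j") auto
qed simp

lemma chain_partition:
 assumes p: "is_partition t m p" shows "chain 0 t (map p [0..<Suc m])"
proof -
 have le: "p i <= p j" if "i <= j" "j <= m" for i j
  using is_partition_less[OF p, of i j] that by (cases "i = j") auto
 have "sorted_wrt (<) (map p [0..<Suc m])"
  unfolding sorted_wrt_iff_nth_less using is_partition_less[OF p] by (auto simp del: upt_Suc)
 moreover have "p 0 = 0" "p m = t" using p by (auto simp: is_partition_def)
 moreover have "p i \<in> {0..t}" if "i <= m" for i
  using le[of 0 i] le[of i m] that calculation by auto
 ultimately show ?thesis unfolding chain_def by (force simp: image_iff simp del: upt_Suc)
qed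

lemma partition_chain:
 assumes P: "chain 0 t P" shows "is_partition t (length P - 1) (nth P)" "P = map (nth P) [0..<Suc (length P - 1)]"
proof -
 have ne: "P \<noteq> []" by (rule chain_nonempty[OF P])
 have "P ! 0 = 0" "P ! (length P - 1) = t"
  using chain_hd[OF P] chain_last[OF P] ne by (auto simp: hd_conv_nth last_conv_nth)
 moreover have "sorted_wrt (<) P" using P by (simp add: chain_def)
 ultimately show "is_partition t (length P - 1) (nth P)"
  unfolding is_partition_def by (auto intro: sorted_wrt_nth_less)
 show "P = map (nth P) [0..<Suc (length P - 1)]" using ne by (simp add: map_nth del: upt_Suc)
qed

lemma mesh_map: "mesh h (map p [0..<Suc m]) \<longleftrightarrow> (\<forall>i<m. p (Suc i) - p i < h)"
 unfolding mesh_def successively_conv_nth by (auto simp: algebra_simps simp del: upt_Suc)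

lemma psum_map: "psum X (map p [0..<Suc m]) = (\<Sum>i<m. X (p i) (p (Suc i)))"
proof (induction m)
 case (Suc m)
 have "map p [0..<Suc (Suc m)] = map p [0..<m] @ p m # [p (Suc m)]" by simp
 then have "psum X (map p [0..<Suc (Suc m)]) = psum X (map p [0..<m] @ [p m]) + psum X [p m, p (Suc m)]"
  using psum_join by metis
 also have "map p [0..<m] @ [p m] = map p [0..<Suc m]" by simp
 finally show ?case using Suc by simp
qed simp

lemma young_sum_eq:
 "young_sum A \<theta> m p n q = psum2 (germ A [(1, \<theta>)]) (map p [0..<Suc m]) (map q [0..<Suc n])"
 unfolding psum2_def psum_map young_sum_def germ_def wsum_def by (simp add: box_def)

text \<open>Indexed partitions and lists determine each other, \<open>m\<close> intervals
  corresponding to \<open>m + 1\<close> points; for time 0 this means \<open>m = 0\<close> and the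
  singleton list.\<close>

lemma has_young_integral_iff:
 "has_young_integral A \<theta> t1 t2 I \<longleftrightarrow> has_int (germ A [(1, \<theta>)]) 0 t1 0 t2 I"
proof
 assume L: "has_young_integral A \<theta> t1 t2 I"
 show "has_int (germ A [(1, \<theta>)]) 0 t1 0 t2 I"
  unfolding has_int_def
 proof (intro allI impI)
  fix e :: real assume "0 < e"
  then obtain d where d: "0 < d" "\<And>m p n q. is_partition t1 m p \<and> is_partition t2 n q \<and>
    (\<forall>i<m. p (Suc i) - p i < d) \<and> (\<forall>j<n. q (Suc j) - q j < d) ==> norm (young_sum A \<theta> m p n q - I) < e"
   using L unfolding has_young_integral_def by blast
  have "norm (psum2 (germ A [(1, \<theta>)]) P Q - I) < e"
   if *: "chain 0 t1 P" "mesh d P" "chain 0 t2 Q" "mesh d Q" for P Q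
  proof -
   note P = partition_chain[OF *(1)] and Q = partition_chain[OF *(3)]
   have "mesh d (map (nth P) [0..<Suc (length P - 1)])" "mesh d (map (nth Q) [0..<Suc (length Q - 1)])"
    using * P(2) Q(2) by metis+
   then have "norm (young_sum A \<theta> (length P - 1) (nth P) (length Q - 1) (nth Q) - I) < e"
    unfolding mesh_map using d(2) P(1) Q(1) by blast
   then show ?thesis unfolding young_sum_eq P(2)[symmetric] Q(2)[symmetric] .
  qed
  then show "\<exists>h>0. \<forall>P Q. chain 0 t1 P \<and> mesh h P \<and> chain 0 t2 Q \<and> mesh h Q --> norm (psum2 (germ A [(1, \<theta>)]) P Q - I) < e"
   using d(1) by blast
 qed
next
 assume L: "has_int (germ A [(1, \<theta>)]) 0 t1 0 t2 I"
 show "has_young_integral A \<theta> t1 t2 I"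
  unfolding has_young_integral_def
 proof (intro allI impI)
  fix e :: real assume "0 < e"
  then obtain h where h: "0 < h" "\<And>P Q. chain 0 t1 P \<and> mesh h P \<and> chain 0 t2 Q \<and> mesh h Q ==> norm (psum2 (germ A [(1, \<theta>)]) P Q - I) < e"
   using L unfolding has_int_def by blast
  have "norm (young_sum A \<theta> m p n q - I) < e"
   if *: "is_partition t1 m p" "is_partition t2 n q" "\<forall>i<m. p (Suc i) - p i < h" "\<forall>j<n. q (Suc j) - q j < h" for m p n q
   unfolding young_sum_eq by (rule h(2)) (use * chain_partition mesh_map in blast)
  then show "\<exists>\<delta>>0. \<forall>m p n q. is_partition t1 m p \<and> is_partition t2 n q \<and>
    (\<forall>i<m. p (Suc i) - p i < \<delta>) \<and> (\<forall>j<n. q (Suc j) - q j < \<delta>) --> norm (young_sum A \<theta> m p n q - I) < e"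
   using h(1) by blast
 qed
qed

section \<open>Hoelder norms and solutions for a regular field\<close>

lemma holder_norm_le:
 fixes f :: "real => 'b::real_normed_vector"
 assumes L: "\<And>s t. 0 <= s ==> s <= t ==> t <= T ==> norm (f t - f s) <= L * (t - s) powr \<gamma>"
  and L0: "norm (f 0) <= L0" and T: "0 < T" and \<gamma>: "0 < \<gamma>"
 shows "holder_norm T \<gamma> f <= ennreal (L0 + L * T powr \<gamma> + L)"
proof -
 have "0 <= L * T powr \<gamma>" using order_trans[OF norm_ge_zero L[of 0 T]] T by simp
 then have Lp: "0 <= L" using T by (simp add: zero_le_mult_iff)
 have L0p: "0 <= L0" using L0 norm_ge_zero order_trans by blast
 have a: "norm (f t) <= L0 + L * T powr \<gamma>" if "t \<in> {0..T}" for t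
 proof -
  have "norm (f t) <= norm (f 0) + norm (f t - f 0)" using norm_triangle_ineq[of "f 0" "f t - f 0"] by simp
  also have "\<dots> <= L0 + L * (t - 0) powr \<gamma>" using L[of 0 t] L0 that by (intro add_mono) auto
  also have "\<dots> <= L0 + L * T powr \<gamma>" using that Lp \<gamma> by (auto intro!: mult_left_mono powr_mono2)
  finally show ?thesis .
 qed
 have b: "norm (f t - f s) / \<bar>t - s\<bar> powr \<gamma> <= L" if "s \<in> {0..T}" "t \<in> {0..T}" "s \<noteq> t" for s t
 proof -
  have "norm (f t - f s) <= L * \<bar>t - s\<bar> powr \<gamma>"
   using L[of s t] L[of t s] that by (cases "s <= t") (auto simp: norm_minus_commute)
  then show ?thesis using that by (simp add: divide_le_eq)
 qed
 have "holder_norm T \<gamma> f <= ennreal (L0 + L * T powr \<gamma>) + ennreal L"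
  unfolding holder_norm_def
  by (intro add_mono SUP_least) (use a b in \<open>auto intro!: ennreal_leI\<close>)
 also have "\<dots> = ennreal (L0 + L * T powr \<gamma> + L)" using L0p Lp by (simp add: ennreal_plus)
 finally show ?thesis .
qed

text \<open>The conclusion covers all small scales, so that several paths can be put on a common
  one.\<close>

lemma holder_norm_hol:
 assumes f: "holder_norm T \<gamma> f < \<infinity>" and \<gamma>: "0 < \<gamma>"
 shows "\<exists>\<tau>0>0. \<forall>\<tau>. 0 < \<tau> --> \<tau> <= \<tau>0 --> hol \<tau> \<gamma> T f"
proof -
 define S where "S = (SUP (s, t)\<in>{(s, t). s \<in> {0..T} \<and> t \<in> {0..T} \<and> s \<noteq> t}.
    ennreal (norm (f t - f s) / \<bar>t - s\<bar> powr \<gamma>))"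
 have "S < \<infinity>" using f unfolding holder_norm_def S_def by (simp add: ennreal_add_less_top)
 then obtain K where K: "0 <= K" "S = ennreal K" by (cases S) auto
 have b: "norm (f t - f s) <= K * (t - s) powr \<gamma>" if "0 <= s" "s <= t" "t <= T" for s t
 proof (cases "s = t")
  case False
  have "ennreal (norm (f t - f s) / \<bar>t - s\<bar> powr \<gamma>) <= S"
   unfolding S_def by (rule SUP_upper2[of "(s, t)"]) (use that False in auto)
  then have "norm (f t - f s) / \<bar>t - s\<bar> powr \<gamma> <= K" using K by simp
  then show ?thesis using that False by (simp add: divide_le_eq)
 qed simp
 \<comment> \<open>Chosen with \<open>\<tau>0 powr (- \<gamma>) = K + 1\<close>; the summand 1 keeps
   the base positive.\<close>
 define \<tau>0 where "\<tau>0 = (K + 1) powr (- (1 / \<gamma>))"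
 have \<tau>0: "0 < \<tau>0" using K by (simp add: \<tau>0_def)
 have "hol \<tau> \<gamma> T f" if \<tau>: "0 < \<tau>" "\<tau> <= \<tau>0" for \<tau>
  unfolding hol_def
 proof (intro allI impI)
  fix s t assume st: "0 <= s" "s <= t" "t <= T" "t - s <= \<tau>"
  have "\<tau>0 powr (- \<gamma>) = K + 1" unfolding \<tau>0_def powr_powr using K \<gamma> by simp
  moreover have "\<tau>0 powr (- \<gamma>) <= \<tau> powr (- \<gamma>)" using \<tau> \<gamma> by (intro powr_mono2') auto
  ultimately have "K <= \<tau> powr (- \<gamma>)" by simp
  then have "K * (t - s) powr \<gamma> <= \<tau> powr (- \<gamma>) * (t - s) powr \<gamma>" by (intro mult_right_mono) auto
  then show "norm (f t - f s) <= \<tau> powr (- \<gamma>) * (t - s) powr \<gamma>" using b[of s t] st by simp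
 qed
 then show ?thesis using \<tau>0 by blast
qed

text \<open>The path of a Young solution, with the perturbation and the regularity condition on the
  field split off.\<close>

definition young_path :: "real => real => (real => real => real^'n::finite => real^'n) => real^'n => (real => real^'n) => bool" where
 "young_path T \<gamma> A u0 \<theta> \<longleftrightarrow> holder_norm T \<gamma> \<theta> < \<infinity> \<and>
   (\<forall>t\<in>{0..T}. \<exists>I. has_young_integral A \<theta> t t I \<and> \<theta> t = u0 + I)"

lemma young_path_iff: "young_path T \<gamma> A u0 \<theta> \<longleftrightarrow> holder_norm T \<gamma> \<theta> < \<infinity> \<and> solves T A u0 \<theta>"
proof -
 have e: "(\<exists>I. has_int X 0 t 0 t I \<and> \<theta> t = u0 + I) \<longleftrightarrow> has_int X 0 t 0 t (\<theta> t - u0)" for X t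
  by (metis add_diff_cancel_left' diff_add_cancel add.commute)
 show ?thesis unfolding young_path_def solves_def has_young_integral_iff e ..
qed

lemma young_path_exists:
 fixes A :: "real => real => real^'n::finite => real^'n"
 assumes A: "regular_field T \<gamma> M A" and M: "0 <= M" and \<gamma>: "1/2 < \<gamma>" and T: "0 < T"
  and sm: "small_scale T \<gamma> M \<tau>"
 shows "\<exists>\<theta>. hol \<tau> \<gamma> T \<theta> \<and> young_path T \<gamma> A u0 \<theta>"
proof -
 have \<tau>: "0 < \<tau>" using sm by (simp add: small_scale_def)
 obtain \<theta> where \<theta>: "hol \<tau> \<gamma> T \<theta>" and s: "solves T A u0 \<theta>" using existence[OF A M \<gamma> T sm] by blast
 have "norm (\<theta> t - \<theta> s) <= M * 4 * bdC T \<gamma> \<tau> * (t - s) powr \<gamma>" if st: "0 <= s" "s <= t" "t <= T" for s t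
 proof -
  have "has_int (germ A [(1, \<theta>)]) 0 t 0 t (\<theta> t - u0)" "has_int (germ A [(1, \<theta>)]) 0 s 0 s (\<theta> s - u0)"
   using s st unfolding solves_def by auto
  from single_incr[OF A M \<gamma> \<tau> \<theta> st this] show ?thesis by simp
 qed
 then have "holder_norm T \<gamma> \<theta> <= ennreal (norm (\<theta> 0) + M * 4 * bdC T \<gamma> \<tau> * T powr \<gamma> + M * 4 * bdC T \<gamma> \<tau>)"
  by (rule holder_norm_le) (use T \<gamma> in auto)
 then have "holder_norm T \<gamma> \<theta> < \<infinity>" using le_less_trans by fastforce
 then show ?thesis using \<theta> s young_path_iff by blast
qed

lemma young_path_stability:
 assumes \<gamma>: "1/2 < \<gamma>" and M: "0 <= M" and \<tau>: "0 < \<tau>" and T: "0 < T"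
 shows "\<exists>C>0. \<forall>(A :: real => real => real^'n::finite => real^'n) B M' u0 v0 \<theta> \<eta>.
   regular_field T \<gamma> M A --> 0 <= M' --> regular_field T \<gamma> M' (%t1 t2 x. B t1 t2 x - A t1 t2 x) -->
   hol \<tau> \<gamma> T \<theta> --> hol \<tau> \<gamma> T \<eta> --> young_path T \<gamma> B v0 \<theta> --> young_path T \<gamma> A u0 \<eta> -->
   holder_norm T \<gamma> (%t. \<theta> t - \<eta> t) <= ennreal (C * (M' + norm (v0 - u0)))"
proof -
 obtain C where C: "0 <= C" and st: "\<And>(A :: real => real => real^'n::finite => real^'n) B M' u0 v0 \<theta> \<eta> s t.
   regular_field T \<gamma> M A ==> 0 <= M' ==> regular_field T \<gamma> M' (%t1 t2 x. B t1 t2 x - A t1 t2 x) ==>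
   hol \<tau> \<gamma> T \<theta> ==> hol \<tau> \<gamma> T \<eta> ==> solves T B v0 \<theta> ==> solves T A u0 \<eta> ==>
   0 <= s ==> s <= t ==> t <= T ==> norm ((\<theta> t - \<eta> t) - (\<theta> s - \<eta> s)) <= C * (M' + norm (v0 - u0)) * (t - s) powr \<gamma>"
  using stability[OF \<gamma> M \<tau> T, where ?'n = 'n] by blast
 \<comment> \<open>The three summands match those of \<open>holder_norm_le\<close>: initial value,
   supremum of the increments from 0, and seminorm.\<close>
 define D where "D = 1 + C * T powr \<gamma> + C"
 have "0 <= C * T powr \<gamma>" using C by simp
 then have D: "0 < D" using C unfolding D_def by linarith
 have "holder_norm T \<gamma> (%t. \<theta> t - \<eta> t) <= ennreal (D * (M' + norm (v0 - u0)))"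
  if "regular_field T \<gamma> M A" "0 <= M'" "regular_field T \<gamma> M' (%t1 t2 x. B t1 t2 x - A t1 t2 x)"
   "hol \<tau> \<gamma> T \<theta>" "hol \<tau> \<gamma> T \<eta>" "young_path T \<gamma> B v0 \<theta>" "young_path T \<gamma> A u0 \<eta>"
  for A B :: "real => real => real^'n::finite => real^'n" and M' u0 v0 \<theta> \<eta>
 proof -
  have s: "solves T B v0 \<theta>" "solves T A u0 \<eta>" using that by (auto simp: young_path_iff)
  have "\<theta> 0 = v0" "\<eta> 0 = u0" using solves_0[OF s(1)] solves_0[OF s(2)] T by auto
  then have i: "norm (\<theta> 0 - \<eta> 0) <= M' + norm (v0 - u0)" using that(2) by simp
  have "holder_norm T \<gamma> (%t. \<theta> t - \<eta> t) <= ennreal ((M' + norm (v0 - u0)) + C * (M' + norm (v0 - u0)) * T powr \<gamma> + C * (M' + norm (v0 - u0)))"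
   by (rule holder_norm_le[OF st[OF that(1-5) s] i T]) (use \<gamma> in auto)
  also have "(M' + norm (v0 - u0)) + C * (M' + norm (v0 - u0)) * T powr \<gamma> + C * (M' + norm (v0 - u0)) = D * (M' + norm (v0 - u0))"
   by (simp add: D_def algebra_simps)
  finally show ?thesis .
 qed
 then show ?thesis using D by blast
qed

text \<open>Stability with the same field on both sides, so \<open>M' = 0\<close>, at a scale that
  suits both paths.\<close>

lemma young_path_unique:
 fixes A :: "real => real => real^'n::finite => real^'n"
 assumes A: "regular_field T \<gamma> M A" and M: "0 <= M" and \<gamma>: "1/2 < \<gamma>" and T: "0 < T"
  and \<theta>: "young_path T \<gamma> A u0 \<theta>" and \<eta>: "young_path T \<gamma> A u0 \<eta>" and t: "t \<in> {0..T}"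
 shows "\<theta> t = \<eta> t"
proof -
 have \<gamma>0: "0 < \<gamma>" using \<gamma> by simp
 have h: "holder_norm T \<gamma> \<theta> < \<infinity>" "holder_norm T \<gamma> \<eta> < \<infinity>" using \<theta> \<eta> by (auto simp: young_path_def)
 obtain a b where ab: "0 < a" "0 < b" "\<And>\<tau>. 0 < \<tau> ==> \<tau> <= a ==> hol \<tau> \<gamma> T \<theta>" "\<And>\<tau>. 0 < \<tau> ==> \<tau> <= b ==> hol \<tau> \<gamma> T \<eta>"
  using holder_norm_hol[OF h(1) \<gamma>0] holder_norm_hol[OF h(2) \<gamma>0] by blast
 define \<tau> where "\<tau> = min a b"
 have \<tau>: "0 < \<tau>" and hh: "hol \<tau> \<gamma> T \<theta>" "hol \<tau> \<gamma> T \<eta>" using ab by (auto simp: \<tau>_def)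
 have "wsum l (%x. 0) = (0 :: real^'n)" for l :: "(real \<times> (real^'n)) list" by (induction l) (auto simp: wsum_def)
 then have z: "regular_field T \<gamma> 0 (%t1 t2 x. A t1 t2 x - A t1 t2 x)"
  unfolding regular_field_def by (simp add: box_def)
 have "\<exists>C>0. holder_norm T \<gamma> (%t. \<theta> t - \<eta> t) <= ennreal (C * (0 + norm (u0 - u0)))"
  using young_path_stability[OF \<gamma> M \<tau> T, where ?'n = 'n] A z hh \<theta> \<eta> order_refl[of "0::real"] by blast
 then have "holder_norm T \<gamma> (%t. \<theta> t - \<eta> t) = 0" by simp
 then have "(SUP t\<in>{0..T}. ennreal (norm (\<theta> t - \<eta> t))) = 0" unfolding holder_norm_def by simp
 then have "ennreal (norm (\<theta> t - \<eta> t)) <= 0" using SUP_upper[OF t, of "%t. ennreal (norm (\<theta> t - \<eta> t))"] by simp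
 then show ?thesis by simp
qed

text \<open>Serves to bound the fields of all late approximations by a common constant.\<close>

lemma regular_field_sum:
 fixes A B :: "real => real => real^'n::finite => real^'n"
 assumes A: "regular_field T \<gamma> M A" and D: "regular_field T \<gamma> M' (%t1 t2 x. B t1 t2 x - A t1 t2 x)"
 shows "regular_field T \<gamma> (M + M') B"
 unfolding regular_field_def
proof (intro allI impI)
 fix s1 t1 s2 t2 K and l :: "(real \<times> (real^'n)) list"
 assume st: "0 <= s1" "s1 <= t1" "t1 <= T" "0 <= s2" "s2 <= t2" "t2 <= T"
  and l: "\<forall>\<xi>. cmod (wsum l (%x. cis (x \<bullet> \<xi>))) <= K * jb \<xi> powr (1 + 1 / \<gamma>)"
 let ?b = "%(A :: real => real => real^'n => real^'n) x. box (s1, s2) (t1, t2) (%r1 r2. A r1 r2 x)"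
 have "?b B = (%x. ?b A x + ?b (%t1 t2 x. B t1 t2 x - A t1 t2 x) x)"
  by (rule ext) (simp add: box_def algebra_simps)
 then have "wsum l (?b B) = wsum l (?b A) + wsum l (?b (%t1 t2 x. B t1 t2 x - A t1 t2 x))"
  by (simp add: wsum_add)
 moreover have "norm (wsum l (?b A)) <= M * (t1 - s1) powr \<gamma> * (t2 - s2) powr \<gamma> * K"
  using A st l unfolding regular_field_def by blast
 moreover have "norm (wsum l (?b (%t1 t2 x. B t1 t2 x - A t1 t2 x))) <= M' * (t1 - s1) powr \<gamma> * (t2 - s2) powr \<gamma> * K"
  using D st l unfolding regular_field_def by blast
 ultimately show "norm (wsum l (?b B)) <= (M + M') * (t1 - s1) powr \<gamma> * (t2 - s2) powr \<gamma> * K"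
  using norm_triangle_ineq[of "wsum l (?b A)" "wsum l (?b (%t1 t2 x. B t1 t2 x - A t1 t2 x))"]
  by (simp add: distrib_right)
qed

text \<open>\<open>w1\<close> is \<open>w0\<close> set to 0 outside \<open>[0, T]\<close>: Borel,
  but possibly unbounded. The last weight is \<open>w1\<close> truncated at the essential bound,
  hence different on a null set only. The path is extended by its end values.\<close>

lemma path_replacement:
 fixes w0 :: "real => real" and z0 :: "real => real^'n::finite"
 assumes T: "0 < T" and w: "w0 \<in> Linfty_on {0..T}" and z: "continuous_on {0..T} z0"
 shows "\<exists>B R w w1 z. path_setting T B R w z \<and> w1 \<in> borel_measurable borel \<and> (\<forall>r\<in>{0..T}. w0 r = w1 r) \<and>
   (AE r in lborel. r \<in> {0..T} --> w1 r = w r) \<and> (\<forall>r\<in>{0..T}. z0 r = z r) \<and> continuous_on UNIV z"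
proof -
 let ?L = "restrict_space lborel {0..T}"
 define w1 where "w1 r = indicator {0..T} r *\<^sub>R w0 r" for r
 have wm: "w0 \<in> borel_measurable ?L" and wn: "esssup ?L (%x. ennreal (norm (w0 x))) < \<infinity>"
  using w by (auto simp: Linfty_on_def Lp_norm_def)
 have w1m [measurable]: "w1 \<in> borel_measurable borel"
  using wm borel_measurable_restrict_space_iff[of "{0..T}" lborel w0] by (simp add: w1_def[abs_def])
 obtain B where B: "0 <= B" "esssup ?L (%x. ennreal (norm (w0 x))) = ennreal B"
  using wn by (cases "esssup ?L (%x. ennreal (norm (w0 x)))") auto
 have "AE r in ?L. ennreal (norm (w0 r)) <= ennreal B" using esssup_AE[of "%x. ennreal (norm (w0 x))" ?L] unfolding B(2) .
 then have ae: "AE r in lborel. r \<in> {0..T} --> ennreal (norm (w0 r)) <= ennreal B" by (subst (asm) AE_restrict_space_iff) auto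
 define w2 where "w2 r = max (- B) (min B (w1 r))" for r
 have ae2: "AE r in lborel. r \<in> {0..T} --> w1 r = w2 r"
  using ae by (rule AE_mp) (intro AE_I2, use B(1) in \<open>auto simp: w2_def w1_def\<close>)
 define z1 where "z1 r = z0 (max 0 (min T r))" for r
 have cz: "continuous_on UNIV z1"
  unfolding z1_def by (rule continuous_on_compose2[OF z]) (use T in \<open>auto intro!: continuous_intros\<close>)
 have "bounded (z0 ` {0..T})" by (rule compact_imp_bounded[OF compact_continuous_image[OF z compact_Icc]])
 then obtain R where R: "\<forall>x\<in>z0 ` {0..T}. norm x <= R" unfolding bounded_iff by blast
 have "path_setting T B R w2 z1"
 proof
  show "w2 \<in> borel_measurable borel" unfolding w2_def by measurable
  show "\<bar>w2 r\<bar> <= B" for r using B(1) by (auto simp: w2_def)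
  show "z1 \<in> borel_measurable borel" by (rule borel_measurable_continuous_onI[OF cz])
  show "norm (z1 r) <= R" for r unfolding z1_def using R T by auto
 qed (rule T)
 moreover have "\<forall>r\<in>{0..T}. w0 r = w1 r" "\<forall>r\<in>{0..T}. z0 r = z1 r" by (auto simp: w1_def z1_def min_def max_def)
 ultimately show ?thesis using w1m ae2 cz by blast
qed

text \<open>The four suprema involve values, their differences and one sum, so a relation
  \<open>P\<close> respecting \<open>+\<close> and \<open>-\<close> carries the bound from values to
  all of them. A relation is used because the averaged distribution and the measure are linked
  through a common density \<open>V\<close>.\<close>

lemma holder2_norm_le:
 fixes u :: "real => real => 'a::{plus, minus}" and v :: "real => real => 'b::{plus, minus}"
 assumes P: "\<And>t1 t2. t1 \<in> {0..T} ==> t2 \<in> {0..T} ==> P (u t1 t2) (v t1 t2)"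
  and diff: "\<And>x y x' y'. P x y ==> P x' y' ==> P (x - x') (y - y')"
  and add: "\<And>x y x' y'. P x y ==> P x' y' ==> P (x + x') (y + y')"
  and le: "\<And>x y. P x y ==> N x <= K * N' y"
 shows "holder2_norm T \<gamma> N u <= K * holder2_norm T \<gamma> N' v"
proof -
 have d: "N x / c <= K * (N' y / c)" if "P x y" for x y c
  using divide_right_mono_ennreal[OF le[OF that], of c] by (simp add: ennreal_times_divide)
 show ?thesis
  unfolding holder2_norm_def distrib_left
 proof (intro add_mono SUP_least)
  fix p assume "p \<in> {0..T} \<times> {0..T}"
  then have p: "fst p \<in> {0..T}" "snd p \<in> {0..T}" by auto
  have "N (u (fst p) (snd p)) <= K * N' (v (fst p) (snd p))" by (rule le[OF P[OF p]])
  also have "\<dots> <= K * (SUP (t1, t2)\<in>{0..T} \<times> {0..T}. N' (v t1 t2))"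
   by (intro mult_left_mono SUP_upper2[of p]) (use p in \<open>auto simp: case_prod_beta mem_Times_iff\<close>)
  finally show "(case p of (t1, t2) => N (u t1 t2)) <= K * (SUP (t1, t2)\<in>{0..T} \<times> {0..T}. N' (v t1 t2))"
   by (simp add: case_prod_beta)
 next
  fix p assume p: "p \<in> {(s1, t1, s2). {s1, t1, s2} \<subseteq> {0..T} \<and> s1 \<noteq> t1}"
  obtain s1 t1 s2 where e: "p = (s1, t1, s2)" by (cases p) auto
  have "N (u t1 s2 - u s1 s2) / ennreal (\<bar>t1 - s1\<bar> powr \<gamma>) <= K * (N' (v t1 s2 - v s1 s2) / ennreal (\<bar>t1 - s1\<bar> powr \<gamma>))"
   using p unfolding e by (intro d diff P) auto
  also have "\<dots> <= K * (SUP (s1, t1, s2)\<in>{(s1, t1, s2). {s1, t1, s2} \<subseteq> {0..T} \<and> s1 \<noteq> t1}. N' (v t1 s2 - v s1 s2) / ennreal (\<bar>t1 - s1\<bar> powr \<gamma>))"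
   by (intro mult_left_mono SUP_upper2[OF p]) (auto simp: e)
  finally show "(case p of (s1, t1, s2) => N (u t1 s2 - u s1 s2) / ennreal (\<bar>t1 - s1\<bar> powr \<gamma>))
   <= K * (SUP (s1, t1, s2)\<in>{(s1, t1, s2). {s1, t1, s2} \<subseteq> {0..T} \<and> s1 \<noteq> t1}. N' (v t1 s2 - v s1 s2) / ennreal (\<bar>t1 - s1\<bar> powr \<gamma>))"
   unfolding e by simp
 next
  fix p assume p: "p \<in> {(s1, s2, t2). {s1, s2, t2} \<subseteq> {0..T} \<and> s2 \<noteq> t2}"
  obtain s1 s2 t2 where e: "p = (s1, s2, t2)" by (cases p) auto
  have "N (u s1 t2 - u s1 s2) / ennreal (\<bar>t2 - s2\<bar> powr \<gamma>) <= K * (N' (v s1 t2 - v s1 s2) / ennreal (\<bar>t2 - s2\<bar> powr \<gamma>))"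
   using p unfolding e by (intro d diff P) auto
  also have "\<dots> <= K * (SUP (s1, s2, t2)\<in>{(s1, s2, t2). {s1, s2, t2} \<subseteq> {0..T} \<and> s2 \<noteq> t2}. N' (v s1 t2 - v s1 s2) / ennreal (\<bar>t2 - s2\<bar> powr \<gamma>))"
   by (intro mult_left_mono SUP_upper2[OF p]) (auto simp: e)
  finally show "(case p of (s1, s2, t2) => N (u s1 t2 - u s1 s2) / ennreal (\<bar>t2 - s2\<bar> powr \<gamma>))
   <= K * (SUP (s1, s2, t2)\<in>{(s1, s2, t2). {s1, s2, t2} \<subseteq> {0..T} \<and> s2 \<noteq> t2}. N' (v s1 t2 - v s1 s2) / ennreal (\<bar>t2 - s2\<bar> powr \<gamma>))"
   unfolding e by simp
 next
  fix p assume p: "p \<in> {(s1, s2, t1, t2). {s1, s2, t1, t2} \<subseteq> {0..T} \<and> s1 \<noteq> t1 \<and> s2 \<noteq> t2}"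
  obtain s1 s2 t1 t2 where e: "p = (s1, s2, t1, t2)" by (cases p) auto
  let ?c = "%s1 s2 t1 t2. ennreal (\<bar>t1 - s1\<bar> powr \<gamma> * \<bar>t2 - s2\<bar> powr \<gamma>)"
  have "N (box (s1, s2) (t1, t2) u) / ?c s1 s2 t1 t2 <= K * (N' (box (s1, s2) (t1, t2) v) / ?c s1 s2 t1 t2)"
   using p unfolding e box_def by (intro d diff add P) auto
  also have "\<dots> <= K * (SUP (s1, s2, t1, t2)\<in>{(s1, s2, t1, t2). {s1, s2, t1, t2} \<subseteq> {0..T} \<and> s1 \<noteq> t1 \<and> s2 \<noteq> t2}.
    N' (box (s1, s2) (t1, t2) v) / ?c s1 s2 t1 t2)"
   by (intro mult_left_mono SUP_upper2[OF p]) (auto simp: e)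
  finally show "(case p of (s1, s2, t1, t2) => N (box (s1, s2) (t1, t2) u) / ?c s1 s2 t1 t2)
   <= K * (SUP (s1, s2, t1, t2)\<in>{(s1, s2, t1, t2). {s1, s2, t1, t2} \<subseteq> {0..T} \<and> s1 \<noteq> t1 \<and> s2 \<noteq> t2}.
    N' (box (s1, s2) (t1, t2) v) / ?c s1 s2 t1 t2)"
   unfolding e by simp
 qed
qed

lemma holder2_norm_value:
 assumes "t1 \<in> {0..T}" "t2 \<in> {0..T}" shows "N (f t1 t2) <= holder2_norm T \<gamma> N f"
proof -
 have "N (f t1 t2) <= (SUP (t1, t2)\<in>{0..T} \<times> {0..T}. N (f t1 t2))"
  by (rule SUP_upper2[of "(t1, t2)"]) (use assms in auto)
 also have "\<dots> <= holder2_norm T \<gamma> N f" unfolding holder2_norm_def add.assoc by (rule add_increasing2) auto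
 finally show ?thesis .
qed

lemma holder2_norm_box:
 assumes "s1 \<in> {0..T}" "t1 \<in> {0..T}" "s2 \<in> {0..T}" "t2 \<in> {0..T}" "s1 < t1" "s2 < t2"
 shows "N (box (s1, s2) (t1, t2) f) <= holder2_norm T \<gamma> N f * ennreal ((t1 - s1) powr \<gamma> * (t2 - s2) powr \<gamma>)"
proof -
 define c where "c = ennreal ((t1 - s1) powr \<gamma> * (t2 - s2) powr \<gamma>)"
 have c: "c \<noteq> 0" "c < top" using assms by (auto simp: c_def ennreal_eq_0_iff not_le)
 have "N (box (s1, s2) (t1, t2) f) / c <= (SUP (s1, s2, t1, t2)\<in>{(s1, s2, t1, t2). {s1, s2, t1, t2} \<subseteq> {0..T} \<and> s1 \<noteq> t1 \<and> s2 \<noteq> t2}.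
    N (box (s1, s2) (t1, t2) f) / ennreal (\<bar>t1 - s1\<bar> powr \<gamma> * \<bar>t2 - s2\<bar> powr \<gamma>))"
  by (rule SUP_upper2[of "(s1, s2, t1, t2)"]) (use assms in \<open>auto simp: c_def\<close>)
 also have "\<dots> <= holder2_norm T \<gamma> N f" unfolding holder2_norm_def by (rule add_increasing) auto
 finally have "N (box (s1, s2) (t1, t2) f) / c * c <= holder2_norm T \<gamma> N f * c" by (intro mult_right_mono) auto
 moreover have "N (box (s1, s2) (t1, t2) f) / c * c = N (box (s1, s2) (t1, t2) f)"
  using c by (simp add: ennreal_divide_times)
 ultimately show ?thesis by (simp add: c_def)
qed

text \<open>The weighted sum passes under the frequency integral, where it meets exactly the
  hypothesis on the characters. The prefactor of the inverse transform is at most 1 and is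
  dropped.\<close>

lemma wsum_hfun:
 fixes a :: "real^'n::finite => complex"
 assumes a: "integrable lborel a" and i: "integrable lborel (%\<xi>. jb \<xi> powr s * cmod (a \<xi>))"
  and l: "\<forall>\<xi>. cmod (wsum l (%x. cis (x \<bullet> \<xi>))) <= K * jb \<xi> powr s"
 shows "cmod (wsum l (hfun a)) <= K * (LINT \<xi>|lborel. jb \<xi> powr s * cmod (a \<xi>))"
proof -
 define c where "c = (2 * pi) ^ CARD('n)"
 have c: "1 <= c" unfolding c_def by (rule two_pi_ge_1)
 note ic = integrable_cis_mult'[OF a]
 have s: "wsum l (%x. cis (x \<bullet> \<xi>)) * a \<xi> = wsum l (%x. cis (x \<bullet> \<xi>) * a \<xi>)" for \<xi> and l :: "(real \<times> (real^'n)) list"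
  by (induction l) (auto simp: wsum_def algebra_simps)
 have I: "integrable lborel (%\<xi>. wsum l (%x. cis (x \<bullet> \<xi>) * a \<xi>)) \<and>
   wsum l (hfun a) = (1 / of_real c) * (LINT \<xi>|lborel. wsum l (%x. cis (x \<bullet> \<xi>) * a \<xi>))" for l
 proof (induction l)
  case (Cons p l)
  obtain d x where p: "p = (d, x)" by (cases p)
  have w: "wsum (p # l) F = d *\<^sub>R F x + wsum l F" for F :: "real^'n => complex" by (simp add: wsum_def p)
  have i1: "integrable lborel (%\<xi>. d *\<^sub>R (cis (x \<bullet> \<xi>) * a \<xi>))" using ic[of x] by (rule integrable_scaleR_right)
  have "d *\<^sub>R hfun a x = (1 / of_real c) * (LINT \<xi>|lborel. d *\<^sub>R (cis (x \<bullet> \<xi>) * a \<xi>))"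
   unfolding hfun_def c_def by simp
  then have "wsum (p # l) (hfun a) = (1 / of_real c) * (LINT \<xi>|lborel. d *\<^sub>R (cis (x \<bullet> \<xi>) * a \<xi>) + wsum l (%x. cis (x \<bullet> \<xi>) * a \<xi>))"
   unfolding w conjunct2[OF Cons.IH] LINT_add[OF i1 conjunct1[OF Cons.IH]] distrib_left by simp
  then show ?case unfolding w using int_add[OF i1 conjunct1[OF Cons.IH]] by simp
 qed (simp add: wsum_def)
 have "cmod (wsum l (hfun a)) = (1 / c) * cmod (LINT \<xi>|lborel. wsum l (%x. cis (x \<bullet> \<xi>)) * a \<xi>)"
  unfolding conjunct2[OF I] s using c by (simp add: norm_mult norm_divide)
 also have "\<dots> <= 1 * cmod (LINT \<xi>|lborel. wsum l (%x. cis (x \<bullet> \<xi>)) * a \<xi>)" using c by (intro mult_right_mono) auto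
 also have "\<dots> <= (LINT \<xi>|lborel. cmod (wsum l (%x. cis (x \<bullet> \<xi>)) * a \<xi>))" using integral_norm_bound by simp
 also have "\<dots> <= (LINT \<xi>|lborel. K * (jb \<xi> powr s * cmod (a \<xi>)))"
 proof (rule integral_mono)
  show "integrable lborel (%\<xi>. cmod (wsum l (%x. cis (x \<bullet> \<xi>)) * a \<xi>))"
   unfolding s by (rule integrable_norm[OF conjunct1[OF I]])
  show "integrable lborel (%\<xi>. K * (jb \<xi> powr s * cmod (a \<xi>)))" using i by (rule integrable_mult_right)
  fix \<xi>
  show "cmod (wsum l (%x. cis (x \<bullet> \<xi>)) * a \<xi>) <= K * (jb \<xi> powr s * cmod (a \<xi>))"
   using mult_right_mono[OF l[rule_format, of \<xi>] norm_ge_zero[of "a \<xi>"]] by (simp add: norm_mult mult.assoc)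
 qed
 also have "\<dots> = K * (LINT \<xi>|lborel. jb \<xi> powr s * cmod (a \<xi>))" by (rule integral_mult_right_zero)
 finally show ?thesis .
qed

lemma hfun_add: "integrable lborel a ==> integrable lborel b ==> hfun (%\<xi>. a \<xi> + b \<xi>) x = hfun a x + hfun b x"
 unfolding hfun_def distrib_left[symmetric]
 by (subst LINT_add[symmetric]) (auto intro: integrable_cis_mult' simp: distrib_left)

lemma hfun_diff: "integrable lborel a ==> integrable lborel b ==> hfun (%\<xi>. a \<xi> - b \<xi>) x = hfun a x - hfun b x"
 unfolding hfun_def right_diff_distrib[symmetric]
 by (subst LINT_diff[symmetric]) (auto intro: integrable_cis_mult' simp: right_diff_distrib)

section \<open>Regularity of the averaged field\<close>

text \<open>\<open>w0\<close> and \<open>z0\<close> are the data of the theorem, \<open>w\<close>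
  and \<open>z\<close> their bounded Borel versions, and \<open>w1\<close> is the link between the
  two weights.\<close>

locale averaging = path_setting T B R w z
 for T B R :: real and w :: "real => real" and z :: "real => real^'n::finite" +
 fixes w0 w1 :: "real => real" and z0 :: "real => real^'n" and q q' :: ennreal and \<gamma> \<delta> \<kappa> H :: real
 assumes w1_meas [measurable]: "w1 \<in> borel_measurable borel" and w01: "\<And>r. r \<in> {0..T} ==> w0 r = w1 r"
  and w1w: "AE r in lborel. r \<in> {0..T} --> w1 r = w r"
  and z0z: "\<And>r. r \<in> {0..T} ==> z0 r = z r" and z_cont: "continuous_on UNIV z"
  and q: "1 <= q" "1 <= q'" "1 / q + 1 / q' = 1"
  and \<gamma>: "1/2 < \<gamma>" "\<gamma> < 1" and \<delta>\<kappa>: "1 + 1 / \<gamma> < \<delta> + \<kappa>"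
  and H0: "0 <= H" and H: "holder2_norm T \<gamma> (FL_norm q \<kappa>) (%t1 t2. signed_integral (two_param_measure w0 z0 t1 t2)) = ennreal H"
begin

lemma bracket_meas [measurable]: "(jb :: real^'n => real) \<in> borel_measurable borel"
 unfolding japanese_bracket_def[abs_def] by measurable

lemma two_param_eq:
 assumes t: "t1 \<in> {0..T}" "t2 \<in> {0..T}" and C: "C \<in> sets borel"
 shows "two_param_measure w0 z0 t1 t2 C = (LINT p|M. wt t1 t2 p * indicator C (zd p))"
proof -
 have "(LINT r2:{0..t2}|lborel. (LINT r1:{0..t1}|lborel. (w0 r1 * w0 r2) *\<^sub>R (indicator C (z0 r2 - z0 r1) :: real)))
   = (LINT p|M. wt t1 t2 p *\<^sub>R indicator C (z (fst p) - z (snd p)))"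
 proof -
  have m: "(%(r2, r1). (indicator C (z r2 - z r1) :: real)) \<in> borel_measurable (borel \<Otimes>\<^sub>M borel)" using C by measurable
  have n: "norm (indicator C (z r2 - z r1) :: real) <= 1" for r2 r1 by (simp add: indicator_def)
  have t': "t1 <= T" "t2 <= T" using t by auto
  show ?thesis by (rule nested_transfer[OF m n t' w1_meas w01 w1w]) (simp_all add: z0z)
 qed
 then show ?thesis unfolding two_param_measure_def zd_def by simp
qed

lemma measd_two_param:
 assumes t: "t1 \<in> {0..T}" "t2 \<in> {0..T}"
 shows "measd (wt t1 t2) (signed_integral (two_param_measure w0 z0 t1 t2))"
 unfolding measd_def
proof (intro conjI ballI impI bm_wt)
 fix f :: "real^'n => complex" assume f: "f \<in> borel_measurable borel" and "\<exists>K. \<forall>x. cmod (f x) <= K"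
 then obtain K where K: "\<And>x. cmod (f x) <= K" by blast
 show "signed_integral (two_param_measure w0 z0 t1 t2) f = (LINT p|M. of_real (wt t1 t2 p) * f (zd p))"
  by (rule signed_integral_pushforward[OF finite_time_square zd_meas bm_integrable[OF bm_wt] two_param_eq[OF t] f K])
qed

lemma averaged_eq:
 assumes t: "t1 \<in> {0..T}" "t2 \<in> {0..T}" and \<phi>: "\<phi> \<in> schwartz"
 shows "averaged_distr b w0 z0 i t1 t2 \<phi> = b i (%x. LINT p|M. of_real (wt t1 t2 p) * \<phi> (x - zd p))"
proof -
 have [measurable]: "\<phi> \<in> borel_measurable borel" by (rule schwartz_measurable[OF \<phi>])
 obtain K where K: "\<And>x. cmod (\<phi> x) <= K" using schwartz_bounded[OF \<phi>] by blast
 have "signed_integral (reflect (two_param_measure w0 z0 t1 t2)) (%y. \<phi> (x + y)) = (LINT p|M. of_real (wt t1 t2 p) * \<phi> (x + - zd p))" for x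
 proof (rule signed_integral_pushforward[OF finite_time_square _ bm_integrable[OF bm_wt], where B = K])
  show "(%p. - zd p) \<in> borel_measurable M" by measurable
  fix C :: "(real^'n) set" assume C: "C \<in> sets borel"
  have e: "uminus ` C = uminus -` C" by (force simp: image_iff)
  have "uminus -` C \<inter> space borel \<in> sets borel" using C by (rule measurable_sets[rotated]) measurable
  then have "uminus ` C \<in> sets borel" unfolding e by simp
  then show "reflect (two_param_measure w0 z0 t1 t2) C = (LINT p|M. wt t1 t2 p * indicator C (- zd p))"
   unfolding reflect_def using two_param_eq[OF t] by (simp add: e indicator_def)
 qed (use K in auto)
 then show ?thesis unfolding averaged_distr_def conv_distr_def by simp
qed

lemma pairD_averaged:
 assumes t: "t1 \<in> {0..T}" "t2 \<in> {0..T}" and g: "represents g (fourier_distr (b i))"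
 shows "pairD g (wt t1 t2) (averaged_distr b w0 z0 i t1 t2)"
 by (rule pairD_convolution[OF g bm_wt]) (rule averaged_eq[OF t])

lemma pairD_spec:
 assumes g [measurable]: "g \<in> borel_measurable borel" and gN: "Lp_norm q' lborel (%\<xi>. jb \<xi> powr \<delta> *\<^sub>R g \<xi>) <= N" "N < \<infinity>"
  and v: "measd V v" "FL_norm q \<kappa> v < \<infinity>"
 shows "integrable lborel (%\<xi>. g \<xi> * mc V \<xi>)" and "pairD g V u ==> spec (%\<xi>. g \<xi> * mc V \<xi>) u"
proof -
 have [measurable]: "mc V \<in> borel_measurable borel" using v(1) mc_meas by (simp add: measd_def)
 have "0 <= \<delta> + \<kappa>" using \<delta>\<kappa> \<gamma> by (smt (verit) divide_pos_pos)
 from weight_estimate(1)[OF v q g gN this] show i: "integrable lborel (%\<xi>. g \<xi> * mc V \<xi>)"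
  by (rule int_bound) (auto simp: norm_mult japanese_bracket_def add_nonneg_eq_0_iff)
 show "spec (%\<xi>. g \<xi> * mc V \<xi>) u" if "pairD g V u"
  using i that unfolding spec_def pairD_def by (simp add: mult.assoc)
qed

text \<open>Two powers of the bracket are available because \<open>\<gamma> < 1\<close> gives
  \<open>1 + 1 / \<gamma> > 2\<close>. The summand 1 in the factor keeps the estimate true when
  \<open>v\<close> has infinite norm and \<open>N = 0\<close>, where
  \<open>0 * \<infinity> = 0\<close>.\<close>

lemma zygmund_le:
 assumes g [measurable]: "g \<in> borel_measurable borel" and gN: "Lp_norm q' lborel (%\<xi>. jb \<xi> powr \<delta> *\<^sub>R g \<xi>) <= N" "N < \<infinity>"
  and v: "measd V v" and u: "pairD g V u"
 shows "zygmund_norm 2 u <= (2 * N + 1) * FL_norm q \<kappa> v"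
proof (cases "FL_norm q \<kappa> v < \<infinity>")
 case True
 have "1 < 1 / \<gamma>" using \<gamma> by simp
 then have "2 <= \<delta> + \<kappa>" using \<delta>\<kappa> by linarith
 note e = weight_estimate[OF v True q g gN this]
 have p: "jb \<xi> powr 2 = (jb \<xi>)\<^sup>2" for \<xi> :: "real^'n"
  using bracket_ge_1[of \<xi>] by simp
 let ?I = "LINT \<xi>|lborel. (jb \<xi>)\<^sup>2 * cmod (g \<xi> * mc V \<xi>)"
 have "zygmund_norm 2 u <= ennreal (2 * ?I)"
  by (rule spec_zygmund[OF pairD_spec(2)[OF g gN v True u] e(1)[unfolded p]])
 also have "\<dots> = 2 * ennreal ?I" by (simp add: ennreal_mult')
 also have "\<dots> <= 2 * (N * FL_norm q \<kappa> v)" using e(2)[unfolded p] by (intro mult_left_mono) auto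
 also have "\<dots> = 2 * N * FL_norm q \<kappa> v" by (simp add: mult.assoc)
 also have "\<dots> <= (2 * N + 1) * FL_norm q \<kappa> v" by (intro mult_right_mono) auto
 finally show ?thesis .
next
 case False
 then have "FL_norm q \<kappa> v = \<infinity>" using top.not_eq_extremum[of "FL_norm q \<kappa> v"] by auto
 then show ?thesis by (simp add: ennreal_mult_top)
qed

lemma zygmund_holder:
 assumes g: "represents g (fourier_distr (b i))" and N: "Lp_norm q' lborel (%\<xi>. jb \<xi> powr \<delta> *\<^sub>R g \<xi>) < \<infinity>"
 shows "holder2_norm T \<gamma> (zygmund_norm (1 + 1)) (averaged_distr b w0 z0 i) < \<infinity>"
proof -
 define N where "N = Lp_norm q' lborel (%\<xi>. jb \<xi> powr \<delta> *\<^sub>R g \<xi>)"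
 have gm: "g \<in> borel_measurable borel" using g by (simp add: represents_def)
 have "holder2_norm T \<gamma> (zygmund_norm 2) (averaged_distr b w0 z0 i)
   <= (2 * N + 1) * holder2_norm T \<gamma> (FL_norm q \<kappa>) (%t1 t2. signed_integral (two_param_measure w0 z0 t1 t2))"
 proof (rule holder2_norm_le[where P = "%u v. \<exists>V. pairD g V u \<and> measd V v"])
  show "\<exists>V. pairD g V (averaged_distr b w0 z0 i t1 t2) \<and> measd V (signed_integral (two_param_measure w0 z0 t1 t2))"
   if "t1 \<in> {0..T}" "t2 \<in> {0..T}" for t1 t2
   using pairD_averaged[where b = b and i = i, OF that g] measd_two_param[OF that] by blast
  show "\<exists>V. pairD g V (x - x') \<and> measd V (y - y')" if "\<exists>V. pairD g V x \<and> measd V y" "\<exists>V. pairD g V x' \<and> measd V y'" for x y x' y'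
   using that pairD_diff measd_diff by blast
  show "\<exists>V. pairD g V (x + x') \<and> measd V (y + y')" if "\<exists>V. pairD g V x \<and> measd V y" "\<exists>V. pairD g V x' \<and> measd V y'" for x y x' y'
   using that pairD_add measd_add by blast
  show "zygmund_norm 2 x <= (2 * N + 1) * FL_norm q \<kappa> y" if "\<exists>V. pairD g V x \<and> measd V y" for x y
   using that zygmund_le[OF gm _ N] unfolding N_def by blast
 qed
 also have "\<dots> < \<infinity>" unfolding H using N by (simp add: N_def ennreal_mult_less_top)
 finally show ?thesis by simp
qed

text \<open>Stated for arbitrary transforms \<open>g\<close>, so that it applies to the field of one
  drift and to the difference of two. The rectangular increment of the field has the transform
  \<open>g * mc V\<close>, with \<open>V\<close> the increment of the weights.\<close>

lemma regular_field_hfun: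
 fixes A :: "real => real => real^'n => real^'n" and g :: "'n => real^'n => complex"
 assumes g: "\<And>i. g i \<in> borel_measurable borel"
  and N: "(\<Sum>i\<in>UNIV. Lp_norm q' lborel (%\<xi>. jb \<xi> powr \<delta> *\<^sub>R g i \<xi>)) <= ennreal N" "0 <= N"
  and A: "\<And>t1 t2 x i. t1 \<in> {0..T} ==> t2 \<in> {0..T} ==> A t1 t2 x $ i = Re (hfun (%\<xi>. g i \<xi> * mc (wt t1 t2) \<xi>) x)"
 shows "regular_field T \<gamma> (N * H) A"
 unfolding regular_field_def
proof (intro allI impI)
 fix s1 t1 s2 t2 K and l :: "(real \<times> (real^'n)) list"
 assume st: "0 <= s1" "s1 <= t1" "t1 <= T" "0 <= s2" "s2 <= t2" "t2 <= T"
  and l: "\<forall>\<xi>. cmod (wsum l (%x. cis (x \<bullet> \<xi>))) <= K * jb \<xi> powr (1 + 1 / \<gamma>)"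
 show "norm (wsum l (%x. box (s1, s2) (t1, t2) (%r1 r2. A r1 r2 x))) <= N * H * (t1 - s1) powr \<gamma> * (t2 - s2) powr \<gamma> * K"
 proof (cases "s1 < t1 \<and> s2 < t2")
  \<comment> \<open>\<open>holder2_norm\<close> controls only rectangles with two positive sides; on
    the others both sides of the estimate are 0.\<close>
  case False
  then have e: "s1 = t1 \<or> s2 = t2" using st by auto
  then have "box (s1, s2) (t1, t2) (%r1 r2. A r1 r2 x) = 0" for x by (auto simp: box_def)
  moreover have "wsum l (%x. 0) = (0 :: real^'n)" by (induction l) (auto simp: wsum_def)
  ultimately show ?thesis using e by auto
 next
  case True
  define N' where "N' i = Lp_norm q' lborel (%\<xi>. jb \<xi> powr \<delta> *\<^sub>R g i \<xi>)" for i
  have N'le: "N' i <= ennreal N" for i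
   using order_trans[OF member_le_sum[of i UNIV N'] N(1)[folded N'_def]] by simp
  have N'fin: "N' i < \<infinity>" for i using le_less_trans[OF N'le ennreal_less_top] by simp
  have st': "s1 \<in> {0..T}" "t1 \<in> {0..T}" "s2 \<in> {0..T}" "t2 \<in> {0..T}" using st by auto
  define V where "V p = wt t1 t2 p - wt t1 s2 p - wt s1 t2 p + wt s1 s2 p" for p
  define v :: "'n distribution" where "v = box (s1, s2) (t1, t2) (%t1 t2. signed_integral (two_param_measure w0 z0 t1 t2))"
  have mv: "measd V v" unfolding V_def v_def box_def fst_conv snd_conv
   by (intro measd_diff measd_add measd_two_param st')
  define h where "h = (t1 - s1) powr \<gamma> * (t2 - s2) powr \<gamma>"
  have FLv: "FL_norm q \<kappa> v <= ennreal (H * h)"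
   using holder2_norm_box[OF st', of "FL_norm q \<kappa>" "%t1 t2. signed_integral (two_param_measure w0 z0 t1 t2)" \<gamma>] True H0
   unfolding H v_def h_def by (simp add: ennreal_mult)
  have FLfin: "FL_norm q \<kappa> v < \<infinity>" using le_less_trans[OF FLv ennreal_less_top] by simp
  have fin: "FL_norm q \<kappa> (signed_integral (two_param_measure w0 z0 a c)) < \<infinity>" if "a \<in> {0..T}" "c \<in> {0..T}" for a c
   using holder2_norm_value[OF that, of "FL_norm q \<kappa>" "%t1 t2. signed_integral (two_param_measure w0 z0 t1 t2)" \<gamma>] H
   by (metis ennreal_less_top infinity_ennreal_def le_less_trans)
  have bx: "box (s1, s2) (t1, t2) (%r1 r2. A r1 r2 x) $ i = Re (hfun (%\<xi>. g i \<xi> * mc V \<xi>) x)" for x i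
  proof -
   note int = pairD_spec(1)[OF g _ N'fin measd_two_param fin, unfolded N'_def, OF order_refl]
   have I: "integrable lborel (%\<xi>. g i \<xi> * mc (wt a c) \<xi>)" if "a \<in> {0..T}" "c \<in> {0..T}" for a c
    using int[OF that that] .
   have "(%\<xi>. g i \<xi> * mc V \<xi>) = (%\<xi>. g i \<xi> * mc (wt t1 t2) \<xi> - g i \<xi> * mc (wt t1 s2) \<xi> - g i \<xi> * mc (wt s1 t2) \<xi> + g i \<xi> * mc (wt s1 s2) \<xi>)"
    unfolding V_def by (rule ext) (simp only: mc_add mc_diff bm_wt bm_diff bm_add distrib_left right_diff_distrib)
   then have "hfun (%\<xi>. g i \<xi> * mc V \<xi>) x = hfun (%\<xi>. g i \<xi> * mc (wt t1 t2) \<xi>) x - hfun (%\<xi>. g i \<xi> * mc (wt t1 s2) \<xi>) x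
     - hfun (%\<xi>. g i \<xi> * mc (wt s1 t2) \<xi>) x + hfun (%\<xi>. g i \<xi> * mc (wt s1 s2) \<xi>) x"
    using I st' by (simp only: hfun_add hfun_diff int_diff int_add)
   then show ?thesis unfolding box_def fst_conv snd_conv using A st' by simp
  qed
  have s: "1 + 1 / \<gamma> <= \<delta> + \<kappa>" using \<delta>\<kappa> by simp
  let ?I = "%i. LINT \<xi>|lborel. jb \<xi> powr (1 + 1 / \<gamma>) * cmod (g i \<xi> * mc V \<xi>)"
  have K: "0 <= K"
  proof -
   have "0 <= K * jb (0 :: real^'n) powr (1 + 1 / \<gamma>)" using order_trans[OF norm_ge_zero l[rule_format]] .
   then show ?thesis by (simp add: japanese_bracket_def)
  qed
  have c: "wsum l F $ i = wsum l (%x. F x $ i)" "Re (wsum l G) = wsum l (%x. Re (G x))"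
   for F :: "real^'n => real^'n" and G i by (induction l) (auto simp: wsum_def)
  have "\<bar>wsum l (%x. box (s1, s2) (t1, t2) (%r1 r2. A r1 r2 x)) $ i\<bar> <= K * ?I i" for i
  proof -
   have "wsum l (%x. box (s1, s2) (t1, t2) (%r1 r2. A r1 r2 x)) $ i = Re (wsum l (hfun (%\<xi>. g i \<xi> * mc V \<xi>)))"
    unfolding c bx ..
   also have "\<bar>\<dots>\<bar> <= cmod (wsum l (hfun (%\<xi>. g i \<xi> * mc V \<xi>)))" by (rule abs_Re_le_cmod)
   also have "\<dots> <= K * ?I i"
    by (rule wsum_hfun[OF pairD_spec(1)[OF g order_refl _ mv FLfin] weight_estimate(1)[OF mv FLfin q g order_refl _ s] l])
      (use N'fin N'_def in auto)
   finally show ?thesis .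
  qed
  then have "norm (wsum l (%x. box (s1, s2) (t1, t2) (%r1 r2. A r1 r2 x))) <= (\<Sum>i\<in>UNIV. K * ?I i)"
   by (intro order_trans[OF norm_le_l1_cart] sum_mono) auto
  also have "\<dots> = K * (\<Sum>i\<in>UNIV. ?I i)" by (rule sum_distrib_left[symmetric])
  also have "\<dots> <= K * (N * (H * h))"
  proof (rule mult_left_mono[OF _ K])
   have I0: "0 <= ?I i" for i by (rule integral_nonneg_AE) simp
   have "ennreal (\<Sum>i\<in>UNIV. ?I i) = (\<Sum>i\<in>UNIV. ennreal (?I i))" using I0 by (simp add: sum_ennreal)
   also have "\<dots> <= (\<Sum>i\<in>UNIV. N' i * FL_norm q \<kappa> v)"
    by (intro sum_mono weight_estimate(2)[OF mv FLfin q g _ N'fin s]) (simp add: N'_def)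
   also have "\<dots> = (\<Sum>i\<in>UNIV. N' i) * FL_norm q \<kappa> v" by (rule sum_distrib_right[symmetric])
   also have "\<dots> <= ennreal N * ennreal (H * h)" using N(1) FLv unfolding N'_def by (intro mult_mono) auto
   also have "\<dots> = ennreal (N * (H * h))" using N(2) by (simp add: ennreal_mult')
   finally show "(\<Sum>i\<in>UNIV. ?I i) <= N * (H * h)" using N(2) H0 by (subst (asm) ennreal_le_iff) (auto simp: h_def)
  qed
  finally show ?thesis by (simp add: h_def mult_ac)
 qed
qed

end

section \<open>Solutions driven by the averaged field\<close>

lemma represents_diff:
 assumes "represents g u" "represents h v" shows "represents (%x. g x - h x) (u - v)"
proof -
 have [measurable]: "g \<in> borel_measurable borel" "h \<in> borel_measurable borel" using assms by (auto simp: represents_def)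
 have "integrable lborel (%x. (g x - h x) * \<phi> x) \<and> (u - v) \<phi> = fun_distr (%x. g x - h x) \<phi>" if \<phi>: "\<phi> \<in> schwartz" for \<phi>
 proof -
  have i: "integrable lborel (%x. g x * \<phi> x)" "integrable lborel (%x. h x * \<phi> x)"
   and e: "u \<phi> = fun_distr g \<phi>" "v \<phi> = fun_distr h \<phi>"
   using assms \<phi> by (auto simp: represents_def)
  show ?thesis unfolding fun_distr_def left_diff_distrib
   using int_diff[OF i] LINT_diff[OF i] e by (simp add: fun_distr_def)
 qed
 then show ?thesis unfolding represents_def by auto
qed

lemma fourier_distr_diff: "fourier_distr (u - v) = fourier_distr u - fourier_distr v"
 by (rule ext) (simp add: fourier_distr_def)

lemma FL_norm_finite:
 assumes "FL_norm p s u < \<infinity>"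
 shows "represents (density_of (fourier_distr u)) (fourier_distr u)"
  and "Lp_norm p lborel (%\<xi>. jb \<xi> powr s *\<^sub>R density_of (fourier_distr u) \<xi>) = FL_norm p s u"
 using assms represents_density_of unfolding FL_norm_def by (auto split: if_splits)

lemma FL_vec_norm_finite:
 assumes "FL_vec_norm p s b < \<infinity>" shows "FL_norm p s (b i) < \<infinity>"
 using member_le_sum[of i UNIV "%i. FL_norm p s (b i)"] assms unfolding FL_vec_norm_def
 by (auto intro: le_less_trans)

lemma unique_onI: "P u ==> (\<And>v t. P v ==> t \<in> S ==> v t = u t) ==> unique_on S P u"
 by (simp add: unique_on_def)

context averaging
begin

abbreviation dens :: "('n => 'n distribution) => 'n => real^'n => complex" where
 "dens b i \<equiv> density_of (fourier_distr (b i))"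

abbreviation AF :: "('n => 'n distribution) => real => real => real^'n => real^'n" where
 "AF b \<equiv> averaged_field b w0 z0"

lemma dens_meas: "FL_vec_norm q' \<delta> b < \<infinity> ==> dens b i \<in> borel_measurable borel"
 using FL_norm_finite(1)[OF FL_vec_norm_finite] by (auto simp: represents_def)

lemma averaged_spec:
 assumes b: "FL_vec_norm q' \<delta> b < \<infinity>" and t: "t1 \<in> {0..T}" "t2 \<in> {0..T}"
 shows "spec (%\<xi>. dens b i \<xi> * mc (wt t1 t2) \<xi>) (averaged_distr b w0 z0 i t1 t2)"
proof -
 have F: "FL_norm q' \<delta> (b i) < \<infinity>" by (rule FL_vec_norm_finite[OF b])
 have "FL_norm q \<kappa> (signed_integral (two_param_measure w0 z0 t1 t2)) <= ennreal H"
  using holder2_norm_value[OF t, of "FL_norm q \<kappa>" "%t1 t2. signed_integral (two_param_measure w0 z0 t1 t2)" \<gamma>] unfolding H .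
 then have v: "FL_norm q \<kappa> (signed_integral (two_param_measure w0 z0 t1 t2)) < \<infinity>"
  using le_less_trans[OF _ ennreal_less_top] by simp
 show ?thesis
  by (rule pairD_spec(2)[OF dens_meas[OF b] _ F measd_two_param[OF t] v pairD_averaged[where b = b and i = i, OF t FL_norm_finite(1)[OF F]]])
    (simp add: FL_norm_finite(2)[OF F])
qed

lemma averaged_field_eq:
 assumes b: "FL_vec_norm q' \<delta> b < \<infinity>" and t: "t1 \<in> {0..T}" "t2 \<in> {0..T}"
 shows "AF b t1 t2 x $ i = Re (hfun (%\<xi>. dens b i \<xi> * mc (wt t1 t2) \<xi>) x)"
 unfolding averaged_field_def by (simp add: spec_continuous_version[OF averaged_spec[OF b t]])

lemma regular_averaged:
 assumes b: "FL_vec_norm q' \<delta> b < \<infinity>"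
 shows "regular_field T \<gamma> (enn2real (FL_vec_norm q' \<delta> b) * H) (AF b)"
proof (rule regular_field_hfun[where g = "dens b"])
 show "(\<Sum>i\<in>UNIV. Lp_norm q' lborel (%\<xi>. jb \<xi> powr \<delta> *\<^sub>R dens b i \<xi>)) <= ennreal (enn2real (FL_vec_norm q' \<delta> b))"
  using b by (simp add: FL_norm_finite(2)[OF FL_vec_norm_finite[OF b]] FL_vec_norm_def[symmetric])
qed (use dens_meas[OF b] averaged_field_eq[OF b] in auto)

text \<open>\<open>density_of\<close> is an arbitrary choice, so the density of the difference
  equals the difference of the densities only almost everywhere, which suffices for the
  norm.\<close>

lemma regular_averaged_diff:
 assumes b: "FL_vec_norm q' \<delta> b < \<infinity>" and b': "FL_vec_norm q' \<delta> b' < \<infinity>" and d: "FL_vec_norm q' \<delta> (b' - b) < \<infinity>"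
 shows "regular_field T \<gamma> (enn2real (FL_vec_norm q' \<delta> (b' - b)) * H) (%t1 t2 x. AF b' t1 t2 x - AF b t1 t2 x)"
proof (rule regular_field_hfun[where g = "%i \<xi>. dens b' i \<xi> - dens b i \<xi>"])
 show m [measurable]: "(%\<xi>. dens b' i \<xi> - dens b i \<xi>) \<in> borel_measurable borel" for i
  using dens_meas[OF b] dens_meas[OF b'] by measurable
 have e: "Lp_norm q' lborel (%\<xi>. jb \<xi> powr \<delta> *\<^sub>R (dens b' i \<xi> - dens b i \<xi>)) = FL_norm q' \<delta> ((b' - b) i)" for i
 proof -
  have F: "FL_norm q' \<delta> ((b' - b) i) < \<infinity>" by (rule FL_vec_norm_finite[OF d])
  have "represents (%\<xi>. dens b' i \<xi> - dens b i \<xi>) (fourier_distr (b' i) - fourier_distr (b i))"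
   by (rule represents_diff[OF FL_norm_finite(1)[OF FL_vec_norm_finite[OF b']] FL_norm_finite(1)[OF FL_vec_norm_finite[OF b]]])
  then have r: "represents (%\<xi>. dens b' i \<xi> - dens b i \<xi>) (fourier_distr ((b' - b) i))" by (simp add: fourier_distr_diff)
  have [measurable]: "dens (b' - b) i \<in> borel_measurable borel" by (rule dens_meas[OF d])
  have "Lp_norm q' lborel (%\<xi>. jb \<xi> powr \<delta> *\<^sub>R (dens b' i \<xi> - dens b i \<xi>))
    = Lp_norm q' lborel (%\<xi>. jb \<xi> powr \<delta> *\<^sub>R dens (b' - b) i \<xi>)"
  proof (rule Lp_norm_cong_AE)
   show "AE \<xi> in lborel. jb \<xi> powr \<delta> *\<^sub>R (dens b' i \<xi> - dens b i \<xi>) = jb \<xi> powr \<delta> *\<^sub>R dens (b' - b) i \<xi>"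
    using density_of_AE[OF r] by (rule AE_mp) auto
  qed measurable
  then show ?thesis using FL_norm_finite(2)[OF F] by simp
 qed
 show "(\<Sum>i\<in>UNIV. Lp_norm q' lborel (%\<xi>. jb \<xi> powr \<delta> *\<^sub>R (dens b' i \<xi> - dens b i \<xi>))) <= ennreal (enn2real (FL_vec_norm q' \<delta> (b' - b)))"
 proof -
  have "(\<Sum>i\<in>UNIV. FL_norm q' \<delta> ((b' - b) i)) = FL_vec_norm q' \<delta> (b' - b)" by (simp only: FL_vec_norm_def)
  then show ?thesis unfolding e using d by simp
 qed
 show "(AF b' t1 t2 x - AF b t1 t2 x) $ i = Re (hfun (%\<xi>. (dens b' i \<xi> - dens b i \<xi>) * mc (wt t1 t2) \<xi>) x)"
  if t: "t1 \<in> {0..T}" "t2 \<in> {0..T}" for t1 t2 x i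
 proof -
  have "integrable lborel (%\<xi>. dens b' i \<xi> * mc (wt t1 t2) \<xi>)" "integrable lborel (%\<xi>. dens b i \<xi> * mc (wt t1 t2) \<xi>)"
   using averaged_spec[OF b t] averaged_spec[OF b' t] by (auto simp: spec_def)
  from hfun_diff[OF this] show ?thesis
   by (simp add: averaged_field_eq[OF b t] averaged_field_eq[OF b' t] left_diff_distrib)
 qed
qed simp

text \<open>The Zygmund regularity holds with \<open>\<kappa>' = 1\<close>, which is admissible since \<open>\<gamma> > 1/2\<close>.\<close>
lemma young_solution_iff:
 assumes b: "FL_vec_norm q' \<delta> b < \<infinity>"
 shows "young_solution T \<gamma> w0 z0 b u0 u \<longleftrightarrow> (\<exists>\<theta>. young_path T \<gamma> (AF b) u0 \<theta> \<and> (\<forall>t\<in>{0..T}. u t = \<theta> t + z0 t))"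
proof -
 have "Lp_norm q' lborel (%\<xi>. jb \<xi> powr \<delta> *\<^sub>R dens b i \<xi>) < \<infinity>" for i
  unfolding FL_norm_finite(2)[OF FL_vec_norm_finite[OF b]] by (rule FL_vec_norm_finite[OF b])
 then have "holder2_norm T \<gamma> (zygmund_norm (1 + 1)) (averaged_distr b w0 z0 i) < \<infinity>" for i
  by (rule zygmund_holder[OF FL_norm_finite(1)[OF FL_vec_norm_finite[OF b]]])
 then have "\<exists>\<kappa>'. 0 < \<kappa>' \<and> \<kappa>' <= 1 \<and> \<gamma> * (1 + \<kappa>') > 1 \<and> (\<forall>i. holder2_norm T \<gamma> (zygmund_norm (1 + \<kappa>')) (averaged_distr b w0 z0 i) < \<infinity>)"
  using \<gamma> by (intro exI[of _ 1]) auto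
 then show ?thesis using \<gamma> unfolding young_solution_def young_path_def by auto
qed

lemma unique_young:
 assumes b: "FL_vec_norm q' \<delta> b < \<infinity>" and \<theta>: "young_path T \<gamma> (AF b) u0 \<theta>"
 shows "unique_on {0..T} (young_solution T \<gamma> w0 z0 b u0) (%t. \<theta> t + z0 t)"
proof (rule unique_onI)
 show "young_solution T \<gamma> w0 z0 b u0 (%t. \<theta> t + z0 t)" unfolding young_solution_iff[OF b] using \<theta> by auto
 fix v t assume "young_solution T \<gamma> w0 z0 b u0 v" and t: "t \<in> {0..T}"
 then obtain \<eta> where \<eta>: "young_path T \<gamma> (AF b) u0 \<eta>" "v t = \<eta> t + z0 t" unfolding young_solution_iff[OF b] by auto
 have "0 <= enn2real (FL_vec_norm q' \<delta> b) * H" using H0 by simp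
 from young_path_unique[OF regular_averaged[OF b] this \<gamma>(1) T \<eta>(1) \<theta> t] show "v t = \<theta> t + z0 t" using \<eta>(2) by simp
qed

text \<open>The stability constant depends on the bound of the field and on the scale of the paths,
  so both must be uniform in \<open>n\<close>. Convergence of the drifts yields this for large
  \<open>n\<close>; the finitely many remaining drifts are covered by adding their bounds.\<close>

lemma approximation:
 assumes b: "FL_vec_norm q' \<delta> b < \<infinity>" and bn: "\<And>n. FL_vec_norm q' \<delta> (bn n) < \<infinity>"
  and lim: "(%n. FL_vec_norm q' \<delta> (bn n - b)) \<longlonglongrightarrow> 0" and \<theta>: "young_path T \<gamma> (AF b) u0 \<theta>"
 shows "\<exists>\<theta>n. (\<forall>n :: nat. young_path T \<gamma> (AF (bn n)) (u0n n) (\<theta>n n)) \<and>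
   (\<exists>C>0. \<forall>n. holder_norm T \<gamma> (%t. \<theta>n n t - \<theta> t) <= ennreal C * (FL_vec_norm q' \<delta> (bn n - b) + ennreal (norm (u0n n - u0))))"
proof -
 define M0 where "M0 = enn2real (FL_vec_norm q' \<delta> b) * H"
 define Mn where "Mn n = enn2real (FL_vec_norm q' \<delta> (bn n)) * H" for n
 have "eventually (%n. FL_vec_norm q' \<delta> (bn n - b) < 1) sequentially" by (rule order_tendstoD(2)[OF lim]) simp
 then obtain k where k: "\<And>n. k <= n ==> FL_vec_norm q' \<delta> (bn n - b) < 1" unfolding eventually_sequentially by blast
 \<comment> \<open>For \<open>n >= k\<close> the drift differs from \<open>b\<close> by less than 1
   in norm, so its field has the bound \<open>M0 + H\<close>; the sum takes care of
   \<open>n < k\<close>.\<close>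
 define M1 where "M1 = M0 + H + (\<Sum>n<k. Mn n)"
 have pos: "0 <= M0" "\<And>n. 0 <= Mn n" using H0 by (auto simp: M0_def Mn_def)
 have M1: "0 <= M1" using pos H0 by (auto simp: M1_def intro!: add_nonneg_nonneg sum_nonneg)
 have mono: "regular_field T \<gamma> M' A" if "regular_field T \<gamma> M'' A" "M'' <= M'" for M' M'' and A :: "real => real => real^'n => real^'n"
  unfolding regular_field_def
 proof (intro allI impI)
  fix s1 t1 s2 t2 K and l :: "(real \<times> (real^'n)) list"
  assume st: "0 <= s1" "s1 <= t1" "t1 <= T" "0 <= s2" "s2 <= t2" "t2 <= T"
   and l: "\<forall>\<xi>. cmod (wsum l (%x. cis (x \<bullet> \<xi>))) <= K * jb \<xi> powr (1 + 1 / \<gamma>)"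
  have "0 <= K * jb (0 :: real^'n) powr (1 + 1 / \<gamma>)" using order_trans[OF norm_ge_zero l[rule_format]] .
  then have "0 <= K" by (simp add: japanese_bracket_def)
  then have "M'' * (t1 - s1) powr \<gamma> * (t2 - s2) powr \<gamma> * K <= M' * (t1 - s1) powr \<gamma> * (t2 - s2) powr \<gamma> * K"
   using that(2) by (intro mult_right_mono) auto
  moreover have "norm (wsum l (%x. box (s1, s2) (t1, t2) (%r1 r2. A r1 r2 x))) <= M'' * (t1 - s1) powr \<gamma> * (t2 - s2) powr \<gamma> * K"
   using that(1) st l unfolding regular_field_def by blast
  ultimately show "norm (wsum l (%x. box (s1, s2) (t1, t2) (%r1 r2. A r1 r2 x))) <= M' * (t1 - s1) powr \<gamma> * (t2 - s2) powr \<gamma> * K"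
   by simp
 qed
 have s0: "0 <= (\<Sum>n<k. Mn n)" using pos by (intro sum_nonneg) auto
 have reg: "regular_field T \<gamma> M1 (AF b)"
  by (rule mono[OF regular_averaged[OF b, folded M0_def]]) (use pos s0 H0 in \<open>auto simp: M1_def\<close>)
 have regn: "regular_field T \<gamma> M1 (AF (bn n))" for n
 proof (cases "n < k")
  case True
  then have "Mn n <= (\<Sum>n<k. Mn n)" using pos by (intro member_le_sum) auto
  then show ?thesis
   by (intro mono[OF regular_averaged[OF bn, folded Mn_def]]) (use pos H0 in \<open>auto simp: M1_def\<close>)
 next
  case False
  then have l: "FL_vec_norm q' \<delta> (bn n - b) < 1" using k by simp
  then have f: "FL_vec_norm q' \<delta> (bn n - b) < \<infinity>" using less_trans[OF l ennreal_one_less_top] by simp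
  have "enn2real (FL_vec_norm q' \<delta> (bn n - b)) <= 1" using enn2real_mono[OF less_imp_le[OF l] ennreal_one_less_top] by simp
  then have "enn2real (FL_vec_norm q' \<delta> (bn n - b)) * H <= 1 * H" using H0 by (intro mult_right_mono)
  then show ?thesis
   by (intro mono[OF regular_field_sum[OF regular_averaged[OF b, folded M0_def] regular_averaged_diff[OF b bn f]]])
     (use s0 in \<open>auto simp: M1_def\<close>)
 qed
 obtain \<tau>1 where \<tau>1: "small_scale T \<gamma> M1 \<tau>1" using small_scale_exists[OF \<gamma>(1) M1 T] by blast
 then have \<tau>1p: "0 < \<tau>1" by (simp add: small_scale_def)
 have "\<forall>n. \<exists>\<theta>. hol \<tau>1 \<gamma> T \<theta> \<and> young_path T \<gamma> (AF (bn n)) (u0n n) \<theta>"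
  using young_path_exists[OF regn M1 \<gamma>(1) T \<tau>1] by blast
 from choice[OF this] obtain \<theta>n where \<theta>n: "\<And>n. hol \<tau>1 \<gamma> T (\<theta>n n) \<and> young_path T \<gamma> (AF (bn n)) (u0n n) (\<theta>n n)" by blast
 \<comment> \<open>The given \<open>\<theta>\<close> need not be \<open>hol\<close> at the scale
   \<open>\<tau>1\<close>; the solution constructed at that scale is, and uniqueness identifies the
   two on \<open>[0, T]\<close>.\<close>
 obtain \<theta>' where \<theta>': "hol \<tau>1 \<gamma> T \<theta>'" "young_path T \<gamma> (AF b) u0 \<theta>'"
  using young_path_exists[OF reg M1 \<gamma>(1) T \<tau>1] by blast
 obtain C where C: "0 < C" and st: "\<And>(A :: real => real => real^'n => real^'n) B M' u0 v0 \<theta> \<eta>.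
   regular_field T \<gamma> M1 A ==> 0 <= M' ==> regular_field T \<gamma> M' (%t1 t2 x. B t1 t2 x - A t1 t2 x) ==>
   hol \<tau>1 \<gamma> T \<theta> ==> hol \<tau>1 \<gamma> T \<eta> ==> young_path T \<gamma> B v0 \<theta> ==> young_path T \<gamma> A u0 \<eta> ==>
   holder_norm T \<gamma> (%t. \<theta> t - \<eta> t) <= ennreal (C * (M' + norm (v0 - u0)))"
  using young_path_stability[OF \<gamma>(1) M1 \<tau>1p T, where ?'n = 'n] by blast
 define C' where "C' = C * (1 + H)"
 have C': "0 < C'" using C H0 by (simp add: C'_def)
 have "holder_norm T \<gamma> (%t. \<theta>n n t - \<theta> t) <= ennreal C' * (FL_vec_norm q' \<delta> (bn n - b) + ennreal (norm (u0n n - u0)))" for n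
 proof (cases "FL_vec_norm q' \<delta> (bn n - b) < \<infinity>")
  case False
  then have "FL_vec_norm q' \<delta> (bn n - b) = \<infinity>" using top.not_eq_extremum[of "FL_vec_norm q' \<delta> (bn n - b)"] by auto
  then show ?thesis using C' by (simp add: ennreal_mult_top)
 next
  case True
  define e where "e = enn2real (FL_vec_norm q' \<delta> (bn n - b))"
  have e: "0 <= e" "FL_vec_norm q' \<delta> (bn n - b) = ennreal e" using True by (auto simp: e_def)
  have eq: "\<theta>' t = \<theta> t" if "t \<in> {0..T}" for t
   using young_path_unique[OF reg M1 \<gamma>(1) T \<theta>'(2) \<theta> that] .
  have "holder_norm T \<gamma> (%t. \<theta>n n t - \<theta> t) = holder_norm T \<gamma> (%t. \<theta>n n t - \<theta>' t)"
   unfolding holder_norm_def by (intro arg_cong2[where f = "(+)"] SUP_cong) (auto simp: eq)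
  also have "\<dots> <= ennreal (C * (e * H + norm (u0n n - u0)))"
   by (rule st[OF reg _ regular_averaged_diff[OF b bn True, folded e_def]]) (use \<theta>n \<theta>' e H0 in auto)
  also have "\<dots> <= ennreal (C' * (e + norm (u0n n - u0)))"
  proof (rule ennreal_leI)
   have "e * H + norm (u0n n - u0) <= (1 + H) * (e + norm (u0n n - u0))"
    using e(1) H0 by (simp add: algebra_simps)
   then show "C * (e * H + norm (u0n n - u0)) <= C' * (e + norm (u0n n - u0))"
    using C by (simp add: C'_def mult.assoc)
  qed
  also have "\<dots> = ennreal C' * (FL_vec_norm q' \<delta> (bn n - b) + ennreal (norm (u0n n - u0)))"
   using C' e by (simp add: ennreal_mult)
  finally show ?thesis .
 qed
 then show ?thesis using \<theta>n C' by blast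
qed

end

section \<open>Lipschitz drifts\<close>

lemma psum_additive:
 assumes P: "chain a b P" and add: "\<And>s m t. a <= s ==> s <= m ==> m <= t ==> t <= b ==> X s m + X m t = X s t"
 shows "psum X P = X a b"
proof -
 have z: "X s s = 0" if "a <= s" "s <= b" for s using add[of s s s] that by simp
 have "psum X (x # l) = X x (last (x # l))" if "sorted_wrt (<) (x # l)" "set (x # l) \<subseteq> {a..b}" for x l
  using that
 proof (induction l arbitrary: x)
  case Nil
  then show ?case using z[of x] by simp
 next
  case (Cons y l)
  then have "psum X (y # l) = X y (last (y # l))" by simp
  moreover have "last (y # l) \<in> {a..b}" "y <= last (y # l)"
   using Cons.prems last_in_set[of "y # l"] by (auto simp del: last.simps)
  ultimately show ?case using Cons.prems add[of x y "last (y # l)"] by auto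
 qed
 moreover have e: "a # tl P = P" using chain_nonempty[OF P] chain_hd[OF P] by (metis list.collapse)
 ultimately have "psum X P = X a (last P)" using P unfolding chain_def by metis
 then show ?thesis unfolding chain_last[OF P] .
qed

lemma psum_norm_le:
 assumes "sorted_wrt (<) P" "set P \<subseteq> {a..b}" "mesh h P"
  and le: "\<And>s t. a <= s ==> s < t ==> t <= b ==> t < s + h ==> norm (X s t) <= Y s t"
 shows "norm (psum X P) <= psum Y P"
 using assms(1-3)
proof (induction P rule: induct_list012)
 case (3 x y l)
 then have "norm (psum X (y # l)) <= psum Y (y # l)" by (simp add: mesh_def)
 moreover have "norm (X x y) <= Y x y" using 3 by (intro le) (auto simp: mesh_def)
 ultimately show ?case using norm_triangle_ineq[of "X x y" "psum X (y # l)"] by simp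
qed auto

lemma psum2_box:
 assumes P: "chain a1 b1 P" and Q: "chain a2 b2 Q"
 shows "psum2 (%s1 t1 s2 t2. box (s1, s2) (t1, t2) \<Phi>) P Q = box (a1, a2) (b1, b2) \<Phi>"
proof -
 have "psum (%s2 t2. box (s1, s2) (t1, t2) \<Phi>) Q = box (s1, a2) (t1, b2) \<Phi>" for s1 t1
  by (rule psum_additive[OF Q]) (simp add: box_def)
 then have "psum2 (%s1 t1 s2 t2. box (s1, s2) (t1, t2) \<Phi>) P Q = psum (%s1 t1. box (s1, a2) (t1, b2) \<Phi>) P"
  unfolding psum2_def by simp
 also have "\<dots> = box (a1, a2) (b1, b2) \<Phi>" by (rule psum_additive[OF P]) (simp add: box_def)
 finally show ?thesis .
qed

lemma lipschitz_growth:
 fixes f :: "'a::real_normed_vector => 'b::real_normed_vector"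
 assumes "L-lipschitz_on UNIV f" shows "norm (f x) <= (norm (f 0) + L) * (1 + norm x)"
proof -
 have L: "0 <= L" by (rule lipschitz_on_nonneg[OF assms])
 have "norm (f x) <= norm (f 0) + norm (f x - f 0)" using norm_triangle_ineq[of "f 0" "f x - f 0"] by simp
 also have "norm (f x - f 0) <= L * norm x" using lipschitz_onD[OF assms, of x 0] by (simp add: dist_norm)
 also have "norm (f 0) + L * norm x <= (norm (f 0) + L) * (1 + norm x)" using L by (simp add: algebra_simps)
 finally show ?thesis by simp
qed

lemma lipschitz_borel: "L-lipschitz_on UNIV f ==> f \<in> borel_measurable borel"
 by (intro borel_measurable_continuous_onI lipschitz_on_continuous_on)

section \<open>Young sums as Riemann sums\<close>

context path_setting
begin

lemma bm_scaleR:
 assumes V: "bm V" and k: "bm k" shows "bm (%p. V p *\<^sub>R k p)"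
proof -
 obtain K K' where K: "\<forall>p. norm (V p) <= K" "\<forall>p. norm (k p) <= K'" using assms unfolding bm_def by blast
 have "norm (V p *\<^sub>R k p) <= K * K'" for p
  using K[rule_format, of p] order_trans[OF norm_ge_zero K(1)[rule_format, of p]] unfolding norm_scaleR real_norm_def by (intro mult_mono) auto
 then show ?thesis using assms unfolding bm_def by auto
qed

lemma bm_lipschitz:
 fixes f :: "'a::{banach, second_countable_topology} => 'b::{banach, second_countable_topology}"
 assumes f: "L-lipschitz_on UNIV f" and g: "bm g" shows "bm (%p. f (g p))"
proof -
 obtain K where K: "\<forall>p. norm (g p) <= K" using g unfolding bm_def by blast
 have gm: "g \<in> borel_measurable M" using g by (simp add: bm_def)
 have "norm (f (g p)) <= (norm (f 0) + L) * (1 + K)" for p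
  using lipschitz_growth[OF f, of "g p"] K[rule_format, of p] lipschitz_on_nonneg[OF f]
  by (elim order_trans) (intro mult_left_mono, auto)
 then show ?thesis using measurable_compose[OF gm lipschitz_borel[OF f]] unfolding bm_def by blast
qed

lemma bm_zd: "bm zd" unfolding bm_def using zd_meas zd_bound by blast

lemma box_integral:
 fixes k :: "real \<times> real => 'b::{banach, second_countable_topology}" and V :: "real => real => real \<times> real => real"
 assumes V: "\<And>r1 r2. bm (V r1 r2)" and k: "bm k"
 shows "box s t (%r1 r2. LINT p|M. V r1 r2 p *\<^sub>R k p) = (LINT p|M. box s t (%r1 r2. V r1 r2 p) *\<^sub>R k p)"
  and "integrable M (%p. box s t (%r1 r2. V r1 r2 p) *\<^sub>R k p)"
proof -
 have i: "integrable M (%p. V r1 r2 p *\<^sub>R k p)" for r1 r2 by (rule bm_integrable[OF bm_scaleR[OF V k]])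
 show "integrable M (%p. box s t (%r1 r2. V r1 r2 p) *\<^sub>R k p)"
  by (intro bm_integrable bm_scaleR k) (unfold box_def, intro bm_add bm_diff V)
 show "box s t (%r1 r2. LINT p|M. V r1 r2 p *\<^sub>R k p) = (LINT p|M. box s t (%r1 r2. V r1 r2 p) *\<^sub>R k p)"
  unfolding box_def scaleR_left_distrib scaleR_left_diff_distrib
  by (simp only: i LINT_add LINT_diff int_diff int_add)
qed

text \<open>\<open>wt\<close> without the factors of \<open>w\<close>: its rectangular increments
  are nonnegative indicators and, times \<open>B * B\<close>, dominate those of
  \<open>wt\<close>.\<close>

definition ii :: "real => real => real \<times> real => real" where
 "ii t1 t2 p = indicator {0..t2} (fst p) * indicator {0..t1} (snd p)"

lemma bm_ii: "bm (ii t1 t2)"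
proof -
 have "norm (ii t1 t2 p) <= 1" for p by (simp add: ii_def indicator_def)
 moreover have "ii t1 t2 \<in> borel_measurable M" unfolding ii_def by measurable
 ultimately show ?thesis unfolding bm_def by blast
qed

lemma box_ii:
 assumes "0 <= s1" "s1 <= t1" "0 <= s2" "s2 <= t2"
 shows "box (s1, s2) (t1, t2) (%r1 r2. ii r1 r2 p) = indicator {s2<..t2} (fst p) * indicator {s1<..t1} (snd p)"
proof -
 have d: "indicator {0..t} x - indicator {0..s} x = (indicator {s<..t} x :: real)" if "0 <= s" "s <= t" for s t x :: real
  using that by (auto simp: indicator_def)
 have "box (s1, s2) (t1, t2) (%r1 r2. ii r1 r2 p) =
   (indicator {0..t2} (fst p) - indicator {0..s2} (fst p)) * (indicator {0..t1} (snd p) - indicator {0..s1} (snd p))"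
  by (simp add: box_def ii_def algebra_simps)
 then show ?thesis using assms by (simp add: d)
qed

lemma box_wt: "box s t (%r1 r2. wt r1 r2 p) = box s t (%r1 r2. ii r1 r2 p) * (w (snd p) * w (fst p))"
 by (simp add: box_def ii_def wt_def algebra_simps)

lemma w_prod: "\<bar>w (snd p) * w (fst p)\<bar> <= B * B"
 unfolding abs_mult using w_bound B_nonneg by (intro mult_mono) auto

text \<open>Of the four corner terms only the one at \<open>(t, t)\<close> survives, since
  \<open>{0..0}\<close> is a null set.\<close>

lemma wt_diagonal:
 fixes k :: "real => real => 'b::{banach, second_countable_topology}"
 assumes k: "(%(r2, r1). k r2 r1) \<in> borel_measurable (borel \<Otimes>\<^sub>M borel)" and K: "\<And>r2 r1. norm (k r2 r1) <= K"
  and t: "0 <= t" "t <= T"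
 shows "box (0, 0) (t, t) (%r1 r2. LINT p|M. wt r1 r2 p *\<^sub>R k (fst p) (snd p)) = (LINT p|M. wt t t p *\<^sub>R k (fst p) (snd p))"
proof -
 have z: "(LINT r:{0..0}|lborel. F r) = 0" for F :: "real => 'b"
  unfolding set_lebesgue_integral_def
 proof (rule integral_eq_zero_AE)
  show "AE r in lborel. indicator {0..0} r *\<^sub>R F r = 0"
   using AE_lborel_singleton[of "0::real"] by (rule AE_mp) (auto simp: indicator_def)
 qed
 have n: "(LINT p|M. wt t1 t2 p *\<^sub>R k (fst p) (snd p)) = 0" if "t1 <= T" "t2 <= T" "t1 = 0 \<or> t2 = 0" for t1 t2
  unfolding nested_integral(1)[OF k K that(1,2), symmetric] using that(3)
 proof
  assume "t1 = 0"
  then show "(LINT r2:{0..t2}|lborel. (LINT r1:{0..t1}|lborel. (w r1 * w r2) *\<^sub>R k r2 r1)) = 0"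
   by (simp only: z) (simp add: set_lebesgue_integral_def)
 qed (simp only: z)
 show ?thesis unfolding box_def fst_conv snd_conv using n[of t 0] n[of 0 t] n[of 0 0] t T by simp
qed

text \<open>On a grid rectangle the summand and the increment of \<open>\<Phi>\<close> integrate
  \<open>f\<close> against the same weight; the path is frozen at the lower left corner in one and
  runs in the other. Uniform continuity and the Lipschitz bound make the integrands differ by a
  small constant, and the resulting majorant \<open>\<Psi>\<close> is additive over the
  grid.\<close>

lemma young_sums_converge:
 fixes f :: "real^'n => real^'n" and \<theta> \<eta> :: "real => real^'n"
 assumes f: "L-lipschitz_on UNIV f"
  and A: "\<And>t1 t2 x. t1 \<in> {0..T} ==> t2 \<in> {0..T} ==> A t1 t2 x = (LINT p|M. wt t1 t2 p *\<^sub>R f (x + zd p))"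
  and \<eta>: "continuous_on UNIV \<eta>" and \<eta>b: "\<And>r. norm (\<eta> r) <= S" and \<theta>\<eta>: "\<And>r. r \<in> {0..T} ==> \<theta> r = \<eta> r" and t: "t \<in> {0..T}"
 shows "has_int (germ A [(1, \<theta>)]) 0 t 0 t (LINT p|M. wt t t p *\<^sub>R f ((\<eta> (fst p) + z (fst p)) - (\<eta> (snd p) + z (snd p))))"
proof -
 have L: "0 <= L" by (rule lipschitz_on_nonneg[OF f])
 have [measurable]: "\<eta> \<in> borel_measurable borel" by (rule borel_measurable_continuous_onI[OF \<eta>])
 have [measurable]: "f \<in> borel_measurable borel" by (rule lipschitz_borel[OF f])
 define g where "g p = (\<eta> (fst p) + z (fst p)) - (\<eta> (snd p) + z (snd p))" for p
 have gb: "norm (g p) <= 2 * (S + R)" for p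
 proof -
  have "norm (\<eta> r + z r) <= S + R" for r using norm_triangle_ineq[of "\<eta> r" "z r"] \<eta>b[of r] z_bound[of r] by linarith
  then show ?thesis unfolding g_def using norm_triangle_ineq4[of "\<eta> (fst p) + z (fst p)" "\<eta> (snd p) + z (snd p)"]
   by (smt (verit))
 qed
 have gm: "g \<in> borel_measurable (borel \<Otimes>\<^sub>M borel)" unfolding g_def by measurable
 then have "g \<in> borel_measurable M" by (simp cong: measurable_cong_sets add: sets_time_measure)
 then have bg: "bm g" unfolding bm_def using gb by blast
 have bk: "bm (%p. f (g p))" by (rule bm_lipschitz[OF f bg])
 define c where "c = measure M (space M)"
 define \<Phi> where "\<Phi> r1 r2 = (LINT p|M. wt r1 r2 p *\<^sub>R f (g p))" for r1 r2
 have \<Phi>t: "box (0, 0) (t, t) \<Phi> = \<Phi> t t"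
 proof -
  have m: "(%(r2, r1). f (g (r2, r1))) \<in> borel_measurable (borel \<Otimes>\<^sub>M borel)" using gm by measurable
  obtain K where K: "\<forall>p. norm (f (g p)) <= K" using bk unfolding bm_def by blast
  from wt_diagonal[OF m, of K t] K t show ?thesis unfolding \<Phi>_def by simp
 qed
 show ?thesis
  unfolding has_int_def
 proof (intro allI impI)
  fix e :: real assume e: "0 < e"
  \<comment> \<open>Makes the final bound \<open>B * B * (2 * L) * c * d\<close> at most
    \<open>e / 2\<close>; the summand 1 avoids a vanishing denominator.\<close>
  define d where "d = e / (2 * (B * B * (2 * L) * c + 1))"
  have D0: "0 <= B * B * (2 * L) * c" using L B_nonneg by (simp add: c_def)
  have d: "0 < d" unfolding d_def using e D0 by (intro divide_pos_pos) auto
  have "uniformly_continuous_on {0..T} \<eta>"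
   by (rule compact_uniformly_continuous[OF continuous_on_subset[OF \<eta>]]) auto
  then obtain h where h: "0 < h" "\<And>x y. x \<in> {0..T} ==> y \<in> {0..T} ==> dist y x < h ==> dist (\<eta> y) (\<eta> x) < d"
   unfolding uniformly_continuous_on_def using d by metis
  have "norm (psum2 (germ A [(1, \<theta>)]) P Q - \<Phi> t t) < e"
   if P: "chain 0 t P" "mesh h P" and Q: "chain 0 t Q" "mesh h Q" for P Q
  proof -
   define C where "C = B * B * (2 * L * d)"
   have C: "0 <= C" using L B_nonneg d by (simp add: C_def)
   define \<Psi> where "\<Psi> r1 r2 = (LINT p|M. ii r1 r2 p *\<^sub>R C)" for r1 r2
   have bC: "bm (%p. C)" unfolding bm_def by auto
   define X where "X s1 t1 s2 t2 = germ A [(1, \<theta>)] s1 t1 s2 t2 - box (s1, s2) (t1, t2) \<Phi>" for s1 t1 s2 t2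
   have X: "norm (X s1 t1 s2 t2) <= box (s1, s2) (t1, t2) \<Psi>"
    if *: "0 <= s1" "s1 < t1" "t1 <= t" "t1 < s1 + h" "0 <= s2" "s2 < t2" "t2 <= t" "t2 < s2 + h" for s1 t1 s2 t2
   proof -
    define x where "x = \<eta> s2 - \<eta> s1"
    have r: "s1 \<in> {0..T}" "t1 \<in> {0..T}" "s2 \<in> {0..T}" "t2 \<in> {0..T}" using * t by auto
    have bx: "bm (%p. f (x + zd p))"
    proof (rule bm_lipschitz[OF f])
     have "bm (%p. x)" unfolding bm_def by auto
     then show "bm (%p. x + zd p)" using bm_zd by (rule bm_add)
    qed
    have g1: "germ A [(1, \<theta>)] s1 t1 s2 t2 = box (s1, s2) (t1, t2) (%r1 r2. LINT p|M. wt r1 r2 p *\<^sub>R f (x + zd p))"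
     unfolding germ_def wsum_def using A r by (simp add: box_def x_def \<theta>\<eta>)
    have "X s1 t1 s2 t2 = (LINT p|M. box (s1, s2) (t1, t2) (%r1 r2. wt r1 r2 p) *\<^sub>R (f (x + zd p) - f (g p)))"
     unfolding X_def g1 \<Phi>_def[abs_def] box_integral(1)[OF bm_wt bx] box_integral(1)[OF bm_wt bk] scaleR_right_diff_distrib
     by (rule LINT_diff[OF box_integral(2)[OF bm_wt bx] box_integral(2)[OF bm_wt bk], symmetric])
    also have "norm \<dots> <= (LINT p|M. norm (box (s1, s2) (t1, t2) (%r1 r2. wt r1 r2 p) *\<^sub>R (f (x + zd p) - f (g p))))"
     by (rule integral_norm_bound)
    also have "\<dots> <= (LINT p|M. box (s1, s2) (t1, t2) (%r1 r2. ii r1 r2 p) *\<^sub>R C)"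
    proof (rule integral_mono)
     show "integrable M (%p. norm (box (s1, s2) (t1, t2) (%r1 r2. wt r1 r2 p) *\<^sub>R (f (x + zd p) - f (g p))))"
      by (rule integrable_norm[OF box_integral(2)[OF bm_wt bm_diff[OF bx bk]]])
     show "integrable M (%p. box (s1, s2) (t1, t2) (%r1 r2. ii r1 r2 p) *\<^sub>R C)"
      by (rule box_integral(2)[OF bm_ii bC])
     fix p :: "real \<times> real"
     let ?i = "box (s1, s2) (t1, t2) (%r1 r2. ii r1 r2 p)"
     have i: "?i = indicator {s2<..t2} (fst p) * indicator {s1<..t1} (snd p)" by (rule box_ii) (use * in auto)
     show "norm (box (s1, s2) (t1, t2) (%r1 r2. wt r1 r2 p) *\<^sub>R (f (x + zd p) - f (g p))) <= ?i *\<^sub>R C"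
     proof (cases "fst p \<in> {s2<..t2} \<and> snd p \<in> {s1<..t1}")
      case True
      then have i1: "?i = 1" by (simp add: i)
      have "dist (\<eta> (fst p)) (\<eta> s2) < d" "dist (\<eta> (snd p)) (\<eta> s1) < d"
       using True * t by (intro h(2); auto simp: dist_real_def)+
      then have n: "norm (\<eta> (snd p) - \<eta> s1) + norm (\<eta> (fst p) - \<eta> s2) <= 2 * d" by (simp add: dist_norm)
      have "norm (f (x + zd p) - f (g p)) <= L * norm ((x + zd p) - g p)"
       using lipschitz_onD[OF f, of "x + zd p" "g p"] by (simp add: dist_norm)
      also have "(x + zd p) - g p = (\<eta> (snd p) - \<eta> s1) - (\<eta> (fst p) - \<eta> s2)"
       by (simp add: x_def zd_def g_def)
      also have "L * norm \<dots> <= L * (2 * d)"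
       using norm_triangle_ineq4[of "\<eta> (snd p) - \<eta> s1" "\<eta> (fst p) - \<eta> s2"] n L by (intro mult_left_mono) auto
      finally have "\<bar>w (snd p) * w (fst p)\<bar> * norm (f (x + zd p) - f (g p)) <= (B * B) * (L * (2 * d))"
       using w_prod[of p] B_nonneg by (intro mult_mono) auto
      then show ?thesis unfolding box_wt i1 by (simp add: C_def mult_ac)
     next
      case False
      then have "?i = 0" by (auto simp: i)
      then show ?thesis unfolding box_wt by simp
     qed
    qed
    also have "\<dots> = box (s1, s2) (t1, t2) \<Psi>" unfolding \<Psi>_def[abs_def] by (rule box_integral(1)[OF bm_ii bC, symmetric])
    finally show ?thesis .
   qed
   have sP: "sorted_wrt (<) P" "set P \<subseteq> {0..t}" and sQ: "sorted_wrt (<) Q" "set Q \<subseteq> {0..t}"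
    using P Q by (auto simp: chain_def)
   have "norm (psum2 X P Q) <= psum2 (%s1 t1 s2 t2. box (s1, s2) (t1, t2) \<Psi>) P Q"
    unfolding psum2_def
   proof (rule psum_norm_le[OF sP P(2)])
    fix s1 t1 assume 1: "0 <= s1" "s1 < t1" "t1 <= t" "t1 < s1 + h"
    show "norm (psum (X s1 t1) Q) <= psum (%s2 t2. box (s1, s2) (t1, t2) \<Psi>) Q"
     by (rule psum_norm_le[OF sQ Q(2) X[OF 1]])
   qed
   also have "\<dots> = box (0, 0) (t, t) \<Psi>" by (rule psum2_box[OF P(1) Q(1)])
   also have "\<dots> = (LINT p|M. box (0, 0) (t, t) (%r1 r2. ii r1 r2 p) *\<^sub>R C)" unfolding \<Psi>_def[abs_def] by (rule box_integral(1)[OF bm_ii bC])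
   also have "\<dots> <= (LINT p|M. C)"
    by (rule integral_mono[OF box_integral(2)[OF bm_ii bC] bm_integrable[OF bC]], subst box_ii)
      (use t C in \<open>auto simp: indicator_def\<close>)
   also have "\<dots> = c * C" by (simp add: c_def)
   also have "c * C = (B * B * (2 * L) * c) * d" by (simp add: C_def)
   also have "\<dots> <= (B * B * (2 * L) * c + 1) * d" using d by (intro mult_right_mono) auto
   also have "\<dots> = e / 2" unfolding d_def using D0 by (simp add: divide_simps)
   finally have "norm (psum2 X P Q) < e" using e by simp
   moreover have "psum2 X P Q = psum2 (germ A [(1, \<theta>)]) P Q - box (0, 0) (t, t) \<Phi>"
    unfolding X_def[abs_def] psum2_diff psum2_box[OF P(1) Q(1)] ..
   ultimately show ?thesis unfolding \<Phi>t by simp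
  qed
  then show "\<exists>h>0. \<forall>P Q. chain 0 t P \<and> mesh h P \<and> chain 0 t Q \<and> mesh h Q -->
    norm (psum2 (germ A [(1, \<theta>)]) P Q - (LINT p|M. wt t t p *\<^sub>R f ((\<eta> (fst p) + z (fst p)) - (\<eta> (snd p) + z (snd p))))) < e"
   using h(1) unfolding \<Phi>_def g_def by blast
 qed
qed

text \<open>A Lipschitz function grows linearly, so it cannot serve as bounded kernel in
  \<open>kernel_fubini\<close> as it stands. Before the translation by \<open>zd\<close> its growth
  is compensated by the decay of \<open>\<phi>\<close>, with an integrable weight \<open>D\<close>
  split off; afterwards it is divided by \<open>1 + norm y\<close>, which is moved to
  \<open>\<phi>\<close>.\<close>

lemma convolution_represents:
 fixes g :: "real^'n => real" and u :: "'n distribution"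
 assumes V: "bm (V :: _ => real)" and g: "L-lipschitz_on UNIV g"
  and u: "\<And>\<phi>. \<phi> \<in> schwartz ==> u \<phi> = fun_distr (%x. of_real (g x)) (%x. LINT p|M. of_real (V p) * \<phi> (x - zd p))"
 shows "represents (%x. LINT p|M. of_real (V p * g (x + zd p))) u"
  and "continuous_on UNIV (%x. LINT p|M. complex_of_real (V p * g (x + zd p)))"
proof -
 have L: "0 <= L" by (rule lipschitz_on_nonneg[OF g])
 have [measurable]: "g \<in> borel_measurable borel" by (rule lipschitz_borel[OF g])
 have Vm [measurable]: "V \<in> borel_measurable M" using V by (simp add: bm_def)
 have Vi: "integrable M (%p. complex_of_real (V p))" by (rule bm_integrable[OF bm_of_real[OF V]])
 have sM: "sigma_finite_measure M" by (rule M.sigma_finite_measure_axioms)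
 define K where "K = \<bar>g 0\<bar> + L"
 have K: "\<bar>g x\<bar> <= K * (1 + norm x)" for x using lipschitz_growth[OF g, of x] by (simp add: K_def)
 have K0: "0 <= K" using L by (simp add: K_def)
 let ?F = "%x. LINT p|M. complex_of_real (V p * g (x + zd p))"
 have bx: "bm (%p. g (x + zd p))" for x
 proof (rule bm_lipschitz[OF g])
  have "bm (%p. x)" unfolding bm_def by auto
  then show "bm (%p. x + zd p)" using bm_zd by (rule bm_add)
 qed
 have Fi: "integrable M (%p. complex_of_real (V p * g (x + zd p)))" for x
  using bm_integrable[OF bm_of_real[OF bm_scaleR[OF V bx]]] by simp
 show cont: "continuous_on UNIV ?F"
 proof -
  define c where "c = (LINT p|M. \<bar>V p\<bar>)"
  have c: "0 <= c" unfolding c_def by (rule integral_nonneg_AE) simp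
  have "(L * c)-lipschitz_on UNIV ?F"
  proof (rule lipschitz_onI)
   fix x y :: "real^'n"
   have "norm (?F x - ?F y) = norm (LINT p|M. complex_of_real (V p * g (x + zd p)) - complex_of_real (V p * g (y + zd p)))"
    unfolding LINT_diff[OF Fi Fi] ..
   also have "\<dots> <= (LINT p|M. norm (complex_of_real (V p * g (x + zd p)) - complex_of_real (V p * g (y + zd p))))" by (rule integral_norm_bound)
   also have "\<dots> <= (LINT p|M. \<bar>V p\<bar> * (L * norm (x - y)))"
   proof (rule integral_mono)
    show "integrable M (%p. norm (complex_of_real (V p * g (x + zd p)) - complex_of_real (V p * g (y + zd p))))"
     by (intro integrable_norm int_diff Fi)
    show "integrable M (%p. \<bar>V p\<bar> * (L * norm (x - y)))"
     by (intro integrable_mult_left integrable_abs bm_integrable V)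
    fix p
    have "norm (complex_of_real (V p * g (x + zd p)) - complex_of_real (V p * g (y + zd p))) = \<bar>V p\<bar> * \<bar>g (x + zd p) - g (y + zd p)\<bar>"
     unfolding of_real_diff[symmetric] norm_of_real right_diff_distrib[symmetric] abs_mult ..
    also have "\<dots> <= \<bar>V p\<bar> * (L * norm (x - y))"
     using lipschitz_onD[OF g, of "x + zd p" "y + zd p"] by (intro mult_left_mono) (auto simp: dist_norm)
    finally show "norm (complex_of_real (V p * g (x + zd p)) - complex_of_real (V p * g (y + zd p))) <= \<bar>V p\<bar> * (L * norm (x - y))" .
   qed
   also have "\<dots> = L * c * dist x y" by (simp add: c_def dist_norm)
   finally show "dist (?F x) (?F y) <= L * c * dist x y" by (simp add: dist_norm)
  qed (use L c in simp)
  then show ?thesis by (rule lipschitz_on_continuous_on)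
 qed
 have Fm: "?F \<in> borel_measurable borel" by (rule borel_measurable_continuous_onI[OF cont])
 have nz: "1 + norm x <= (1 + 2 * R) * (1 + norm (x - zd p))" for x p
 proof -
  have "norm x <= norm (x - zd p) + norm (zd p)" using norm_triangle_ineq[of "x - zd p" "zd p"] by simp
  then have "1 + norm x <= 1 + norm (x - zd p) + 2 * R" using zd_bound[of p] by linarith
  also have "\<dots> <= (1 + 2 * R) * (1 + norm (x - zd p))" using R_nonneg by (simp add: algebra_simps)
  finally show ?thesis .
 qed
 have "integrable lborel (%x. ?F x * \<phi> x) \<and> u \<phi> = fun_distr ?F \<phi>" if \<phi>: "\<phi> \<in> schwartz" for \<phi>
 proof -
  have [measurable]: "\<phi> \<in> borel_measurable borel" by (rule schwartz_measurable[OF \<phi>])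
  define N where "N = 2 * DIM(real^'n)"
  define D where "D x = complex_of_real (1 / (1 + norm x) ^ N)" for x :: "real^'n"
  have Di: "integrable lborel D" unfolding D_def N_def by (intro integrable_of_real integrable_decay)
  obtain C where C: "0 <= C" "\<forall>x. (1 + norm x) ^ Suc N * norm (\<phi> x) <= C" using rapid_bound[OF schwartz_rapid[OF \<phi>]] by blast
  \<comment> \<open>Bounded because translation by \<open>zd p\<close> changes
    \<open>1 + norm x\<close> by at most the factor \<open>1 + 2 * R\<close>, and
    \<open>\<phi>\<close> decays with one power more than \<open>N\<close>.\<close>
  let ?k = "%x p. complex_of_real (g x * (1 + norm x) ^ N) * \<phi> (x - zd p)"
  have kb: "cmod (?k x p) <= K * ((1 + 2 * R) ^ Suc N * C)" for x p
  proof -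
   have n0: "0 <= 1 + norm x" by (simp add: add_nonneg_nonneg)
   have "cmod (?k x p) = \<bar>g x\<bar> * (1 + norm x) ^ N * cmod (\<phi> (x - zd p))"
    unfolding norm_mult norm_of_real abs_mult abs_of_nonneg[OF zero_le_power[OF n0]] ..
   also have "\<dots> <= (K * (1 + norm x)) * (1 + norm x) ^ N * cmod (\<phi> (x - zd p))" using K[of x] n0 by (intro mult_right_mono) auto
   also have "\<dots> = K * ((1 + norm x) ^ Suc N * cmod (\<phi> (x - zd p)))" by simp
   also have "\<dots> <= K * (((1 + 2 * R) * (1 + norm (x - zd p))) ^ Suc N * cmod (\<phi> (x - zd p)))"
    using K0 n0 nz[of x p] by (intro mult_left_mono mult_right_mono power_mono) auto
   also have "\<dots> = K * ((1 + 2 * R) ^ Suc N * ((1 + norm (x - zd p)) ^ Suc N * cmod (\<phi> (x - zd p))))"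
    by (simp only: power_mult_distrib mult.assoc)
   also have "\<dots> <= K * ((1 + 2 * R) ^ Suc N * C)"
    using C(2) K0 R_nonneg by (intro mult_left_mono) auto
   finally show ?thesis .
  qed
  have km: "(%(x, p). ?k x p) \<in> borel_measurable (lborel \<Otimes>\<^sub>M M)" by measurable
  have D1: "complex_of_real ((1 + norm x) ^ N) * D x = 1" for x
  proof -
   have "(1 + norm x) ^ N \<noteq> 0" using norm_ge_zero[of x] by (intro power_not_zero) linarith
   then show ?thesis unfolding D_def of_real_mult[symmetric] by simp
  qed
  let ?k2 = "%p y. complex_of_real (g (y + zd p) / (1 + norm y))"
  have ui: "integrable lborel (%y. (1 + norm y) ^ 1 *\<^sub>R \<phi> y)" by (rule integrable_rapid[OF _ schwartz_rapid[OF \<phi>]]) measurable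
  have k2b: "cmod (?k2 p y) <= K * (1 + 2 * R)" for p y
  proof -
   have n0: "0 < 1 + norm y" by (rule add_pos_nonneg) auto
   have "\<bar>g (y + zd p)\<bar> <= K * (1 + norm (y + zd p))" by (rule K)
   also have "\<dots> <= K * ((1 + 2 * R) * (1 + norm y))" using nz[of "y + zd p" p] K0 by (intro mult_left_mono) auto
   finally have "\<bar>g (y + zd p)\<bar> / (1 + norm y) <= K * (1 + 2 * R)" using n0 by (simp add: divide_le_eq mult.assoc)
   then show ?thesis unfolding norm_of_real abs_divide abs_of_pos[OF n0] .
  qed
  have k2m: "(%(p, y). ?k2 p y) \<in> borel_measurable (M \<Otimes>\<^sub>M lborel)" by measurable
  have k2e: "?k2 p y * of_real (V p) * ((1 + norm y) ^ 1 *\<^sub>R \<phi> y) = of_real (V p * g (y + zd p)) * \<phi> y" for p y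
  proof -
   have "1 + norm y \<noteq> 0" using norm_ge_zero[of y] by linarith
   then have "complex_of_real (1 + norm y) \<noteq> 0" unfolding of_real_eq_0_iff .
   then show ?thesis by (simp add: scaleR_conv_of_real)
  qed
  have "u \<phi> = (LINT x|lborel. of_real (g x) * (LINT p|M. of_real (V p) * \<phi> (x - zd p)))" unfolding u[OF \<phi>] fun_distr_def ..
  also have "\<dots> = (LINT x|lborel. (LINT p|M. ?k x p * D x * of_real (V p)))"
  proof (rule LINT_cong[OF refl])
   fix x
   have "of_real (g x) * (LINT p|M. of_real (V p) * \<phi> (x - zd p)) = (LINT p|M. of_real (g x) * (of_real (V p) * \<phi> (x - zd p)))"
    by (rule integral_mult_right_zero[symmetric])
   also have "\<dots> = (LINT p|M. ?k x p * D x * of_real (V p))"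
   proof (rule LINT_cong[OF refl])
    fix p
    have "?k x p * D x * of_real (V p) = of_real (g x) * (of_real (V p) * \<phi> (x - zd p)) * (complex_of_real ((1 + norm x) ^ N) * D x)"
     unfolding of_real_mult by (simp only: mult_ac)
    then show "of_real (g x) * (of_real (V p) * \<phi> (x - zd p)) = ?k x p * D x * of_real (V p)" unfolding D1 mult_1_right by (rule sym)
   qed
   finally show "of_real (g x) * (LINT p|M. of_real (V p) * \<phi> (x - zd p)) = (LINT p|M. ?k x p * D x * of_real (V p))" .
  qed
  also have "\<dots> = (LINT p|M. (LINT x|lborel. ?k x p * D x * of_real (V p)))"
   by (rule kernel_fubini(2)[OF sigma_finite_lborel sM Di Vi km kb])
  also have "\<dots> = (LINT p|M. (LINT y|lborel. ?k2 p y * of_real (V p) * ((1 + norm y) ^ 1 *\<^sub>R \<phi> y)))"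
  proof (rule LINT_cong[OF refl])
   fix p
   have "(LINT x|lborel. ?k x p * D x * of_real (V p)) = (LINT x|lborel. of_real (V p * g x) * \<phi> (x - zd p))"
   proof (rule LINT_cong[OF refl])
    fix x
    have "?k x p * D x * of_real (V p) = of_real (V p * g x) * \<phi> (x - zd p) * (complex_of_real ((1 + norm x) ^ N) * D x)"
     unfolding of_real_mult by (simp only: mult_ac)
    then show "?k x p * D x * of_real (V p) = of_real (V p * g x) * \<phi> (x - zd p)" unfolding D1 mult_1_right .
   qed
   also have "\<dots> = (LINT y|lborel. of_real (V p * g (zd p + 1 *\<^sub>R y)) * \<phi> (zd p + 1 *\<^sub>R y - zd p))"
    by (subst integral_lborel_affine[of _ 1 "zd p"]) auto
   also have "\<dots> = (LINT y|lborel. ?k2 p y * of_real (V p) * ((1 + norm y) ^ 1 *\<^sub>R \<phi> y))"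
    unfolding k2e by (simp add: add.commute)
   finally show "(LINT x|lborel. ?k x p * D x * of_real (V p)) = (LINT y|lborel. ?k2 p y * of_real (V p) * ((1 + norm y) ^ 1 *\<^sub>R \<phi> y))" .
  qed
  also have "\<dots> = (LINT y|lborel. (LINT p|M. ?k2 p y * of_real (V p) * ((1 + norm y) ^ 1 *\<^sub>R \<phi> y)))"
   by (rule kernel_fubini(2)[OF sM sigma_finite_lborel Vi ui k2m k2b])
  also have "\<dots> = fun_distr ?F \<phi>"
   unfolding fun_distr_def k2e by (intro LINT_cong[OF refl] integral_mult_left_zero)
  finally have 1: "u \<phi> = fun_distr ?F \<phi>" .
  have "(%(y, p). ?k2 p y) \<in> borel_measurable (lborel \<Otimes>\<^sub>M M)" by measurable
  from kernel_fubini(3)[OF sigma_finite_lborel sM ui Vi this k2b]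
  have "integrable lborel (%y. LINT p|M. ?k2 p y * ((1 + norm y) ^ 1 *\<^sub>R \<phi> y) * of_real (V p))" .
  moreover have "(LINT p|M. ?k2 p y * ((1 + norm y) ^ 1 *\<^sub>R \<phi> y) * of_real (V p)) = ?F y * \<phi> y" for y
  proof -
   have "(LINT p|M. ?k2 p y * ((1 + norm y) ^ 1 *\<^sub>R \<phi> y) * of_real (V p)) = (LINT p|M. of_real (V p * g (y + zd p)) * \<phi> y)"
    unfolding k2e[symmetric] by (simp only: mult_ac)
   then show ?thesis by (simp only: integral_mult_left_zero)
  qed
  ultimately show ?thesis using 1 by simp
 qed
 then show "represents ?F u" unfolding represents_def using Fm by blast
qed

section \<open>Uniqueness for the classical equation\<close>

lemma product_integral:
 fixes e i :: "real => real"
 assumes b: "bm (%p. e (fst p) * i (snd p))"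
 shows "(LINT p|M. e (fst p) * i (snd p)) = (LINT x|time_measure T. e x) * (LINT y|time_measure T. i y)"
proof -
 interpret L: finite_measure "time_measure T" by (rule finite_time_measure)
 interpret pair_sigma_finite "time_measure T" "time_measure T" ..
 show ?thesis using integral_fst'[OF bm_integrable[OF b]] by simp
qed

lemma exp_integral:
 assumes \<mu>: "0 < \<mu>" and t: "t \<in> {0..T}"
 shows "(LINT r|time_measure T. indicator {0..t} r * exp (\<mu> * r)) <= exp (\<mu> * t) / \<mu>"
  and "0 <= (LINT r|time_measure T. indicator {0..t} r * exp (\<mu> * r))"
  and "(LINT r|time_measure T. (indicator {0..t} r :: real)) = t"
proof -
 have "(LINT r|time_measure T. indicator {0..t} r * exp (\<mu> * r)) = (LINT r|lborel. indicator {0..T} r *\<^sub>R (indicator {0..t} r * exp (\<mu> * r)))"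
  unfolding set_lebesgue_integral_def[symmetric] by (rule integral_time_measure) measurable
 also have "\<dots> = (LINT r|lborel. indicator {0..t} r *\<^sub>R exp (\<mu> * r))"
  using t by (intro LINT_cong[OF refl]) (auto simp: indicator_def)
 also have "\<dots> = exp (\<mu> * t) / \<mu> - exp (\<mu> * 0) / \<mu>"
 proof (rule integral_FTC_Icc)
  show "((%r. exp (\<mu> * r) / \<mu>) has_vector_derivative exp (\<mu> * x)) (at x within {0..t})" for x
   unfolding has_real_derivative_iff_has_vector_derivative[symmetric]
   using \<mu> by (auto intro!: derivative_eq_intros)
  show "continuous_on {0..t} (%r. exp (\<mu> * r))" by (intro continuous_intros)
 qed (use t in auto)
 finally have e: "(LINT r|time_measure T. indicator {0..t} r * exp (\<mu> * r)) = (exp (\<mu> * t) - 1) / \<mu>"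
  by (simp add: diff_divide_distrib)
 show "(LINT r|time_measure T. indicator {0..t} r * exp (\<mu> * r)) <= exp (\<mu> * t) / \<mu>"
  "0 <= (LINT r|time_measure T. indicator {0..t} r * exp (\<mu> * r))"
  unfolding e using \<mu> t by (auto simp: divide_right_mono)
 have "(LINT r|time_measure T. (indicator {0..t} r :: real)) = (LINT r|lborel. indicator {0..T} r *\<^sub>R (indicator {0..t} r :: real))"
  unfolding set_lebesgue_integral_def[symmetric] by (rule integral_time_measure) measurable
 also have "\<dots> = (LINT r|lborel. (indicator {0..t} r :: real))"
  using t by (intro LINT_cong[OF refl]) (auto simp: indicator_def)
 also have "\<dots> = t" using t by simp
 finally show "(LINT r|time_measure T. (indicator {0..t} r :: real)) = t" .
qed

text \<open>The weight \<open>exp (- \<mu> t)\<close> turns the difference of two solutions into a contraction.\<close>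
lemma classical_unique:
 fixes f :: "real^'n => real^'n" and u v :: "real => real^'n"
 assumes f: "L-lipschitz_on UNIV f" and u: "continuous_on UNIV u" "\<And>r. norm (u r) <= S" and v: "continuous_on UNIV v" "\<And>r. norm (v r) <= S"
  and eq: "\<And>t. t \<in> {0..T} ==> u t - v t = (LINT p|M. wt t t p *\<^sub>R f (u (fst p) - u (snd p))) - (LINT p|M. wt t t p *\<^sub>R f (v (fst p) - v (snd p)))"
  and t: "t \<in> {0..T}"
 shows "u t = v t"
proof -
 have L: "0 <= L" by (rule lipschitz_on_nonneg[OF f])
 have bu: "bm (%p. f (y (fst p) - y (snd p)))" if y: "continuous_on UNIV y" "\<And>r. norm (y r) <= S" for y :: "real => real^'n"
 proof (rule bm_lipschitz[OF f])
  have [measurable]: "y \<in> borel_measurable borel" by (rule borel_measurable_continuous_onI[OF y(1)])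
  have "norm (y (fst p) - y (snd p)) <= S + S" for p :: "real \<times> real"
   using norm_triangle_ineq4[of "y (fst p)" "y (snd p)"] y(2)[of "fst p"] y(2)[of "snd p"] by linarith
  moreover have "(%p. y (fst p) - y (snd p)) \<in> borel_measurable M" by measurable
  ultimately show "bm (%p. y (fst p) - y (snd p))" unfolding bm_def by blast
 qed
 \<comment> \<open>Makes \<open>2 * (B * B * L) * T / \<mu>\<close> at most 1/2: the two path values
   contribute one term each, in which one variable ranges freely over a length at most
   \<open>T\<close> and the other yields \<open>exp (\<mu> * t0) / \<mu>\<close>.\<close>
 define \<mu> where "\<mu> = 4 * (B * B * L) * T + 1"
 have BL: "0 <= B * B * L" using L B_nonneg by simp
 have \<mu>: "0 < \<mu>" using BL T by (auto simp: \<mu>_def intro!: add_nonneg_pos)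
 define d where "d r = norm (u r - v r)" for r
 have "continuous_on {0..T} (%r. exp (- (\<mu> * r)) * d r)"
  unfolding d_def using continuous_on_subset[OF u(1)] continuous_on_subset[OF v(1)] by (intro continuous_intros) auto
 \<comment> \<open>The weighted difference attains its maximum \<open>m\<close> at
   \<open>t0\<close>, and the equation at \<open>t0\<close> gives \<open>m <= m / 2\<close>.\<close>
 then obtain t0 where t0: "t0 \<in> {0..T}" "\<And>r. r \<in> {0..T} ==> exp (- (\<mu> * r)) * d r <= exp (- (\<mu> * t0)) * d t0"
  using continuous_attains_sup[of "{0..T}" "%r. exp (- (\<mu> * r)) * d r"] T by auto
 define m where "m = exp (- (\<mu> * t0)) * d t0"
 have m0: "0 <= m" by (simp add: m_def d_def)
 have dm: "d r <= m * exp (\<mu> * r)" if "r \<in> {0..T}" for r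
 proof -
  have "exp (\<mu> * r) * (exp (- (\<mu> * r)) * d r) <= exp (\<mu> * r) * m" unfolding m_def by (intro mult_left_mono t0 that) simp
  moreover have "exp (\<mu> * r) * exp (- (\<mu> * r)) = 1" by (simp add: exp_minus)
  then have "exp (\<mu> * r) * (exp (- (\<mu> * r)) * d r) = d r" unfolding mult.assoc[symmetric] by (simp only: mult_1_left)
  ultimately show ?thesis unfolding mult.commute[of m] by (simp only:)
 qed
 let ?I = "%r. indicator {0..t0} r :: real" and ?E = "%r. indicator {0..t0} r * exp (\<mu> * r) :: real"
 define c where "c = B * B * (L * m)"
 have c0: "0 <= c" using L m0 B_nonneg by (simp add: c_def)
 have E: "0 <= ?E r" "?E r <= exp (\<mu> * T)" "0 <= ?I r" "?I r <= 1" for r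
  using t0(1) \<mu> by (auto simp: indicator_def)
 have b1: "bm (%p. ?E (fst p) * ?I (snd p))" and b2: "bm (%p. ?I (fst p) * ?E (snd p))"
 proof -
  have "norm (?E x * ?I y) <= exp (\<mu> * T) * 1" "norm (?I x * ?E y) <= 1 * exp (\<mu> * T)" for x y :: real
  proof -
   have "?E x * ?I y <= exp (\<mu> * T) * 1" by (rule mult_mono[OF E(2) E(4) _ E(3)]) simp
   then show "norm (?E x * ?I y) <= exp (\<mu> * T) * 1"
    using mult_nonneg_nonneg[OF E(1)[of x] E(3)[of y]] by (simp only: real_norm_def abs_of_nonneg)
   have "?I x * ?E y <= 1 * exp (\<mu> * T)" by (rule mult_mono[OF E(4) E(2) _ E(1)]) simp
   then show "norm (?I x * ?E y) <= 1 * exp (\<mu> * T)"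
    using mult_nonneg_nonneg[OF E(3)[of x] E(1)[of y]] by (simp only: real_norm_def abs_of_nonneg)
  qed
  moreover have "(%p. ?E (fst p) * ?I (snd p)) \<in> borel_measurable M" "(%p. ?I (fst p) * ?E (snd p)) \<in> borel_measurable M" by measurable
  ultimately show "bm (%p. ?E (fst p) * ?I (snd p))" "bm (%p. ?I (fst p) * ?E (snd p))" unfolding bm_def by blast+
 qed
 note iu = bm_integrable[OF bm_scaleR[OF bm_wt bu[OF u]]] and iv = bm_integrable[OF bm_scaleR[OF bm_wt bu[OF v]]]
 have "u t0 - v t0 = (LINT p|M. wt t0 t0 p *\<^sub>R (f (u (fst p) - u (snd p)) - f (v (fst p) - v (snd p))))"
  unfolding eq[OF t0(1)] scaleR_right_diff_distrib by (rule LINT_diff[OF iu iv, symmetric])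
 then have "d t0 = norm (LINT p|M. wt t0 t0 p *\<^sub>R (f (u (fst p) - u (snd p)) - f (v (fst p) - v (snd p))))" by (simp only: d_def)
 also have "\<dots> <= (LINT p|M. norm (wt t0 t0 p *\<^sub>R (f (u (fst p) - u (snd p)) - f (v (fst p) - v (snd p)))))" by (rule integral_norm_bound)
 also have "\<dots> <= (LINT p|M. c * (?E (fst p) * ?I (snd p) + ?I (fst p) * ?E (snd p)))"
 proof (rule integral_mono)
  show "integrable M (%p. norm (wt t0 t0 p *\<^sub>R (f (u (fst p) - u (snd p)) - f (v (fst p) - v (snd p)))))"
   by (intro integrable_norm bm_integrable bm_scaleR bm_wt bm_diff bu u v)
  show "integrable M (%p. c * (?E (fst p) * ?I (snd p) + ?I (fst p) * ?E (snd p)))"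
   by (intro integrable_mult_right bm_integrable bm_add b1 b2)
  fix p :: "real \<times> real"
  show "norm (wt t0 t0 p *\<^sub>R (f (u (fst p) - u (snd p)) - f (v (fst p) - v (snd p)))) <= c * (?E (fst p) * ?I (snd p) + ?I (fst p) * ?E (snd p))"
  proof (cases "fst p \<in> {0..t0} \<and> snd p \<in> {0..t0}")
   case True
   then have r: "fst p \<in> {0..T}" "snd p \<in> {0..T}" using t0(1) by auto
   have "norm (f (u (fst p) - u (snd p)) - f (v (fst p) - v (snd p))) <= L * norm ((u (fst p) - u (snd p)) - (v (fst p) - v (snd p)))"
    using lipschitz_onD[OF f, of "u (fst p) - u (snd p)" "v (fst p) - v (snd p)"] by (simp add: dist_norm)
   also have "\<dots> <= L * (m * (exp (\<mu> * fst p) + exp (\<mu> * snd p)))"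
   proof (rule mult_left_mono[OF _ L])
    have "(u (fst p) - u (snd p)) - (v (fst p) - v (snd p)) = (u (fst p) - v (fst p)) - (u (snd p) - v (snd p))" by simp
    then have "norm ((u (fst p) - u (snd p)) - (v (fst p) - v (snd p))) <= d (fst p) + d (snd p)"
     unfolding d_def using norm_triangle_ineq4 by metis
    also have "\<dots> <= m * exp (\<mu> * fst p) + m * exp (\<mu> * snd p)" by (rule add_mono[OF dm[OF r(1)] dm[OF r(2)]])
    finally show "norm ((u (fst p) - u (snd p)) - (v (fst p) - v (snd p))) <= m * (exp (\<mu> * fst p) + exp (\<mu> * snd p))"
     by (simp add: distrib_left)
   qed
   finally have "norm (f (u (fst p) - u (snd p)) - f (v (fst p) - v (snd p))) <= L * (m * (exp (\<mu> * fst p) + exp (\<mu> * snd p)))" .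
   then have "\<bar>w (snd p) * w (fst p)\<bar> * norm (f (u (fst p) - u (snd p)) - f (v (fst p) - v (snd p)))
     <= (B * B) * (L * (m * (exp (\<mu> * fst p) + exp (\<mu> * snd p))))"
    using w_prod[of p] B_nonneg by (intro mult_mono) auto
   then show ?thesis using True by (simp add: wt_def c_def mult.assoc)
  next
   case False
   then have "wt t0 t0 p = 0" by (auto simp: wt_def)
   then show ?thesis using c0 E by (auto intro!: mult_nonneg_nonneg add_nonneg_nonneg)
  qed
 qed
 also have "\<dots> = c * ((LINT p|M. ?E (fst p) * ?I (snd p)) + (LINT p|M. ?I (fst p) * ?E (snd p)))"
  unfolding integral_mult_right_zero LINT_add[OF bm_integrable[OF b1] bm_integrable[OF b2]] ..
 also have "\<dots> = c * (2 * t0 * (LINT r|time_measure T. ?E r))"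
  unfolding product_integral[OF b1] product_integral[OF b2] exp_integral(3)[OF \<mu> t0(1)] by simp
 also have "\<dots> <= c * (2 * T * (exp (\<mu> * t0) / \<mu>))"
  using exp_integral(1,2)[OF \<mu> t0(1)] t0(1) c0 T by (intro mult_left_mono mult_mono) auto
 also have "\<dots> = (2 * (B * B * L) * T / \<mu>) * (m * exp (\<mu> * t0))" by (simp add: c_def)
 also have "\<dots> <= (1 / 2) * (m * exp (\<mu> * t0))"
  using \<mu> m0 by (intro mult_right_mono) (auto simp: divide_le_eq \<mu>_def)
 finally have "exp (- (\<mu> * t0)) * d t0 <= exp (- (\<mu> * t0)) * ((1 / 2) * (m * exp (\<mu> * t0)))" by (intro mult_left_mono) auto
 also have "\<dots> = m / 2" by (simp add: exp_minus)
 finally have "m = 0" using m0 unfolding m_def[symmetric] by simp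
 then have "d t <= 0" using dm[OF t] by simp
 then show ?thesis by (simp add: d_def)
qed

end

context averaging
begin

lemma double_integral_eq:
 fixes f :: "real^'n => real^'n" and u y :: "real => real^'n"
 assumes f: "L-lipschitz_on UNIV f" and y: "continuous_on UNIV y" "\<And>r. norm (y r) <= S"
  and uy: "\<And>r. r \<in> {0..T} ==> u r = y r" and t: "t \<in> {0..T}"
 shows "(LINT s:{0..t}|lborel. (LINT r:{0..t}|lborel. (w0 s * w0 r) *\<^sub>R f (u s - u r))) = (LINT p|M. wt t t p *\<^sub>R f (y (fst p) - y (snd p)))"
proof -
 have [measurable]: "y \<in> borel_measurable borel" by (rule borel_measurable_continuous_onI[OF y(1)])
 have [measurable]: "f \<in> borel_measurable borel" by (rule lipschitz_borel[OF f])
 have m: "(%(r2, r1). f (y r2 - y r1)) \<in> borel_measurable (borel \<Otimes>\<^sub>M borel)" by measurable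
 have K: "norm (f (y r2 - y r1)) <= (norm (f 0) + L) * (1 + (S + S))" for r2 r1
 proof -
  have "norm (y r2 - y r1) <= S + S" using norm_triangle_ineq4[of "y r2" "y r1"] y(2)[of r2] y(2)[of r1] by linarith
  then have "(norm (f 0) + L) * (1 + norm (y r2 - y r1)) <= (norm (f 0) + L) * (1 + (S + S))"
   using lipschitz_on_nonneg[OF f] by (intro mult_left_mono) auto
  then show ?thesis using lipschitz_growth[OF f, of "y r2 - y r1"] by linarith
 qed
 have t': "t <= T" using t by simp
 have "(LINT s:{0..t}|lborel. (LINT r:{0..t}|lborel. (w0 r * w0 s) *\<^sub>R f (u s - u r))) = (LINT p|M. wt t t p *\<^sub>R f (y (fst p) - y (snd p)))"
  by (rule nested_transfer[OF m K t' t' w1_meas w01 w1w]) (simp_all add: uy)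
 then show ?thesis by (simp only: mult.commute)
qed

lemma clamp:
 fixes u :: "real => real^'n"
 assumes "continuous_on {0..T} u"
 shows "\<exists>y S. continuous_on UNIV y \<and> (\<forall>r. norm (y r) <= S) \<and> (\<forall>r\<in>{0..T}. u r = y r)"
proof (intro exI conjI allI ballI)
 let ?y = "%r. u (max 0 (min T r))"
 show "continuous_on UNIV ?y"
  by (rule continuous_on_compose2[OF assms]) (use T in \<open>auto intro!: continuous_intros\<close>)
 have "bounded (u ` {0..T})" by (rule compact_imp_bounded[OF compact_continuous_image[OF assms compact_Icc]])
 then obtain S where S: "\<forall>x\<in>u ` {0..T}. norm x <= S" unfolding bounded_iff by blast
 then show "norm (?y r) <= (SOME S. \<forall>x\<in>u ` {0..T}. norm x <= S)" for r
  by (rule someI2) (use T in auto)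
qed (auto simp: min_def max_def)

text \<open>One distribution is represented both by the inverse transform of its spectrum and by the
  convolution with \<open>f\<close>; being continuous, the two agree at every point. The boundedness
  required by \<open>continuous_version\<close> is supplied by the first representation.\<close>

lemma averaged_field_lipschitz:
 fixes f :: "real^'n => real^'n"
 assumes f: "L-lipschitz_on UNIV f" and F: "FL_vec_norm q' \<delta> (vec_fun_distr f) < \<infinity>" and t: "t1 \<in> {0..T}" "t2 \<in> {0..T}"
 shows "AF (vec_fun_distr f) t1 t2 x = (LINT p|M. wt t1 t2 p *\<^sub>R f (x + zd p))"
proof -
 have "AF (vec_fun_distr f) t1 t2 x $ i = (LINT p|M. wt t1 t2 p *\<^sub>R f (x + zd p)) $ i" for i
 proof -
  have g: "L-lipschitz_on UNIV (%x. f x $ i)"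
  proof (rule lipschitz_onI)
   show "dist (f x $ i) (f y $ i) <= L * dist x y" for x y
    using order_trans[OF dist_vec_nth_le lipschitz_onD[OF f, of x y]] by simp
  qed (rule lipschitz_on_nonneg[OF f])
  let ?u = "averaged_distr (vec_fun_distr f) w0 z0 i t1 t2"
  let ?a = "%\<xi>. dens (vec_fun_distr f) i \<xi> * mc (wt t1 t2) \<xi>"
  have s: "spec ?a ?u" by (rule averaged_spec[OF F t])
  have u: "?u \<phi> = fun_distr (%x. of_real (f x $ i)) (%x. LINT p|M. of_real (wt t1 t2 p) * \<phi> (x - zd p))" if "\<phi> \<in> schwartz" for \<phi>
   unfolding averaged_eq[OF t that] vec_fun_distr_def ..
  note c = convolution_represents[OF bm_wt g u]
  have "integrable lborel ?a" using s by (simp add: spec_def)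
  from represents_continuous_unique[OF hfun_represents[OF s] c(1) hfun_continuous[OF this] c(2)]
  have e: "hfun ?a x = (LINT p|M. complex_of_real (wt t1 t2 p * f (x + zd p) $ i))" by metis
  have "bm (%p. f (x + zd p))"
  proof (rule bm_lipschitz[OF f])
   have "bm (%p. x)" unfolding bm_def by auto
   then show "bm (%p. x + zd p)" using bm_zd by (rule bm_add)
  qed
  from bm_integrable[OF bm_scaleR[OF bm_wt this]]
  have i: "integrable M (%p. wt t1 t2 p *\<^sub>R f (x + zd p))" .
  have "AF (vec_fun_distr f) t1 t2 x $ i = (LINT p|M. wt t1 t2 p * f (x + zd p) $ i)"
   unfolding averaged_field_eq[OF F t] e integral_complex_of_real by simp
  also have "\<dots> = (LINT p|M. (wt t1 t2 p *\<^sub>R f (x + zd p)) $ i)" by simp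
  also have "\<dots> = (LINT p|M. wt t1 t2 p *\<^sub>R f (x + zd p)) $ i"
   by (rule integral_bounded_linear[OF bounded_linear_vec_nth i])
  finally show ?thesis .
 qed
 then show ?thesis by (simp add: vec_eq_iff)
qed

lemma young_path_continuous:
 assumes "young_path T \<gamma> A u0 (\<theta> :: real => real^'n)" shows "continuous_on {0..T} \<theta>"
proof -
 have h: "holder_norm T \<gamma> \<theta> < \<infinity>" using assms by (simp add: young_path_def)
 have "0 < \<gamma>" using \<gamma> by simp
 from holder_norm_hol[OF h this] obtain \<tau> where \<tau>: "0 < \<tau>" "hol \<tau> \<gamma> T \<theta>" by blast
 define K where "K = \<tau> powr (- \<gamma>)"
 have K: "0 < K" using \<tau> by (simp add: K_def)
 have b: "dist (\<theta> t) (\<theta> s) <= K * \<bar>t - s\<bar> powr \<gamma>" if "s \<in> {0..T}" "t \<in> {0..T}" "\<bar>t - s\<bar> <= \<tau>" for s t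
  using \<tau>(2)[unfolded hol_def, rule_format, of s t] \<tau>(2)[unfolded hol_def, rule_format, of t s] that
  by (cases "s <= t") (auto simp: dist_norm norm_minus_commute K_def)
 show ?thesis
  unfolding continuous_on_iff
 proof (intro ballI allI impI)
  fix s e :: real assume s: "s \<in> {0..T}" and e: "0 < e"
  define d where "d = min \<tau> ((e / K) powr (1 / \<gamma>))"
  have d: "0 < d" using \<tau> e K by (simp add: d_def)
  have "dist (\<theta> t) (\<theta> s) < e" if t: "t \<in> {0..T}" "dist t s < d" for t
  proof -
   have ts: "\<bar>t - s\<bar> < d" using t by (simp add: dist_real_def)
   have "\<bar>t - s\<bar> powr \<gamma> < ((e / K) powr (1 / \<gamma>)) powr \<gamma>"
    using ts \<gamma> by (intro powr_less_mono2) (auto simp: d_def)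
   also have "\<dots> = e / K" using e K \<gamma> by (simp add: powr_powr)
   finally have "K * \<bar>t - s\<bar> powr \<gamma> < e" using K by (simp add: pos_less_divide_eq mult.commute)
   then show ?thesis using b[OF s t(1)] ts by (simp add: d_def)
  qed
  then show "\<exists>d>0. \<forall>t\<in>{0..T}. dist t s < d --> dist (\<theta> t) (\<theta> s) < e" using d by blast
 qed
qed

text \<open>The Young sums also converge to the double integral and limits of grid sums are unique,
  so the Young solution solves the equation literally. Competing solutions, which are merely
  continuous, are excluded by \<open>classical_unique\<close>.\<close>

lemma unique_classical:
 fixes f :: "real^'n => real^'n"
 assumes f: "L-lipschitz_on UNIV f" and F: "FL_vec_norm q' \<delta> (vec_fun_distr f) < \<infinity>"
  and \<theta>: "young_path T \<gamma> (AF (vec_fun_distr f)) u0 \<theta>"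
 shows "unique_on {0..T} (classical_solution T w0 z0 f u0) (%t. \<theta> t + z0 t)"
proof -
 have c\<theta>: "continuous_on {0..T} \<theta>" by (rule young_path_continuous[OF \<theta>])
 obtain \<eta> S where \<eta>: "continuous_on UNIV \<eta>" "\<And>r. norm (\<eta> r) <= S" "\<And>r. r \<in> {0..T} ==> \<theta> r = \<eta> r"
  using clamp[OF c\<theta>] by blast
 define y where "y r = \<eta> r + z r" for r
 have cy: "continuous_on UNIV y" unfolding y_def by (intro continuous_intros \<eta> z_cont)
 have yb: "norm (y r) <= S + R" for r using norm_triangle_ineq[of "\<eta> r" "z r"] \<eta>(2)[of r] z_bound[of r] by (simp add: y_def)
 have uy: "\<theta> r + z0 r = y r" if "r \<in> {0..T}" for r using \<eta>(3)[OF that] z0z[OF that] by (simp add: y_def)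
 have s: "solves T (AF (vec_fun_distr f)) u0 \<theta>" using \<theta> by (simp add: young_path_iff)
 have I: "\<theta> t = u0 + (LINT p|M. wt t t p *\<^sub>R f (y (fst p) - y (snd p)))" if t: "t \<in> {0..T}" for t
 proof -
  have "has_int (germ (AF (vec_fun_distr f)) [(1, \<theta>)]) 0 t 0 t (\<theta> t - u0)" using s t by (simp add: solves_def)
  moreover have "has_int (germ (AF (vec_fun_distr f)) [(1, \<theta>)]) 0 t 0 t (LINT p|M. wt t t p *\<^sub>R f (y (fst p) - y (snd p)))"
   unfolding y_def by (rule young_sums_converge[OF f averaged_field_lipschitz[OF f F] \<eta> t])
  ultimately have "\<theta> t - u0 = (LINT p|M. wt t t p *\<^sub>R f (y (fst p) - y (snd p)))" using has_int_unique t by fastforce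
  then show ?thesis by (metis add.commute diff_add_cancel)
 qed
 have cu: "continuous_on {0..T} (%t. \<theta> t + z0 t)"
  using continuous_on_subset[OF cy] uy by (subst continuous_on_cong[OF refl uy]) auto
 show ?thesis
 proof (rule unique_onI)
  show "classical_solution T w0 z0 f u0 (%t. \<theta> t + z0 t)"
   unfolding classical_solution_def
  proof (intro conjI cu ballI)
   fix t assume t: "t \<in> {0..T}"
   show "\<theta> t + z0 t = u0 + (LINT s:{0..t}|lborel. (LINT r:{0..t}|lborel. (w0 s * w0 r) *\<^sub>R f ((\<theta> s + z0 s) - (\<theta> r + z0 r)))) + z0 t"
    using I[OF t] double_integral_eq[OF f cy yb uy t] by simp
  qed
  fix v t assume v: "classical_solution T w0 z0 f u0 v" and t: "t \<in> {0..T}"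
  have cv: "continuous_on {0..T} v" using v by (simp add: classical_solution_def)
  obtain x S' where x: "continuous_on UNIV x" "\<And>r. norm (x r) <= S'" "\<And>r. r \<in> {0..T} ==> v r = x r"
   using clamp[OF cv] by blast
  have xe: "x t = u0 + (LINT p|M. wt t t p *\<^sub>R f (x (fst p) - x (snd p))) + z0 t" if t: "t \<in> {0..T}" for t
   using v t double_integral_eq[OF f x t] x(3)[OF t] unfolding classical_solution_def by simp
  have ye: "y t = u0 + (LINT p|M. wt t t p *\<^sub>R f (y (fst p) - y (snd p))) + z0 t" if t: "t \<in> {0..T}" for t
   using I[OF t] uy[OF t] by simp
  have xb: "norm (x r) <= max S' (S + R)" "norm (y r) <= max S' (S + R)" for r
   using x(2)[of r] yb[of r] by auto
  have "x t = y t"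
  proof (rule classical_unique[OF f x(1) xb(1) cy xb(2) _ t])
   fix s assume "s \<in> {0..T}"
   then show "x s - y s = (LINT p|M. wt s s p *\<^sub>R f (x (fst p) - x (snd p))) - (LINT p|M. wt s s p *\<^sub>R f (y (fst p) - y (snd p)))"
    using xe[of s] ye[of s] by (simp add: algebra_simps)
  qed
  then show "v t = \<theta> t + z0 t" using x(3)[OF t] uy[OF t] by simp
 qed
qed

end

theorem theorem5p4:
  fixes T \<gamma> \<delta> \<kappa> :: real
    and q q' :: ennreal
    and w :: "real \<Rightarrow> real"
    and z :: "real \<Rightarrow> real^'n::finite"
    and u0 :: "real^'n"
    and b :: "'n \<Rightarrow> 'n distribution"
  assumes "T > 0"
    and "w \<in> Linfty_on {0..T}"
    and "continuous_on {0..T} z"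
    and "1/2 < \<gamma>" and "\<gamma> < 1"
    and "1 \<le> q" and "1 \<le> q'"
    and "1 / q + 1 / q' = 1"
    and "\<delta> + \<kappa> > 1 + 1 / \<gamma>"
    and "\<And>i. real_valued_distr (b i)"
    and "FL_vec_norm q' \<delta> b < \<infinity>"
    and "holder2_norm T \<gamma> (FL_norm q \<kappa>)
           (\<lambda>t1 t2. signed_integral (two_param_measure w z t1 t2)) < \<infinity>"
  shows "\<exists>u. unique_on {0..T} (young_solution T \<gamma> w z b u0) u \<and>
    (\<forall>(bn :: nat \<Rightarrow> real^'n \<Rightarrow> real^'n) (u0n :: nat \<Rightarrow> real^'n).
       (\<forall>n. \<exists>L. L-lipschitz_on UNIV (bn n)) \<longrightarrow>
       (\<forall>n. FL_vec_norm q' \<delta> (vec_fun_distr (bn n)) < \<infinity>) \<longrightarrow>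
       (\<lambda>n. FL_vec_norm q' \<delta> (vec_fun_distr (bn n) - b)) \<longlonglongrightarrow> 0 \<longrightarrow>
       u0n \<longlonglongrightarrow> u0 \<longrightarrow>
       (\<exists>un. 
          (\<forall>n. unique_on {0..T} (young_solution T \<gamma> w z (vec_fun_distr (bn n)) (u0n n)) (un n)) \<and>
          (\<forall>n. unique_on {0..T} (classical_solution T w z (bn n) (u0n n)) (un n)) \<and>
          (\<exists>C>0. \<forall>n. holder_norm T \<gamma> (\<lambda>t. un n t - u t)
             \<le> ennreal C * (FL_vec_norm q' \<delta> (vec_fun_distr (bn n) - b)
                              + ennreal (norm (u0n n - u0))))))"proof -
 \<comment> \<open>The analysis runs on globally bounded Borel versions, while the notions of
   solution keep the original \<open>w\<close> and \<open>z\<close>.\<close>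
 obtain B R w' w1 z' where ps: "path_setting T B R w' z'" and w1: "w1 \<in> borel_measurable borel" "\<forall>r\<in>{0..T}. w r = w1 r"
   "AE r in lborel. r \<in> {0..T} --> w1 r = w' r" and z': "\<forall>r\<in>{0..T}. z r = z' r" "continuous_on UNIV z'"
  using path_replacement[OF assms(1-3)] by blast
 obtain H where hH: "0 <= H" "holder2_norm T \<gamma> (FL_norm q \<kappa>) (%t1 t2. signed_integral (two_param_measure w z t1 t2)) = ennreal H"
  using assms(12) by (cases "holder2_norm T \<gamma> (FL_norm q \<kappa>) (%t1 t2. signed_integral (two_param_measure w z t1 t2))") auto
 interpret P: path_setting T B R w' z' by (rule ps)
 interpret averaging T B R w' z' w w1 z q q' \<gamma> \<delta> \<kappa> H
  by unfold_locales (use w1 z' assms hH in auto)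
 let ?M = "enn2real (FL_vec_norm q' \<delta> b) * H"
 have M: "0 <= ?M" using hH(1) by simp
 obtain \<tau> where "small_scale T \<gamma> ?M \<tau>" using small_scale_exists[OF assms(4) M assms(1)] by blast
 then obtain \<theta> where \<theta>: "young_path T \<gamma> (AF b) u0 \<theta>"
  using young_path_exists[OF regular_averaged[OF assms(11)] M assms(4) assms(1)] by blast
 show ?thesis
 proof (intro exI[of _ "%t. \<theta> t + z t"] conjI allI impI)
  show "unique_on {0..T} (young_solution T \<gamma> w z b u0) (%t. \<theta> t + z t)" by (rule unique_young[OF assms(11) \<theta>])
  fix bn :: "nat => real^'n => real^'n" and u0n :: "nat => real^'n"
  assume lip: "\<forall>n. \<exists>L. L-lipschitz_on UNIV (bn n)" and fin: "\<forall>n. FL_vec_norm q' \<delta> (vec_fun_distr (bn n)) < \<infinity>"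
   and lim: "(%n. FL_vec_norm q' \<delta> (vec_fun_distr (bn n) - b)) \<longlonglongrightarrow> 0"
  obtain \<theta>n C where \<theta>n: "\<And>n. young_path T \<gamma> (AF (vec_fun_distr (bn n))) (u0n n) (\<theta>n n)" and C: "0 < C"
    "\<And>n. holder_norm T \<gamma> (%t. \<theta>n n t - \<theta> t)
      <= ennreal C * (FL_vec_norm q' \<delta> (vec_fun_distr (bn n) - b) + ennreal (norm (u0n n - u0)))"
   using approximation[OF assms(11) fin[rule_format] lim \<theta>, of u0n] by blast
  show "\<exists>un. (\<forall>n. unique_on {0..T} (young_solution T \<gamma> w z (vec_fun_distr (bn n)) (u0n n)) (un n)) \<and>
    (\<forall>n. unique_on {0..T} (classical_solution T w z (bn n) (u0n n)) (un n)) \<and>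
    (\<exists>C>0. \<forall>n. holder_norm T \<gamma> (%t. un n t - (\<theta> t + z t))
      <= ennreal C * (FL_vec_norm q' \<delta> (vec_fun_distr (bn n) - b) + ennreal (norm (u0n n - u0))))"
  \<comment> \<open>One family of paths serves both notions of solution, and \<open>z\<close>
    cancels in differences, so the bound for the paths is the bound for the solutions.\<close>
  proof (intro exI[of _ "%n t. \<theta>n n t + z t"] conjI allI exI[of _ C])
   fix n
   show "unique_on {0..T} (young_solution T \<gamma> w z (vec_fun_distr (bn n)) (u0n n)) (%t. \<theta>n n t + z t)"
    by (rule unique_young[OF fin[rule_format] \<theta>n])
   obtain L where "L-lipschitz_on UNIV (bn n)" using lip by blast
   then show "unique_on {0..T} (classical_solution T w z (bn n) (u0n n)) (%t. \<theta>n n t + z t)"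
    by (rule unique_classical[OF _ fin[rule_format] \<theta>n])
   show "holder_norm T \<gamma> (%t. \<theta>n n t + z t - (\<theta> t + z t))
     <= ennreal C * (FL_vec_norm q' \<delta> (vec_fun_distr (bn n) - b) + ennreal (norm (u0n n - u0)))"
    using C(2)[of n] by simp
  qed (rule C(1))
 qed
qed

end
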